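(* Let $L=\mathcal{O}(1)\to\mathbf{CP}^1$, let $h$ be a smooth $S^1$-invariant hermitian metric on $L$ with positive curvature form $\omega$, and let $h_0=e^{-\varphi_0}h$, $h_1=e^{-\varphi_1}h$ be two smooth $S^1$-invariant hermitian metrics on $L$ with positive curvature. Let $\varphi_t$, $t\in[0,1]$, be the (smooth, $S^1$-invariant) Monge-Ampère geodesic joining $\varphi_0$ to $\varphi_1$, and let $\varphi_N(t,z)$ be the Bergman geodesic potentials of height $N$ defined in the context. Then $$\lim_{N\to\infty}\varphi_N(t,z)=\varphi_t(z)$$ uniformly in the $C^2$ topology on $[0,1]\times\mathbf{CP}^1$ (i.e. all derivatives in $(t,z)$ of order at most $2$ of $\varphi_N-\varphi_t$ converge to $0$ uniformly on $[0,1]\times\mathbf{CP}^1$).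
   Context: The curvature form of a hermitian metric $h$ on $L$ is $\mathrm{Ric}(h)=-\sqrt{-1}\,\partial\bar\partial\log h$ (in local frames); $\omega=\mathrm{Ric}(h)$ and $\mathrm{Ric}(e^{-\varphi}h)=\omega_\varphi=\omega+\sqrt{-1}\,\partial\bar\partial\varphi$. $S^1$ acts on $\mathbf{CP}^1$ by rotation $z\mapsto e^{i\theta}z$ of the affine coordinate. Monge-Ampère geodesic: $\varphi_t$, $t\in[0,1]$, is the path of smooth $S^1$-invariant functions with $\omega_{\varphi_t}>0$, with the given endpoints $\varphi_0,\varphi_1$, satisfying $\frac{\partial^2\varphi_t}{\partial t^2}=|\partial\dot\varphi_t|^2_{\omega_{\varphi_t}}$, where for $\omega_\varphi=\sqrt{-1}\,g\,dz\wedge d\bar z$ one puts $|\partial\psi|^2_{\omega_\varphi}=g^{-1}|\partial_z\psi|^2$. (In this toric setting it is known that it exists, is unique and is smooth.) Bergman geodesic: in the affine chart, with the standard trivialization of $\mathcal{O}(1)$, the monomials $z^{N\alpha}$, $\alpha\in\frac1N\mathbf{Z}\cap[0,1]$, form a basis of $H^0(\mathbf{CP}^1,L^N)$, orthogonal for every $S^1$-invariant metric. For $i=0,1$ put $\mathcal{Q}^N_{h_i}(\alpha)=\int_{\mathbf{CP}^1}|z^{N\alpha}|^2_{h_i^N}\,\mathrm{Ric}(h_i)$. Then $$\varphi_N(t,z)=\frac1N\log\left(\sum_{\alpha\in\frac1N\mathbf{Z}\cap[0,1]}\frac{|z^{N\alpha}|^2_{h^N}}{(\mathcal{Q}^N_{h_0}(\alpha))^{1-t}(\mathcal{Q}^N_{h_1}(\alpha))^{t}}\right),$$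 where $|\cdot|_{h^N}$ is the pointwise norm on $L^N$ induced by $h$. *)

theory Defs
  imports "HOL-Analysis.Analysis"
begin

section \<open>The complex projective line\<close>

definition collinear_nonzero :: "complex \<times> complex \<Rightarrow> complex \<times> complex \<Rightarrow> bool" where
  "collinear_nonzero u v \<longleftrightarrow>
     u \<noteq> 0 \<and> v \<noteq> 0 \<and> (\<exists>c. c \<noteq> 0 \<and> v = (c * fst u, c * snd u))"

quotient_type cp1 = "complex \<times> complex" / partial: collinear_nonzero
proof (rule part_equivpI)
  show "\<exists>x. collinear_nonzero x x"
    by (rule exI[of _ "(1, 0)"]) (auto simp: collinear_nonzero_def zero_prod_def intro!: exI[of _ 1])
  show "symp collinear_nonzero"
  proof (rule sympI)
    fix u v assume "collinear_nonzero u v"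
    then obtain c where c: "u \<noteq> 0" "v \<noteq> 0" "c \<noteq> 0" "v = (c * fst u, c * snd u)"
      by (auto simp: collinear_nonzero_def)
    then have "u = (inverse c * fst v, inverse c * snd v)" by (simp add: prod_eq_iff)
    with c show "collinear_nonzero v u"
      unfolding collinear_nonzero_def by (metis inverse_nonzero_iff_nonzero)
  qed
  show "transp collinear_nonzero"
  proof (rule transpI)
    fix u v w assume "collinear_nonzero u v" "collinear_nonzero v w"
    then obtain c d where c: "u \<noteq> 0" "c \<noteq> 0" "v = (c * fst u, c * snd u)"
      "w \<noteq> 0" "d \<noteq> 0" "w = (d * fst v, d * snd v)"
      unfolding collinear_nonzero_def by blast
    then have "d * c \<noteq> 0" "w = ((d * c) * fst u, (d * c) * snd u)"
      by (simp_all add: mult.assoc)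
    with c show "collinear_nonzero u w" unfolding collinear_nonzero_def by blast
  qed
qed

text \<open>
  The point \<open>abs_cp1 (a, b)\<close> is \<open>[a : b]\<close>; the affine coordinate is \<open>z = b / a\<close>.
  A chart is given through its lift to nonzero vectors: \<open>z \<mapsto> (1, z)\<close> is the affine chart, and
  \<open>w \<mapsto> (w, 1)\<close>, with \<open>w = 1 / z\<close>, is the chart around the point at infinity.
\<close>

definition affine_lift :: "complex \<Rightarrow> complex \<times> complex" where
  "affine_lift z = (1, z)"

definition infinity_lift :: "complex \<Rightarrow> complex \<times> complex" where
  "infinity_lift w = (w, 1)"

definition chart_lifts :: "(complex \<Rightarrow> complex \<times> complex) set" where
  "chart_lifts = {affine_lift, infinity_lift}"

definition in_chart :: "(cp1 \<Rightarrow> 'a) \<Rightarrow> (complex \<Rightarrow> complex \<times> complex) \<Rightarrow> complex \<Rightarrow> 'a" where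
  "in_chart f \<sigma> \<zeta> = f (abs_cp1 (\<sigma> \<zeta>))"

definition path_in_chart ::
    "(real \<Rightarrow> cp1 \<Rightarrow> 'a) \<Rightarrow> (complex \<Rightarrow> complex \<times> complex) \<Rightarrow> real \<times> complex \<Rightarrow> 'a" where
  "path_in_chart F \<sigma> p = in_chart (F (fst p)) \<sigma> (snd p)"

definition rotate_vec :: "real \<Rightarrow> complex \<times> complex \<Rightarrow> complex \<times> complex" where
  "rotate_vec \<theta> v = (fst v, cis \<theta> * snd v)"

definition S1_invariant :: "(cp1 \<Rightarrow> real) \<Rightarrow> bool" where
  "S1_invariant f \<longleftrightarrow> (\<forall>\<theta> v. v \<noteq> 0 \<longrightarrow> f (abs_cp1 (rotate_vec \<theta> v)) = f (abs_cp1 v))"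


section \<open>Differentiability classes\<close>

text \<open>
  Derivatives are taken within \<open>S\<close>; for the sets used below (\<open>UNIV\<close> and \<open>{0..1} \<times> UNIV\<close>)
  they are unique, and one-sided in the time direction at the two ends.
\<close>

primrec iter_deriv ::
    "'a::euclidean_space set \<Rightarrow> 'a list \<Rightarrow> ('a \<Rightarrow> 'b::real_normed_vector) \<Rightarrow> 'a \<Rightarrow> 'b" where
  "iter_deriv S [] f = f"
| "iter_deriv S (v # vs) f = iter_deriv S vs (\<lambda>x. frechet_derivative f (at x within S) v)"

definition Ck_on ::
    "nat \<Rightarrow> 'a::euclidean_space set \<Rightarrow> ('a \<Rightarrow> 'b::real_normed_vector) \<Rightarrow> bool" where
  "Ck_on k S f \<longleftrightarrow>
     (\<forall>vs \<in> lists Basis.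
        (length vs < k \<longrightarrow> iter_deriv S vs f differentiable_on S) \<and>
        (length vs \<le> k \<longrightarrow> continuous_on S (iter_deriv S vs f)))"

definition smooth_on ::
    "'a::euclidean_space set \<Rightarrow> ('a \<Rightarrow> 'b::real_normed_vector) \<Rightarrow> bool" where
  "smooth_on S f \<longleftrightarrow> (\<forall>k. Ck_on k S f)"

definition smooth_path :: "(real \<Rightarrow> cp1 \<Rightarrow> real) \<Rightarrow> bool" where
  "smooth_path F \<longleftrightarrow> (\<forall>\<sigma> \<in> chart_lifts. smooth_on ({0..1} \<times> UNIV) (path_in_chart F \<sigma>))"

text \<open>
  Convergence in the \<open>C\<^sup>2\<close> topology on \<open>[0,1] \<times> CP\<^sup>1\<close>: the derivatives of order at most \<open>2\<close> of
  the differences, in either chart, tend to \<open>0\<close> uniformly over compact subsets of that chart.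
  Since the two closed unit discs cover \<open>CP\<^sup>1\<close>, this is uniformity on all of \<open>[0,1] \<times> CP\<^sup>1\<close>;
  the derivatives in a chart coordinate cannot be controlled uniformly on the whole
  noncompact chart other than through a change of chart.
\<close>

definition C2_converges :: "(nat \<Rightarrow> real \<Rightarrow> cp1 \<Rightarrow> real) \<Rightarrow> (real \<Rightarrow> cp1 \<Rightarrow> real) \<Rightarrow> bool" where
  "C2_converges F G \<longleftrightarrow>
     (\<forall>\<sigma> \<in> chart_lifts.
        let S = {0..1} \<times> UNIV;
            D = (\<lambda>N p. path_in_chart (F N) \<sigma> p - path_in_chart G \<sigma> p)
        in (\<forall>\<^sub>F N in sequentially. Ck_on 2 S (D N)) \<and>
           (\<forall>vs \<in> lists Basis. length vs \<le> 2 \<longrightarrow>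
              (\<forall>K. compact K \<longrightarrow>
                 uniform_limit ({0..1} \<times> K) (\<lambda>N. iter_deriv S vs (D N)) (\<lambda>_. 0) sequentially)))"


section \<open>Wirtinger derivatives\<close>

definition wirtinger_z :: "(complex \<Rightarrow> complex) \<Rightarrow> complex \<Rightarrow> complex" where
  "wirtinger_z f \<zeta> =
     (frechet_derivative f (at \<zeta>) 1 - \<i> * frechet_derivative f (at \<zeta>) \<i>) / 2"

definition wirtinger_zbar :: "(complex \<Rightarrow> complex) \<Rightarrow> complex \<Rightarrow> complex" where
  "wirtinger_zbar f \<zeta> =
     (frechet_derivative f (at \<zeta>) 1 + \<i> * frechet_derivative f (at \<zeta>) \<i>) / 2"

text \<open>
  For real \<open>u\<close> of class \<open>C\<^sup>2\<close> the mixed derivative below is real, so that taking the real part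
  only changes its type.
\<close>

definition ddbar :: "(complex \<Rightarrow> real) \<Rightarrow> complex \<Rightarrow> real" where
  "ddbar u \<zeta> = Re (wirtinger_z (wirtinger_zbar (\<lambda>x. complex_of_real (u x))) \<zeta>)"


section \<open>Hermitian metrics on the hyperplane bundle\<close>

text \<open>
  The fibre of \<open>O(1)\<close> over \<open>[v]\<close> is the dual of the line spanned by \<open>v\<close>. Every nonzero element of
  the total space is the functional \<open>v\<^sup>*\<close> on the line of \<open>v\<close> with \<open>v\<^sup>*(v) = 1\<close>, for exactly one
  nonzero vector \<open>v\<close>, and \<open>(c v)\<^sup>* = c\<^sup>-\<^sup>1 v\<^sup>*\<close>. A hermitian metric is therefore encoded by its
  squared norm \<open>h v = |v\<^sup>*|\<^sup>2\<close>; the value at \<open>v = 0\<close> is irrelevant.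
  The standard frame of \<open>O(1)\<close> over the affine chart, the coordinate function \<open>(a, b) \<mapsto> a\<close>, is
  \<open>(affine_lift z)\<^sup>*\<close> over \<open>z\<close>, and likewise for the other chart; so \<open>h \<circ> \<sigma>\<close> is
  the squared norm of the standard frame in the chart of \<open>\<sigma>\<close>.
\<close>

type_synonym metric = "complex \<times> complex \<Rightarrow> real"

definition hermitian_metric :: "metric \<Rightarrow> bool" where
  "hermitian_metric h \<longleftrightarrow>
     (\<forall>v. v \<noteq> 0 \<longrightarrow> h v > 0) \<and>
     (\<forall>v c. v \<noteq> 0 \<longrightarrow> c \<noteq> 0 \<longrightarrow> h (c * fst v, c * snd v) = h v / (cmod c)\<^sup>2)"

definition smooth_metric :: "metric \<Rightarrow> bool" where
  "smooth_metric h \<longleftrightarrow> (\<forall>\<sigma> \<in> chart_lifts. smooth_on UNIV (h \<circ> \<sigma>))"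

definition S1_invariant_metric :: "metric \<Rightarrow> bool" where
  "S1_invariant_metric h \<longleftrightarrow> (\<forall>\<theta> v. v \<noteq> 0 \<longrightarrow> h (rotate_vec \<theta> v) = h v)"

definition twist :: "(cp1 \<Rightarrow> real) \<Rightarrow> metric \<Rightarrow> metric" where
  "twist \<phi> h v = exp (- \<phi> (abs_cp1 v)) * h v"

text \<open>
  A real \<open>(1,1)\<close>-form is represented in a chart by the coefficient \<open>g\<close> in \<open>\<i> g d\<zeta> \<and> d\<zeta>bar\<close>.
\<close>

definition ric :: "metric \<Rightarrow> (complex \<Rightarrow> complex \<times> complex) \<Rightarrow> complex \<Rightarrow> real" where
  "ric h \<sigma> \<zeta> = - ddbar (\<lambda>x. ln (h (\<sigma> x))) \<zeta>"

definition positive_curvature :: "metric \<Rightarrow> bool" where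
  "positive_curvature h \<longleftrightarrow> (\<forall>\<sigma> \<in> chart_lifts. \<forall>\<zeta>. ric h \<sigma> \<zeta> > 0)"

definition omega_pot ::
    "metric \<Rightarrow> (cp1 \<Rightarrow> real) \<Rightarrow> (complex \<Rightarrow> complex \<times> complex) \<Rightarrow> complex \<Rightarrow> real" where
  "omega_pot h \<phi> \<sigma> \<zeta> = ric h \<sigma> \<zeta> + ddbar (in_chart \<phi> \<sigma>) \<zeta>"


section \<open>Monge-Ampere geodesics\<close>

definition time_deriv :: "(real \<Rightarrow> cp1 \<Rightarrow> real) \<Rightarrow> real \<Rightarrow> cp1 \<Rightarrow> real" where
  "time_deriv F t p = vector_derivative (\<lambda>s. F s p) (at t within {0..1})"

definition grad_norm2 ::
    "metric \<Rightarrow> (cp1 \<Rightarrow> real) \<Rightarrow> (cp1 \<Rightarrow> real) \<Rightarrow>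
       (complex \<Rightarrow> complex \<times> complex) \<Rightarrow> complex \<Rightarrow> real" where
  "grad_norm2 h \<phi> \<psi> \<sigma> \<zeta> =
     (cmod (wirtinger_z (\<lambda>x. complex_of_real (in_chart \<psi> \<sigma> x)) \<zeta>))\<^sup>2 / omega_pot h \<phi> \<sigma> \<zeta>"

definition MA_geodesic ::
    "metric \<Rightarrow> (cp1 \<Rightarrow> real) \<Rightarrow> (cp1 \<Rightarrow> real) \<Rightarrow> (real \<Rightarrow> cp1 \<Rightarrow> real) \<Rightarrow> bool" where
  "MA_geodesic h \<phi>0 \<phi>1 \<phi> \<longleftrightarrow>
     smooth_path \<phi> \<and>
     \<phi> 0 = \<phi>0 \<and> \<phi> 1 = \<phi>1 \<and>
     (\<forall>t \<in> {0..1}. S1_invariant (\<phi> t)) \<and>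
     (\<forall>t \<in> {0..1}. \<forall>\<sigma> \<in> chart_lifts. \<forall>\<zeta>. omega_pot h (\<phi> t) \<sigma> \<zeta> > 0) \<and>
     (\<forall>t \<in> {0..1}. \<forall>\<sigma> \<in> chart_lifts. \<forall>\<zeta>.
        in_chart (time_deriv (time_deriv \<phi>) t) \<sigma> \<zeta> =
        grad_norm2 h (\<phi> t) (time_deriv \<phi> t) \<sigma> \<zeta>)"


section \<open>Bergman geodesics\<close>

text \<open>
  A section of \<open>O(N)\<close> is a homogeneous polynomial \<open>s\<close> of degree \<open>N\<close> on \<open>\<complex>\<^sup>2\<close>, with
  \<open>s([v]) = s(v) (v\<^sup>*)\<^sup>N\<close>. The value below does not depend on the representative chosen by
  \<open>rep_cp1\<close>, see \<open>section_norm2_abs\<close>.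
\<close>

definition section_norm2 ::
    "metric \<Rightarrow> nat \<Rightarrow> (complex \<times> complex \<Rightarrow> complex) \<Rightarrow> cp1 \<Rightarrow> real" where
  "section_norm2 h N s p = (cmod (s (rep_cp1 p)))\<^sup>2 * h (rep_cp1 p) ^ N"

text \<open>
  With \<open>k = N \<alpha>\<close>, this is the monomial \<open>z\<^sup>k\<close> in the standard trivialization over the affine chart.
\<close>

definition monomial_section :: "nat \<Rightarrow> nat \<Rightarrow> complex \<times> complex \<Rightarrow> complex" where
  "monomial_section N k v = fst v ^ (N - k) * snd v ^ k"

lemma section_norm2_abs:
  assumes h: "hermitian_metric h" and v: "v \<noteq> 0"
    and s: "\<And>c u. s (c * fst u, c * snd u) = c ^ N * s u"
  shows "section_norm2 h N s (abs_cp1 v) = (cmod (s v))\<^sup>2 * h v ^ N"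
proof -
  have "collinear_nonzero v v"
    using v by (auto simp: collinear_nonzero_def intro!: exI[of _ 1])
  then have "collinear_nonzero (rep_cp1 (abs_cp1 v)) v"
    using Quotient3_rep_abs[OF Quotient3_cp1] by blast
  then obtain c where c: "rep_cp1 (abs_cp1 v) \<noteq> 0" "c \<noteq> 0"
      "v = (c * fst (rep_cp1 (abs_cp1 v)), c * snd (rep_cp1 (abs_cp1 v)))"
    unfolding collinear_nonzero_def by blast
  define u where "u = rep_cp1 (abs_cp1 v)"
  have u: "u \<noteq> 0" "v = (c * fst u, c * snd u)" using c unfolding u_def by auto
  have "h v = h u / (cmod c)\<^sup>2" using h u c(2) by (simp add: hermitian_metric_def)
  moreover have "s v = c ^ N * s u" using s u by simp
  ultimately have "(cmod (s v))\<^sup>2 * h v ^ N = (cmod (s u))\<^sup>2 * h u ^ N"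
    using c(2) by (simp add: norm_mult norm_power power_mult_distrib power_divide
        flip: power_mult) (simp add: mult.commute)
  then show ?thesis by (simp add: section_norm2_def u_def)
qed

lemma monomial_section_homogeneous:
  "k \<le> N \<Longrightarrow> monomial_section N k (c * fst u, c * snd u) = c ^ N * monomial_section N k u"
  by (simp add: monomial_section_def power_mult_distrib flip: power_add)

text \<open>
  Integration against \<open>Ric(h)\<close> over \<open>CP\<^sup>1\<close>: the point at infinity is a null set, and
  \<open>\<i> dz \<and> dzbar = 2 dx \<and> dy\<close>.
\<close>

definition integral_ric :: "metric \<Rightarrow> (cp1 \<Rightarrow> real) \<Rightarrow> real" where
  "integral_ric h f = (LINT z|lborel. in_chart f affine_lift z * (2 * ric h affine_lift z))"

definition norming_const :: "metric \<Rightarrow> nat \<Rightarrow> nat \<Rightarrow> real" where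
  "norming_const h N k = integral_ric h (section_norm2 h N (monomial_section N k))"

definition bergman_potential ::
    "metric \<Rightarrow> metric \<Rightarrow> metric \<Rightarrow> nat \<Rightarrow> real \<Rightarrow> cp1 \<Rightarrow> real" where
  "bergman_potential h h0 h1 N t p =
     1 / real N *
     ln (\<Sum>k = 0..N. section_norm2 h N (monomial_section N k) p /
           (norming_const h0 N k powr (1 - t) * norming_const h1 N k powr t))"

end

theory Submission
  imports Defs
begin

text \<open>
  In the variable \<open>x = |z|\<^sup>2\<close> an invariant potential becomes a function \<open>U\<^sub>t\<close> of \<open>x > 0\<close> with
  moment map \<open>y = x U\<^sub>t'\<close> and curvature coefficient \<open>g = y'\<close>. The geodesic equation turns into
  Burgers' equation, whose characteristics give
  \<open>y = x exp ((1 - t) l\<^sub>0(y) + t l\<^sub>1(y))\<close>, where \<open>l\<^sub>i\<close> is \<open>ln (y / x)\<close> for the \<open>i\<close>-th end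
  metric, as a function of \<open>y\<close>.

  The derivatives of order one and two of the Bergman potential are means and \<open>N\<close>-fold covariances
  of \<open>k / N\<close> and \<open>ln (Q\<^sub>0(k) / Q\<^sub>1(k)) / N\<close> for the probability weights proportional to
  \<open>w\<^sub>k x\<^sup>k\<close>, \<open>w\<^sub>k = Q\<^sub>0(k)\<^sup>t\<^sup>-\<^sup>1 Q\<^sub>1(k)\<^sup>-\<^sup>t\<close>. Integration by parts in the integral that defines \<open>Q\<^sub>i(k)\<close>
  shows that \<open>ln ((k + 1) / N * Q\<^sub>i(k) / Q\<^sub>i(k + 1)) = l\<^sub>i((k + 1) / N) + O(1 / N)\<close>, and
  summation by parts gives the discrete Stein identity
  \<open>E[(k / N) f(k)] = x E[H\<^sub>N(k) f(k + 1)]\<close> with \<open>H\<^sub>N(k) = (k + 1) / N * w\<^sub>k\<^sub>+\<^sub>1 / w\<^sub>k\<close>. Together they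
  determine these means and covariances up to \<open>O(N\<^sup>-\<^sup>1\<^sup>/\<^sup>2)\<close>, uniformly down to \<open>x = 0\<close>, and the
  limits are the derivatives of \<open>U\<^sub>t\<close>. The remaining constant of integration is controlled at
  \<open>z = 0\<close>, where \<open>ln Q\<^sub>i(0) / N\<close> tends to \<open>- U\<^sub>i(0)\<close>. The inversion \<open>x \<mapsto> 1 / x\<close> exchanges \<open>k\<close> and
  \<open>N - k\<close>, so that the chart at infinity is of the same form.
\<close>

section \<open>A recursive characterisation of continuous differentiability\<close>

text \<open>The obstacle is uniformity where the picture degenerates. At z = 0 the Hessian of a
  function of r = |z| contains \<open>Dr Phi / r\<close>, so radial derivatives must be small
  relative to r. For this reason means and covariances are estimated after division by x or by its
  square root, and l must have a Lipschitz derivative down to moment 0. Near moment 1, the point at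
  infinity, no such control of l is available. But a chart is only examined for |z| \<le> R, where
  all moments stay below 1 - 3\<delta>, and indices k with k / N beyond about 1 - \<delta> are
  handled by log-convexity of the norming constants alone: they lie at distance at least \<delta>
  from the moment, so crude bounds suffice there. Everything assumed about the norming constants is
  preserved by convex combination of their logarithms; this gives uniformity in t with one set of
  constants. At t = 0 and t = 1 derivatives are one-sided, and at z = 0 polar coordinates fail. All
  estimates are therefore made for 0 < t < 1 and nonzero z, and reach the rest by continuity of the
  derivatives.\<close>

primrec ck :: "nat \<Rightarrow> 'a::euclidean_space set \<Rightarrow> ('a \<Rightarrow> real) \<Rightarrow> bool" where
  "ck 0 S f \<longleftrightarrow> continuous_on S f"
| "ck (Suc n) S f \<longleftrightarrow>
     (\<exists>f'. (\<forall>x\<in>S. (f has_derivative f' x) (at x within S)) \<and> (\<forall>b\<in>Basis. ck n S (\<lambda>x. f' x b)))"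

lemma ckI:
  assumes "\<And>x. x \<in> S \<Longrightarrow> (f has_derivative f' x) (at x within S)"
    "\<And>b. b \<in> Basis \<Longrightarrow> ck n S (\<lambda>x. f' x b)"
  shows "ck (Suc n) S f"
  using assms by auto

lemma ck_cong:
  assumes "\<And>x. x \<in> S \<Longrightarrow> f x = g x"
  shows "ck n S f \<longleftrightarrow> ck n S g"
proof -
  have *: "ck n S g" if "ck n S f" "\<And>x. x \<in> S \<Longrightarrow> f x = g x" for f g :: "'a \<Rightarrow> real"
  proof (cases n)
    case 0
    then show ?thesis using that continuous_on_cong by force
  next
    case (Suc m)
    from that(1)[unfolded Suc] obtain f' where
      "\<And>x. x \<in> S \<Longrightarrow> (f has_derivative f' x) (at x within S)"
      "\<And>b. b \<in> Basis \<Longrightarrow> ck m S (\<lambda>x. f' x b)" by auto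
    then show ?thesis unfolding Suc
      by (intro ckI[where f' = f']) (auto intro: has_derivative_transform[of _ S g f] simp: that(2))
  qed
  show ?thesis using *[of f g] *[of g f] assms by auto
qed

lemma ck_imp_continuous_on: "ck n S f \<Longrightarrow> continuous_on S f"
proof (cases n)
  case (Suc m)
  assume "ck n S f"
  then obtain f' where "\<And>x. x \<in> S \<Longrightarrow> (f has_derivative f' x) (at x within S)" using Suc by fastforce
  then show ?thesis by (rule has_derivative_continuous_on)
qed simp

lemma ck_SucD: "ck (Suc n) S f \<Longrightarrow> ck n S f"
proof (induction n arbitrary: f)
  case 0
  then show ?case using ck_imp_continuous_on[of "Suc 0"] by simp
next
  case (Suc n)
  from Suc.prems obtain f' where "\<And>x. x \<in> S \<Longrightarrow> (f has_derivative f' x) (at x within S)"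
      "\<And>b. b \<in> Basis \<Longrightarrow> ck (Suc n) S (\<lambda>x. f' x b)" by auto
  with Suc.IH show ?case by (intro ckI[where f' = f']) auto
qed

lemma ck_const: "ck n S (\<lambda>x. c)"
  by (induction n arbitrary: c) (auto intro!: exI[of _ "\<lambda>_ _. 0"])

lemma ck_add: "ck n S f \<Longrightarrow> ck n S g \<Longrightarrow> ck n S (\<lambda>x. f x + g x)"
proof (induction n arbitrary: f g)
  case 0
  then show ?case by (auto intro: continuous_on_add)
next
  case (Suc n)
  from Suc.prems(1) obtain f' where f: "\<And>x. x \<in> S \<Longrightarrow> (f has_derivative f' x) (at x within S)"
      "\<And>b. b \<in> Basis \<Longrightarrow> ck n S (\<lambda>x. f' x b)" by auto
  from Suc.prems(2) obtain g' where g: "\<And>x. x \<in> S \<Longrightarrow> (g has_derivative g' x) (at x within S)"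
      "\<And>b. b \<in> Basis \<Longrightarrow> ck n S (\<lambda>x. g' x b)" by auto
  show ?case using f g Suc.IH
    by (intro ckI[where f' = "\<lambda>x v. f' x v + g' x v"]) (auto intro: has_derivative_add)
qed

lemma ck_mult: "ck n S f \<Longrightarrow> ck n S g \<Longrightarrow> ck n S (\<lambda>x. f x * g x)"
proof (induction n arbitrary: f g)
  case 0
  then show ?case by (auto intro: continuous_on_mult)
next
  case (Suc n)
  from Suc.prems(1) obtain f' where f: "\<And>x. x \<in> S \<Longrightarrow> (f has_derivative f' x) (at x within S)"
      "\<And>b. b \<in> Basis \<Longrightarrow> ck n S (\<lambda>x. f' x b)" by auto
  from Suc.prems(2) obtain g' where g: "\<And>x. x \<in> S \<Longrightarrow> (g has_derivative g' x) (at x within S)"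
      "\<And>b. b \<in> Basis \<Longrightarrow> ck n S (\<lambda>x. g' x b)" by auto
  show ?case using f g Suc.IH Suc.prems[THEN ck_SucD]
    by (intro ckI[where f' = "\<lambda>x v. f x * g' x v + f' x v * g x"])
       (auto intro: has_derivative_mult ck_add)
qed

lemma ck_cmult: "ck n S f \<Longrightarrow> ck n S (\<lambda>x. c * f x)"
  by (intro ck_mult ck_const)

lemma ck_minus: "ck n S f \<Longrightarrow> ck n S (\<lambda>x. - f x)"
  using ck_cmult[of n S f "-1"] by simp

lemma ck_diff: "ck n S f \<Longrightarrow> ck n S g \<Longrightarrow> ck n S (\<lambda>x. f x - g x)"
  using ck_add[of n S f "\<lambda>x. - g x"] ck_minus[of n S g] by simp

lemma ck_sum: "(\<And>i. i \<in> I \<Longrightarrow> ck n S (f i)) \<Longrightarrow> ck n S (\<lambda>x. \<Sum>i\<in>I. f i x)"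
  by (induction I rule: infinite_finite_induct) (auto intro: ck_const ck_add)

lemma ck_power: "ck n S f \<Longrightarrow> ck n S (\<lambda>x. f x ^ m)"
  by (induction m) (auto intro: ck_const ck_mult)

lemma ck_inverse: "ck n S f \<Longrightarrow> (\<And>x. x \<in> S \<Longrightarrow> f x \<noteq> 0) \<Longrightarrow> ck n S (\<lambda>x. inverse (f x))"
proof (induction n arbitrary: f)
  case 0
  then show ?case by (auto intro: continuous_on_inverse)
next
  case (Suc n)
  from Suc.prems(1) obtain f' where f: "\<And>x. x \<in> S \<Longrightarrow> (f has_derivative f' x) (at x within S)"
      "\<And>b. b \<in> Basis \<Longrightarrow> ck n S (\<lambda>x. f' x b)" by auto
  have *: "ck n S (\<lambda>x. inverse (f x))" using Suc ck_SucD by blast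
  show ?case using f Suc.prems(2) *
    by (intro ckI[where f' = "\<lambda>x v. - (inverse (f x) * f' x v * inverse (f x))"])
       (auto intro!: has_derivative_inverse ck_minus ck_mult)
qed

lemma ck_ln: 
  assumes f: "ck n S f" and pos: "\<And>x. x \<in> S \<Longrightarrow> f x > 0"
  shows "ck n S (\<lambda>x. ln (f x))"
proof (cases n)
  case 0
  then show ?thesis using assms by (auto intro!: continuous_on_ln simp: less_imp_neq[symmetric])
next
  case (Suc m)
  from f[unfolded Suc] obtain f' where f': "\<And>x. x \<in> S \<Longrightarrow> (f has_derivative f' x) (at x within S)"
      "\<And>b. b \<in> Basis \<Longrightarrow> ck m S (\<lambda>x. f' x b)" by auto
  have "ck m S f" using f Suc ck_SucD by blast
  then have *: "ck m S (\<lambda>x. inverse (f x))" using pos by (intro ck_inverse) force+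
  show ?thesis unfolding Suc using f' *
    by (intro ckI[where f' = "\<lambda>x v. f' x v * inverse (f x)"])
       (auto intro!: ck_mult derivative_eq_intros simp: pos divide_inverse)
qed

lemma ck_exp: "ck n S f \<Longrightarrow> ck n S (\<lambda>x. exp (f x))"
proof (induction n arbitrary: f)
  case 0
  then show ?case by (auto intro: continuous_on_exp)
next
  case (Suc n)
  from Suc.prems(1) obtain f' where f: "\<And>x. x \<in> S \<Longrightarrow> (f has_derivative f' x) (at x within S)"
      "\<And>b. b \<in> Basis \<Longrightarrow> ck n S (\<lambda>x. f' x b)" by auto
  have *: "ck n S (\<lambda>x. exp (f x))" using Suc ck_SucD by blast
  show ?case using f *
    by (intro ckI[where f' = "\<lambda>x v. f' x v * exp (f x)"])
       (auto intro!: ck_mult derivative_eq_intros)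
qed

lemma ck_bounded_linear:
  assumes "bounded_linear f" shows "ck n S f"
proof (cases n)
  case 0
  then show ?thesis using assms by (auto intro: linear_continuous_on)
next
  case (Suc m)
  show ?thesis unfolding Suc using assms
    by (intro ckI[where f' = "\<lambda>x. f"]) (auto intro: bounded_linear_imp_has_derivative ck_const)
qed

text \<open>The chain rule gives the derivative \<open>f' (c + A x) (A v)\<close>; expanding
  \<open>A v\<close> in the basis reduces the induction to the coordinates of f'. Affine
  substitutions suffice for time slices, for the real axis inside the plane, and for restriction to
  subsets.\<close>

lemma ck_affine:
  fixes f :: "'b::euclidean_space \<Rightarrow> real" and A :: "'a::euclidean_space \<Rightarrow> 'b"
  assumes A: "bounded_linear A"
  shows "ck n S f \<Longrightarrow> (\<And>x. x \<in> T \<Longrightarrow> c + A x \<in> S) \<Longrightarrow> ck n T (\<lambda>x. f (c + A x))"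
proof (induction n arbitrary: f)
  case 0
  have "continuous_on T (\<lambda>x. c + A x)" 
    using A by (intro continuous_intros linear_continuous_on)
  with 0 show ?case by (auto intro!: continuous_on_compose2[of S f])
next
  case (Suc n)
  from Suc.prems(1) obtain f' where f: "\<And>x. x \<in> S \<Longrightarrow> (f has_derivative f' x) (at x within S)"
      "\<And>b. b \<in> Basis \<Longrightarrow> ck n S (\<lambda>x. f' x b)" by auto
  have d: "((\<lambda>x. f (c + A x)) has_derivative (\<lambda>v. f' (c + A x) (A v))) (at x within T)"
    if "x \<in> T" for x
  proof -
    have "((\<lambda>x. c + A x) has_derivative A) (at x within T)"
      using A by (auto intro!: derivative_eq_intros bounded_linear_imp_has_derivative)
    moreover have "(f has_derivative f' (c + A x)) (at (c + A x) within (\<lambda>x. c + A x) ` T)"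
      using f(1)[of "c + A x"] Suc.prems(2) that by (auto intro: has_derivative_subset)
    ultimately show ?thesis using diff_chain_within[of "\<lambda>x. c + A x" A x T f] by (simp add: o_def)
  qed
  have eq: "f' (c + A x) (A b) = (\<Sum>i\<in>Basis. (A b \<bullet> i) * f' (c + A x) i)" if "x \<in> T" for x b
  proof -
    have "linear (f' (c + A x))" 
      using f(1)[of "c + A x"] Suc.prems(2) that has_derivative_linear by blast
    then show ?thesis
      using linear_sum[of "f' (c + A x)" "\<lambda>i. (A b \<bullet> i) *\<^sub>R i" Basis]
      by (simp add: euclidean_representation linear_cmul)
  qed
  have "ck n T (\<lambda>x. f' (c + A x) i)" if "i \<in> Basis" for i
    using Suc.IH[OF f(2)[OF that] Suc.prems(2)] .
  then have "ck n T (\<lambda>x. \<Sum>i\<in>Basis. (A b \<bullet> i) * f' (c + A x) i)" for b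
    by (intro ck_sum ck_cmult)
  then have e: "ck n T (\<lambda>x. f' (c + A x) (A b))" for b
    using ck_cong[of T "\<lambda>x. f' (c + A x) (A b)" "\<lambda>x. \<Sum>i\<in>Basis. (A b \<bullet> i) * f' (c + A x) i" n] eq
    by simp
  show ?case
    by (rule ckI[where f' = "\<lambda>x v. f' (c + A x) (A v)"]) (rule d e, assumption?)+
qed

lemma ck_subset: "ck n S f \<Longrightarrow> T \<subseteq> S \<Longrightarrow> ck n T f"
  using ck_affine[OF bounded_linear_ident, of n S f T 0] by (simp add: subset_iff)

text \<open>Accumulation along every basis direction is what makes derivatives within \<open>S\<close> unique.\<close>

definition thick :: "'a::euclidean_space set \<Rightarrow> bool" where
  "thick S \<longleftrightarrow> (\<forall>x\<in>S. \<forall>i\<in>Basis. \<forall>e>0. \<exists>d. 0 < \<bar>d\<bar> \<and> \<bar>d\<bar> < e \<and> x + d *\<^sub>R i \<in> S)"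

lemma thick_frechet:
  assumes "thick S" "x \<in> S" "(f has_derivative f') (at x within S)"
  shows "frechet_derivative f (at x within S) = f'"
proof -
  have "(f has_derivative frechet_derivative f (at x within S)) (at x within S)"
    using assms(3) by (simp add: differentiableI flip: frechet_derivative_works)
  then show ?thesis
    using frechet_derivative_unique_within[of f _ x S f'] assms unfolding thick_def by blast
qed

lemma thick_open: "open S \<Longrightarrow> thick S"
  unfolding thick_def
proof safe
  fix x i :: 'a and e :: real assume *: "open S" "x \<in> S" "i \<in> Basis" "e > 0"
  then obtain d where d: "d > 0" "ball x d \<subseteq> S" using open_contains_ball by blast
  show "\<exists>d. 0 < \<bar>d\<bar> \<and> \<bar>d\<bar> < e \<and> x + d *\<^sub>R i \<in> S"
    using * d by (intro exI[of _ "min d e / 2"]) (auto simp: dist_norm subset_iff)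
qed

lemma thick_strip: "thick ({0..1::real} \<times> (UNIV::'b::euclidean_space set))"
  unfolding thick_def
proof safe
  fix t :: real and z :: 'b and i :: "real \<times> 'b" and e :: real assume *: "t \<in> {0..1}" "i \<in> Basis" "(e::real) > 0"
  show "\<exists>d. 0 < \<bar>d\<bar> \<and> \<bar>d\<bar> < e \<and> (t, z) + d *\<^sub>R i \<in> {0..1} \<times> UNIV"
  \<comment> \<open>At t = 1 the only admissible displacement in time is backwards, which is why
    \<open>thick\<close> leaves the sign of d free.\<close>
  proof (cases "t < 1")
    case True
    have i: "fst i = 0 \<or> fst i = 1" using *(2) by (auto simp: Basis_prod_def)
    show ?thesis
      apply (rule exI[of _ "min (1 - t) e / 2"])
      using True * i by (cases i) (auto simp: min_def field_simps)
  next
    case False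
    have i: "fst i = 0 \<or> fst i = 1" using *(2) by (auto simp: Basis_prod_def)
    show ?thesis
      apply (rule exI[of _ "- min 1 e / 2"])
      using False * i by (cases i) (auto simp: min_def field_simps)
  qed
qed

text \<open>\<open>iter_deriv\<close> differentiates along the head of the list first, so splitting
  off the head turns the quantification over lists into the recursion of \<open>ck\<close>.\<close>

lemma Ck_on_Suc:
  "Ck_on (Suc n) S f \<longleftrightarrow> f differentiable_on S \<and>
     (\<forall>b\<in>Basis. Ck_on n S (\<lambda>x. frechet_derivative f (at x within S) b))"
proof
  assume *: "Ck_on (Suc n) S f"
  have "f differentiable_on S" using bspec[OF *[unfolded Ck_on_def], of "[]"] by simp
  moreover have "Ck_on n S (\<lambda>x. frechet_derivative f (at x within S) b)" if "b \<in> Basis" for b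
    unfolding Ck_on_def
  proof (intro ballI conjI impI)
    fix vs :: "'a list" assume vs: "vs \<in> lists Basis"
    have "b # vs \<in> lists Basis" using vs that by auto
    note ** = bspec[OF *[unfolded Ck_on_def] this]
    show "iter_deriv S vs (\<lambda>x. frechet_derivative f (at x within S) b) differentiable_on S" if "length vs < n"
      using ** that by auto
    show "continuous_on S (iter_deriv S vs (\<lambda>x. frechet_derivative f (at x within S) b))" if "length vs \<le> n"
      using ** that by auto
  qed
  ultimately show "f differentiable_on S \<and>
     (\<forall>b\<in>Basis. Ck_on n S (\<lambda>x. frechet_derivative f (at x within S) b))" by blast
next
  assume *: "f differentiable_on S \<and>
     (\<forall>b\<in>Basis. Ck_on n S (\<lambda>x. frechet_derivative f (at x within S) b))"
  then have "continuous_on S f" using differentiable_imp_continuous_on by blast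
  show "Ck_on (Suc n) S f"
    unfolding Ck_on_def
  proof
    fix vs :: "'a list" assume vs: "vs \<in> lists Basis"
    show "(length vs < Suc n \<longrightarrow> iter_deriv S vs f differentiable_on S) \<and>
          (length vs \<le> Suc n \<longrightarrow> continuous_on S (iter_deriv S vs f))"
      using vs * \<open>continuous_on S f\<close> by (cases vs) (auto simp: Ck_on_def)
  qed
qed

text \<open>On a thick set the derivative within S is unique, so whatever derivative
  \<open>ck\<close> supplies is the \<open>frechet_derivative\<close> used by \<open>Ck_on\<close>.
  The closure rules above, proved with freely chosen derivatives, now transfer to
  \<open>Ck_on\<close>.\<close>

lemma Ck_on_iff_ck:
  assumes S: "thick S"
  shows "Ck_on n S f \<longleftrightarrow> ck n S f"
proof (induction n arbitrary: f)
  case 0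
  then show ?case by (auto simp: Ck_on_def)
next
  case (Suc n)
  show ?case
  proof
    assume "Ck_on (Suc n) S f"
    then show "ck (Suc n) S f"
      unfolding Ck_on_Suc Suc differentiable_on_def
      by (intro ckI[where f' = "\<lambda>x. frechet_derivative f (at x within S)"])
         (auto simp flip: frechet_derivative_works)
  next
    assume "ck (Suc n) S f"
    then obtain f' where f: "\<And>x. x \<in> S \<Longrightarrow> (f has_derivative f' x) (at x within S)"
      "\<And>b. b \<in> Basis \<Longrightarrow> ck n S (\<lambda>x. f' x b)" by auto
    have eq: "frechet_derivative f (at x within S) b = f' x b" if "x \<in> S" for x b
      using thick_frechet[OF S that f(1)[OF that]] by simp
    have "ck n S (\<lambda>x. frechet_derivative f (at x within S) b)" if "b \<in> Basis" for b
      using f(2)[OF that] ck_cong[OF eq, where S = S and n = n] by simp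
    moreover have "f differentiable_on S"
      using f(1) by (auto simp: differentiable_on_def differentiable_def)
    ultimately show "Ck_on (Suc n) S f" unfolding Ck_on_Suc Suc by simp
  qed
qed

lemma smooth_on_iff_ck: "thick S \<Longrightarrow> smooth_on S f \<longleftrightarrow> (\<forall>n. ck n S f)"
  by (simp add: smooth_on_def Ck_on_iff_ck)

text \<open>Both mixed derivatives are limits of the same second difference quotient.\<close>

lemma second_difference_mvt:
  fixes f :: "'a::real_normed_vector \<Rightarrow> real"
  assumes S: "\<And>s t. s \<in> {0..h} \<Longrightarrow> t \<in> {0..h} \<Longrightarrow> x + s *\<^sub>R a + t *\<^sub>R b \<in> S" and h: "h > 0"
    and f: "\<And>x. x \<in> S \<Longrightarrow> (f has_derivative f' x) (at x)"
    and fa: "\<And>x. x \<in> S \<Longrightarrow> ((\<lambda>x. f' x a) has_derivative fa x) (at x)"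
  shows "\<exists>s\<in>{0..h}. \<exists>t\<in>{0..h}. f (x + h *\<^sub>R a + h *\<^sub>R b) - f (x + h *\<^sub>R a) - f (x + h *\<^sub>R b) + f x
      = h\<^sup>2 * fa (x + s *\<^sub>R a + t *\<^sub>R b) b"
proof -
  define p where "p s = f (x + s *\<^sub>R a + h *\<^sub>R b) - f (x + s *\<^sub>R a)" for s
  have d: "((\<lambda>s. f (x + s *\<^sub>R a + c *\<^sub>R b)) has_real_derivative f' (x + s *\<^sub>R a + c *\<^sub>R b) a) (at s)"
    if "s \<in> {0..h}" "c \<in> {0..h}" for s c
  proof -
    have "((\<lambda>s. f (x + s *\<^sub>R a + c *\<^sub>R b)) has_derivative (\<lambda>r. f' (x + s *\<^sub>R a + c *\<^sub>R b) (r *\<^sub>R a))) (at s)"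
      by (rule has_derivative_compose[where f = "\<lambda>s. x + s *\<^sub>R a + c *\<^sub>R b" and g = f, OF _ f[OF S[OF that]]])
         (auto intro!: derivative_eq_intros)
    moreover have "linear (f' (x + s *\<^sub>R a + c *\<^sub>R b))" using f[OF S[OF that]] has_derivative_linear by blast
    ultimately show ?thesis
      by (simp add: has_field_derivative_def linear_cmul mult.commute[of _ "f' _ _"])
  qed
  have "(p has_real_derivative f' (x + s *\<^sub>R a + h *\<^sub>R b) a - f' (x + s *\<^sub>R a) a) (at s)"
    if "s \<in> {0..h}" for s
    unfolding p_def using d[of s h] d[of s 0] h that by (auto intro!: derivative_eq_intros)
  then obtain s where s: "s \<in> {0<..<h}"
    "p h - p 0 = h * (f' (x + s *\<^sub>R a + h *\<^sub>R b) a - f' (x + s *\<^sub>R a) a)"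
    using MVT2[of 0 h p "\<lambda>s. f' (x + s *\<^sub>R a + h *\<^sub>R b) a - f' (x + s *\<^sub>R a) a"] h by auto
  have "((\<lambda>t. f' (x + s *\<^sub>R a + t *\<^sub>R b) a) has_real_derivative fa (x + s *\<^sub>R a + t *\<^sub>R b) b) (at t)"
    if "t \<in> {0..h}" for t
  proof -
    have s': "s \<in> {0..h}" using s by auto
    have "((\<lambda>t. f' (x + s *\<^sub>R a + t *\<^sub>R b) a) has_derivative (\<lambda>r. fa (x + s *\<^sub>R a + t *\<^sub>R b) (r *\<^sub>R b))) (at t)"
      by (rule has_derivative_compose[where f = "\<lambda>t. x + s *\<^sub>R a + t *\<^sub>R b" and g = "\<lambda>x. f' x a", OF _ fa[OF S[OF s' that]]])
         (auto intro!: derivative_eq_intros)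
    moreover have "linear (fa (x + s *\<^sub>R a + t *\<^sub>R b))" using fa[OF S[OF s' that]] has_derivative_linear by blast
    ultimately show ?thesis
      by (simp add: has_field_derivative_def linear_cmul mult.commute[of _ "fa _ _"])
  qed
  then obtain t where t: "t \<in> {0<..<h}"
    "f' (x + s *\<^sub>R a + h *\<^sub>R b) a - f' (x + s *\<^sub>R a) a = h * fa (x + s *\<^sub>R a + t *\<^sub>R b) b"
    using MVT2[of 0 h "\<lambda>t. f' (x + s *\<^sub>R a + t *\<^sub>R b) a" "\<lambda>t. fa (x + s *\<^sub>R a + t *\<^sub>R b) b"] h by auto
  show ?thesis
    using s t by (intro bexI[of _ s] bexI[of _ t]) (auto simp: p_def power2_eq_square algebra_simps)
qed

text \<open>If the mixed derivatives differed at x, continuity would keep them apart on a small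
  parallelogram, while the second difference over it equals h^2 times a value of each.\<close>

lemma symmetric_second_derivative:
  fixes f :: "'a::real_normed_vector \<Rightarrow> real"
  assumes S: "open S" "x \<in> S"
    and f: "\<And>x. x \<in> S \<Longrightarrow> (f has_derivative f' x) (at x)"
    and fa: "\<And>x. x \<in> S \<Longrightarrow> ((\<lambda>x. f' x a) has_derivative fa x) (at x)"
    and fb: "\<And>x. x \<in> S \<Longrightarrow> ((\<lambda>x. f' x b) has_derivative fb x) (at x)"
    and ca: "continuous_on S (\<lambda>x. fa x b)" and cb: "continuous_on S (\<lambda>x. fb x a)"
  shows "fa x b = fb x a"
proof (rule ccontr)
  assume neq: "fa x b \<noteq> fb x a"
  define e where "e = \<bar>fa x b - fb x a\<bar> / 2"
  have e: "e > 0" using neq by (auto simp: e_def)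
  have "isCont (\<lambda>x. fa x b) x" "isCont (\<lambda>x. fb x a) x"
    using ca cb S continuous_on_eq_continuous_at by blast+
  then obtain d1 d2 where d: "d1 > 0" "d2 > 0" 
    "\<And>y. dist y x < d1 \<Longrightarrow> \<bar>fa y b - fa x b\<bar> < e" "\<And>y. dist y x < d2 \<Longrightarrow> \<bar>fb y a - fb x a\<bar> < e"
    using e unfolding continuous_at_eps_delta dist_real_def by metis
  obtain d3 where d3: "d3 > 0" "ball x d3 \<subseteq> S" using S open_contains_ball by blast
  define m where "m = min d1 (min d2 d3)"
  \<comment> \<open>So small that the parallelogram spanned by h a and h b stays within distance m
    of x.\<close>
  define h where "h = m / (2 * (norm a + norm b + 1))"
  have m: "m > 0" "m \<le> d1" "m \<le> d2" "m \<le> d3" using d d3 by (auto simp: m_def)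
  have np: "norm a + norm b + 1 > 0" using norm_ge_zero[of a] norm_ge_zero[of b] by linarith
  have h: "h > 0" using m np by (simp add: h_def)
  have near: "dist (x + s *\<^sub>R a + t *\<^sub>R b) x < m" if "s \<in> {0..h}" "t \<in> {0..h}" for s t
  proof -
    have "dist (x + s *\<^sub>R a + t *\<^sub>R b) x = norm (s *\<^sub>R a + t *\<^sub>R b)" by (simp add: dist_norm)
    also have "\<dots> \<le> s * norm a + t * norm b"
      using norm_triangle_ineq[of "s *\<^sub>R a" "t *\<^sub>R b"] that by simp
    also have "\<dots> \<le> h * norm a + h * norm b" using that by (intro add_mono mult_right_mono) auto
    also have "\<dots> \<le> h * (norm a + norm b + 1)" using h by (simp add: algebra_simps)
    also have "\<dots> = m / 2" using np by (simp add: h_def field_simps)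
    also have "\<dots> < m" using m by simp
    finally show ?thesis .
  qed
  have in_S: "x + s *\<^sub>R a + t *\<^sub>R b \<in> S" if "s \<in> {0..h}" "t \<in> {0..h}" for s t
    using near[OF that] m(4) d3(2) by (auto simp: subset_iff dist_commute)
  from second_difference_mvt[OF in_S h f fa]
  obtain s t where st: "s \<in> {0..h}" "t \<in> {0..h}"
    "f (x + h *\<^sub>R a + h *\<^sub>R b) - f (x + h *\<^sub>R a) - f (x + h *\<^sub>R b) + f x
      = h\<^sup>2 * fa (x + s *\<^sub>R a + t *\<^sub>R b) b" by blast
  have in_S': "x + s *\<^sub>R b + t *\<^sub>R a \<in> S" if "s \<in> {0..h}" "t \<in> {0..h}" for s t
    using in_S[OF that(2,1)] by (simp add: algebra_simps)
  from second_difference_mvt[OF in_S' h f fb]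
  obtain s' t' where st': "s' \<in> {0..h}" "t' \<in> {0..h}"
    "f (x + h *\<^sub>R b + h *\<^sub>R a) - f (x + h *\<^sub>R b) - f (x + h *\<^sub>R a) + f x
      = h\<^sup>2 * fb (x + s' *\<^sub>R b + t' *\<^sub>R a) a" by blast
  have "f (x + h *\<^sub>R b + h *\<^sub>R a) = f (x + h *\<^sub>R a + h *\<^sub>R b)" by (simp add: algebra_simps)
  with st(3) st'(3) have "h\<^sup>2 * fa (x + s *\<^sub>R a + t *\<^sub>R b) b = h\<^sup>2 * fb (x + s' *\<^sub>R b + t' *\<^sub>R a) a" by linarith
  then have eq: "fa (x + s *\<^sub>R a + t *\<^sub>R b) b = fb (x + t' *\<^sub>R a + s' *\<^sub>R b) a"
    using h by (simp add: algebra_simps)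
  have "\<bar>fa (x + s *\<^sub>R a + t *\<^sub>R b) b - fa x b\<bar> < e" using near[OF st(1,2)] m d by force
  moreover have "\<bar>fb (x + t' *\<^sub>R a + s' *\<^sub>R b) a - fb x a\<bar> < e" using near[OF st'(2,1)] m d by force
  ultimately show False using eq unfolding e_def abs_if by (auto split: if_splits)
qed

section \<open>Rotation invariant functions\<close>

lemma DERIV_of_ck:
  fixes F :: "real \<Rightarrow> real"
  assumes "\<And>n. ck n UNIV F"
  shows "(F has_real_derivative deriv F x) (at x)" "ck n UNIV (deriv F)"
proof -
  have *: "\<exists>F'. (\<forall>x. (F has_real_derivative F' x) (at x)) \<and> ck n UNIV F'" for n
  proof -
    from assms[of "Suc n"] obtain D where D: "\<And>x. (F has_derivative D x) (at x)" "ck n UNIV (\<lambda>x. D x 1)"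
      by auto
    have "(F has_real_derivative D x 1) (at x)" for x
    proof -
      have "D x v = D x 1 * v" for v
        using linear_cmul[OF has_derivative_linear[OF D(1)], of x v 1] by simp
      then have "D x = (*) (D x 1)" by (intro ext)
      then show ?thesis using D(1)[of x] unfolding has_field_derivative_def by metis
    qed
    with D(2) show ?thesis by (intro exI[of _ "\<lambda>x. D x 1"]) simp
  qed
  then obtain F' where F': "\<forall>x. (F has_real_derivative F' x) (at x)" "ck n UNIV F'" by blast
  then have "deriv F = F'" using DERIV_imp_deriv by blast
  with F' show "(F has_real_derivative deriv F x) (at x)" "ck n UNIV (deriv F)" by auto
qed

lemma frechet_of_ck:
  assumes "\<And>n. ck n UNIV f"
  shows "(f has_derivative frechet_derivative f (at x)) (at x)"
    "b \<in> Basis \<Longrightarrow> ck n UNIV (\<lambda>x. frechet_derivative f (at x) b)"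
proof -
  from assms[of "Suc n"] obtain D where D: "\<And>x. (f has_derivative D x) (at x)"
    "\<And>b. b \<in> Basis \<Longrightarrow> ck n UNIV (\<lambda>x. D x b)" by auto
  have "frechet_derivative f (at x) = D x" for x using frechet_derivative_at[OF D(1)] by simp
  then show "(f has_derivative frechet_derivative f (at x)) (at x)"
    "b \<in> Basis \<Longrightarrow> ck n UNIV (\<lambda>x. frechet_derivative f (at x) b)" using D by auto
qed

lemma one_i_Basis: "1 \<in> (Basis :: complex set)" "\<i> \<in> (Basis :: complex set)"
  by (auto simp: Basis_complex_def)

lemma frechet_complex_of_real:
  assumes "(f has_derivative D) (at z)"
  shows "frechet_derivative (\<lambda>x. complex_of_real (f x)) (at z) v = complex_of_real (D v)"
proof -
  have "((\<lambda>x. complex_of_real (f x)) has_derivative (\<lambda>v. complex_of_real (D v))) (at z)"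
    using assms by (auto intro!: derivative_eq_intros)
  then show ?thesis by (simp flip: frechet_derivative_at)
qed

definition lap :: "(complex \<Rightarrow> real) \<Rightarrow> complex \<Rightarrow> real" where
  "lap f z = frechet_derivative (\<lambda>x. frechet_derivative f (at x) 1) (at z) 1
           + frechet_derivative (\<lambda>x. frechet_derivative f (at x) \<i>) (at z) \<i>"

text \<open>The composition of the two Wirtinger operators is a quarter of the Laplacian plus an
  imaginary multiple of the difference of the mixed derivatives; the real part in
  \<open>ddbar\<close> removes the latter.\<close>

lemma ddbar_eq_lap:
  assumes f: "\<And>n. ck n UNIV f"
  shows "ddbar f z = lap f z / 4"
proof -
  define D where "D v x = frechet_derivative f (at x) v" for v x
  have 1: "wirtinger_zbar (\<lambda>x. complex_of_real (f x)) = 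
      (\<lambda>x. (complex_of_real (D 1 x) + \<i> * complex_of_real (D \<i> x)) / 2)"
    using frechet_complex_of_real[OF frechet_of_ck(1)[OF f]] by (simp add: wirtinger_zbar_def D_def fun_eq_iff)
  have ckD: "ck n UNIV (D 1)" "ck n UNIV (D \<i>)" for n 
    using frechet_of_ck(2)[OF f] one_i_Basis unfolding D_def by blast+
  define E where "E v w = frechet_derivative (D v) (at z) w" for v w
  have E: "(D 1 has_derivative E 1) (at z)" "(D \<i> has_derivative E \<i>) (at z)"
    using frechet_of_ck(1)[OF ckD(1)] frechet_of_ck(1)[OF ckD(2)] unfolding E_def by blast+
  have "((\<lambda>x. (complex_of_real (D 1 x) + \<i> * complex_of_real (D \<i> x)) / 2) has_derivative
      (\<lambda>v. (complex_of_real (E 1 v) + \<i> * complex_of_real (E \<i> v)) / 2)) (at z)"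
    using E by (auto intro!: derivative_eq_intros)
  then have 2: "frechet_derivative (\<lambda>x. (complex_of_real (D 1 x) + \<i> * complex_of_real (D \<i> x)) / 2) (at z) =
      (\<lambda>v. (complex_of_real (E 1 v) + \<i> * complex_of_real (E \<i> v)) / 2)"
    by (simp flip: frechet_derivative_at)
  show ?thesis unfolding ddbar_def 1 wirtinger_z_def 2
    by (simp add: lap_def E_def D_def[abs_def] field_simps)
qed

lemma ck_lap: "(\<And>n. ck n UNIV f) \<Longrightarrow> ck n UNIV (lap f)"
  unfolding lap_def
  by (intro ck_add frechet_of_ck(2)[OF frechet_of_ck(2)] one_i_Basis) 

lemma ck_of_real_line: "ck n UNIV f \<Longrightarrow> ck n UNIV (\<lambda>r. f (complex_of_real r))"
  using ck_affine[OF bounded_linear_of_real, of n UNIV f UNIV 0] by simp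

text \<open>f stands for a local potential in one chart, \<phi> minus the logarithm of the metric;
  \<open>ddbar_pos\<close> is the positivity of the curvature form.\<close>

locale radial =
  fixes f :: "complex \<Rightarrow> real"
  assumes smooth: "ck n UNIV f"
    and radial: "f z = f (complex_of_real (cmod z))"
    and ddbar_pos: "ddbar f z > 0"
begin

text \<open>The profile along the whole real axis, negative radii included. Smoothness across 0
  together with evenness encodes the smoothness of f at the origin.\<close>

definition "e r = f (complex_of_real r)"
definition "e1 = deriv e"
definition "e2 = deriv e1"
definition "G r = ddbar f (complex_of_real r)"
definition "G1 = deriv G"

lemma ck_e: "ck n UNIV e" unfolding e_def[abs_def] by (intro ck_of_real_line smooth)

lemma e: "(e has_real_derivative e1 r) (at r)" "(e1 has_real_derivative e2 r) (at r)"
  and ck_e1: "ck n UNIV e1"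
proof -
  show 1: "ck n UNIV e1" for n unfolding e1_def by (rule DERIV_of_ck(2)[OF ck_e])
  show "(e has_real_derivative e1 r) (at r)" unfolding e1_def by (rule DERIV_of_ck(1)[OF ck_e])
  show "(e1 has_real_derivative e2 r) (at r)" unfolding e2_def by (rule DERIV_of_ck(1)[OF 1])
qed

lemma ck_G: "ck n UNIV G"
proof -
  have "G = (\<lambda>r. (1 / 4) * lap f (complex_of_real r))"
    using ddbar_eq_lap[OF smooth] by (simp add: G_def fun_eq_iff)
  then show ?thesis by (simp only:) (intro ck_cmult ck_of_real_line ck_lap smooth)
qed

lemma G: "(G has_real_derivative G1 r) (at r)" and ck_G1: "ck n UNIV G1"
  unfolding G1_def by (rule DERIV_of_ck[OF ck_G])+

lemma G_pos: "G r > 0" by (simp add: G_def ddbar_pos)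

lemma f_eq: "f z = e (cmod z)" using radial by (simp add: e_def)

lemma e_even: "e (- r) = e r"
  using f_eq[of "complex_of_real (- r)"] f_eq[of "complex_of_real r"] by (simp add: e_def)

lemma e1_odd: "e1 (- r) = - e1 r"
proof -
  have "((\<lambda>r. e (- r)) has_real_derivative - e1 (- r)) (at r)"
    using e(1)[of "- r"] by (simp add: DERIV_mirror)
  then have "(e has_real_derivative - e1 (- r)) (at r)" by (simp add: e_even)
  with e(1)[of r] show ?thesis using DERIV_unique by fastforce
qed

lemma e1_0: "e1 0 = 0" using e1_odd[of 0] by simp

definition "q r = e1 r / r"
definition "q' r = e2 r / r - e1 r / r\<^sup>2"

lemma q: "r > 0 \<Longrightarrow> (q has_real_derivative q' r) (at r)"
  unfolding q_def q'_def
  by (auto intro!: derivative_eq_intros e simp: power2_eq_square field_simps)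

lemma frechet_f: 
  assumes z: "z \<noteq> 0"
  shows "frechet_derivative f (at z) v = q (cmod z) * (z \<bullet> v)"
proof -
  have "((\<lambda>z. e (cmod z)) has_derivative (\<lambda>v. (z \<bullet> v / cmod z) * e1 (cmod z))) (at z)"
  proof -
    have n: "(cmod has_derivative (\<lambda>v. z \<bullet> v / cmod z)) (at z)"
      using has_derivative_norm[OF z] by (simp add: sgn_div_norm inner_commute divide_inverse mult.commute)
    show ?thesis
      using has_derivative_compose[OF n e(1)[of "cmod z", unfolded has_field_derivative_def]]
      by (simp add: mult.commute)
  qed
  moreover have "f = (\<lambda>z. e (cmod z))" using f_eq by auto
  ultimately have "(f has_derivative (\<lambda>v. (z \<bullet> v / cmod z) * e1 (cmod z))) (at z)" by simp
  then show ?thesis by (simp add: q_def flip: frechet_derivative_at)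
qed

lemma frechet2_f:
  assumes z: "z \<noteq> 0"
  shows "frechet_derivative (\<lambda>x. frechet_derivative f (at x) w) (at z) v =
     q (cmod z) * (v \<bullet> w) + (q' (cmod z) * (z \<bullet> v / cmod z)) * (z \<bullet> w)"
proof -
  have n: "(cmod has_derivative (\<lambda>v. z \<bullet> v / cmod z)) (at z)"
    using has_derivative_norm[OF z] by (simp add: sgn_div_norm inner_commute divide_inverse mult.commute)
  have "((\<lambda>x. q (cmod x)) has_derivative (\<lambda>v. q' (cmod z) * (z \<bullet> v / cmod z))) (at z)"
    using has_derivative_compose[OF n q[of "cmod z", unfolded has_field_derivative_def]] z by simp
  then have "((\<lambda>x. q (cmod x) * (x \<bullet> w)) has_derivative
      (\<lambda>v. q (cmod z) * (v \<bullet> w) + (q' (cmod z) * (z \<bullet> v / cmod z)) * (z \<bullet> w))) (at z)"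
    by (auto intro!: derivative_eq_intros)
  then have "((\<lambda>x. frechet_derivative f (at x) w) has_derivative
      (\<lambda>v. q (cmod z) * (v \<bullet> w) + (q' (cmod z) * (z \<bullet> v / cmod z)) * (z \<bullet> w))) (at z)"
    by (rule has_derivative_transform_within_open[where s = "- {0}"]) (use z frechet_f in auto)
  then show ?thesis by (simp flip: frechet_derivative_at)
qed

lemma ddbar_eq: 
  assumes z: "z \<noteq> 0"
  shows "ddbar f z = (e2 (cmod z) + e1 (cmod z) / cmod z) / 4"
proof -
  have z': "cmod z > 0" "(Re z)\<^sup>2 + (Im z)\<^sup>2 = (cmod z)\<^sup>2" using z by (auto simp: cmod_power2)
  have "lap f z = 2 * q (cmod z) + q' (cmod z) / cmod z * ((Re z)\<^sup>2 + (Im z)\<^sup>2)"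
    unfolding lap_def frechet2_f[OF z] 
    by (simp add: inner_complex_def power2_eq_square add_divide_distrib distrib_left)
  also have "\<dots> = e2 (cmod z) + e1 (cmod z) / cmod z"
    unfolding z'(2) using z'(1) by (simp add: q_def q'_def power2_eq_square field_simps)
  finally show ?thesis by (simp add: ddbar_eq_lap[OF smooth])
qed

lemma ddbar_radial: "z \<noteq> 0 \<Longrightarrow> ddbar f z = G (cmod z)"
  by (simp add: G_def ddbar_eq)

lemma G_eq: "r > 0 \<Longrightarrow> G r = (e2 r + e1 r / r) / 4"
  by (simp add: G_def ddbar_eq)

lemma G_even: "G (- r) = G r"
  by (cases "r = 0") (auto simp: G_def ddbar_eq)

lemma G1_odd: "G1 (- r) = - G1 r"
proof -
  have "((\<lambda>r. G (- r)) has_real_derivative - G1 (- r)) (at r)"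
    using G[of "- r"] by (simp add: DERIV_mirror)
  then have "(G has_real_derivative - G1 (- r)) (at r)" by (simp add: G_even)
  with G[of r] show ?thesis using DERIV_unique by fastforce
qed

text \<open>In the variable \<open>x = |z|\<^sup>2\<close>, \<open>U\<close> is the potential, \<open>y = x U'\<close> its moment map, and
  \<open>g = y'\<close> is the coefficient of the curvature form.\<close>

definition "U x = e (sqrt x)"
definition "y x = sqrt x * e1 (sqrt x) / 2"
definition "g x = G (sqrt x)"
definition "g' x = G1 (sqrt x) / (2 * sqrt x)"

lemma U: "x > 0 \<Longrightarrow> (U has_real_derivative y x / x) (at x)"
proof -
  assume x: "x > 0"
  have "(U has_real_derivative e1 (sqrt x) * (inverse (sqrt x) / 2)) (at x)"
    unfolding U_def by (rule DERIV_chain2[OF e(1) DERIV_real_sqrt[OF x]])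
  moreover have "e1 (sqrt x) * (inverse (sqrt x) / 2) = y x / x"
    using x by (simp add: y_def field_simps)
  ultimately show ?thesis by simp
qed

lemma y: "x > 0 \<Longrightarrow> (y has_real_derivative g x) (at x)"
proof -
  assume x: "x > 0"
  have "((\<lambda>x. e1 (sqrt x)) has_real_derivative e2 (sqrt x) * (inverse (sqrt x) / 2)) (at x)"
    by (rule DERIV_chain2[OF e(2) DERIV_real_sqrt[OF x]])
  then have "(y has_real_derivative (sqrt x * (e2 (sqrt x) * (inverse (sqrt x) / 2)) + inverse (sqrt x) / 2 * e1 (sqrt x)) / 2) (at x)"
    unfolding y_def by (intro DERIV_cdivide DERIV_mult' DERIV_real_sqrt x)
  moreover have "(sqrt x * (e2 (sqrt x) * (inverse (sqrt x) / 2)) + inverse (sqrt x) / 2 * e1 (sqrt x)) / 2 = g x"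
    using x by (simp add: g_def G_eq field_simps)
  ultimately show ?thesis by simp
qed

lemma g: "x > 0 \<Longrightarrow> (g has_real_derivative g' x) (at x)"
proof -
  assume x: "x > 0"
  have "(g has_real_derivative G1 (sqrt x) * (inverse (sqrt x) / 2)) (at x)"
    unfolding g_def by (rule DERIV_chain2[OF G DERIV_real_sqrt[OF x]])
  then show ?thesis by (simp add: g'_def field_simps)
qed

lemma g_pos: "g x > 0" by (simp add: g_def G_pos)

lemma g'_cont: "continuous_on {0<..} g'"
proof -
  have "continuous_on UNIV G1" using ck_G1 ck_imp_continuous_on by blast
  then have "continuous_on {0<..} (\<lambda>x. G1 (sqrt x))"
    by (rule continuous_on_compose2) (auto intro: continuous_intros)
  then show ?thesis unfolding g'_def[abs_def] by (intro continuous_intros) auto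
qed

text \<open>As a function of the radius the moment is \<open>r * e1 r / 2\<close>, which vanishes at
  0 and has derivative \<open>2 * r * G r > 0\<close>.\<close>

lemma y_pos: assumes "x > 0" shows "y x > 0"
proof -
  define Y where "Y r = r * e1 r / 2" for r
  have Y: "(Y has_real_derivative (e1 r + r * e2 r) / 2) (at r)" for r
    unfolding Y_def by (auto intro!: derivative_eq_intros e)
  have pos: "(e1 r + r * e2 r) / 2 > 0" if "r > 0" for r
  proof -
    have "(e1 r + r * e2 r) / 2 = 2 * r * G r" using that by (simp add: G_eq field_simps)
    then show ?thesis using that G_pos[of r] by simp
  qed
  have "Y 0 < Y (sqrt x)"
  proof (rule DERIV_pos_imp_increasing_open[of 0 "sqrt x" Y])
    show "\<exists>y. (Y has_real_derivative y) (at r) \<and> y > 0" if "0 < r" "r < sqrt x" for r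
      using Y[of r] pos that by blast
    show "continuous_on {0..sqrt x} Y" using Y by (intro continuous_at_imp_continuous_on ballI DERIV_isCont)
  qed (use assms in auto)
  then show ?thesis by (simp add: Y_def y_def)
qed

lemma mvt_pos: "r > 0 \<Longrightarrow> (\<And>s. (F has_real_derivative F' s) (at s)) \<Longrightarrow> \<exists>s. 0 < s \<and> s < r \<and> F r - F 0 = r * F' s"
  using MVT2[of 0 r F F'] by auto

text \<open>An even function \<open>G\<close> of class \<open>C\<^sup>4\<close> satisfies \<open>G' r = G'' 0 r + O(r\<^sup>3)\<close>, because its third
  derivative vanishes at \<open>0\<close>; so \<open>g'\<close> is Lipschitz at \<open>0\<close>.\<close>

lemma half_profile:
  obtains K g1 where "K \<ge> 1"
    "\<And>x. 0 < x \<Longrightarrow> x \<le> B \<Longrightarrow> 1 / K \<le> g x \<and> g x \<le> K \<and> \<bar>g' x\<bar> \<le> K \<and> \<bar>U x\<bar> \<le> K \<and>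
       f 0 \<le> U x \<and> U x \<le> f 0 + K * x \<and> y x \<le> K * x \<and> \<bar>g' x - g1\<bar> \<le> K * x"
proof -
  \<comment> \<open>\<open>max B 1\<close> keeps the interval nonempty for every B.\<close>
  define S where "S = {0..sqrt (max B 1)}"
  have "compact S" "S \<noteq> {}" by (auto simp: S_def)
  define G2 where "G2 = deriv G1"
  define G3 where "G3 = deriv G2"
  define G4 where "G4 = deriv G3"
  have ck: "ck n UNIV G2" "ck n UNIV G3" "ck n UNIV G4" for n
    unfolding G4_def G3_def G2_def by (intro DERIV_of_ck(2) ck_G1)+
  have d: "(G1 has_real_derivative G2 r) (at r)" "(G2 has_real_derivative G3 r) (at r)" 
      "(G3 has_real_derivative G4 r) (at r)" for r
    unfolding G2_def G3_def G4_def by (intro DERIV_of_ck(1) ck_G1 ck[unfolded G2_def G3_def])+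
  have bd: "\<exists>M. \<forall>r\<in>S. \<bar>F r\<bar> \<le> M" if "continuous_on UNIV F" for F :: "real \<Rightarrow> real"
  proof -
    have "continuous_on S F" using that continuous_on_subset by blast
    then have "bounded (F ` S)" using \<open>compact S\<close> compact_continuous_image compact_imp_bounded by blast
    then show ?thesis by (auto simp: bounded_iff)
  qed
  have cont: "continuous_on UNIV F" if "ck 0 UNIV F" for F :: "real \<Rightarrow> real" using that by simp
  obtain M0 where M0: "\<And>r. r \<in> S \<Longrightarrow> \<bar>e r\<bar> \<le> M0" using bd[OF cont[OF ck_e]] by blast
  have "ck 0 UNIV e2" unfolding e2_def by (rule DERIV_of_ck(2)[OF ck_e1])
  then obtain M2 where M2: "\<And>r. r \<in> S \<Longrightarrow> \<bar>e2 r\<bar> \<le> M2" using bd[OF cont] by blast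
  obtain N0 where N0: "\<And>r. r \<in> S \<Longrightarrow> \<bar>G r\<bar> \<le> N0" using bd[OF cont[OF ck_G]] by blast
  obtain N2 where N2: "\<And>r. r \<in> S \<Longrightarrow> \<bar>G2 r\<bar> \<le> N2" using bd[OF cont[OF ck(1)]] by blast
  obtain N4 where N4: "\<And>r. r \<in> S \<Longrightarrow> \<bar>G4 r\<bar> \<le> N4" using bd[OF cont[OF ck(3)]] by blast
  have "continuous_on S G" using cont[OF ck_G] continuous_on_subset by blast
  then obtain r0 where r0: "r0 \<in> S" "\<And>r. r \<in> S \<Longrightarrow> G r0 \<le> G r"
    using continuous_attains_inf[OF \<open>compact S\<close> \<open>S \<noteq> {}\<close>] by blast
  have G1_0: "G1 0 = 0" using G1_odd[of 0] by simp
  have G2_even: "G2 (- r) = G2 r" for r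
  proof -
    have "((\<lambda>r. G1 (- r)) has_real_derivative - G2 (- r)) (at r)"
      using d(1)[of "- r"] by (simp add: DERIV_mirror)
    then have "((\<lambda>r. - G1 r) has_real_derivative - G2 (- r)) (at r)" by (simp add: G1_odd)
    then have "(G1 has_real_derivative G2 (- r)) (at r)" using DERIV_minus by fastforce
    with d(1)[of r] show ?thesis using DERIV_unique by blast
  qed
  have G3_0: "G3 0 = 0"
  proof -
    have "((\<lambda>r. G2 (- r)) has_real_derivative - G3 0) (at 0)"
      using d(2)[of 0] DERIV_mirror[where f = G2 and x = 0 and y = "G3 0"] by simp
    then have "(G2 has_real_derivative - G3 0) (at 0)" by (simp add: G2_even)
    from DERIV_unique[OF d(2)[of 0] this] show ?thesis by simp
  qed
  define K where "K = 1 + 1 / G r0 + \<bar>M0\<bar> + \<bar>N0\<bar> + \<bar>N2\<bar> + \<bar>N4\<bar> + \<bar>M2\<bar>"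
  have invp: "1 / G r0 > 0" using G_pos by simp
  then have Kb: "1 \<le> K" "1 / G r0 \<le> K" "\<bar>M0\<bar> \<le> K" "\<bar>N0\<bar> \<le> K" "\<bar>N2\<bar> \<le> K" "\<bar>N4\<bar> \<le> K" "\<bar>M2\<bar> \<le> K"
    unfolding K_def by linarith+
  show ?thesis
  proof (rule that)
    show "K \<ge> 1" by (rule Kb)
    fix x :: real assume x: "0 < x" "x \<le> B"
    define r where "r = sqrt x"
    have r: "r > 0" "r * r = x" using x by (auto simp: r_def)
    have Sr: "s \<in> S" if "0 \<le> s" "s \<le> r" for s
      using that x by (auto simp: S_def r_def intro: order_trans)
    have rS: "r \<in> S" "0 \<in> S" using Sr[of r] Sr[of 0] r by auto
    \<comment> \<open>The bound on the fourth derivative is integrated three times by the mean value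
      theorem: linear for \<open>G3\<close>, quadratic for \<open>G2\<close>, cubic for
      \<open>G1\<close>. The starting values are \<open>G3 0 = 0\<close> and
      \<open>G1 0 = 0\<close>.\<close>
    have G3b: "\<bar>G3 s\<bar> \<le> \<bar>N4\<bar> * s" if s: "0 < s" "s \<le> r" for s
    proof -
      obtain t where t: "0 < t" "t < s" "G3 s - G3 0 = s * G4 t" using mvt_pos[OF s(1) d(3)] by blast
      then have "\<bar>G3 s\<bar> = s * \<bar>G4 t\<bar>" using s G3_0 by (simp add: abs_mult)
      moreover have "\<bar>G4 t\<bar> \<le> \<bar>N4\<bar>" using N4[OF Sr[of t]] t s by auto
      ultimately show ?thesis using s by (simp add: mult.commute mult_left_mono)
    qed
    have G2b: "\<bar>G2 s - G2 0\<bar> \<le> \<bar>N4\<bar> * s\<^sup>2" if s: "0 < s" "s \<le> r" for s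
    proof -
      obtain t where t: "0 < t" "t < s" "G2 s - G2 0 = s * G3 t" using mvt_pos[OF s(1) d(2)] by blast
      then have "\<bar>G2 s - G2 0\<bar> = s * \<bar>G3 t\<bar>" using s by (simp add: abs_mult)
      also have "\<dots> \<le> s * (\<bar>N4\<bar> * t)" using G3b[of t] t s by (intro mult_left_mono) auto
      also have "\<dots> \<le> s * (\<bar>N4\<bar> * s)" using t s by (intro mult_left_mono) auto
      finally show ?thesis by (simp add: power2_eq_square mult_ac)
    qed
    have G1b: "\<bar>G1 r - G2 0 * r\<bar> \<le> \<bar>N4\<bar> * r\<^sup>2 * r"
    proof -
      have "((\<lambda>r. G1 r - G2 0 * r) has_real_derivative G2 s - G2 0) (at s)" for s
        by (auto intro!: derivative_eq_intros d)
      then obtain t where t: "0 < t" "t < r" "(G1 r - G2 0 * r) - (G1 0 - G2 0 * 0) = r * (G2 t - G2 0)"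
        using mvt_pos[OF r(1), of "\<lambda>r. G1 r - G2 0 * r" "\<lambda>s. G2 s - G2 0"] by blast
      then have "\<bar>G1 r - G2 0 * r\<bar> = r * \<bar>G2 t - G2 0\<bar>" using r by (simp add: abs_mult G1_0)
      also have "\<dots> \<le> r * (\<bar>N4\<bar> * t\<^sup>2)" using G2b[of t] t r by (intro mult_left_mono) auto
      also have "\<dots> \<le> r * (\<bar>N4\<bar> * r\<^sup>2)" using t r by (intro mult_left_mono power_mono) auto
      finally show ?thesis by (simp add: mult_ac)
    qed
    have "\<bar>g' x - G2 0 / 2\<bar> \<le> K * x"
    proof -
      have "g' x - G2 0 / 2 = (G1 r - G2 0 * r) / (2 * r)" using r by (simp add: g'_def r_def[symmetric] field_simps)
      then have "\<bar>g' x - G2 0 / 2\<bar> = \<bar>G1 r - G2 0 * r\<bar> / (2 * r)" using r by simp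
      also have "\<dots> \<le> \<bar>N4\<bar> * r\<^sup>2 * r / (2 * r)" using G1b r by (intro divide_right_mono) auto
      also have "\<dots> = \<bar>N4\<bar> * x / 2" using r by (simp add: power2_eq_square)
      also have "\<dots> \<le> \<bar>N4\<bar> * x" using x by simp
      also have "\<dots> \<le> K * x" using x Kb by (intro mult_right_mono) auto
      finally show ?thesis .
    qed
    moreover have "\<bar>g' x\<bar> \<le> K"
    proof -
      obtain t where t: "0 < t" "t < r" "G1 r - G1 0 = r * G2 t" using mvt_pos[OF r(1) d(1)] by blast
      then have "\<bar>g' x\<bar> = \<bar>G2 t\<bar> / 2" using r G1_0 by (simp add: g'_def r_def[symmetric] abs_mult)
      also have "\<dots> \<le> \<bar>N2\<bar>" using N2[OF Sr[of t]] t by auto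
      finally show ?thesis using Kb by linarith
    qed
    moreover have "1 / K \<le> g x"
    proof -
      have "1 / K \<le> 1 / (1 / G r0)" using invp Kb by (intro divide_left_mono) auto
      then show ?thesis using r0(2)[OF rS(1)] by (simp add: g_def r_def)
    qed
    moreover have "g x \<le> K" "\<bar>U x\<bar> \<le> K"
      using N0[OF rS(1)] M0[OF rS(1)] Kb by (auto simp: g_def U_def r_def)
    moreover have e1b: "\<bar>e1 s\<bar> \<le> \<bar>M2\<bar> * s" if s: "0 < s" "s \<le> r" for s
    proof -
      obtain t where t: "0 < t" "t < s" "e1 s - e1 0 = s * e2 t" using mvt_pos[OF s(1) e(2)] by blast
      then have "\<bar>e1 s\<bar> = s * \<bar>e2 t\<bar>" using s e1_0 by (simp add: abs_mult)
      moreover have "\<bar>e2 t\<bar> \<le> \<bar>M2\<bar>" using M2[OF Sr[of t]] t s by auto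
      ultimately show ?thesis using s by (simp add: mult.commute mult_left_mono)
    qed
    moreover have "y x \<le> K * x"
    proof -
      have "y x \<le> r * \<bar>e1 r\<bar> / 2" using r by (simp add: y_def r_def[symmetric] mult_left_mono)
      also have "\<dots> \<le> r * (\<bar>M2\<bar> * r) / 2" using e1b[of r] r by (intro divide_right_mono mult_left_mono) auto
      also have "\<dots> = \<bar>M2\<bar> * x / 2" using r by simp
      also have "\<dots> \<le> K * x" 
      proof -
        have "\<bar>M2\<bar> / 2 \<le> K" using Kb by linarith
        then show ?thesis using x mult_right_mono[of "\<bar>M2\<bar> / 2" K x] by simp
      qed
      finally show ?thesis .
    qed
    moreover have "f 0 \<le> U x \<and> U x \<le> f 0 + K * x"
    proof -
      obtain t where t: "0 < t" "t < r" "e r - e 0 = r * e1 t" using mvt_pos[OF r(1) e(1)] by blast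
      have "e1 t > 0" using y_pos[of "t\<^sup>2"] t by (simp add: y_def zero_less_mult_iff)
      then have 1: "0 \<le> e r - e 0" using t r by simp
      have "e1 t \<le> \<bar>M2\<bar> * t" using e1b[of t] t by auto
      also have "\<dots> \<le> \<bar>M2\<bar> * r" using t by (intro mult_left_mono) auto
      finally have "r * e1 t \<le> r * (\<bar>M2\<bar> * r)" using r by (intro mult_left_mono) auto
      also have "\<dots> = \<bar>M2\<bar> * x" using r by simp
      also have "\<dots> \<le> K * x" using x Kb by (intro mult_right_mono) auto
      finally show ?thesis using 1 t(3) by (simp add: U_def r_def[symmetric] e_def)
    qed
    ultimately show "1 / K \<le> g x \<and> g x \<le> K \<and> \<bar>g' x\<bar> \<le> K \<and> \<bar>U x\<bar> \<le> K \<and>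
       f 0 \<le> U x \<and> U x \<le> f 0 + K * x \<and> y x \<le> K * x \<and> \<bar>g' x - G2 0 / 2\<bar> \<le> K * x" by blast
  qed
qed

end

section \<open>Norming constants of one potential\<close>

text \<open>The Fubini-Study density, which dominates every integrand below.\<close>

lemma set_integrable_inverse_square:
  "set_integrable lborel {0<..} (\<lambda>x::real. 1 / (1 + x)\<^sup>2)"
  "(LBINT x:{0<..}. 1 / (1 + x)\<^sup>2) = (1::real)"
proof -
  have e: "einterval 0 \<infinity> = {0::real<..}" by (auto simp: einterval_def)
  have D: "((\<lambda>x. - 1 / (1 + x)) has_real_derivative 1 / (1 + x)\<^sup>2) (at x)" if "x > 0" for x :: real
    using that by (auto intro!: derivative_eq_intros simp: power2_eq_square)
  have A: "(((\<lambda>x. - 1 / (1 + x)) \<circ> real_of_ereal) \<longlongrightarrow> - 1) (at_right 0)"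
  proof -
    have "((\<lambda>x::real. - 1 / (1 + x)) \<longlongrightarrow> - 1 / (1 + 0)) (at_right 0)" by (intro tendsto_intros) auto
    then show ?thesis by (simp add: zero_ereal_def ereal_tendsto_simps)
  qed
  have B: "(((\<lambda>x. - 1 / (1 + x)) \<circ> real_of_ereal) \<longlongrightarrow> 0) (at_left \<infinity>)"
  proof -
    have "((\<lambda>x::real. - 1 / (1 + x)) \<longlongrightarrow> 0) at_top"
      by (intro tendsto_divide_0[OF tendsto_const] filterlim_at_top_imp_at_infinity
          filterlim_tendsto_add_at_top[OF tendsto_const] filterlim_ident)
    then show ?thesis by (simp add: ereal_tendsto_simps)
  qed
  note * = interval_integral_FTC_nonneg[of 0 \<infinity> "\<lambda>x. - 1 / (1 + x)" "\<lambda>x. 1 / (1 + x)\<^sup>2", OF _ _ _ _ A B]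
  have c: "isCont (\<lambda>x::real. 1 / (1 + x)\<^sup>2) x" if "x > 0" for x
    using that by (intro continuous_intros) auto
  have "set_integrable lborel (einterval 0 \<infinity>) (\<lambda>x::real. 1 / (1 + x)\<^sup>2)"
    by (rule *(1)) (use D c in \<open>auto intro!: AE_I2\<close>)
  then show "set_integrable lborel {0<..} (\<lambda>x::real. 1 / (1 + x)\<^sup>2)" unfolding e .
  have "(LBINT x=0..\<infinity>. 1 / (1 + x)\<^sup>2) = 0 - (-1::real)"
    by (rule *(2)) (use D c in \<open>auto intro!: AE_I2\<close>)
  then show "(LBINT x:{0<..}. 1 / (1 + x)\<^sup>2) = (1::real)"
    by (simp add: interval_lebesgue_integral_def e)
qed

text \<open>The bounds of the Fubini-Study profile U = ln (1 + x), y = x / (1 + x), g = 1 / (1 +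
  x)^2, up to a constant. \<open>g'_le\<close> decays at infinity so that x g' / g, which
  integration by parts produces, stays bounded.\<close>

locale profile =
  fixes U y g g' :: "real \<Rightarrow> real" and U0 C :: real
  assumes U: "\<And>x. x > 0 \<Longrightarrow> (U has_real_derivative y x / x) (at x)"
    and y: "\<And>x. x > 0 \<Longrightarrow> (y has_real_derivative g x) (at x)"
    and g: "\<And>x. x > 0 \<Longrightarrow> (g has_real_derivative g' x) (at x)"
    and g'_cont: "continuous_on {0<..} g'"
    and g_pos: "\<And>x. x > 0 \<Longrightarrow> g x > 0"
    and g'_le: "\<And>x. x > 0 \<Longrightarrow> \<bar>g' x\<bar> \<le> C * g x / (1 + x)"
    and g_le: "\<And>x. x > 0 \<Longrightarrow> g x \<le> C / (1 + x)\<^sup>2"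
    and g_ge: "\<And>x. x > 0 \<Longrightarrow> x \<le> 2 \<Longrightarrow> 1 / C \<le> g x"
    and U_ln: "\<And>x. x > 0 \<Longrightarrow> \<bar>U x - ln (1 + x)\<bar> \<le> C"
    and U_0: "\<And>x. x > 0 \<Longrightarrow> U0 \<le> U x" "\<And>x. x > 0 \<Longrightarrow> x \<le> 1 \<Longrightarrow> U x \<le> U0 + C * x"
    and y_range: "\<And>x. x > 0 \<Longrightarrow> 0 < y x" "\<And>x. x > 0 \<Longrightarrow> y x < 1"
    and C: "C \<ge> 1"
begin

definition W :: "nat \<Rightarrow> nat \<Rightarrow> real \<Rightarrow> real" where
  "W N j x = x ^ j * exp (- real N * U x) * g x"

definition I :: "nat \<Rightarrow> nat \<Rightarrow> (real \<Rightarrow> real) \<Rightarrow> real" where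
  "I N j \<phi> = (LBINT x:{0<..}. W N j x * \<phi> x)"

lemma W_pos: "x > 0 \<Longrightarrow> W N j x > 0"
  using g_pos by (simp add: W_def)

lemma cont:
  "continuous_on {0<..} U" "continuous_on {0<..} y" "continuous_on {0<..} g" "continuous_on {0<..} (W N j)"
proof -
  show 1: "continuous_on {0<..} U" "continuous_on {0<..} y" "continuous_on {0<..} g"
    using U y g by (auto intro!: continuous_at_imp_continuous_on DERIV_isCont)
  show "continuous_on {0<..} (W N j)"
    unfolding W_def by (intro continuous_intros 1)
qed

text \<open>x^j is at most (1 + x)^N, which cancels exp (- N U) up to exp (N C). A factor
  exponential in N is harmless: the bound serves integrability, boundary terms at fixed N, and ln Q
  = O(N).\<close>

lemma W_le: 
  assumes "x > 0" "j \<le> N"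
  shows "W N j x \<le> (C * exp (N * C)) * (1 / (1 + x)\<^sup>2)"
proof -
  have "exp (- real N * U x) \<le> exp (N * C - N * ln (1 + x))"
  proof -
    have "ln (1 + x) - C \<le> U x" using U_ln[OF assms(1)] by linarith
    then have "N * (ln (1 + x) - C) \<le> N * U x" by (intro mult_left_mono) auto
    then show ?thesis by (simp add: algebra_simps)
  qed
  also have "\<dots> = exp (N * C) / (1 + x) ^ N"
    using assms by (simp add: exp_diff exp_of_nat_mult)
  finally have 1: "exp (- real N * U x) \<le> exp (N * C) / (1 + x) ^ N" .
  have "x ^ j \<le> (1 + x) ^ j" using assms by (intro power_mono) auto
  also have "\<dots> \<le> (1 + x) ^ N" using assms by (intro power_increasing) auto
  finally have "x ^ j * exp (- real N * U x) \<le> (1 + x) ^ N * (exp (N * C) / (1 + x) ^ N)"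
    using 1 assms by (intro mult_mono) auto
  also have "\<dots> = exp (N * C)" using assms by simp
  finally have "W N j x \<le> exp (N * C) * (C / (1 + x)\<^sup>2)"
    unfolding W_def using g_le[OF assms(1)] g_pos[OF assms(1)] by (intro mult_mono) auto
  then show ?thesis by (simp add: mult_ac)
qed

lemma W_integrable:
  assumes j: "j \<le> N" and \<phi>: "continuous_on {0<..} \<phi>" "\<And>x. x > 0 \<Longrightarrow> \<bar>\<phi> x\<bar> \<le> B"
  shows "set_integrable lborel {0<..} (\<lambda>x. W N j x * \<phi> x)"
proof (rule set_integrable_bound)
  have B: "B \<ge> 0" using \<phi>(2)[of 1] by force
  show "set_integrable lborel {0<..} (\<lambda>x. (C * exp (N * C) * B) * (1 / (1 + x)\<^sup>2))"
    by (intro set_integrable_mult_right set_integrable_inverse_square)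
  have "continuous_on {0<..} (\<lambda>x. W N j x * \<phi> x)" by (intro continuous_intros cont \<phi>)
  then show "set_borel_measurable lborel {0<..} (\<lambda>x. W N j x * \<phi> x)"
    unfolding set_borel_measurable_def
    using borel_measurable_continuous_on_indicator[of "{0<..}" "\<lambda>x. W N j x * \<phi> x"] by simp
  show "AE x in lborel. x \<in> {0<..} \<longrightarrow> norm (W N j x * \<phi> x) \<le> norm (C * exp (N * C) * B * (1 / (1 + x)\<^sup>2))"
  proof (intro AE_I2 impI)
    fix x :: real assume x: "x \<in> {0<..}"
    have "norm (W N j x * \<phi> x) = W N j x * \<bar>\<phi> x\<bar>" using W_pos[of x N j] x by (simp add: abs_mult)
    also have "\<dots> \<le> (C * exp (N * C)) * (1 / (1 + x)\<^sup>2) * B"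
      using W_le[of x j N] \<phi>(2)[of x] x j C by (intro mult_mono) auto
    also have "\<dots> = norm (C * exp (N * C) * B * (1 / (1 + x)\<^sup>2))" using x C B by simp
    finally show "norm (W N j x * \<phi> x) \<le> norm (C * exp (N * C) * B * (1 / (1 + x)\<^sup>2))" .
  qed
qed

text \<open>A class of test functions, closed under the algebraic operations, that is integrable
  against every weight \<open>W N j\<close> with j \<le> N.\<close>

definition bcont :: "(real \<Rightarrow> real) \<Rightarrow> bool" where
  "bcont \<phi> \<longleftrightarrow> continuous_on {0<..} \<phi> \<and> (\<exists>B. \<forall>x>0. \<bar>\<phi> x\<bar> \<le> B)"

lemma bcontI: "continuous_on {0<..} \<phi> \<Longrightarrow> (\<And>x. x > 0 \<Longrightarrow> \<bar>\<phi> x\<bar> \<le> B) \<Longrightarrow> bcont \<phi>"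
  by (auto simp: bcont_def)

lemma bcont_const [simp]: "bcont (\<lambda>_. c)" by (rule bcontI[of _ "\<bar>c\<bar>"]) auto

lemma bcont_add [simp]: "bcont f \<Longrightarrow> bcont h \<Longrightarrow> bcont (\<lambda>x. f x + h x)"
proof -
  assume "bcont f" "bcont h"
  then obtain A B where *: "continuous_on {0<..} f" "continuous_on {0<..} h"
    "\<And>x. x > 0 \<Longrightarrow> \<bar>f x\<bar> \<le> A" "\<And>x. x > 0 \<Longrightarrow> \<bar>h x\<bar> \<le> B" by (auto simp: bcont_def)
  show ?thesis
  proof (rule bcontI)
    fix x :: real assume "x > 0"
    then show "\<bar>f x + h x\<bar> \<le> A + B" using *(3)[of x] *(4)[of x] by linarith
  qed (intro continuous_on_add *)
qed

lemma bcont_mult [simp]: "bcont f \<Longrightarrow> bcont h \<Longrightarrow> bcont (\<lambda>x. f x * h x)"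
proof -
  assume "bcont f" "bcont h"
  then obtain A B where *: "continuous_on {0<..} f" "continuous_on {0<..} h"
    "\<And>x. x > 0 \<Longrightarrow> \<bar>f x\<bar> \<le> A" "\<And>x. x > 0 \<Longrightarrow> \<bar>h x\<bar> \<le> B" by (auto simp: bcont_def)
  show ?thesis
  proof (rule bcontI)
    fix x :: real assume x: "x > 0"
    have "A \<ge> 0" using *(3)[of 1] by force
    then show "\<bar>f x * h x\<bar> \<le> A * B" using *(3)[OF x] *(4)[OF x] by (auto simp: abs_mult intro!: mult_mono)
  qed (intro continuous_on_mult *)
qed

lemma bcont_diff [simp]: "bcont f \<Longrightarrow> bcont h \<Longrightarrow> bcont (\<lambda>x. f x - h x)"
  using bcont_add[of f "\<lambda>x. (-1) * h x"] bcont_mult[of "\<lambda>_. -1" h] by simp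

lemma bcont_power [simp]: "bcont f \<Longrightarrow> bcont (\<lambda>x. f x ^ n)"
  by (induction n) auto

lemma bcont_y [simp]: "bcont y"
proof (rule bcontI)
  show "\<bar>y x\<bar> \<le> 1" if "x > 0" for x using y_range[OF that] by simp
qed (rule cont)

lemma xg_le: "x > 0 \<Longrightarrow> x * g x \<le> C"
proof -
  assume x: "x > 0"
  have "x * g x \<le> x * (C / (1 + x)\<^sup>2)" using g_le[OF x] x by (intro mult_left_mono) auto
  also have "\<dots> = C * (x / (1 + x)\<^sup>2)" by simp
  also have "\<dots> \<le> C * 1"
  proof (rule mult_left_mono)
    have "x * 1 \<le> (1 + x) * (1 + x)" using x by (intro mult_mono) auto
    then show "x / (1 + x)\<^sup>2 \<le> 1" using x by (simp add: power2_eq_square)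
  qed (use C in auto)
  finally show ?thesis by simp
qed

lemma bcont_xg [simp]: "bcont (\<lambda>x. x * g x)"
proof (rule bcontI)
  show "\<bar>x * g x\<bar> \<le> C" if "x > 0" for x using xg_le[OF that] g_pos[OF that] that by simp
qed (intro continuous_intros cont)

lemma quot_le: "x > 0 \<Longrightarrow> \<bar>g' x / g x\<bar> \<le> C" "x > 0 \<Longrightarrow> \<bar>x * g' x / g x\<bar> \<le> C"
proof -
  assume x: "x > 0"
  have 1: "\<bar>g' x / g x\<bar> \<le> C * (1 / (1 + x))"
    using g'_le[OF x] g_pos[OF x] by (simp add: abs_divide field_simps)
  have "1 / (1 + x) \<le> 1" using x by simp
  then have "C * (1 / (1 + x)) \<le> C * 1" using C by (intro mult_left_mono) auto
  then show "\<bar>g' x / g x\<bar> \<le> C" using 1 by linarith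
  have "\<bar>x * g' x / g x\<bar> = x * \<bar>g' x / g x\<bar>" using x by (simp add: abs_mult)
  also have "\<dots> \<le> x * (C * (1 / (1 + x)))" using 1 x by (intro mult_left_mono) auto
  also have "\<dots> = C * (x / (1 + x))" by simp
  also have "\<dots> \<le> C * 1" using x C by (intro mult_left_mono) auto
  finally show "\<bar>x * g' x / g x\<bar> \<le> C" by simp
qed

lemma bcont_quot [simp]: "bcont (\<lambda>x. g' x / g x)" "bcont (\<lambda>x. x * g' x / g x)"
proof -
  have *: "x \<in> {0<..} \<Longrightarrow> g x \<noteq> 0" for x using g_pos[of x] by auto
  show "bcont (\<lambda>x. g' x / g x)"
    using quot_le * by (intro bcontI[where B = C] continuous_intros cont g'_cont) auto
  show "bcont (\<lambda>x. x * g' x / g x)"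
    using quot_le * by (intro bcontI[where B = C] continuous_intros cont g'_cont) auto
qed

lemma I_integrable: "j \<le> N \<Longrightarrow> bcont \<phi> \<Longrightarrow> set_integrable lborel {0<..} (\<lambda>x. W N j x * \<phi> x)"
  using W_integrable by (auto simp: bcont_def)

lemma I_add: "j \<le> N \<Longrightarrow> bcont f \<Longrightarrow> bcont h \<Longrightarrow> I N j (\<lambda>x. f x + h x) = I N j f + I N j h"
  using I_integrable[of j N f] I_integrable[of j N h] unfolding I_def
  by (simp add: distrib_left)

lemma I_cmult: "I N j (\<lambda>x. c * f x) = c * I N j f"
proof -
  have "(\<lambda>x. W N j x * (c * f x)) = (\<lambda>x. c * (W N j x * f x))" by (auto simp: mult_ac)
  then show ?thesis unfolding I_def by simp
qed

lemma I_diff: "j \<le> N \<Longrightarrow> bcont f \<Longrightarrow> bcont h \<Longrightarrow> I N j (\<lambda>x. f x - h x) = I N j f - I N j h"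
  using I_integrable[of j N f] I_integrable[of j N h] unfolding I_def
  by (simp add: right_diff_distrib)

lemma I_mono:
  assumes "j \<le> N" "bcont f" "bcont h" "\<And>x. x > 0 \<Longrightarrow> f x \<le> h x"
  shows "I N j f \<le> I N j h"
  unfolding I_def using assms W_pos
  by (intro set_integral_mono I_integrable mult_left_mono) (auto simp: less_imp_le)

lemma I_cong: "(\<And>x. x > 0 \<Longrightarrow> f x = h x) \<Longrightarrow> I N j f = I N j h"
  unfolding I_def by (rule set_lebesgue_integral_cong) auto

section \<open>Size, log-convexity and quotients of the norming integrals\<close>

definition Q :: "nat \<Rightarrow> nat \<Rightarrow> real" where "Q N j = I N j (\<lambda>_. 1)"

lemma I_const: "I N j (\<lambda>_. c) = c * Q N j"
  using I_cmult[of N j c "\<lambda>_. 1"] by (simp add: Q_def)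

lemma I_abs_le:
  assumes "j \<le> N" "bcont f" "\<And>x. x > 0 \<Longrightarrow> \<bar>f x\<bar> \<le> B"
  shows "\<bar>I N j f\<bar> \<le> B * Q N j"
proof -
  have "I N j f \<le> I N j (\<lambda>_. B)" "I N j (\<lambda>_. - B) \<le> I N j f"
    using assms by (intro I_mono; force simp: abs_le_iff)+
  then show ?thesis by (simp add: I_const abs_le_iff)
qed

lemma I_ge_interval:
  assumes j: "j \<le> N" and ab: "0 < a" "a \<le> b" and m: "\<And>x. a \<le> x \<Longrightarrow> x \<le> b \<Longrightarrow> m \<le> W N j x"
  shows "m * (b - a) \<le> Q N j"
proof -
  have "m * (b - a) = (LBINT x:{a..b}. m)" using ab by (simp add: set_integral_const)
  also have "\<dots> \<le> (LBINT x:{a..b}. W N j x * 1)"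
  proof (intro set_integral_mono)
    show "set_integrable lborel {a..b} (\<lambda>x. W N j x * 1)"
      by (rule set_integrable_subset[OF I_integrable[OF j, of "\<lambda>_. 1"]]) (use ab in auto)
    have "integrable lborel (indicat_real {a..b})" by (simp add: integrable_indicator_iff emeasure_lborel_Icc_eq)
    then show "set_integrable lborel {a..b} (\<lambda>x. m)" by (simp add: set_integrable_def)
  qed (use m in auto)
  also have "\<dots> \<le> (LBINT x:{0<..}. W N j x * 1)"
    unfolding set_lebesgue_integral_def
  proof (rule integral_mono)
    show "integrable lborel (\<lambda>x. indicat_real {0<..} x *\<^sub>R (W N j x * 1))"
      using I_integrable[OF j, of "\<lambda>_. 1"] by (simp add: set_integrable_def)
    have "set_integrable lborel {a..b} (\<lambda>x. W N j x * 1)"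
      by (rule set_integrable_subset[OF I_integrable[OF j, of "\<lambda>_. 1"]]) (use ab in auto)
    then show "integrable lborel (\<lambda>x. indicat_real {a..b} x *\<^sub>R (W N j x * 1))"
      by (simp add: set_integrable_def)
    show "indicat_real {a..b} x *\<^sub>R (W N j x * 1) \<le> indicat_real {0<..} x *\<^sub>R (W N j x * 1)" for x
      using ab W_pos[of x N j] by (auto simp: indicator_def)
  qed
  finally show ?thesis by (simp add: Q_def I_def)
qed

text \<open>Restriction to [1, 2], where x^j \<ge> 1, gives a lower bound independent of j.\<close>

lemma Q_lower: assumes "j \<le> N" shows "exp (- real N * (C + 2)) / C \<le> Q N j"
proof -
  have "exp (- real N * (C + 2)) / C * (2 - 1) \<le> Q N j"
  proof (rule I_ge_interval[OF assms])
    fix x :: real assume x: "1 \<le> x" "x \<le> 2"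
    have "ln (1 + x) \<le> x" using x by (intro ln_add_one_self_le_self) auto
    then have "U x \<le> C + 2" using U_ln[of x] x by linarith
    then have "N * U x \<le> N * (C + 2)" by (intro mult_left_mono) auto
    then have "exp (- real N * (C + 2)) \<le> exp (- real N * U x)" by simp
    moreover have "1 \<le> x ^ j" using x by (simp add: one_le_power)
    ultimately have "1 * exp (- real N * (C + 2)) * (1 / C) \<le> x ^ j * exp (- real N * U x) * g x"
      using g_ge[of x] x C by (intro mult_mono) auto
    then show "exp (- real N * (C + 2)) / C \<le> W N j x" by (simp add: W_def)
  qed auto
  then show ?thesis by simp
qed

lemma Q_pos: "j \<le> N \<Longrightarrow> Q N j > 0"
  using Q_lower[of j N] C by (smt (verit) divide_pos_pos exp_gt_zero)

lemma Q_upper: assumes "j \<le> N" shows "Q N j \<le> C * exp (N * C)"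
proof -
  have "Q N j \<le> (LBINT x:{0<..}. (C * exp (N * C)) * (1 / (1 + x)\<^sup>2))"
    unfolding Q_def I_def
  proof (intro set_integral_mono I_integrable set_integrable_mult_right set_integrable_inverse_square(1))
    fix x :: real assume "x \<in> {0<..}"
    then show "W N j x * 1 \<le> (C * exp (N * C)) * (1 / (1 + x)\<^sup>2)" using W_le[of x j N] assms by simp
  qed (use assms in auto)
  also have "\<dots> = C * exp (N * C)" by (simp only: set_integral_mult_right set_integrable_inverse_square(2) mult_1_right)
  finally show ?thesis .
qed

lemma ln_Q_bound: 
  assumes "j \<le> N" "N \<ge> 1"
  shows "\<bar>ln (Q N j)\<bar> \<le> N * (C + 2 + ln C)"
proof -
  have lC: "ln C \<ge> 0" "ln C \<le> N * ln C" using C assms mult_right_mono[of 1 N "ln C"] by auto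
  have "ln (exp (- real N * (C + 2)) / C) \<le> ln (Q N j)"
    using Q_lower[OF assms(1)] Q_pos[OF assms(1)] C by (subst ln_le_cancel_iff) auto
  then have "- real N * (C + 2) - ln C \<le> ln (Q N j)" using C by (simp add: ln_div)
  moreover have "ln (Q N j) \<le> ln (C * exp (N * C))"
    using Q_upper[OF assms(1)] Q_pos[OF assms(1)] C by (subst ln_le_cancel_iff) auto
  then have "ln (Q N j) \<le> ln C + N * C" using C by (simp add: ln_mult)
  ultimately show ?thesis using lC by (simp add: abs_le_iff algebra_simps)
qed

text \<open>Above, U is replaced by its lower bound U0. Below, the integral is restricted to
  [1 / (2 N), 1 / N], where N U exceeds N U0 by at most C; the short interval costs only ln (2 N),
  which is negligible after division by N.\<close>

lemma ln_Q_0_bound: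
  assumes "N \<ge> 1"
  shows "\<bar>ln (Q N 0) + N * U0\<bar> \<le> C + ln C + ln (2 * N)"
proof -
  have "ln C \<ge> 0" "ln (2 * real N) \<ge> 0" using C assms by auto
  have "Q N 0 \<le> (LBINT x:{0<..}. (C * exp (- real N * U0)) * (1 / (1 + x)\<^sup>2))"
    unfolding Q_def I_def
  proof (intro set_integral_mono I_integrable set_integrable_mult_right set_integrable_inverse_square(1))
    fix x :: real assume x: "x \<in> {0<..}"
    have "N * U0 \<le> N * U x" using U_0(1)[of x] x by (intro mult_left_mono) auto
    then have "exp (- real N * U x) * g x \<le> exp (- real N * U0) * (C / (1 + x)\<^sup>2)"
      using g_le[of x] g_pos[of x] x by (intro mult_mono) auto
    then show "W N 0 x * 1 \<le> (C * exp (- real N * U0)) * (1 / (1 + x)\<^sup>2)" by (simp add: W_def mult_ac)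
  qed auto
  also have "\<dots> = C * exp (- real N * U0)" by (simp only: set_integral_mult_right set_integrable_inverse_square(2) mult_1_right)
  finally have "ln (Q N 0) \<le> ln (C * exp (- real N * U0))" using Q_pos[of 0 N] C by (subst ln_le_cancel_iff) auto
  then have 1: "ln (Q N 0) \<le> ln C - N * U0" using C by (simp add: ln_mult)
  have "exp (- real N * U0 - C) / C * (1 / N - 1 / (2 * N)) \<le> Q N 0"
  proof (rule I_ge_interval)
    fix x :: real assume x: "1 / (2 * N) \<le> x" "x \<le> 1 / N"
    have "0 < 1 / (2 * real N)" using assms by simp
    then have x0: "x > 0" using x by linarith
    have x1: "x \<le> 1" 
    proof -
      have "1 / real N \<le> 1" using assms by simp
      then show ?thesis using x by linarith
    qed
    have "N * x \<le> 1" using x assms by (simp add: field_simps)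
    then have "C * (N * x) \<le> C * 1" using C by (intro mult_left_mono) auto
    moreover have "N * U x \<le> N * (U0 + C * x)" using U_0(2)[of x] x0 x1 by (intro mult_left_mono) auto
    ultimately have "N * U x \<le> N * U0 + C" by (simp add: algebra_simps)
    then have "exp (- real N * U0 - C) * (1 / C) \<le> exp (- real N * U x) * g x"
      using g_ge[of x] x0 x1 C by (intro mult_mono) auto
    then show "exp (- real N * U0 - C) / C \<le> W N 0 x" by (simp add: W_def)
  qed (use assms in \<open>auto simp: field_simps\<close>)
  also have "1 / N - 1 / (2 * N) = 1 / (2 * real N)" using assms by (simp add: field_simps)
  finally have "ln (exp (- real N * U0 - C) / C * (1 / (2 * real N))) \<le> ln (Q N 0)"
    using Q_pos[of 0 N] C assms by (subst ln_le_cancel_iff) auto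
  also have "ln (exp (- real N * U0 - C) / C * (1 / (2 * real N))) = - real N * U0 - C - ln C - ln (2 * N)"
    using C assms by (simp add: ln_div ln_mult)
  finally show ?thesis using 1 \<open>ln C \<ge> 0\<close> \<open>ln (2 * real N) \<ge> 0\<close> C by (simp add: abs_le_iff)
qed

text \<open>Cauchy-Schwarz for the moments of the positive weight \<open>W N j\<close>: the second
  moment about the mean s is nonnegative.\<close>

lemma Q_log_convex:
  assumes "j + 2 \<le> N"
  shows "Q N (j + 1) ^ 2 \<le> Q N j * Q N (j + 2)"
proof -
  define s where "s = Q N (j + 1) / Q N j"
  have p: "Q N j > 0" using Q_pos assms by simp
  have sh: "I N (j + m) (\<lambda>_. 1) = (LBINT x:{0<..}. W N j x * x ^ m)" for m
    unfolding I_def W_def by (rule set_lebesgue_integral_cong) (auto simp: power_add)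
  have si: "set_integrable lborel {0<..} (\<lambda>x. W N j x * x ^ m)" if "m \<le> 2" for m
  proof -
    have "set_integrable lborel {0<..} (\<lambda>x. W N (j + m) x * 1)" using that assms by (intro I_integrable) auto
    then show ?thesis by (simp add: W_def power_add mult_ac)
  qed
  have "0 \<le> (LBINT x:{0<..}. W N j x * (x - s)\<^sup>2)"
    unfolding set_lebesgue_integral_def using W_pos
    by (intro Bochner_Integration.integral_nonneg) (auto simp: less_imp_le indicator_def)
  also have "(\<lambda>x. W N j x * (x - s)\<^sup>2) = (\<lambda>x. W N j x * x ^ 2 - (2 * s) * (W N j x * x ^ 1) + s\<^sup>2 * (W N j x * x ^ 0))"
    by (auto simp: power2_eq_square algebra_simps)
  also have "(LBINT x:{0<..}. W N j x * x ^ 2 - (2 * s) * (W N j x * x ^ 1) + s\<^sup>2 * (W N j x * x ^ 0))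
      = Q N (j + 2) - 2 * s * Q N (j + 1) + s\<^sup>2 * Q N (j + 0)"
    unfolding Q_def sh using si[of 0] si[of 1] si[of 2]
    by (simp add: set_integral_add set_integral_diff)
  finally have "0 \<le> Q N j * (Q N (j + 2) - 2 * s * Q N (j + 1) + s\<^sup>2 * Q N j)" using p by simp
  also have "\<dots> = Q N j * Q N (j + 2) - (Q N (j + 1))\<^sup>2"
    using p by (simp add: s_def power2_eq_square field_simps)
  finally show ?thesis by simp
qed

text \<open>The integrated function is the derivative of \<open>x * W N j x * \<phi> x\<close>
  divided by \<open>W N j x\<close>. The boundary terms vanish because x W is bounded by a multiple
  of x / (1 + x)^2.\<close>

lemma integration_by_parts:
  assumes j: "j \<le> N" and \<phi>: "\<And>x. x > 0 \<Longrightarrow> (\<phi> has_real_derivative \<phi>' x) (at x)"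
    and b: "bcont \<phi>" "bcont (\<lambda>x. x * \<phi>' x)" and c: "continuous_on {0<..} \<phi>'"
  shows "I N j (\<lambda>x. (real j + 1 - real N * y x) * \<phi> x + x * \<phi>' x + \<phi> x * (x * g' x / g x)) = 0"
proof -
  define F where "F x = x * W N j x * \<phi> x" for x
  define f where "f x = W N j x * ((real j + 1 - real N * y x) * \<phi> x + x * \<phi>' x + \<phi> x * (x * g' x / g x))" for x
  have e: "einterval 0 \<infinity> = {0::real<..}" by (auto simp: einterval_def)
  have F: "(F has_real_derivative f x) (at x)" if x: "x > 0" for x
  proof -
    have "F = (\<lambda>x. x ^ (j + 1) * exp (- real N * U x) * g x * \<phi> x)" by (auto simp: F_def W_def)
    moreover have "((\<lambda>x. x ^ (j + 1) * exp (- real N * U x) * g x * \<phi> x) has_real_derivative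
      ((real (j + 1) * x ^ j) * exp (- real N * U x) * g x * \<phi> x
       + x ^ (j + 1) * (exp (- real N * U x) * (- real N * (y x / x))) * g x * \<phi> x
       + x ^ (j + 1) * exp (- real N * U x) * g' x * \<phi> x
       + x ^ (j + 1) * exp (- real N * U x) * g x * \<phi>' x)) (at x)"
      by (rule derivative_eq_intros U[OF x] g[OF x] \<phi>[OF x] refl | simp add: algebra_simps)+
    moreover have "(real (j + 1) * x ^ j) * exp (- real N * U x) * g x * \<phi> x
       + x ^ (j + 1) * (exp (- real N * U x) * (- real N * (y x / x))) * g x * \<phi> x
       + x ^ (j + 1) * exp (- real N * U x) * g' x * \<phi> x
       + x ^ (j + 1) * exp (- real N * U x) * g x * \<phi>' x = f x"
      using x g_pos[OF x] by (simp add: f_def W_def field_simps)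
    ultimately show ?thesis by simp
  qed
  have "bcont (\<lambda>x. (real j + 1 - real N * y x) * \<phi> x + x * \<phi>' x + \<phi> x * (x * g' x / g x))"
    using bcont_add[OF bcont_add[OF bcont_mult[OF bcont_diff b(1)] b(2)] bcont_mult[OF b(1) bcont_quot(2)]]
    by (simp add: bcont_diff bcont_mult)
  then have int: "set_integrable lborel {0<..} f" and cf: "continuous_on {0<..} f"
    unfolding f_def using j by (auto intro: I_integrable) (auto intro!: continuous_on_mult cont simp: bcont_def)
  obtain B where B: "\<And>x. x > 0 \<Longrightarrow> \<bar>\<phi> x\<bar> \<le> B" using b by (auto simp: bcont_def)
  have B0: "B \<ge> 0" using B[of 1] by force
  define K where "K = C * exp (N * C) * B"
  have FK: "\<bar>F x\<bar> \<le> K * (x / (1 + x)\<^sup>2)" if x: "x > 0" for x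
  proof -
    have "\<bar>F x\<bar> = x * (W N j x * \<bar>\<phi> x\<bar>)" using x W_pos[OF x, of N j] by (simp add: F_def abs_mult)
    also have "\<dots> \<le> x * (C * exp (N * C) * (1 / (1 + x)\<^sup>2) * B)"
      using W_le[OF x j] B[OF x] x C by (intro mult_left_mono mult_mono) auto
    finally show ?thesis by (simp add: K_def mult_ac)
  qed
  have FA: "(F \<longlongrightarrow> 0) (at_right 0)"
  proof (rule Lim_null_comparison)
    show "\<forall>\<^sub>F x in at_right 0. norm (F x) \<le> K * (x / (1 + x)\<^sup>2)"
      using FK by (auto simp: eventually_at_filter intro!: always_eventually)
    have "((\<lambda>x. K * (x / (1 + x)\<^sup>2)) \<longlongrightarrow> K * (0 / (1 + 0)\<^sup>2)) (at_right 0)"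
      by (intro tendsto_intros) auto
    then show "((\<lambda>x. K * (x / (1 + x)\<^sup>2)) \<longlongrightarrow> 0) (at_right 0)" by simp
  qed
  have FB: "(F \<longlongrightarrow> 0) at_top"
  proof (rule Lim_null_comparison)
    have "norm (F x) \<le> K * (1 / x)" if "x > 0" for x
    proof -
      have "x / (1 + x)\<^sup>2 \<le> x / x\<^sup>2"
        using that by (intro divide_left_mono power_mono) auto
      then have "x / (1 + x)\<^sup>2 \<le> 1 / x" using that by (simp add: power2_eq_square)
      moreover have "K \<ge> 0" using C B0 by (simp add: K_def)
      ultimately have "K * (x / (1 + x)\<^sup>2) \<le> K * (1 / x)" by (intro mult_left_mono)
      then show ?thesis using FK[OF that] by simp
    qed
    then show "\<forall>\<^sub>F x in at_top. norm (F x) \<le> K * (1 / x)"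
      by (intro eventually_mono[OF eventually_gt_at_top[of 0]])
    have "((\<lambda>x. K * (1 / x)) \<longlongrightarrow> K * 0) at_top"
      by (intro tendsto_intros tendsto_divide_0[OF tendsto_const] filterlim_at_top_imp_at_infinity filterlim_ident)
    then show "((\<lambda>x. K * (1 / x)) \<longlongrightarrow> 0) at_top" by simp
  qed
  have "(LBINT x=0..\<infinity>. f x) = 0 - 0"
  proof (rule interval_integral_FTC_integrable)
    show "((F \<circ> real_of_ereal) \<longlongrightarrow> 0) (at_right 0)" using FA by (simp add: zero_ereal_def ereal_tendsto_simps)
    show "((F \<circ> real_of_ereal) \<longlongrightarrow> 0) (at_left \<infinity>)" using FB by (simp add: ereal_tendsto_simps)
    show "set_integrable lborel (einterval 0 \<infinity>) f" unfolding e by (rule int)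
    show "(F has_vector_derivative f x) (at x)" if "0 < ereal x" for x
      using F[of x] that by (simp add: has_real_derivative_iff_has_vector_derivative)
    show "isCont f x" if "0 < ereal x" for x
      using cf that by (auto simp: continuous_on_eq_continuous_at)
  qed auto
  then show ?thesis by (simp add: interval_lebesgue_integral_def e I_def f_def)
qed

text \<open>With the test function 1, N times the deviation of the mean is the integral of the
  bounded function 1 + x g' / g.\<close>

lemma mean_y: 
  assumes j: "j \<le> N" "N \<ge> 1"
  shows "\<bar>I N j (\<lambda>x. y x - j / N)\<bar> \<le> (1 + C) / N * Q N j"
proof -
  have "I N j (\<lambda>x. (real j + 1 - real N * y x) * 1 + x * 0 + 1 * (x * g' x / g x)) = 0"
    using integration_by_parts[of j N "\<lambda>_. 1" "\<lambda>_. 0"] j by simp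
  also have "(\<lambda>x. (real j + 1 - real N * y x) * 1 + x * 0 + 1 * (x * g' x / g x)) =
      (\<lambda>x. (1 + x * g' x / g x) - N * (y x - j / N))" using j by (auto simp: field_simps)
  also have "I N j \<dots> = I N j (\<lambda>x. 1 + x * g' x / g x) - N * I N j (\<lambda>x. y x - j / N)"
    using j by (subst I_diff) (auto simp: I_cmult)
  finally have "N * I N j (\<lambda>x. y x - j / N) = I N j (\<lambda>x. 1 + x * g' x / g x)" by simp
  moreover have "\<bar>I N j (\<lambda>x. 1 + x * g' x / g x)\<bar> \<le> (1 + C) * Q N j"
  proof (rule I_abs_le)
    show "\<bar>1 + x * g' x / g x\<bar> \<le> 1 + C" if "x > 0" for x using quot_le(2)[OF that] by linarith
  qed (use j in auto)
  ultimately have "\<bar>N * I N j (\<lambda>x. y x - j / N)\<bar> \<le> (1 + C) * Q N j" by simp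
  then show ?thesis using j by (simp add: abs_mult field_simps)
qed

text \<open>The test function y - j / N produces its own square with the factor N. The other terms
  are bounded, since x times its derivative is x g.\<close>

lemma mean_y_square: 
  assumes j: "j \<le> N" "N \<ge> 1"
  shows "I N j (\<lambda>x. (y x - j / N)\<^sup>2) \<le> (1 + 2 * C) / N * Q N j"
proof -
  have a: "0 \<le> j / N" "j / N \<le> (1::real)" using j by auto
  have d: "\<bar>y x - j / N\<bar> \<le> 1" if "x > 0" for x using y_range[OF that] a by linarith
  have "I N j (\<lambda>x. (real j + 1 - real N * y x) * (y x - j / N) + x * g x + (y x - j / N) * (x * g' x / g x)) = 0"
    by (rule integration_by_parts) (use j y in \<open>auto intro!: derivative_eq_intros cont\<close>)
  also have "(\<lambda>x. (real j + 1 - real N * y x) * (y x - j / N) + x * g x + (y x - j / N) * (x * g' x / g x)) =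
      (\<lambda>x. ((y x - j / N) + x * g x + (y x - j / N) * (x * g' x / g x)) - N * (y x - j / N)\<^sup>2)"
    using j by (auto simp: field_simps power2_eq_square)
  also have "I N j \<dots> = I N j (\<lambda>x. (y x - j / N) + x * g x + (y x - j / N) * (x * g' x / g x))
      - I N j (\<lambda>x. N * (y x - j / N)\<^sup>2)"
    using j by (intro I_diff bcont_add bcont_mult[of "\<lambda>x. y x - j / N"] bcont_diff bcont_const bcont_quot bcont_y
        bcont_xg bcont_mult[OF bcont_const] bcont_power)
  also have "I N j (\<lambda>x. N * (y x - j / N)\<^sup>2) = N * I N j (\<lambda>x. (y x - j / N)\<^sup>2)" by (rule I_cmult)
  finally have "N * I N j (\<lambda>x. (y x - j / N)\<^sup>2) = I N j (\<lambda>x. (y x - j / N) + x * g x + (y x - j / N) * (x * g' x / g x))"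
    by simp
  moreover have "\<bar>I N j (\<lambda>x. (y x - j / N) + x * g x + (y x - j / N) * (x * g' x / g x))\<bar> \<le> (1 + 2 * C) * Q N j"
  proof (rule I_abs_le)
    show "bcont (\<lambda>x. (y x - j / N) + x * g x + (y x - j / N) * (x * g' x / g x))"
      by (intro bcont_add bcont_mult[of "\<lambda>x. y x - j / N"] bcont_diff bcont_const bcont_quot bcont_y bcont_xg)
    fix x :: real assume x: "x > 0"
    have "\<bar>(y x - j / N) * (x * g' x / g x)\<bar> \<le> 1 * C"
      unfolding abs_mult using d[OF x] quot_le(2)[OF x] by (intro mult_mono) auto
    moreover have "0 \<le> x * g x" "x * g x \<le> C" using x g_pos[OF x] xg_le[OF x] by auto
    moreover have "\<bar>p + q + r\<bar> \<le> 1 + 2 * C" if "\<bar>r\<bar> \<le> 1 * C" "0 \<le> q" "q \<le> C" "\<bar>p\<bar> \<le> 1" for p q r :: real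
      using that by linarith
    ultimately show "\<bar>(y x - j / N) + x * g x + (y x - j / N) * (x * g' x / g x)\<bar> \<le> 1 + 2 * C"
      using d[OF x] by blast
  qed (use j in auto)
  ultimately have "N * I N j (\<lambda>x. (y x - j / N)\<^sup>2) \<le> (1 + 2 * C) * Q N j" by simp
  then show ?thesis using j by (simp add: field_simps)
qed

text \<open>Integration by parts with test function 1 at index k. Taking a factor x out of the
  integrand raises the index of the weight to k + 1 and makes the quotient of norming constants an
  average of y / x, up to O(1 / N).\<close>

lemma Q_ratio:
  assumes k: "k < N"
  shows "real (k + 1) * Q N k = N * I N (k + 1) (\<lambda>x. y x / x - 1 / N * (g' x / g x))"
proof -
  have "I N k (\<lambda>x. (real k + 1 - real N * y x) * 1 + x * 0 + 1 * (x * g' x / g x)) = 0"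
    using integration_by_parts[of k N "\<lambda>_. 1" "\<lambda>_. 0"] k by simp
  also have "(\<lambda>x. (real k + 1 - real N * y x) * 1 + x * 0 + 1 * (x * g' x / g x)) =
      (\<lambda>x. (real k + 1) - (N * y x - x * g' x / g x))" by auto
  also have "I N k \<dots> = I N k (\<lambda>x. real k + 1) - I N k (\<lambda>x. N * y x - x * g' x / g x)"
    using k by (subst I_diff) auto
  finally have "real (k + 1) * Q N k = I N k (\<lambda>x. N * y x - x * g' x / g x)"
    by (simp add: I_const add.commute)
  also have "\<dots> = I N (k + 1) (\<lambda>x. N * (y x / x - 1 / N * (g' x / g x)))"
    unfolding I_def by (rule set_lebesgue_integral_cong) (use k in \<open>auto simp: W_def field_simps\<close>)
  finally show ?thesis by (simp only: I_cmult)
qed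

lemma bcont_yx: 
  assumes "\<And>x. x > 0 \<Longrightarrow> y x / x \<le> B" shows "bcont (\<lambda>x. y x / x)"
  using assms y_range by (intro bcontI[where B = B] continuous_intros cont) (auto simp: abs_mult less_imp_le)

text \<open>\<open>Q_ratio\<close> gives an average of y / x under the weight of index k + 1, which
  concentrates at y = (k + 1) / N. There the linear Taylor term is controlled by
  \<open>mean_y\<close> and the quadratic one by \<open>mean_y_square\<close>, both of order 1 / N.
  A will be the value of y / x at that moment.\<close>

lemma ratio_asymp:
  assumes k: "k < N" and B: "\<And>x. x > 0 \<Longrightarrow> y x / x \<le> B"
    and taylor: "\<And>x. x > 0 \<Longrightarrow>
      \<bar>y x / x - A - A' * (y x - real (k + 1) / N)\<bar> \<le> D * (y x - real (k + 1) / N)\<^sup>2"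
  shows "\<bar>real (k + 1) / N * (Q N k / Q N (k + 1)) - A\<bar> \<le> (\<bar>A'\<bar> * (1 + C) + D * (1 + 2 * C) + C) / N"
proof -
  define \<alpha> where "\<alpha> = real (k + 1) / N"
  have N: "N \<ge> 1" "k + 1 \<le> N" using k by auto
  \<comment> \<open>A negative D would force y to be constant by the Taylor bound, but y is strictly
    increasing.\<close>
  have Dp: "D \<ge> 0"
  proof (rule ccontr)
    assume D: "\<not> D \<ge> 0"
    have *: "(y x - \<alpha>)\<^sup>2 = 0" if "x > 0" for x
    proof -
      have "0 \<le> D * (y x - \<alpha>)\<^sup>2" using taylor[OF that] unfolding \<alpha>_def by linarith
      then show ?thesis using D by (simp add: zero_le_mult_iff not_le)
    qed
    have "y 1 < y 2"
    proof (rule DERIV_pos_imp_increasing[of 1 2 y])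
      show "\<exists>d. (y has_real_derivative d) (at x) \<and> d > 0" if "1 \<le> x" "x \<le> 2" for x
        using y[of x] g_pos[of x] that by (intro exI[of _ "g x"]) auto
    qed simp
    then show False using *[of 1] *[of 2] by simp
  qed
  note bc = bcont_yx[OF B]
  have qp: "Q N (k + 1) > 0" using Q_pos N by blast
  have "real (k + 1) / N * (Q N k / Q N (k + 1)) = real (k + 1) * Q N k / (N * Q N (k + 1))" by simp
  also have "\<dots> = I N (k + 1) (\<lambda>x. y x / x - 1 / N * (g' x / g x)) / Q N (k + 1)"
    unfolding Q_ratio[OF k] using N by simp
  finally have eq: "real (k + 1) / N * (Q N k / Q N (k + 1)) = \<dots>" .
  have "I N (k + 1) (\<lambda>x. y x / x - 1 / N * (g' x / g x))
     = I N (k + 1) (\<lambda>x. ((y x / x - A - A' * (y x - \<alpha>)) - 1 / N * (g' x / g x)) + (A + A' * (y x - \<alpha>)))"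
    by (rule I_cong) simp
  also have "\<dots> = I N (k + 1) (\<lambda>x. y x / x - A - A' * (y x - \<alpha>)) - 1 / N * I N (k + 1) (\<lambda>x. g' x / g x)
      + (A * Q N (k + 1) + A' * I N (k + 1) (\<lambda>x. y x - \<alpha>))"
  proof -
    have b1: "bcont (\<lambda>x. A' * (y x - \<alpha>))" by (intro bcont_mult bcont_diff bcont_const bcont_y)
    have b2: "bcont (\<lambda>x. y x / x - A - A' * (y x - \<alpha>))" by (intro bcont_diff bc bcont_const b1)
    have b3: "bcont (\<lambda>x. 1 / N * (g' x / g x))" by (intro bcont_mult[OF bcont_const] bcont_quot)
    show ?thesis
      using I_add[OF N(2) bcont_diff[OF b2 b3] bcont_add[OF bcont_const b1]]
        I_diff[OF N(2) b2 b3] I_add[OF N(2) bcont_const b1] by (simp only: I_const I_cmult)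
  qed
  finally have "I N (k + 1) (\<lambda>x. y x / x - 1 / N * (g' x / g x)) - A * Q N (k + 1)
      = I N (k + 1) (\<lambda>x. y x / x - A - A' * (y x - \<alpha>)) - 1 / N * I N (k + 1) (\<lambda>x. g' x / g x)
       + A' * I N (k + 1) (\<lambda>x. y x - \<alpha>)" by simp
  moreover have "\<bar>I N (k + 1) (\<lambda>x. y x / x - A - A' * (y x - \<alpha>))\<bar> \<le> D * ((1 + 2 * C) / N * Q N (k + 1))"
  proof -
    have "I N (k + 1) (\<lambda>x. y x / x - A - A' * (y x - \<alpha>)) \<le> I N (k + 1) (\<lambda>x. D * (y x - \<alpha>)\<^sup>2)"
      "I N (k + 1) (\<lambda>x. (-1) * (D * (y x - \<alpha>)\<^sup>2)) \<le> I N (k + 1) (\<lambda>x. y x / x - A - A' * (y x - \<alpha>))"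
    proof -
      have b2: "bcont (\<lambda>x. y x / x - A - A' * (y x - \<alpha>))"
        by (intro bcont_diff bc bcont_const bcont_mult bcont_y)
      have b3: "bcont (\<lambda>x. D * (y x - \<alpha>)\<^sup>2)"
        by (intro bcont_mult bcont_power bcont_diff bcont_const bcont_y)
      have b4: "bcont (\<lambda>x. (-1) * (D * (y x - \<alpha>)\<^sup>2))" by (intro bcont_mult[OF bcont_const] b3)
      have t: "\<bar>y x / x - A - A' * (y x - \<alpha>)\<bar> \<le> D * (y x - \<alpha>)\<^sup>2" if "x > 0" for x
        using taylor[OF that] unfolding \<alpha>_def .
      show "I N (k + 1) (\<lambda>x. y x / x - A - A' * (y x - \<alpha>)) \<le> I N (k + 1) (\<lambda>x. D * (y x - \<alpha>)\<^sup>2)"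
      proof (rule I_mono[OF N(2) b2 b3])
        show "y x / x - A - A' * (y x - \<alpha>) \<le> D * (y x - \<alpha>)\<^sup>2" if "x > 0" for x
          using t[OF that] by (rule abs_le_D1)
      qed
      show "I N (k + 1) (\<lambda>x. (-1) * (D * (y x - \<alpha>)\<^sup>2)) \<le> I N (k + 1) (\<lambda>x. y x / x - A - A' * (y x - \<alpha>))"
      proof (rule I_mono[OF N(2) b4 b2])
        show "(-1) * (D * (y x - \<alpha>)\<^sup>2) \<le> y x / x - A - A' * (y x - \<alpha>)" if "x > 0" for x
          using t[OF that] by linarith
      qed
    qed
    then have "\<bar>I N (k + 1) (\<lambda>x. y x / x - A - A' * (y x - \<alpha>))\<bar> \<le> D * I N (k + 1) (\<lambda>x. (y x - \<alpha>)\<^sup>2)"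
      unfolding I_cmult by linarith
    also have "\<dots> \<le> D * ((1 + 2 * C) / N * Q N (k + 1))"
      using mean_y_square[OF N(2,1)] Dp unfolding \<alpha>_def by (intro mult_left_mono) auto
    finally show ?thesis .
  qed
  moreover have "\<bar>1 / N * I N (k + 1) (\<lambda>x. g' x / g x)\<bar> \<le> 1 / N * (C * Q N (k + 1))"
    unfolding abs_mult using I_abs_le[OF N(2), of "\<lambda>x. g' x / g x" C] quot_le by (intro mult_mono) auto
  moreover have "\<bar>A' * I N (k + 1) (\<lambda>x. y x - \<alpha>)\<bar> \<le> \<bar>A'\<bar> * ((1 + C) / N * Q N (k + 1))"
    unfolding abs_mult using mean_y[OF N(2,1)] unfolding \<alpha>_def by (intro mult_left_mono) auto
  ultimately have "\<bar>I N (k + 1) (\<lambda>x. y x / x - 1 / N * (g' x / g x)) - A * Q N (k + 1)\<bar>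
     \<le> D * ((1 + 2 * C) / N * Q N (k + 1)) + 1 / N * (C * Q N (k + 1)) + \<bar>A'\<bar> * ((1 + C) / N * Q N (k + 1))"
    by linarith
  also have "\<dots> = (\<bar>A'\<bar> * (1 + C) + D * (1 + 2 * C) + C) / N * Q N (k + 1)"
    by (simp add: add_divide_distrib algebra_simps)
  finally have *: "\<bar>I N (k + 1) (\<lambda>x. y x / x - 1 / N * (g' x / g x)) - A * Q N (k + 1)\<bar> \<le> \<dots>" .
  have "real (k + 1) / N * (Q N k / Q N (k + 1)) - A
      = (I N (k + 1) (\<lambda>x. y x / x - 1 / N * (g' x / g x)) - A * Q N (k + 1)) / Q N (k + 1)"
    unfolding eq using qp by (simp add: diff_divide_distrib)
  then show ?thesis using * qp by (simp only: abs_divide abs_of_pos pos_divide_le_eq)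
qed

end

section \<open>Discrete Stein estimates\<close>

text \<open>With w k the reciprocal of the interpolated norming constant and x = |z|^2,
  \<open>Z\<close> is the sum inside the logarithm of the Bergman potential, up to the metric factor
  and 2 \<pi>.\<close>

locale bergman_sum =
  fixes N :: nat and w :: "nat \<Rightarrow> real" and x :: real
  assumes N: "N \<ge> 1" and w: "\<And>k. w k > 0" and x: "x > 0"
begin

definition Z :: real where "Z = (\<Sum>k\<le>N. w k * x ^ k)"

definition mean :: "(nat \<Rightarrow> real) \<Rightarrow> real" where "mean f = (\<Sum>k\<le>N. w k * x ^ k * f k) / Z"

definition cov :: "(nat \<Rightarrow> real) \<Rightarrow> (nat \<Rightarrow> real) \<Rightarrow> real" where
  "cov f g = mean (\<lambda>k. (f k - mean f) * (g k - mean g))"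

definition frac :: "nat \<Rightarrow> real" where "frac k = real k / real N"

text \<open>The factor that appears when the summation index is shifted by one. Its value 0 at N
  lets the shifted sum run over the same range.\<close>

definition Hn :: "nat \<Rightarrow> real" where
  "Hn k = (if k < N then real (k + 1) / real N * (w (k + 1) / w k) else 0)"

lemma Z_pos: "Z > 0"
  unfolding Z_def using w x by (intro sum_pos) auto

lemma mean_add: "mean (\<lambda>k. f k + g k) = mean f + mean g"
  by (simp add: mean_def distrib_left sum.distrib add_divide_distrib)

lemma mean_cmult: "mean (\<lambda>k. c * f k) = c * mean f"
  by (simp add: mean_def sum_distrib_left mult_ac)

lemma mean_diff: "mean (\<lambda>k. f k - g k) = mean f - mean g"
  using mean_add[of f "\<lambda>k. (-1) * g k"] mean_cmult[of "-1" g] by simp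

lemma mean_const: "mean (\<lambda>k. c) = c"
  using Z_pos by (simp add: mean_def Z_def flip: sum_distrib_right)

lemma mean_mono: "(\<And>k. k \<le> N \<Longrightarrow> f k \<le> g k) \<Longrightarrow> mean f \<le> mean g"
  unfolding mean_def using Z_pos w x
  by (intro divide_right_mono sum_mono mult_left_mono) (auto simp: less_imp_le)

lemma mean_cong: "(\<And>k. k \<le> N \<Longrightarrow> f k = g k) \<Longrightarrow> mean f = mean g"
  unfolding mean_def by (intro arg_cong2[where f = "(/)"] sum.cong) auto

lemma mean_nonneg: "(\<And>k. k \<le> N \<Longrightarrow> 0 \<le> f k) \<Longrightarrow> 0 \<le> mean f"
  using mean_mono[of "\<lambda>_. 0" f] by (simp add: mean_const)

lemma mean_abs: "\<bar>mean f\<bar> \<le> mean (\<lambda>k. \<bar>f k\<bar>)"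
proof -
  have "mean f \<le> mean (\<lambda>k. \<bar>f k\<bar>)" by (intro mean_mono) auto
  moreover have "mean (\<lambda>k. (-1) * f k) \<le> mean (\<lambda>k. \<bar>f k\<bar>)" by (intro mean_mono) auto
  ultimately show ?thesis unfolding mean_cmult by linarith
qed

lemma mean_Cauchy_Schwarz: "(mean (\<lambda>k. f k * g k))\<^sup>2 \<le> mean (\<lambda>k. (f k)\<^sup>2) * mean (\<lambda>k. (g k)\<^sup>2)"
proof -
  define q where "q k = sqrt (w k * x ^ k / Z)" for k
  have q: "q k * q k = w k * x ^ k / Z" for k using w[of k] x Z_pos by (simp add: q_def)
  have E: "mean h = (\<Sum>k\<le>N. q k * q k * h k)" for h
    by (simp add: mean_def q sum_divide_distrib)
  have "(\<Sum>k\<le>N. (q k * f k) * (q k * g k))\<^sup>2 \<le> (\<Sum>k\<le>N. (q k * f k)\<^sup>2) * (\<Sum>k\<le>N. (q k * g k)\<^sup>2)"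
    by (rule Cauchy_Schwarz_ineq_sum)
  then show ?thesis by (simp add: E power2_eq_square mult_ac)
qed

lemma mean_CS_bound:
  assumes "mean (\<lambda>k. (f k)\<^sup>2) \<le> a\<^sup>2" "mean (\<lambda>k. (g k)\<^sup>2) \<le> b\<^sup>2" "a \<ge> 0" "b \<ge> 0"
  shows "\<bar>mean (\<lambda>k. f k * g k)\<bar> \<le> a * b"
proof -
  have "(mean (\<lambda>k. f k * g k))\<^sup>2 \<le> a\<^sup>2 * b\<^sup>2"
    using mean_Cauchy_Schwarz[of f g] mult_mono[OF assms(1,2)] mean_nonneg[of "\<lambda>k. (g k)\<^sup>2"] by simp
  then have "\<bar>mean (\<lambda>k. f k * g k)\<bar> \<le> \<bar>a * b\<bar>"
    unfolding abs_le_square_iff power_mult_distrib .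
  then show ?thesis using assms by simp
qed

lemma mean_le_sqrt: 
  assumes "mean (\<lambda>k. (f k)\<^sup>2) \<le> a\<^sup>2" "a \<ge> 0"
  shows "mean (\<lambda>k. \<bar>f k\<bar>) \<le> a"
  using mean_CS_bound[of "\<lambda>k. \<bar>f k\<bar>" a "\<lambda>k. 1" 1] assms by (auto simp: mean_const)

lemma cov_eq: "cov f g = mean (\<lambda>k. f k * (g k - mean g))"
proof -
  have "cov f g = mean (\<lambda>k. f k * (g k - mean g) - mean f * (g k - mean g))"
    by (simp add: cov_def algebra_simps)
  also have "\<dots> = mean (\<lambda>k. f k * (g k - mean g)) - mean f * (mean g - mean g)"
    by (simp only: mean_diff mean_cmult mean_const)
  finally show ?thesis by simp
qed

lemma cov_eq': "cov f g = mean (\<lambda>k. f k * g k) - mean f * mean g"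
proof -
  have "cov f g = mean (\<lambda>k. f k * g k - mean g * f k)" by (simp add: cov_eq algebra_simps)
  then show ?thesis by (simp add: mean_diff mean_cmult)
qed

lemma Hn_nonneg: "Hn k \<ge> 0"
  using w by (simp add: Hn_def less_imp_le)

lemma stein_identity: "mean (\<lambda>k. frac k * \<phi> k) = x * mean (\<lambda>k. Hn k * \<phi> (Suc k))"
proof -
  obtain M where M: "N = Suc M" using N by (cases N) auto
  have frac0: "frac 0 = 0" by (simp add: frac_def)
  have "(\<Sum>k\<le>Suc M. w k * x ^ k * (frac k * \<phi> k)) = (\<Sum>k\<le>M. w (Suc k) * x ^ Suc k * (frac (Suc k) * \<phi> (Suc k)))"
    by (subst sum.atMost_Suc_shift) (simp add: frac0)
  also have "\<dots> = (\<Sum>k\<le>M. x * (w k * x ^ k * (Hn k * \<phi> (Suc k))))"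
  proof (rule sum.cong)
    fix k assume "k \<in> {..M}"
    then have "k < N" by (simp add: M)
    then show "w (Suc k) * x ^ Suc k * (frac (Suc k) * \<phi> (Suc k)) = x * (w k * x ^ k * (Hn k * \<phi> (Suc k)))"
      using w[of k] by (simp add: Hn_def frac_def)
  qed simp
  also have "\<dots> = (\<Sum>k\<le>N. x * (w k * x ^ k * (Hn k * \<phi> (Suc k))))"
  proof -
    have "Hn N = 0" by (simp add: Hn_def)
    then show ?thesis by (simp add: M)
  qed
  also have "\<dots> = x * (\<Sum>k\<le>N. w k * x ^ k * (Hn k * \<phi> (Suc k)))"
    by (rule sum_distrib_left[symmetric])
  finally show ?thesis by (simp add: mean_def flip: M)
qed

lemma mean_frac: "mean frac = x * mean Hn"
  using stein_identity[of "\<lambda>_. 1"] by simp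

end

text \<open>\<open>Hn k\<close> is close to \<open>H + H' (k / N - y)\<close> and \<open>y = x H\<close>, so by the identity
  \<open>E[(k / N) f k] = x E[Hn k f (k + 1)]\<close> the distribution concentrates at \<open>y\<close> like a Gaussian
  of variance \<open>x H / (1 - x H') / N\<close>.\<close>

locale stein_bounds = bergman_sum +
  fixes y H H' c K R :: real
  assumes y: "0 \<le> y" "y \<le> 1" and yH: "y = x * H" and c: "0 < c" and K: "K \<ge> 1" and R: "x \<le> R"
    and Hn_le: "\<And>k. k \<le> N \<Longrightarrow> Hn k \<le> K" and H: "\<bar>H\<bar> \<le> K" "\<bar>H'\<bar> \<le> K" and denom: "c \<le> 1 - x * H'"
    and drift: "\<And>k. k \<le> N \<Longrightarrow>
      c * (frac k - y)\<^sup>2 - K / N * \<bar>frac k - y\<bar> \<le> (frac k - x * Hn k) * (frac k - y)"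
    and lin: "\<And>k. k \<le> N \<Longrightarrow> \<bar>Hn k - H - H' * (frac k - y)\<bar> \<le> K * (1 / N + (frac k - y)\<^sup>2)"
begin

text \<open>\<open>C2\<close> and \<open>C4\<close> bound the second and fourth moments of k / N - y
  in units of s, \<open>CT\<close> the quadratic mean of a Taylor remainder, \<open>C5\<close> the
  error of the mean of \<open>Hn\<close>, \<open>C6\<close> that of the variance and
  \<open>C7\<close> the variance itself. All depend on c, K and R only, never on N, x or the
  weights.\<close>

definition "C2 = K * (R + 1) / c"
definition "C4 = (K * C2 + 5 * R * K * (C2 + 1)) / c"
definition "CT = K * sqrt (2 * (1 + C4))"
definition "C5 = K * (sqrt C2 + 1 + C2)"
definition "C6 = (C5 + CT * sqrt C2) / c"
definition "C7 = K / c + C6"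
definition "CF = C5 + C6 + (CT * sqrt C7 + K * sqrt R * C6) + (K\<^sup>2 * R * C6 + 2 * K * CT * sqrt C2 + CT\<^sup>2)"

definition "d k = frac k - y"
text \<open>The scale of the fluctuations of k / N about y.\<close>

definition "s = 1 / sqrt (real N)"

lemma s: "s > 0" "s\<^sup>2 = 1 / N" "s \<le> 1" "N * s\<^sup>2 = 1"
  using N by (auto simp: power_divide s_def)

lemma R_pos: "R > 0" using R x by linarith

lemma C_nonneg: "C2 \<ge> 0" "C4 \<ge> 0" "CT \<ge> 0" "C5 \<ge> 0" "C6 \<ge> 0" "C7 \<ge> 0"
proof -
  show 2: "C2 \<ge> 0" using c K R_pos by (simp add: C2_def)
  show 4: "C4 \<ge> 0" using 2 c K R_pos by (simp add: C4_def)
  show T: "CT \<ge> 0" using 4 K by (simp add: CT_def)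
  show 5: "C5 \<ge> 0" using 2 K by (simp add: C5_def)
  show 6: "C6 \<ge> 0" using 2 5 T c by (simp add: C6_def)
  show "C7 \<ge> 0" using 6 c K by (simp add: C7_def)
qed

lemma d_le: "k \<le> N \<Longrightarrow> \<bar>d k\<bar> \<le> 1"
proof -
  assume "k \<le> N"
  then have "frac k \<le> 1" "frac k \<ge> 0" using N by (auto simp: frac_def)
  then show ?thesis using y by (auto simp: d_def)
qed

lemma d_Suc: "d (Suc k) = d k + 1 / N"
  using N by (simp add: d_def frac_def field_simps)

text \<open>The Stein identity minus the mean of \<open>x * Hn k * \<phi> k\<close>. On the right
  only increments of \<phi> remain; they carry a factor 1 / N for the powers of d used
  below.\<close>

lemma mean_drift: "mean (\<lambda>k. (frac k - x * Hn k) * \<phi> k) = x * mean (\<lambda>k. Hn k * (\<phi> (Suc k) - \<phi> k))"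
proof -
  have "mean (\<lambda>k. (frac k - x * Hn k) * \<phi> k) = mean (\<lambda>k. frac k * \<phi> k - x * (Hn k * \<phi> k))"
    by (simp add: algebra_simps)
  also have "\<dots> = x * (mean (\<lambda>k. Hn k * \<phi> (Suc k)) - mean (\<lambda>k. Hn k * \<phi> k))"
    by (simp add: mean_diff mean_cmult stein_identity right_diff_distrib)
  also have "\<dots> = x * mean (\<lambda>k. Hn k * (\<phi> (Suc k) - \<phi> k))"
    by (simp add: right_diff_distrib flip: mean_diff)
  finally show ?thesis .
qed

text \<open>Test function d: the left side is at least c d^2 up to O(1 / N) by \<open>drift\<close>,
  and the increment of d is exactly 1 / N.\<close>

lemma second_moment: "mean (\<lambda>k. (d k)\<^sup>2) \<le> C2 * s\<^sup>2"
proof -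
  have "c * mean (\<lambda>k. (d k)\<^sup>2) - K / N \<le> mean (\<lambda>k. (frac k - x * Hn k) * d k)"
  proof -
    have "mean (\<lambda>k. c * (d k)\<^sup>2 - K / N) \<le> mean (\<lambda>k. (frac k - x * Hn k) * d k)"
    proof (rule mean_mono)
      fix k assume k: "k \<le> N"
      have "K / N * \<bar>d k\<bar> \<le> K / N * 1" using d_le[OF k] K by (intro mult_left_mono) auto
      then show "c * (d k)\<^sup>2 - K / N \<le> (frac k - x * Hn k) * d k" using drift[OF k, folded d_def] by linarith
    qed
    then show ?thesis by (simp add: mean_diff mean_cmult mean_const)
  qed
  also have "mean (\<lambda>k. (frac k - x * Hn k) * d k) = x * mean (\<lambda>k. 1 / N * Hn k)"
    by (subst mean_drift) (simp add: d_Suc)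
  also have "\<dots> = x * (1 / N * mean Hn)" by (simp only: mean_cmult)
  also have "\<dots> \<le> R * (1 / N * K)"
  proof -
    have "mean Hn \<le> K" using mean_mono[of Hn "\<lambda>_. K"] Hn_le by (simp add: mean_const)
    then show ?thesis using x R K mean_nonneg[of Hn] Hn_nonneg by (intro mult_mono) (auto intro: divide_right_mono)
  qed
  finally have "c * mean (\<lambda>k. (d k)\<^sup>2) \<le> K * (R + 1) * (1 / N)" by (simp add: algebra_simps)
  then have "mean (\<lambda>k. (d k)\<^sup>2) \<le> K * (R + 1) * (1 / N) / c" using c by (simp only: pos_le_divide_eq mult.commute)
  then show ?thesis by (simp add: C2_def s(2) mult_ac)
qed

text \<open>Test function d^3: the drift bound is multiplied by d^2, and the increment of d^3 is of
  order d^2 / N, so the second moment closes the estimate.\<close>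

lemma fourth_moment: "mean (\<lambda>k. (d k) ^ 4) \<le> C4 * s ^ 4"
proof -
  have "c * mean (\<lambda>k. (d k) ^ 4) - K / N * mean (\<lambda>k. (d k)\<^sup>2) \<le> mean (\<lambda>k. (frac k - x * Hn k) * d k ^ 3)"
  proof -
    have "mean (\<lambda>k. c * (d k) ^ 4 - K / N * (d k)\<^sup>2) \<le> mean (\<lambda>k. (frac k - x * Hn k) * d k ^ 3)"
    proof (rule mean_mono)
      fix k assume k: "k \<le> N"
      have "K / N * \<bar>d k\<bar> \<le> K / N * 1" using d_le[OF k] K by (intro mult_left_mono) auto
      then have "c * (d k)\<^sup>2 - K / N \<le> (frac k - x * Hn k) * d k" using drift[OF k, folded d_def] by linarith
      from mult_right_mono[OF this, of "(d k)\<^sup>2"]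
      show "c * (d k) ^ 4 - K / N * (d k)\<^sup>2 \<le> (frac k - x * Hn k) * d k ^ 3"
        by (simp add: power2_eq_square power3_eq_cube power4_eq_xxxx algebra_simps)
    qed
    then show ?thesis by (simp only: mean_diff mean_cmult)
  qed
  also have "mean (\<lambda>k. (frac k - x * Hn k) * d k ^ 3) = x * mean (\<lambda>k. Hn k * ((d k + s\<^sup>2) ^ 3 - d k ^ 3))"
    by (subst mean_drift) (simp only: d_Suc s(2))
  also have "\<dots> \<le> R * mean (\<lambda>k. (5 * K * s\<^sup>2) * ((d k)\<^sup>2 + s ^ 4))"
  proof -
    have "mean (\<lambda>k. Hn k * ((d k + s\<^sup>2) ^ 3 - d k ^ 3)) \<le> mean (\<lambda>k. (5 * K * s\<^sup>2) * ((d k)\<^sup>2 + s ^ 4))"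
    proof (rule mean_mono)
      fix k assume k: "k \<le> N"
      define e where "e = s\<^sup>2"
      have e: "e > 0" using s(1,3) by (simp add: e_def)
      have e4: "s ^ 4 = e\<^sup>2" by (simp add: e_def flip: power_mult)
      have a: "3 * (d k * e) \<le> 2 * ((d k)\<^sup>2 + e\<^sup>2)"
      proof -
        have "0 \<le> (d k - e)\<^sup>2" "0 \<le> (d k)\<^sup>2" "0 \<le> e\<^sup>2" by simp_all
        moreover have "(d k - e)\<^sup>2 = (d k)\<^sup>2 + e\<^sup>2 - 2 * (d k * e)" by (simp add: power2_diff)
        ultimately show ?thesis unfolding distrib_left by linarith
      qed
      have "(d k + e) ^ 3 - d k ^ 3 = e * (3 * (d k)\<^sup>2 + 3 * (d k * e) + e\<^sup>2)"
        by (simp add: power3_eq_cube power2_eq_square algebra_simps)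
      also have "\<dots> \<le> e * (5 * ((d k)\<^sup>2 + e\<^sup>2))"
      proof (rule mult_left_mono)
        show "3 * (d k)\<^sup>2 + 3 * (d k * e) + e\<^sup>2 \<le> 5 * ((d k)\<^sup>2 + e\<^sup>2)"
          using a zero_le_power2[of e] unfolding distrib_left by linarith
      qed (use e in auto)
      finally have "(d k + e) ^ 3 - d k ^ 3 \<le> e * (5 * ((d k)\<^sup>2 + e\<^sup>2))" .
      then have "Hn k * ((d k + e) ^ 3 - d k ^ 3) \<le> Hn k * (e * (5 * ((d k)\<^sup>2 + e\<^sup>2)))"
        using Hn_nonneg by (intro mult_left_mono)
      also have "\<dots> \<le> K * (e * (5 * ((d k)\<^sup>2 + e\<^sup>2)))"
        using Hn_le[OF k] e by (intro mult_right_mono) auto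
      finally show "Hn k * ((d k + s\<^sup>2) ^ 3 - d k ^ 3) \<le> (5 * K * s\<^sup>2) * ((d k)\<^sup>2 + s ^ 4)"
        unfolding e4 by (simp add: e_def[symmetric] mult_ac)
    qed
    moreover have "mean (\<lambda>k. (5 * K * s\<^sup>2) * ((d k)\<^sup>2 + s ^ 4)) \<ge> 0"
      using K by (intro mean_nonneg) auto
    ultimately show ?thesis using x R
      by (meson mult_left_mono mult_right_mono order_trans less_imp_le)
  qed
  also have "\<dots> = R * (5 * K * s\<^sup>2 * (mean (\<lambda>k. (d k)\<^sup>2) + s ^ 4))"
    by (simp only: mean_cmult mean_add mean_const)
  also have "\<dots> \<le> R * (5 * K * s\<^sup>2 * (C2 * s\<^sup>2 + s\<^sup>2))"
  proof -
    have "s ^ 4 = s\<^sup>2 * s\<^sup>2" by (simp flip: power_add)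
    also have "\<dots> \<le> s\<^sup>2 * 1" using s(1,3) by (intro mult_left_mono) (auto simp: power_le_one)
    finally show ?thesis using second_moment R_pos K by (intro mult_left_mono add_mono) auto
  qed
  finally have "c * mean (\<lambda>k. (d k) ^ 4) \<le> K / N * mean (\<lambda>k. (d k)\<^sup>2) + R * (5 * K * s\<^sup>2 * (C2 * s\<^sup>2 + s\<^sup>2))"
    by simp
  also have "K / N * mean (\<lambda>k. (d k)\<^sup>2) \<le> K / N * (C2 * s\<^sup>2)"
    using second_moment K by (intro mult_left_mono) auto
  also have "K / N * (C2 * s\<^sup>2) + R * (5 * K * s\<^sup>2 * (C2 * s\<^sup>2 + s\<^sup>2)) = c * (C4 * (s\<^sup>2 * s\<^sup>2))"
  proof -
    have "K / N = K * s\<^sup>2" by (simp add: s(2))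
    moreover have "c * C4 = K * C2 + 5 * R * K * (C2 + 1)" using c by (simp add: C4_def)
    then have "c * (C4 * (s\<^sup>2 * s\<^sup>2)) = (K * C2 + 5 * R * K * (C2 + 1)) * (s\<^sup>2 * s\<^sup>2)"
      by (simp flip: mult.assoc)
    ultimately show ?thesis by (simp add: algebra_simps)
  qed
  finally have "c * mean (\<lambda>k. (d k) ^ 4) \<le> c * (C4 * (s\<^sup>2 * s\<^sup>2))" by simp
  then show ?thesis using c by (simp flip: power_add)
qed

text \<open>The remainder is quadratic in d, so its mean square is governed by the fourth
  moment.\<close>

lemma remainder_moment:
  assumes T: "\<And>k. k \<le> N \<Longrightarrow> \<bar>T k\<bar> \<le> K * (1 / N + (d k)\<^sup>2)"
  shows "mean (\<lambda>k. (T k)\<^sup>2) \<le> (CT * s\<^sup>2)\<^sup>2"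
proof -
  have "mean (\<lambda>k. (T k)\<^sup>2) \<le> mean (\<lambda>k. 2 * K\<^sup>2 * (s ^ 4 + d k ^ 4))"
  proof (rule mean_mono)
    fix k assume k: "k \<le> N"
    have "(T k)\<^sup>2 \<le> (K * (s\<^sup>2 + (d k)\<^sup>2))\<^sup>2"
      using T[OF k] K by (metis abs_ge_zero power2_abs power_mono s(2))
    also have "\<dots> = K\<^sup>2 * (s\<^sup>2 + (d k)\<^sup>2)\<^sup>2" by (simp add: power_mult_distrib)
    also have "\<dots> \<le> K\<^sup>2 * (2 * (s ^ 4 + d k ^ 4))"
    proof (rule mult_left_mono)
      have "(A + B)\<^sup>2 \<le> 2 * (A\<^sup>2 + B\<^sup>2)" for A B :: real
        unfolding power2_sum distrib_left using sum_squares_bound[of A B] by linarith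
      from this[of "s\<^sup>2" "(d k)\<^sup>2"]
      show "(s\<^sup>2 + (d k)\<^sup>2)\<^sup>2 \<le> 2 * (s ^ 4 + d k ^ 4)" by (simp flip: power_mult)
    qed simp
    finally show "(T k)\<^sup>2 \<le> 2 * K\<^sup>2 * (s ^ 4 + d k ^ 4)" by (simp only: mult_ac)
  qed
  also have "\<dots> = 2 * K\<^sup>2 * (s ^ 4 + mean (\<lambda>k. d k ^ 4))" by (simp only: mean_cmult mean_add mean_const)
  also have "\<dots> \<le> 2 * K\<^sup>2 * (s ^ 4 + C4 * s ^ 4)"
    using fourth_moment by (intro mult_left_mono add_left_mono) auto
  also have "\<dots> = (CT * s\<^sup>2)\<^sup>2"
    using C_nonneg by (simp add: CT_def power_mult_distrib algebra_simps flip: power_mult)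
  finally show ?thesis .
qed

lemma variance_le: "cov frac frac \<le> (sqrt C2 * s)\<^sup>2"
proof -
  have "cov frac frac = mean (\<lambda>k. (d k)\<^sup>2) - (mean d)\<^sup>2"
  proof -
    have "mean d = mean frac - y" unfolding d_def by (simp add: mean_diff mean_const)
    then have "cov frac frac = mean (\<lambda>k. (d k - mean d) * (d k - mean d))"
      by (simp add: cov_def d_def)
    also have "\<dots> = cov d d" by (simp add: cov_def)
    finally show ?thesis by (simp add: cov_eq' power2_eq_square)
  qed
  also have "\<dots> \<le> C2 * s\<^sup>2" using second_moment by (smt (verit) zero_le_power2)
  finally show ?thesis using C_nonneg by (simp add: power_mult_distrib)
qed

lemma variance_nonneg: "cov f f \<ge> 0"
  unfolding cov_def by (intro mean_nonneg) auto

text \<open>Cauchy-Schwarz. The factor \<open>sqrt (cov frac frac)\<close> is kept instead of a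
  multiple of s because it shrinks with x, and \<open>cov_asymp\<close> divides by
  \<open>sqrt x\<close>.\<close>

lemma remainder_cov:
  assumes T: "\<And>k. k \<le> N \<Longrightarrow> \<bar>T k\<bar> \<le> K * (1 / N + (d k)\<^sup>2)"
  shows "\<bar>cov T frac\<bar> \<le> CT * s\<^sup>2 * sqrt (cov frac frac)"
proof -
  have "mean (\<lambda>k. (frac k - mean frac)\<^sup>2) \<le> (sqrt (cov frac frac))\<^sup>2"
    using variance_nonneg[of frac] by (simp add: cov_def power2_eq_square)
  then show ?thesis unfolding cov_eq[of T] using C_nonneg variance_nonneg[of frac]
    by (intro mean_CS_bound remainder_moment T) auto
qed

lemma cov_linear_remainder: "cov (\<lambda>k. a + b * d k + T k) frac = b * cov frac frac + cov T frac"
proof -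
  have "cov (\<lambda>k. a + b * d k + T k) frac
      = mean (\<lambda>k. (a - b * y) * (frac k - mean frac) + b * (frac k * (frac k - mean frac)) + T k * (frac k - mean frac))"
    by (simp add: cov_eq d_def algebra_simps)
  also have "\<dots> = (a - b * y) * (mean frac - mean frac) + b * cov frac frac + cov T frac"
    by (simp only: mean_add mean_cmult mean_diff mean_const cov_eq)
  finally show ?thesis by simp
qed

text \<open>By \<open>mean_frac\<close> the mean of \<open>frac\<close> is x times
  \<open>mean Hn\<close>; estimating the latter yields a bound on \<open>mean frac / x\<close> that
  is uniform as x tends to 0.\<close>

lemma mean_Hn: "\<bar>mean Hn - H\<bar> \<le> C5 * s"
proof -
  have "\<bar>mean Hn - H\<bar> = \<bar>mean (\<lambda>k. Hn k - H)\<bar>" by (simp add: mean_diff mean_const)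
  also have "\<dots> \<le> mean (\<lambda>k. \<bar>Hn k - H\<bar>)" by (rule mean_abs)
  also have "\<dots> \<le> mean (\<lambda>k. K * \<bar>d k\<bar> + K * (s\<^sup>2 + (d k)\<^sup>2))"
  proof (rule mean_mono)
    fix k assume k: "k \<le> N"
    have "\<bar>H' * d k\<bar> \<le> K * \<bar>d k\<bar>" using H by (simp add: abs_mult mult_right_mono)
    then show "\<bar>Hn k - H\<bar> \<le> K * \<bar>d k\<bar> + K * (s\<^sup>2 + (d k)\<^sup>2)" using lin[OF k, folded d_def] unfolding s(2) by linarith
  qed
  also have "\<dots> = K * mean (\<lambda>k. \<bar>d k\<bar>) + K * (s\<^sup>2 + mean (\<lambda>k. (d k)\<^sup>2))"
    by (simp only: mean_add mean_cmult mean_const)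
  also have "\<dots> \<le> K * (sqrt C2 * s) + K * (s + C2 * s)"
  proof (intro add_mono mult_left_mono)
    have "s * s \<le> s * 1" using s(1,3) by (intro mult_left_mono) auto
    then have ss: "s\<^sup>2 \<le> s" by (simp add: power2_eq_square)
    then show "s\<^sup>2 \<le> s" .
    show "mean (\<lambda>k. \<bar>d k\<bar>) \<le> sqrt C2 * s"
      using second_moment C_nonneg s(1,3) by (intro mean_le_sqrt) (auto simp: power_mult_distrib)
    show "mean (\<lambda>k. (d k)\<^sup>2) \<le> C2 * s" 
      using second_moment mult_left_mono[OF ss C_nonneg(1)] by linarith
  qed (use K in auto)
  also have "\<dots> = C5 * s" by (simp add: C5_def algebra_simps)
  finally show ?thesis .
qed

text \<open>Read H as a function of y with derivative H': implicit differentiation of y = x H in x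
  gives H / (1 - x H'), so g is the derivative of the moment. V is the rescaled variance divided by
  x, whose limit it is.\<close>

abbreviation "g \<equiv> H / (1 - x * H')"
abbreviation "V \<equiv> real N * cov frac frac / x"

text \<open>The Stein identity for \<phi> = frac - mean frac, with \<open>Hn\<close> linearised, is
  a linear equation for the variance: \<open>V * (1 - x * H') = N * cov T frac + mean Hn\<close>.
  The first term on the right is O(s), and 1 - x H' is at least c.\<close>

lemma variance_asymp: "\<bar>V - g\<bar> \<le> C6 * s"
proof -
  define T where "T k = Hn k - H - H' * d k" for k
  have T: "\<bar>T k\<bar> \<le> K * (1 / N + (d k)\<^sup>2)" if "k \<le> N" for k using lin[OF that, folded d_def] by (simp add: T_def)
  have "cov frac frac = x * mean (\<lambda>k. Hn k * (frac (Suc k) - mean frac))"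
    by (simp add: cov_eq stein_identity)
  also have "\<dots> = x * mean (\<lambda>k. Hn k * (frac k - mean frac) + 1 / N * Hn k)"
    using N by (simp add: frac_def field_simps)
  also have "\<dots> = x * (cov Hn frac + 1 / N * mean Hn)" by (simp only: mean_add mean_cmult cov_eq)
  also have "cov Hn frac = cov (\<lambda>k. H + H' * d k + T k) frac" by (simp add: T_def)
  also have "\<dots> = H' * cov frac frac + cov T frac" by (rule cov_linear_remainder)
  finally have eq: "cov frac frac = x * (H' * cov frac frac + cov T frac + 1 / N * mean Hn)" .
  have "cov frac frac * (1 - x * H') = cov frac frac - x * (H' * cov frac frac)"
    by (simp add: algebra_simps)
  also have "\<dots> = x * (cov T frac + 1 / N * mean Hn)"
  proof -
    have "x * (p + q + r) = x * p + x * (q + r)" for p q r by (simp add: distrib_left)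
    then show ?thesis using eq by (metis add_diff_cancel_left')
  qed
  finally have eq': "cov frac frac * (1 - x * H') = x * (cov T frac + 1 / N * mean Hn)" .
  have "V * (1 - x * H') = N / x * (cov frac frac * (1 - x * H'))" by simp
  also have "\<dots> = N * cov T frac + mean Hn"
    unfolding eq' using N x by (simp add: distrib_left)
  finally have "V * (1 - x * H') = N * cov T frac + mean Hn" .
  then have "\<bar>V * (1 - x * H') - H\<bar> \<le> \<bar>N * cov T frac\<bar> + \<bar>mean Hn - H\<bar>" 
    by linarith
  then have "\<bar>V * (1 - x * H') - H\<bar> \<le> N * \<bar>cov T frac\<bar> + \<bar>mean Hn - H\<bar>" 
    by (simp add: abs_mult)
  also have "\<dots> \<le> N * (CT * s\<^sup>2 * (sqrt C2 * s)) + C5 * s"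
  proof (intro add_mono mult_left_mono mean_Hn)
    have "\<bar>cov T frac\<bar> \<le> CT * s\<^sup>2 * sqrt (cov frac frac)" by (rule remainder_cov) (rule T)
    also have "sqrt (cov frac frac) \<le> sqrt C2 * s"
      using variance_le C_nonneg s(1,3) by (intro real_le_lsqrt) (auto simp: variance_nonneg)
    finally show "\<bar>cov T frac\<bar> \<le> CT * s\<^sup>2 * (sqrt C2 * s)" using C_nonneg by (simp add: mult_left_mono)
  qed simp
  also have "\<dots> = (N * s\<^sup>2) * (CT * sqrt C2 * s) + C5 * s" by simp
  also have "\<dots> = (c * C6) * s" unfolding s(4) using c by (simp add: C6_def distrib_right)
  also have "\<dots> = c * (C6 * s)" by simp
  finally have *: "\<bar>V * (1 - x * H') - H\<bar> \<le> c * (C6 * s)" .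
  have p: "1 - x * H' > 0" using denom c by linarith
  have "c * \<bar>V - g\<bar> \<le> (1 - x * H') * \<bar>V - g\<bar>" using denom by (intro mult_right_mono) auto
  also have "\<dots> = \<bar>(1 - x * H') * (V - g)\<bar>" using p by (simp add: abs_mult)
  also have "(1 - x * H') * (V - g) = V * (1 - x * H') - H"
  proof -
    have "(1 - x * H') * g = H" using p by simp
    then show ?thesis unfolding right_diff_distrib[of _ V] by (simp only: mult.commute)
  qed
  also note *
  finally show ?thesis using c by simp
qed

lemma V_bounds: "0 \<le> V" "V \<le> C7"
proof -
  show "0 \<le> V" using variance_nonneg[of frac] x by simp
  have "\<bar>g\<bar> \<le> K / c" unfolding abs_divide using H denom c by (intro frac_le) auto
  moreover have "C6 * s \<le> C6 * 1" using s(1,3) C_nonneg by (intro mult_left_mono) auto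
  ultimately show "V \<le> C7" using variance_asymp unfolding C7_def by linarith
qed

context
  fixes lam :: "nat \<Rightarrow> real" and lam0 l :: real
  assumes l: "\<bar>l\<bar> \<le> K"
    and lam: "\<And>k. k \<le> N \<Longrightarrow> \<bar>lam k - lam0 - l * (frac k - y)\<bar> \<le> K * (1 / N + (frac k - y)\<^sup>2)"
begin

definition "Rm k = lam k - lam0 - l * d k"

lemma Rm: "k \<le> N \<Longrightarrow> \<bar>Rm k\<bar> \<le> K * (1 / N + (d k)\<^sup>2)" using lam[folded d_def] by (simp add: Rm_def)

text \<open>To first order \<open>lam\<close> is affine in \<open>frac\<close> with slope l, so this
  covariance is l times the variance. Division by sqrt x is what the mixed derivative in (t, r) asks
  for.\<close>

lemma cov_asymp: "\<bar>N * cov lam frac / sqrt x - l * sqrt x * g\<bar> \<le> (CT * sqrt C7 + K * sqrt R * C6) * s"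
proof -
  have "cov lam frac = cov (\<lambda>k. lam0 + l * d k + Rm k) frac" by (simp add: Rm_def)
  then have "cov lam frac = l * cov frac frac + cov Rm frac" by (simp only: cov_linear_remainder)
  then have "N * cov lam frac / sqrt x = l * (N * cov frac frac / sqrt x) + N * cov Rm frac / sqrt x"
    by (simp add: distrib_left add_divide_distrib)
  also have "N * cov frac frac / sqrt x = sqrt x * V"
    using x by (simp add: field_simps)
  finally have "N * cov lam frac / sqrt x - l * sqrt x * g = l * sqrt x * (V - g) + N * cov Rm frac / sqrt x"
    by (simp add: algebra_simps)
  then have "\<bar>N * cov lam frac / sqrt x - l * sqrt x * g\<bar> \<le> \<bar>l * sqrt x * (V - g)\<bar> + \<bar>N * cov Rm frac / sqrt x\<bar>"
    by (simp only: abs_triangle_ineq)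
  also have "\<bar>l * sqrt x * (V - g)\<bar> \<le> K * sqrt R * (C6 * s)"
    unfolding abs_mult using l variance_asymp R x K by (intro mult_mono) auto
  also have "\<bar>N * cov Rm frac / sqrt x\<bar> \<le> CT * sqrt C7 * s"
  proof -
    have "\<bar>N * cov Rm frac / sqrt x\<bar> = N * \<bar>cov Rm frac\<bar> / sqrt x" using x by (simp add: abs_mult)
    also have "\<dots> \<le> N * (CT * s\<^sup>2 * sqrt (cov frac frac)) / sqrt x"
      using x remainder_cov[OF Rm] by (intro divide_right_mono mult_left_mono) auto
    also have "\<dots> = (N * s\<^sup>2) * (CT * sqrt (cov frac frac / x))" by (simp add: real_sqrt_divide)
    also have "cov frac frac / x = V * s\<^sup>2" unfolding s(2) using N by simp
    also have "sqrt (V * s\<^sup>2) = sqrt V * s" unfolding real_sqrt_mult using s(1) by simp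
    also have "N * s\<^sup>2 * (CT * (sqrt V * s)) \<le> 1 * (CT * (sqrt C7 * s))"
      unfolding s(4) using C_nonneg V_bounds s(1,3) by (intro mult_left_mono mult_right_mono) auto
    finally show ?thesis by simp
  qed
  finally show ?thesis by (simp add: algebra_simps)
qed

text \<open>Expand the square of affine part plus remainder. After multiplication by N the cross
  term is O(s) and the remainder contributes O(s^2).\<close>

lemma var_asymp: "\<bar>N * cov lam lam - l\<^sup>2 * x * g\<bar> \<le> (K\<^sup>2 * R * C6 + 2 * K * CT * sqrt C2 + CT\<^sup>2) * s"
proof -
  have "lam k - mean lam = l * (frac k - mean frac) + (Rm k - mean Rm)" for k
  proof -
    have "mean lam = mean (\<lambda>k. (lam0 - l * y) + l * frac k + Rm k)" by (simp add: Rm_def d_def algebra_simps)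
    also have "\<dots> = (lam0 - l * y) + l * mean frac + mean Rm" by (simp only: mean_add mean_cmult mean_const)
    finally show ?thesis by (simp add: Rm_def d_def algebra_simps)
  qed
  then have "cov lam lam = mean (\<lambda>k. (l * (frac k - mean frac) + (Rm k - mean Rm)) * (l * (frac k - mean frac) + (Rm k - mean Rm)))"
    by (simp only: cov_def)
  also have "\<dots> = mean (\<lambda>k. l\<^sup>2 * ((frac k - mean frac) * (frac k - mean frac))
      + 2 * l * ((Rm k - mean Rm) * (frac k - mean frac)) + (Rm k - mean Rm) * (Rm k - mean Rm))"
    by (intro mean_cong) (simp add: power2_eq_square algebra_simps)
  also have "\<dots> = l\<^sup>2 * cov frac frac + 2 * l * cov Rm frac + cov Rm Rm"
    by (simp only: mean_add mean_cmult cov_def)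
  finally have "N * cov lam lam - l\<^sup>2 * x * g = l\<^sup>2 * x * (V - g) + 2 * l * (N * cov Rm frac) + N * cov Rm Rm"
    using x by (simp add: algebra_simps)
  then have "\<bar>N * cov lam lam - l\<^sup>2 * x * g\<bar> \<le> \<bar>l\<^sup>2 * x * (V - g)\<bar> + \<bar>2 * l * (N * cov Rm frac)\<bar> + \<bar>N * cov Rm Rm\<bar>"
    using abs_triangle_ineq[of "l\<^sup>2 * x * (V - g) + 2 * l * (N * cov Rm frac)" "N * cov Rm Rm"]
      abs_triangle_ineq[of "l\<^sup>2 * x * (V - g)" "2 * l * (N * cov Rm frac)"] by simp
  also have "\<bar>l\<^sup>2 * x * (V - g)\<bar> \<le> K\<^sup>2 * R * (C6 * s)"
    unfolding abs_mult using l variance_asymp R x K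
    by (intro mult_mono) (auto simp: abs_le_square_iff[symmetric])
  also have "\<bar>2 * l * (N * cov Rm frac)\<bar> \<le> 2 * K * (CT * sqrt C2 * s)"
  proof -
    have "\<bar>cov Rm frac\<bar> \<le> CT * s\<^sup>2 * sqrt (cov frac frac)" by (rule remainder_cov) (rule Rm)
    also have "sqrt (cov frac frac) \<le> sqrt C2 * s"
      using variance_le C_nonneg s(1,3) by (intro real_le_lsqrt) (auto simp: variance_nonneg)
    finally have "\<bar>cov Rm frac\<bar> \<le> CT * s\<^sup>2 * (sqrt C2 * s)" using C_nonneg by (simp add: mult_left_mono)
    then have "N * \<bar>cov Rm frac\<bar> \<le> N * (CT * s\<^sup>2 * (sqrt C2 * s))" by (intro mult_left_mono) auto
    also have "\<dots> = (N * s\<^sup>2) * (CT * sqrt C2 * s)" by simp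
    finally have "N * \<bar>cov Rm frac\<bar> \<le> CT * sqrt C2 * s" unfolding s(4) by simp
    then have "2 * \<bar>l\<bar> * (N * \<bar>cov Rm frac\<bar>) \<le> 2 * K * (CT * sqrt C2 * s)"
      using l K by - (rule mult_mono, auto)
    then show ?thesis by (simp add: abs_mult)
  qed
  also have "\<bar>N * cov Rm Rm\<bar> \<le> CT\<^sup>2 * s"
  proof -
    have "cov Rm Rm = mean (\<lambda>k. (Rm k)\<^sup>2) - (mean Rm)\<^sup>2" by (simp add: cov_eq' power2_eq_square)
    also have "\<dots> \<le> (CT * s\<^sup>2)\<^sup>2" using remainder_moment[OF Rm] by (smt (verit) zero_le_power2)
    finally have "N * cov Rm Rm \<le> N * (CT * s\<^sup>2)\<^sup>2" by (intro mult_left_mono) auto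
    also have "\<dots> = (N * s\<^sup>2) * (CT\<^sup>2 * s * s)" by (simp add: power2_eq_square)
    also have "\<dots> \<le> 1 * (CT\<^sup>2 * s * 1)" unfolding s(4) using s(1,3) by (intro mult_left_mono) auto
    finally show ?thesis using variance_nonneg[of Rm] by simp
  qed
  finally show ?thesis by (simp add: algebra_simps)
qed

end

lemma CF_ge: "C5 \<le> CF" "C6 \<le> CF" "CT * sqrt C7 + K * sqrt R * C6 \<le> CF"
    "K\<^sup>2 * R * C6 + 2 * K * CT * sqrt C2 + CT\<^sup>2 \<le> CF"
proof -
  have "0 \<le> CT * sqrt C7 + K * sqrt R * C6" "0 \<le> K\<^sup>2 * R * C6 + 2 * K * CT * sqrt C2 + CT\<^sup>2"
    using C_nonneg R_pos K by auto
  then show "C5 \<le> CF" "C6 \<le> CF" "CT * sqrt C7 + K * sqrt R * C6 \<le> CF"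
    "K\<^sup>2 * R * C6 + 2 * K * CT * sqrt C2 + CT\<^sup>2 \<le> CF" 
    using C_nonneg by (auto simp: CF_def)
qed

lemma stein_asymptotics:
  assumes l: "\<bar>l\<bar> \<le> K" 
    and lam: "\<And>k. k \<le> N \<Longrightarrow> \<bar>lam k - lam0 - l * (frac k - y)\<bar> \<le> K * (1 / N + (frac k - y)\<^sup>2)"
  shows "\<bar>mean frac / x - H\<bar> \<le> CF * s" "\<bar>V - g\<bar> \<le> CF * s"
    "\<bar>N * cov lam frac / sqrt x - l * sqrt x * g\<bar> \<le> CF * s" "\<bar>N * cov lam lam - l\<^sup>2 * x * g\<bar> \<le> CF * s"
proof -
  have "mean frac / x = mean Hn" using x by (simp add: mean_frac)
  have le: "C * s \<le> CF * s" if "C \<le> CF" for C using that s(1) by (intro mult_right_mono) auto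
  show "\<bar>mean frac / x - H\<bar> \<le> CF * s"
    unfolding \<open>mean frac / x = mean Hn\<close> using mean_Hn le[OF CF_ge(1)] by linarith
  show "\<bar>V - g\<bar> \<le> CF * s"
    using variance_asymp le[OF CF_ge(2)] by linarith
  show "\<bar>N * cov lam frac / sqrt x - l * sqrt x * g\<bar> \<le> CF * s"
    using cov_asymp[OF l lam] le[OF CF_ge(3)] by linarith
  show "\<bar>N * cov lam lam - l\<^sup>2 * x * g\<bar> \<le> CF * s"
    using var_asymp[OF l lam] le[OF CF_ge(4)] by linarith
qed

end

section \<open>Potentials on the projective line\<close>

text \<open>A second order Taylor bound for a merely Lipschitz derivative, by the mean value
  theorem; having L instead of L / 2 is harmless.\<close>

lemma C11_taylor:
  fixes F F' :: "real \<Rightarrow> real"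
  assumes J: "convex J" and F: "\<And>a. a \<in> J \<Longrightarrow> (F has_real_derivative F' a) (at a)"
    and L: "\<And>a b. a \<in> J \<Longrightarrow> b \<in> J \<Longrightarrow> \<bar>F' a - F' b\<bar> \<le> L * \<bar>a - b\<bar>"
    and ab: "a \<in> J" "b \<in> J"
  shows "\<bar>F b - F a - F' a * (b - a)\<bar> \<le> L * (b - a)\<^sup>2"
proof (cases "a = b")
  case False
  have seg: "closed_segment a b \<subseteq> J" using J ab by (simp add: closed_segment_subset)
  obtain c where c: "c \<in> closed_segment a b" "F b - F a = (b - a) * F' c"
  proof (cases "a < b")
    case True
    then obtain c where "a < c" "c < b" "F b - F a = (b - a) * F' c"
      using MVT2[of a b F F'] F seg by (auto simp: closed_segment_eq_real_ivl subset_iff)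
    then show ?thesis using True by (intro that[of c]) (auto simp: closed_segment_eq_real_ivl)
  next
    case False
    then have "b < a" using \<open>a \<noteq> b\<close> by simp
    then obtain c where "b < c" "c < a" "F a - F b = (a - b) * F' c"
      using MVT2[of b a F F'] F seg by (auto simp: closed_segment_eq_real_ivl subset_iff)
    then show ?thesis using False by (intro that[of c]) (auto simp: closed_segment_eq_real_ivl algebra_simps)
  qed
  have Lpos: "L \<ge> 0" using L[OF ab] False by (smt (verit) mult_neg_pos abs_ge_zero zero_less_abs_iff)
  have "\<bar>F b - F a - F' a * (b - a)\<bar> = \<bar>F' c - F' a\<bar> * \<bar>b - a\<bar>"
    unfolding c(2) by (simp add: abs_mult[symmetric] algebra_simps)
  also have "\<dots> \<le> (L * \<bar>c - a\<bar>) * \<bar>b - a\<bar>"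
    using L[of c a] c(1) seg ab by (intro mult_right_mono) auto
  also have "\<dots> \<le> (L * \<bar>b - a\<bar>) * \<bar>b - a\<bar>"
    using c(1) Lpos by (intro mult_right_mono mult_left_mono) (auto simp: closed_segment_eq_real_ivl split: if_splits)
  finally show ?thesis by (simp add: power2_eq_square mult.assoc)
qed auto

lemma abs_diff_le_of_deriv:
  fixes F F' :: "real \<Rightarrow> real"
  assumes J: "convex J" and F: "\<And>a. a \<in> J \<Longrightarrow> (F has_real_derivative F' a) (at a)"
    and K: "\<And>a. a \<in> J \<Longrightarrow> \<bar>F' a\<bar> \<le> K" and ab: "a \<in> J" "b \<in> J"
  shows "\<bar>F a - F b\<bar> \<le> K * \<bar>a - b\<bar>"
  using field_differentiable_bound[OF J, of F F' K a b] ab F K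
  by (force intro: has_field_derivative_at_within)

text \<open>The known bounds concern l = ln (y / x), while the Stein identity involves exp l. The
  constant is a Lipschitz constant of exp l times l', by the product rule.\<close>

lemma C11_exp:
  fixes l l' :: "real \<Rightarrow> real"
  assumes J: "convex J" and l: "\<And>a. a \<in> J \<Longrightarrow> (l has_real_derivative l' a) (at a)"
    and K: "\<And>a. a \<in> J \<Longrightarrow> \<bar>l a\<bar> \<le> K" "\<And>a. a \<in> J \<Longrightarrow> \<bar>l' a\<bar> \<le> K"
    and L: "\<And>a b. a \<in> J \<Longrightarrow> b \<in> J \<Longrightarrow> \<bar>l' a - l' b\<bar> \<le> K * \<bar>a - b\<bar>"
    and ab: "a \<in> J" "b \<in> J"
  shows "\<bar>exp (l b) - exp (l a) - exp (l a) * l' a * (b - a)\<bar> \<le> exp K * K * (1 + K) * (b - a)\<^sup>2"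
proof (rule C11_taylor[where F = "\<lambda>a. exp (l a)" and F' = "\<lambda>a. exp (l a) * l' a", OF J _ _ ab])
  show d: "((\<lambda>a. exp (l a)) has_real_derivative exp (l a) * l' a) (at a)" if "a \<in> J" for a
    using l[OF that] by (auto intro!: derivative_eq_intros)
  fix a b assume ab: "a \<in> J" "b \<in> J"
  have K0: "K \<ge> 0" using K(1)[OF ab(1)] by linarith
  have e: "exp (l c) \<le> exp K" if "c \<in> J" for c using K(1)[OF that] by simp
  have "\<bar>exp (l a) - exp (l b)\<bar> \<le> (exp K * K) * \<bar>a - b\<bar>"
  proof (rule abs_diff_le_of_deriv[OF J d _ ab])
    show "\<bar>exp (l c) * l' c\<bar> \<le> exp K * K" if "c \<in> J" for c
      unfolding abs_mult using e[OF that] K(2)[OF that] by (intro mult_mono) auto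
  qed
  then have 1: "\<bar>exp (l a) - exp (l b)\<bar> * \<bar>l' b\<bar> \<le> (exp K * K) * \<bar>a - b\<bar> * K"
    using K(2)[OF ab(2)] K0 by (intro mult_mono) auto
  have 2: "exp (l a) * \<bar>l' a - l' b\<bar> \<le> exp K * (K * \<bar>a - b\<bar>)"
    using e[OF ab(1)] L[OF ab] by (intro mult_mono) auto
  have "exp (l a) * l' a - exp (l b) * l' b = exp (l a) * (l' a - l' b) + (exp (l a) - exp (l b)) * l' b"
    by (simp add: algebra_simps)
  then have "\<bar>exp (l a) * l' a - exp (l b) * l' b\<bar> \<le> exp (l a) * \<bar>l' a - l' b\<bar> + \<bar>exp (l a) - exp (l b)\<bar> * \<bar>l' b\<bar>"
    using abs_triangle_ineq[of "exp (l a) * (l' a - l' b)" "(exp (l a) - exp (l b)) * l' b"] by (simp add: abs_mult)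
  also have "\<dots> \<le> exp K * (K * \<bar>a - b\<bar>) + (exp K * K) * \<bar>a - b\<bar> * K" using 1 2 by (rule add_mono[rotated])
  also have "\<dots> = exp K * K * (1 + K) * \<bar>a - b\<bar>" by (simp add: algebra_simps)
  finally show "\<bar>exp (l a) * l' a - exp (l b) * l' b\<bar> \<le> exp K * K * (1 + K) * \<bar>a - b\<bar>" .
qed

lemma abs_ln_diff_le:
  assumes "0 < m" "m \<le> a" "m \<le> b"
  shows "\<bar>ln a - ln b\<bar> \<le> \<bar>a - b\<bar> / (m::real)"
proof -
  have *: "ln a - ln b \<le> \<bar>a - b\<bar> / m" if "0 < m" "m \<le> a" "m \<le> b" for a b :: real
  proof -
    have "ln a - ln b = ln (1 + (a - b) / b)" 
    proof -
      have "1 + (a - b) / b = a / b" using that by (simp add: field_simps)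
      then show ?thesis using that by (simp add: ln_div)
    qed
    also have "\<dots> \<le> (a - b) / b" using that by (intro ln_add_one_self_le_self2) (simp add: field_simps)
    also have "\<dots> \<le> \<bar>a - b\<bar> / b" using that by (intro divide_right_mono) auto
    also have "\<dots> \<le> \<bar>a - b\<bar> / m" using that by (intro divide_left_mono) auto
    finally show ?thesis .
  qed
  show ?thesis using *[of a b] *[of b a] assms by (simp add: abs_le_iff abs_minus_commute)
qed

text \<open>f and fi are the local potentials of one form in the two charts. The term 2 ln |z| is
  the transition rule of O(1); it makes the moment run from 0 to 1.\<close>

locale potential = aff: radial f + inf: radial fi for f fi +
  assumes glue: "z \<noteq> 0 \<Longrightarrow> f z = 2 * ln (cmod z) + fi (1 / z)"
begin

abbreviation "U \<equiv> aff.U"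
abbreviation "y \<equiv> aff.y"
abbreviation "g \<equiv> aff.g"
abbreviation "g' \<equiv> aff.g'"

section \<open>Gluing the two charts by inversion, and global bounds\<close>

lemma U_inf: assumes "x > 0" shows "U x = ln x + inf.U (1 / x)"
proof -
  have "U x = 2 * ln (sqrt x) + fi (1 / complex_of_real (sqrt x))"
    using glue[of "complex_of_real (sqrt x)"] assms by (simp add: aff.U_def aff.e_def)
  also have "1 / complex_of_real (sqrt x) = complex_of_real (sqrt (1 / x))" by (simp add: real_sqrt_divide)
  finally show ?thesis using assms by (simp add: inf.U_def inf.e_def ln_sqrt)
qed

lemma D_inverse: "x > 0 \<Longrightarrow> ((\<lambda>x. 1 / x) has_real_derivative - 1 / x\<^sup>2) (at (x::real))"
  by (auto intro!: derivative_eq_intros simp: power2_eq_square)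

lemma y_inf: assumes "x > 0" shows "y x = 1 - inf.y (1 / x)"
proof -
  have "((\<lambda>x. ln x + inf.U (1 / x)) has_real_derivative 1 / x + inf.y (1 / x) / (1 / x) * (- 1 / x\<^sup>2)) (at x)"
    using assms by (intro DERIV_add DERIV_ln_divide DERIV_chain2[OF inf.U D_inverse]) auto
  then have "(U has_real_derivative 1 / x + inf.y (1 / x) / (1 / x) * (- 1 / x\<^sup>2)) (at x)"
    by (rule has_field_derivative_transform_within_open[where S = "{0<..}"]) (use assms U_inf in auto)
  from DERIV_unique[OF this aff.U[OF assms]] show ?thesis using assms
    by (simp add: field_simps power2_eq_square)
qed

lemma g_inf: assumes "x > 0" shows "g x = inf.g (1 / x) / x\<^sup>2"
proof -
  have "((\<lambda>x. 1 - inf.y (1 / x)) has_real_derivative 0 - inf.g (1 / x) * (- 1 / x\<^sup>2)) (at x)"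
    using assms by (intro DERIV_diff DERIV_const DERIV_chain2[OF inf.y D_inverse]) auto
  then have "(y has_real_derivative 0 - inf.g (1 / x) * (- 1 / x\<^sup>2)) (at x)"
    by (rule has_field_derivative_transform_within_open[where S = "{0<..}"]) (use assms y_inf in auto)
  from DERIV_unique[OF this aff.y[OF assms]] show ?thesis by simp
qed

lemma g'_inf: assumes "x > 0" shows "g' x = - inf.g' (1 / x) / x ^ 4 - 2 * inf.g (1 / x) / x ^ 3"
proof -
  have "((\<lambda>x. inf.g (1 / x)) has_real_derivative inf.g' (1 / x) * (- 1 / x\<^sup>2)) (at x)"
    using assms by (intro DERIV_chain2[OF inf.g D_inverse]) auto
  then have "((\<lambda>x. inf.g (1 / x) / x\<^sup>2) has_real_derivative
      (inf.g' (1 / x) * (- 1 / x\<^sup>2) * x\<^sup>2 - inf.g (1 / x) * (2 * x)) / (x\<^sup>2 * x\<^sup>2)) (at x)"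
    using assms by (auto intro!: derivative_eq_intros)
  then have "(g has_real_derivative (inf.g' (1 / x) * (- 1 / x\<^sup>2) * x\<^sup>2 - inf.g (1 / x) * (2 * x)) / (x\<^sup>2 * x\<^sup>2)) (at x)"
    by (rule has_field_derivative_transform_within_open[where S = "{0<..}"]) (use assms g_inf in auto)
  from DERIV_unique[OF this aff.g[OF assms]] show ?thesis using assms
    by (simp add: field_simps power2_eq_square power3_eq_cube power4_eq_xxxx)
qed

lemma y_range: "x > 0 \<Longrightarrow> 0 < y x" "x > 0 \<Longrightarrow> y x < 1"
  using aff.y_pos inf.y_pos[of "1 / x"] y_inf by auto

text \<open>Near 0 the bounds come from \<open>half_profile\<close> for f, for x \<ge> 1 from
  \<open>half_profile\<close> for fi at 1 / x. The decay (1 + x)^(-2) is the factor 1 / x^2 in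
  \<open>g_inf\<close>.\<close>

lemma profile_exists: obtains C where "profile U y g g' (f 0) C"
proof -
  obtain K1 c1 where K1: "K1 \<ge> 1" and aff:
    "\<And>x. 0 < x \<Longrightarrow> x \<le> 2 \<Longrightarrow> 1 / K1 \<le> g x \<and> g x \<le> K1 \<and> \<bar>g' x\<bar> \<le> K1 \<and> \<bar>U x\<bar> \<le> K1 \<and>
       f 0 \<le> U x \<and> U x \<le> f 0 + K1 * x \<and> y x \<le> K1 * x \<and> \<bar>g' x - c1\<bar> \<le> K1 * x"
    using aff.half_profile[of 2] by metis
  obtain K2 c2 where K2: "K2 \<ge> 1" and inf:
    "\<And>x. 0 < x \<Longrightarrow> x \<le> 1 \<Longrightarrow> 1 / K2 \<le> inf.g x \<and> inf.g x \<le> K2 \<and> \<bar>inf.g' x\<bar> \<le> K2 \<and> \<bar>inf.U x\<bar> \<le> K2 \<and>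
       fi 0 \<le> inf.U x \<and> inf.U x \<le> fi 0 + K2 * x \<and> inf.y x \<le> K2 * x \<and> \<bar>inf.g' x - c2\<bar> \<le> K2 * x"
    using inf.half_profile[of 1] by metis
  define K where "K = max K1 K2"
  have K: "K \<ge> 1" "K1 \<le> K" "K2 \<le> K" using K1 by (auto simp: K_def)
  \<comment> \<open>Six is dictated by the bound \<open>2 * (2 + K\<^sup>2) \<le> C\<close>, with K
    \<ge> 1.\<close>
  define C where "C = 6 * K\<^sup>2"
  have KK: "K \<le> K\<^sup>2" "1 \<le> K\<^sup>2" 
    using K mult_left_mono[of 1 K K] one_le_power[of K 2] by (auto simp: power2_eq_square)
  have C: "K \<le> C" "4 * K \<le> C" "2 * K\<^sup>2 \<le> C" "2 * (2 + K\<^sup>2) \<le> C" "K + 1 \<le> C" "C \<ge> 1"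
    using KK K by (auto simp: C_def)
  have h2: "1 / x \<le> 2 / (1 + x)" if "x \<ge> 1" for x :: real using that by (simp add: field_simps)
  show ?thesis
  proof (rule that, unfold_locales)
    fix x :: real assume x: "x > 0"
    show "(U has_real_derivative y x / x) (at x)" "(y has_real_derivative g x) (at x)"
      "(g has_real_derivative g' x) (at x)" "g x > 0" "0 < y x" "y x < 1"
      using aff.U aff.y aff.g aff.g_pos y_range x by auto
    show "\<bar>g' x\<bar> \<le> C * g x / (1 + x)"
    proof (cases "x \<le> 1")
      case True
      have a: "1 / K1 \<le> g x" "\<bar>g' x\<bar> \<le> K1" using aff[of x] x True by auto
      have "1 \<le> K1 * g x" using a(1) K1 by (simp add: field_simps)
      then have "K1 * 1 \<le> K1 * (K1 * g x)" using K1 by (intro mult_left_mono) auto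
      also have "\<dots> = (K1 * K1) * g x" by simp
      also have "\<dots> \<le> K\<^sup>2 * g x" using K1 K aff.g_pos[of x] 
        by (intro mult_right_mono) (auto simp: power2_eq_square intro!: mult_mono)
      finally have "\<bar>g' x\<bar> \<le> K\<^sup>2 * g x" using a by simp
      then have "(1 + x) * \<bar>g' x\<bar> \<le> 2 * (K\<^sup>2 * g x)" using True x by (intro mult_mono) auto
      also have "\<dots> \<le> C * g x" using C(3) aff.g_pos[of x] mult_right_mono[of "2 * K\<^sup>2" C "g x"] by simp
      finally show ?thesis using x by (simp add: pos_le_divide_eq mult.commute)
    next
      case False
      then have x1: "x \<ge> 1" by simp
      define w where "w = 1 / x"
      have w: "0 < w" "w \<le> 1" using x1 by (auto simp: w_def)
      have i: "1 / K2 \<le> inf.g w" "\<bar>inf.g' w\<bar> \<le> K2" using inf[OF w] by auto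
      have "1 \<le> K2 * inf.g w" using i(1) K2 by (simp add: field_simps)
      then have "K2 * 1 \<le> K2 * (K2 * inf.g w)" using K2 by (intro mult_left_mono) auto
      also have "\<dots> = (K2 * K2) * inf.g w" by simp
      also have "\<dots> \<le> K\<^sup>2 * inf.g w" using K2 K inf.g_pos[of w] 
        by (intro mult_right_mono) (auto simp: power2_eq_square intro!: mult_mono)
      finally have gw: "\<bar>inf.g' w\<bar> \<le> K\<^sup>2 * inf.g w" using i by simp
      have "g' x = - (inf.g' w * w ^ 4) - 2 * inf.g w * w ^ 3"
        using g'_inf[OF x] by (simp add: w_def power_one_over)
      then have "\<bar>g' x\<bar> \<le> \<bar>inf.g' w\<bar> * w ^ 4 + 2 * inf.g w * w ^ 3"
        using w inf.g_pos[of w] by (simp add: abs_le_iff abs_if)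
      also have "\<dots> \<le> K\<^sup>2 * inf.g w * w ^ 3 + 2 * inf.g w * w ^ 3"
      proof -
        have "w ^ 4 \<le> w ^ 3" using w by (intro power_decreasing) auto
        then have "\<bar>inf.g' w\<bar> * w ^ 4 \<le> K\<^sup>2 * inf.g w * w ^ 3"
          using gw w inf.g_pos[of w] by (intro mult_mono) auto
        then show ?thesis by simp
      qed
      also have "\<dots> = (2 + K\<^sup>2) * (inf.g w * w\<^sup>2) * w" by (simp add: algebra_simps power2_eq_square power3_eq_cube)
      also have "inf.g w * w\<^sup>2 = g x" using g_inf[OF x] by (simp add: w_def power_one_over)
      also have "(2 + K\<^sup>2) * g x * w \<le> (2 + K\<^sup>2) * g x * (2 / (1 + x))"
        using h2[OF x1] aff.g_pos[of x] by (intro mult_left_mono) (auto simp: w_def)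
      also have "\<dots> = (2 * (2 + K\<^sup>2)) * (g x / (1 + x))" by simp
      also have "\<dots> \<le> C * (g x / (1 + x))" using C(4) aff.g_pos[of x] x by (intro mult_right_mono) auto
      finally show ?thesis by simp
    qed
    show "g x \<le> C / (1 + x)\<^sup>2"
    proof (cases "x \<le> 1")
      case True
      have "(1 + x)\<^sup>2 \<le> 2\<^sup>2" using True x by (intro power_mono) auto
      then have "g x * (1 + x)\<^sup>2 \<le> K * 4" using aff[of x] True x K aff.g_pos[of x] by (intro mult_mono) auto
      then show ?thesis using C(2) x by (simp add: pos_le_divide_eq)
    next
      case False
      then have x1: "x \<ge> 1" by simp
      have "inf.g (1 / x) \<le> K" using inf[of "1 / x"] x1 K by auto
      then have "g x * x\<^sup>2 \<le> K" using g_inf[OF x] x by simp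
      moreover have "(1 + x)\<^sup>2 \<le> (2 * x)\<^sup>2" using x1 by (intro power_mono) auto
      then have "g x * (1 + x)\<^sup>2 \<le> g x * (2 * x)\<^sup>2" using aff.g_pos[of x] by (intro mult_left_mono) auto
      ultimately have "g x * (1 + x)\<^sup>2 \<le> 4 * K" by (simp add: power_mult_distrib)
      then show ?thesis using C(2) x by (simp add: pos_le_divide_eq)
    qed
    show "\<bar>U x - ln (1 + x)\<bar> \<le> C"
    proof (cases "x \<le> 1")
      case True
      have "0 \<le> ln (1 + x)" "ln (1 + x) \<le> 1" using x True ln_add_one_self_le_self[of x] by auto
      moreover have "\<bar>U x\<bar> \<le> K" using aff[of x] True x K by auto
      ultimately show ?thesis using C(5) by linarith
    next
      case False
      then have x1: "x \<ge> 1" by simp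
      have "\<bar>inf.U (1 / x)\<bar> \<le> K" using inf[of "1 / x"] x1 K by auto
      moreover have "ln (1 + x) - ln x = ln (1 + 1 / x)" 
      proof -
        have "1 + 1 / x = (1 + x) / x" using x by (simp add: field_simps)
        then show ?thesis using x by (simp add: ln_div)
      qed
      moreover have "0 \<le> ln (1 + 1 / x)" "ln (1 + 1 / x) \<le> 1 / x" 
        using x ln_add_one_self_le_self[of "1 / x"] by auto
      moreover have "1 / x \<le> 1" using x1 by simp
      ultimately show ?thesis using C(5) U_inf[OF x] by linarith
    qed
    show "f 0 \<le> U x"
    proof (cases "x \<le> 1")
      case True then show ?thesis using aff[of x] x by auto
    next
      case False
      have "U 1 \<le> U x"
      proof (rule DERIV_nonneg_imp_nondecreasing[of 1 x U])
        show "\<exists>d. (U has_real_derivative d) (at s) \<and> 0 \<le> d" if "1 \<le> s" "s \<le> x" for s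
          using aff.U[of s] y_range[of s] that by (intro exI[of _ "y s / s"]) auto
      qed (use False in auto)
      then show ?thesis using aff[of 1] by auto
    qed
    show "U x \<le> f 0 + C * x" if "x \<le> 1"
    proof -
      have "K1 * x \<le> C * x" using C K x by (intro mult_right_mono) auto
      moreover have "U x \<le> f 0 + K1 * x" using aff[of x] x that by auto
      ultimately show ?thesis by linarith
    qed
    show "1 / C \<le> g x" if "x \<le> 2"
    proof -
      have "1 / C \<le> 1 / K1" using C K K1 by (intro divide_left_mono) auto
      then show ?thesis using aff[of x] x that by linarith
    qed
  qed (use C aff.g'_cont in auto)
qed

text \<open>Restated outside \<open>profile\<close>, whose constant C is only known to
  exist.\<close>

definition Q :: "nat \<Rightarrow> nat \<Rightarrow> real" where
  "Q N j = (LBINT x:{0<..}. x ^ j * exp (- real N * U x) * g x)"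

lemma Q_profile: "profile U y g g' (f 0) C \<Longrightarrow> profile.Q U g N j = Q N j"
  by (simp add: profile.Q_def profile.I_def profile.W_def Q_def)

lemma Q_pos: "j \<le> N \<Longrightarrow> Q N j > 0"
  using profile_exists profile.Q_pos Q_profile by metis

lemma Q_log_convex: "j + 2 \<le> N \<Longrightarrow> Q N (j + 1) ^ 2 \<le> Q N j * Q N (j + 2)"
  using profile_exists profile.Q_log_convex Q_profile by metis

lemma ln_Q_bound:
  obtains C :: real where "C \<ge> 0" "\<And>N j. j \<le> N \<Longrightarrow> N \<ge> 1 \<Longrightarrow> \<bar>ln (Q N j)\<bar> \<le> real N * C"
proof -
  obtain C where C: "profile U y g g' (f 0) C" by (rule profile_exists)
  have "C \<ge> 1" by (rule profile.C[OF C])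
  then show ?thesis using profile.ln_Q_bound[OF C] Q_profile[OF C] by (intro that[of "C + 2 + ln C"]) auto
qed

lemma ln_Q_0_tendsto: "(\<lambda>N. ln (Q N 0) / N) \<longlonglongrightarrow> - f 0"
proof -
  obtain C where C: "profile U y g g' (f 0) C" by (rule profile_exists)
  have b: "\<bar>ln (Q N 0) + N * f 0\<bar> \<le> C + ln C + ln (2 * N)" if "N \<ge> 1" for N
    using profile.ln_Q_0_bound[OF C that] Q_profile[OF C] by simp
  have "(\<lambda>N. ln (Q N 0) / N + f 0) \<longlonglongrightarrow> 0"
  proof (rule Lim_null_comparison)
    show "\<forall>\<^sub>F N in sequentially. norm (ln (Q N 0) / real N + f 0) \<le> (C + ln C + ln 2) * (1 / N) + ln (real N) / real N"
    proof (rule eventually_mono[OF eventually_ge_at_top[of 1]])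
      fix N :: nat assume N: "1 \<le> N"
      have "ln (Q N 0) / real N + f 0 = (ln (Q N 0) + N * f 0) / N" using N by (simp add: field_simps)
      then have "norm (ln (Q N 0) / real N + f 0) = \<bar>ln (Q N 0) + N * f 0\<bar> / N" by simp
      also have "\<dots> \<le> (C + ln C + ln (2 * N)) / N" using b[OF N] by (intro divide_right_mono) auto
      also have "\<dots> = (C + ln C + ln 2) * (1 / N) + ln (real N) / real N"
        using N by (simp add: ln_mult add_divide_distrib)
      finally show "norm (ln (Q N 0) / real N + f 0) \<le> \<dots>" .
    qed
    have "(\<lambda>N. (C + ln C + ln 2) * (1 / real N) + ln (real N) / real N) \<longlonglongrightarrow> (C + ln C + ln 2) * 0 + 0"
      by (intro tendsto_intros lim_1_over_n lim_ln_over_n)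
    then show "(\<lambda>N. (C + ln C + ln 2) * (1 / real N) + ln (real N) / real N) \<longlonglongrightarrow> 0" by simp
  qed
  from tendsto_add[OF this tendsto_const[of "- f 0"]] show ?thesis by simp
qed

section \<open>The moment map, its inverse, and the function l\<close>

lemma y_mono: "0 < a \<Longrightarrow> a < b \<Longrightarrow> y a < y b"
proof (rule DERIV_pos_imp_increasing[of a b y])
  show "\<exists>d. (y has_real_derivative d) (at s) \<and> d > 0" if "0 < a" "a \<le> s" for s
    using aff.y[of s] aff.g_pos[of s] that by (intro exI[of _ "g s"]) auto
qed

lemma y_inj: "inj_on y {0<..}"
  using y_mono by (intro linorder_inj_onI') (auto simp: less_imp_neq)

lemma y_cont: "continuous_on S y" and g_cont: "continuous_on S g"
proof -
  have "continuous_on UNIV aff.e1" "continuous_on UNIV aff.G"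
    using aff.ck_e1 aff.ck_G ck_imp_continuous_on by blast+
  then show "continuous_on S y" "continuous_on S g" unfolding aff.y_def[abs_def] aff.g_def[abs_def]
    by (auto intro!: continuous_intros intro: continuous_on_compose2)
qed

lemma y_surj: assumes v: "0 < v" "v < 1" shows "\<exists>x>0. y x = v"
proof -
  obtain K1 c1 where K1: "K1 \<ge> 1" and aff: "\<And>x. 0 < x \<Longrightarrow> x \<le> 1 \<Longrightarrow> y x \<le> K1 * x"
    using aff.half_profile[of 1] by metis
  obtain K2 c2 where K2: "K2 \<ge> 1" and inf: "\<And>x. 0 < x \<Longrightarrow> x \<le> 1 \<Longrightarrow> inf.y x \<le> K2 * x"
    using inf.half_profile[of 1] by metis
  \<comment> \<open>a and 1 / w bracket the solution: y is at most K1 x near 0, and 1 - y is at most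
    K2 / x near infinity.\<close>
  define a where "a = v / K1"
  have a: "0 < a" "a \<le> 1" using v K1 by (auto simp: a_def)
  have ya: "y a \<le> v" using aff[OF a] K1 by (simp add: a_def)
  define w where "w = (1 - v) / K2"
  have w: "0 < w" "w \<le> 1" using v K2 by (auto simp: w_def)
  have "inf.y w \<le> 1 - v" using inf[OF w] K2 by (simp add: w_def)
  then have yb: "v \<le> y (1 / w)" using y_inf[of "1 / w"] w by simp
  have "a \<le> 1 / w" using a w by (meson le_divide_eq_1_pos order_trans)
  moreover have "continuous_on {a..1 / w} y"
    by (rule y_cont)
  ultimately obtain x where "a \<le> x" "x \<le> 1 / w" "y x = v"
    using IVT'[of y a v "1 / w"] ya yb by blast
  then show ?thesis using a by (intro exI[of _ x]) auto
qed

text \<open>The inverse moment map. In the variable ln x, \<open>ln (X v)\<close> is the derivative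
  of the Legendre dual of U, the symplectic potential.\<close>

definition "X v = inv_into {0<..} y v"

lemma X: "0 < v \<Longrightarrow> v < 1 \<Longrightarrow> X v > 0" "0 < v \<Longrightarrow> v < 1 \<Longrightarrow> y (X v) = v"
  using y_surj[of v] inv_into_into[of v y "{0<..}"] f_inv_into_f[of v y "{0<..}"] by (auto simp: X_def)

lemma X_y: "x > 0 \<Longrightarrow> X (y x) = x"
  using inv_into_f_f[OF y_inj, of x] by (simp add: X_def)

lemma X_mono: assumes "0 < a" "a \<le> b" "b < 1" shows "X a \<le> X b"
proof (rule ccontr)
  assume "\<not> X a \<le> X b"
  then have "y (X b) < y (X a)" using assms X by (intro y_mono) auto
  then show False using X assms by auto
qed

lemma X_deriv: assumes v: "0 < v" "v < 1" shows "(X has_real_derivative 1 / g (X v)) (at v)"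
proof -
  define x where "x = X v"
  have x: "x > 0" "y x = v" using X v by (auto simp: x_def)
  have "isCont X (y x)"
    by (rule isCont_inverse_function2[of "x / 2" x "2 * x"])
       (use x in \<open>auto intro!: X_y DERIV_isCont[OF aff.y]\<close>)
  then have "(X has_real_derivative inverse (g (X v))) (at v)"
    using aff.y[OF x(1)] aff.g_pos[of x] X v x
    by (intro DERIV_inverse_function[of y _ _ _ 0 1]) (auto simp: x_def)
  then show ?thesis by (simp add: inverse_eq_divide)
qed

text \<open>\<open>ln (X v)\<close> has a logarithmic singularity at v = 0, which the difference
  with ln v removes. m is the derivative of l expressed in x = X v, and m' is the derivative of m in
  x.\<close>

definition "l v = ln v - ln (X v)"
definition "m x = 1 / y x - 1 / (x * g x)"
definition "m' x = (g x + x * g' x) / (x * g x)\<^sup>2 - g x / (y x)\<^sup>2"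
definition "l' v = m (X v)"

lemma exp_l: "0 < v \<Longrightarrow> v < 1 \<Longrightarrow> exp (l v) = v / X v"
  using X by (simp add: l_def exp_diff)

lemma l_deriv: assumes v: "0 < v" "v < 1" shows "(l has_real_derivative l' v) (at v)"
proof -
  have "((\<lambda>v. ln v - ln (X v)) has_real_derivative 1 / v - 1 / X v * (1 / g (X v))) (at v)"
    using X[OF v] v by (intro DERIV_diff DERIV_ln_divide DERIV_chain2[OF DERIV_ln_divide X_deriv]) auto
  then show ?thesis using X[OF v] by (simp add: l_def[abs_def] l'_def m_def)
qed

lemma m_deriv: assumes x: "x > 0" shows "(m has_real_derivative m' x) (at x)"
proof -
  have p: "y x \<noteq> 0" "g x \<noteq> 0" "x \<noteq> 0" using y_range[OF x] aff.g_pos[of x] x by auto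
  have "((\<lambda>x. inverse (y x) - inverse (x * g x)) has_real_derivative
     - (inverse (y x) * g x * inverse (y x)) - - (inverse (x * g x) * (1 * g x + g' x * x) * inverse (x * g x))) (at x)"
    using p by (intro DERIV_diff DERIV_inverse' DERIV_mult DERIV_ident aff.y aff.g x) auto
  moreover have "- (inverse (y x) * g x * inverse (y x)) - - (inverse (x * g x) * (1 * g x + g' x * x) * inverse (x * g x)) = m' x"
    by (simp add: m'_def power2_eq_square divide_inverse algebra_simps)
  ultimately show ?thesis by (simp add: m_def[abs_def] inverse_eq_divide)
qed

lemma l'_deriv: assumes v: "0 < v" "v < 1" shows "(l' has_real_derivative m' (X v) / g (X v)) (at v)"
  using DERIV_chain2[OF m_deriv[OF X(1)[OF v]] X_deriv[OF v]] by (simp add: l'_def[abs_def])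

text \<open>The source of the lower bound for the denominator of the limiting variance: with x = X v
  the right side is (y / x) / g.\<close>

lemma one_minus_l': assumes v: "0 < v" "v < 1" shows "1 - v * l' v = v / (X v * g (X v))"
  using X[OF v] v by (simp add: l'_def m_def right_diff_distrib)

lemma mvt0:
  fixes F F' :: "real \<Rightarrow> real"
  assumes "continuous_on {0..x} F" "x > 0" "\<And>s. 0 < s \<Longrightarrow> s < x \<Longrightarrow> (F has_real_derivative F' s) (at s)"
  obtains s where "0 < s" "s < x" "F x - F 0 = x * F' s"
proof -
  obtain s where "0 < s" "s < x" "F x - F 0 = F' s * (x - 0)"
    using mvt[of 0 x F "\<lambda>s v. F' s * v"] assms by (auto simp: has_field_derivative_def)
  then show ?thesis using that by (simp add: mult.commute)
qed

lemma y_0: "y 0 = 0" by (simp add: aff.y_def)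

text \<open>All quantities are expressed through \<open>A x = x g x - y x = x\<^sup>2 (y / x)'\<close>,
  whose leading term at \<open>0\<close> is \<open>g' 0 x\<^sup>2 / 2\<close>.\<close>

lemma m_bounds:
  assumes B: "B > 0"
  obtains K where "K \<ge> 1" "\<And>x. 0 < x \<Longrightarrow> x \<le> B \<Longrightarrow> 1 / K \<le> y x / x \<and> y x / x \<le> K \<and> 1 / K \<le> g x \<and> g x \<le> K
      \<and> \<bar>m x\<bar> \<le> K ^ 3 \<and> \<bar>m' x\<bar> \<le> 5 * K ^ 7"
proof -
  obtain K c where K: "K \<ge> 1" and hp: 
    "\<And>x. 0 < x \<Longrightarrow> x \<le> B \<Longrightarrow> 1 / K \<le> g x \<and> g x \<le> K \<and> \<bar>g' x\<bar> \<le> K \<and> \<bar>g' x - c\<bar> \<le> K * x"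
    using aff.half_profile[of B] by metis
  show ?thesis
  proof (rule that[OF K])
    fix x assume x: "0 < x" "x \<le> B"
    define A where "A s = s * g s - y s" for s
    have A_cont: "continuous_on S A" for S unfolding A_def by (intro continuous_intros y_cont g_cont)
    have A_deriv: "(A has_real_derivative s * g' s) (at s)" if "s > 0" for s
      unfolding A_def using that by (auto intro!: derivative_eq_intros aff.y aff.g)
    have A0: "A 0 = 0" by (simp add: A_def y_0)
    obtain s where s: "0 < s" "s < x" "y x - y 0 = x * g s"
      using mvt0[of x y g] y_cont aff.y x by blast
    then have yx: "y x = x * g s" by (simp add: y_0)
    then have H: "1 / K \<le> y x / x" "y x / x \<le> K" using hp[of s] s x by auto
    then have yb: "x / K \<le> y x" "y x \<le> K * x" using x by (auto simp: field_simps)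
    have gb: "1 / K \<le> g x" "g x \<le> K" "\<bar>g' x\<bar> \<le> K" "\<bar>g' x - c\<bar> \<le> K * x" using hp[OF x] by auto
    have Ab: "\<bar>A x\<bar> \<le> K * x\<^sup>2"
    proof -
      obtain s where s: "0 < s" "s < x" "A x - A 0 = x * (s * g' s)"
        using mvt0[of x A "\<lambda>s. s * g' s"] A_cont A_deriv x by blast
      then have "\<bar>A x\<bar> = x * (s * \<bar>g' s\<bar>)" using x by (simp add: A0 abs_mult)
      also have "\<dots> \<le> x * (x * K)" using hp[of s] s x by (intro mult_left_mono mult_mono) auto
      finally show ?thesis by (simp add: power2_eq_square mult_ac)
    qed
    have Ac: "\<bar>A x - c * x\<^sup>2 / 2\<bar> \<le> K * x ^ 3"
    proof -
      define F where "F s = A s - c * s\<^sup>2 / 2" for s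
      have "(F has_real_derivative s * (g' s - c)) (at s)" if "s > 0" for s
      proof -
        have "(F has_real_derivative s * g' s - c * s) (at s)"
          unfolding F_def using that by (auto intro!: derivative_eq_intros A_deriv)
        then show ?thesis by (simp add: algebra_simps)
      qed
      moreover have "continuous_on {0..x} F" unfolding F_def by (intro continuous_intros A_cont) auto
      ultimately obtain s where s: "0 < s" "s < x" "F x - F 0 = x * (s * (g' s - c))"
        using mvt0[of x F "\<lambda>s. s * (g' s - c)"] x by blast
      then have "\<bar>F x\<bar> = x * (s * \<bar>g' s - c\<bar>)" using x by (simp add: F_def A0 abs_mult)
      also have "\<dots> \<le> x * (x * (K * x))"
      proof -
        have "\<bar>g' s - c\<bar> \<le> K * s" using hp[of s] s x by auto
        also have "\<dots> \<le> K * x" using s K by (intro mult_left_mono) auto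
        finally show ?thesis using s x by (intro mult_left_mono mult_mono) auto
      qed
      finally show ?thesis by (simp add: F_def power3_eq_cube mult_ac)
    qed
    have ypos: "y x > 0" "g x > 0" using y_range x aff.g_pos by auto
    have den: "x\<^sup>2 / K\<^sup>2 \<le> y x * (x * g x)"
    proof -
      have "(x / K) * (x * (1 / K)) \<le> y x * (x * g x)"
        using yb gb x K ypos by (intro mult_mono mult_left_mono) auto
      then show ?thesis by (simp add: power2_eq_square mult_ac)
    qed
    have mA: "m x = A x / (y x * (x * g x))" using ypos x by (simp add: m_def A_def field_simps)
    have "\<bar>m x\<bar> = \<bar>A x\<bar> / (y x * (x * g x))" unfolding mA using ypos x by (simp add: abs_mult)
    also have "\<dots> \<le> K * x\<^sup>2 / (x\<^sup>2 / K\<^sup>2)" using Ab den x K ypos by (intro frac_le) auto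
    also have "\<dots> = K ^ 3" using x K by (simp add: power2_eq_square power3_eq_cube)
    finally have mb: "\<bar>m x\<bar> \<le> K ^ 3" .
    \<comment> \<open>c is the limit of g' at 0. Both x^2 g' and 2 A have leading term c x^2;
      subtracting it from each makes the two pieces O(x^3). The numerator is then O(x^4), which
      matches the denominator.\<close>
    have num: "m' x = (y x * (g x * (x\<^sup>2 * (g' x - c) - 2 * (A x - c * x\<^sup>2 / 2)) - x * g' x * A x) - g x * (A x)\<^sup>2)
        / (y x * (x * g x))\<^sup>2"
    proof -
      have "m' x = ((g x + x * g' x) * (y x)\<^sup>2 - g x * (x * g x)\<^sup>2) / (y x * (x * g x))\<^sup>2"
        using ypos x by (simp add: m'_def diff_divide_distrib power_mult_distrib)
      also have "(g x + x * g' x) * (y x)\<^sup>2 - g x * (x * g x)\<^sup>2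
          = y x * (g x * (x\<^sup>2 * (g' x - c) - 2 * (A x - c * x\<^sup>2 / 2)) - x * g' x * A x) - g x * (A x)\<^sup>2"
        unfolding A_def by (simp add: power2_eq_square algebra_simps)
      finally show ?thesis .
    qed
    have n1: "\<bar>x\<^sup>2 * (g' x - c) - 2 * (A x - c * x\<^sup>2 / 2)\<bar> \<le> 3 * K * x ^ 3"
    proof -
      have "\<bar>x\<^sup>2 * (g' x - c)\<bar> \<le> x\<^sup>2 * (K * x)" unfolding abs_mult using gb by (intro mult_mono) auto
      also have "\<dots> = K * x ^ 3" by (simp add: power2_eq_square power3_eq_cube)
      finally have "\<bar>x\<^sup>2 * (g' x - c)\<bar> \<le> K * x ^ 3" .
      moreover have "\<bar>p - 2 * q\<bar> \<le> 3 * K * x ^ 3" if "\<bar>p\<bar> \<le> K * x ^ 3" "\<bar>q\<bar> \<le> K * x ^ 3" for p q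
        using that by linarith
      ultimately show ?thesis using Ac by blast
    qed
    have n2: "\<bar>x * g' x * A x\<bar> \<le> K\<^sup>2 * x ^ 3"
    proof -
      have "\<bar>x * g' x * A x\<bar> \<le> (x * K) * (K * x\<^sup>2)" unfolding abs_mult using gb Ab x by (intro mult_mono) auto
      then show ?thesis by (simp add: power2_eq_square power3_eq_cube mult_ac)
    qed
    define P where "P = x\<^sup>2 * (g' x - c) - 2 * (A x - c * x\<^sup>2 / 2)"
    have "\<bar>g x * P - x * g' x * A x\<bar> \<le> K * (3 * K * x ^ 3) + K\<^sup>2 * x ^ 3"
    proof -
      have "\<bar>g x * P\<bar> \<le> K * (3 * K * x ^ 3)" unfolding abs_mult P_def using n1 gb ypos K by (intro mult_mono) auto
      then show ?thesis using n2 by linarith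
    qed
    also have "\<dots> = 4 * K\<^sup>2 * x ^ 3" by (simp add: power2_eq_square)
    finally have "\<bar>y x * (g x * P - x * g' x * A x)\<bar> \<le> (K * x) * (4 * K\<^sup>2 * x ^ 3)"
      unfolding abs_mult[of "y x"] using yb ypos x by (intro mult_mono) auto
    moreover have "\<bar>g x * (A x)\<^sup>2\<bar> \<le> K * (K * x\<^sup>2)\<^sup>2"
    proof -
      have "\<bar>A x\<bar>\<^sup>2 \<le> (K * x\<^sup>2)\<^sup>2" using Ab by (intro power_mono) auto
      then show ?thesis unfolding abs_mult using gb ypos by (intro mult_mono) auto
    qed
    ultimately have "\<bar>y x * (g x * P - x * g' x * A x) - g x * (A x)\<^sup>2\<bar> \<le> (K * x) * (4 * K\<^sup>2 * x ^ 3) + K * (K * x\<^sup>2)\<^sup>2"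
      by linarith
    also have "\<dots> = 5 * K ^ 3 * x ^ 4" by (simp add: power2_eq_square power3_eq_cube power4_eq_xxxx)
    finally have nb: "\<bar>y x * (g x * P - x * g' x * A x) - g x * (A x)\<^sup>2\<bar> \<le> 5 * K ^ 3 * x ^ 4" .
    have "\<bar>m' x\<bar> = \<bar>y x * (g x * P - x * g' x * A x) - g x * (A x)\<^sup>2\<bar> / (y x * (x * g x))\<^sup>2"
      unfolding num P_def[symmetric] by simp
    also have "\<dots> \<le> 5 * K ^ 3 * x ^ 4 / (x\<^sup>2 / K\<^sup>2)\<^sup>2"
      using nb x K by (intro frac_le power_mono den) auto
    also have "\<dots> = 5 * K ^ 7" using x K by (simp add: power_divide field_simps flip: power_mult power_add)
    finally show "1 / K \<le> y x / x \<and> y x / x \<le> K \<and> 1 / K \<le> g x \<and> g x \<le> K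
      \<and> \<bar>m x\<bar> \<le> K ^ 3 \<and> \<bar>m' x\<bar> \<le> 5 * K ^ 7" using H gb mb by blast
  qed
qed

text \<open>Moments up to 1 - \<delta> correspond to x \<le> B = X (1 - \<delta>), where
  \<open>m_bounds\<close> applies. The Lipschitz bound for l' comes from its derivative m' /
  g.\<close>

lemma l_bounds:
  assumes d: "0 < \<delta>" "\<delta> < 1"
  obtains K where "K \<ge> 1"
    "\<And>v. 0 < v \<Longrightarrow> v \<le> 1 - \<delta> \<Longrightarrow> \<bar>l v\<bar> \<le> K \<and> \<bar>l' v\<bar> \<le> K \<and> 1 / K \<le> 1 - v * l' v"
    "\<And>v w. 0 < v \<Longrightarrow> v \<le> 1 - \<delta> \<Longrightarrow> 0 < w \<Longrightarrow> w \<le> 1 - \<delta> \<Longrightarrow> \<bar>l' v - l' w\<bar> \<le> K * \<bar>v - w\<bar>"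
proof -
  define B where "B = X (1 - \<delta>)"
  have B: "B > 0" using X d by (simp add: B_def)
  obtain K where K: "K \<ge> 1" and b: "\<And>x. 0 < x \<Longrightarrow> x \<le> B \<Longrightarrow> 1 / K \<le> y x / x \<and> y x / x \<le> K \<and> 1 / K \<le> g x \<and> g x \<le> K
      \<and> \<bar>m x\<bar> \<le> K ^ 3 \<and> \<bar>m' x\<bar> \<le> 5 * K ^ 7" using m_bounds[OF B] by blast
  have xr: "0 < X v" "X v \<le> B" "v < 1" if "0 < v" "v \<le> 1 - \<delta>" for v
    using that X[of v] X_mono[of v "1 - \<delta>"] d by (auto simp: B_def)
  define M where "M = 5 * K ^ 8"
  have Kp: "K \<le> K ^ 8" "K ^ 2 \<le> K ^ 8" "K ^ 3 \<le> K ^ 8" "1 \<le> K ^ 8"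
    using K power_increasing[of 1 8 K] power_increasing[of 2 8 K] power_increasing[of 3 8 K] by (auto simp: one_le_power)
  have M: "M \<ge> 1" "K \<le> M" "K\<^sup>2 \<le> M" "K ^ 3 \<le> M" unfolding M_def using Kp by linarith+
  show ?thesis
  proof (rule that[OF M(1)])
    fix v assume v: "0 < v" "v \<le> 1 - \<delta>"
    note x = xr[OF v] and bx = b[OF xr(1,2)[OF v]]
    have yv: "y (X v) = v" using X v x by auto
    have "l v = ln (v / X v)" using v x by (simp add: l_def ln_div)
    moreover have "ln (v / X v) \<le> K"
    proof -
      have "v / X v \<le> K" using bx yv by simp
      then have "ln (v / X v) \<le> ln K" using v x K by (subst ln_le_cancel_iff) auto
      then show ?thesis using ln_le_minus_one[of K] K by linarith
    qed
    moreover have "- K \<le> ln (v / X v)"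
    proof -
      have "1 / K \<le> v / X v" using bx yv by simp
      then have "ln (1 / K) \<le> ln (v / X v)" using v x K by (subst ln_le_cancel_iff) auto
      then show ?thesis using ln_le_minus_one[of K] K by (simp add: ln_div)
    qed
    ultimately have "\<bar>l v\<bar> \<le> M" using M by linarith
    moreover have "\<bar>l' v\<bar> \<le> M" using bx M unfolding l'_def by linarith
    moreover have "1 / M \<le> 1 - v * l' v"
    proof -
      have "1 - v * l' v = (y (X v) / X v) / g (X v)" using one_minus_l'[of v] v x yv by simp
      also have "\<dots> \<ge> (1 / K) / K" 
      proof (rule frac_le)
        show "0 \<le> y (X v) / X v" using v x yv by simp
      qed (use bx aff.g_pos[of "X v"] in auto)
      moreover have "1 / M \<le> 1 / K\<^sup>2" using M K by (intro divide_left_mono) auto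
      ultimately show ?thesis by (simp add: power2_eq_square)
    qed
    ultimately show "\<bar>l v\<bar> \<le> M \<and> \<bar>l' v\<bar> \<le> M \<and> 1 / M \<le> 1 - v * l' v" by blast
  next
    fix v w assume vw: "0 < v" "v \<le> 1 - \<delta>" "0 < w" "w \<le> 1 - \<delta>"
    show "\<bar>l' v - l' w\<bar> \<le> M * \<bar>v - w\<bar>"
    proof (rule abs_diff_le_of_deriv[of "{0<..1 - \<delta>}"])
      fix a assume a: "a \<in> {0<..1 - \<delta>}"
      then have a': "0 < a" "a \<le> 1 - \<delta>" by auto
      show "(l' has_real_derivative m' (X a) / g (X a)) (at a)" using l'_deriv xr[OF a'] a' by blast
      have bx: "1 / K \<le> g (X a)" "\<bar>m' (X a)\<bar> \<le> 5 * K ^ 7" using b[OF xr(1,2)[OF a']] by auto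
      have "\<bar>m' (X a) / g (X a)\<bar> = \<bar>m' (X a)\<bar> / g (X a)" using aff.g_pos[of "X a"] by simp
      also have "\<dots> \<le> 5 * K ^ 7 / (1 / K)" using bx K by (intro frac_le) auto
      also have "\<dots> = M" by (simp add: M_def eval_nat_numeral)
      finally show "\<bar>m' (X a) / g (X a)\<bar> \<le> M" .
    qed (use vw in auto)
  qed
qed

text \<open>\<open>ratio_asymp\<close> with A = exp (l \<alpha>), the value of y / x at moment
  \<alpha>. Its Taylor hypothesis is demanded at every x, also where l is not controlled; there y is
  far from \<alpha> and boundedness of y / x is enough. The lower bound on A then permits the
  passage to logarithms.\<close>

lemma ratio_ln_asymp:
  assumes d: "0 < \<delta>" "\<delta> < 1"
  obtains C N0 where "C \<ge> 0" "\<And>N k. N \<ge> N0 \<Longrightarrow> k < N \<Longrightarrow> real (k + 1) / N \<le> 1 - \<delta> \<Longrightarrow>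
    \<bar>ln (real (k + 1) / N * (Q N k / Q N (k + 1))) - l (real (k + 1) / N)\<bar> \<le> C / N"
proof -
  obtain Cp where Cp: "profile U y g g' (f 0) Cp" by (rule profile_exists)
  have Cp1: "Cp \<ge> 1" by (rule profile.C[OF Cp])
  obtain K where K: "K \<ge> 1" and lb:
    "\<And>v. 0 < v \<Longrightarrow> v \<le> 1 - \<delta> / 2 \<Longrightarrow> \<bar>l v\<bar> \<le> K \<and> \<bar>l' v\<bar> \<le> K \<and> 1 / K \<le> 1 - v * l' v"
    and lL: "\<And>v w. 0 < v \<Longrightarrow> v \<le> 1 - \<delta> / 2 \<Longrightarrow> 0 < w \<Longrightarrow> w \<le> 1 - \<delta> / 2 \<Longrightarrow> \<bar>l' v - l' w\<bar> \<le> K * \<bar>v - w\<bar>"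
    using l_bounds[of "\<delta> / 2"] d by auto
  define E where "E = exp K"
  have E: "E \<ge> 1" using K by (simp add: E_def)
  define Bd where "Bd = max E (1 / X (1 - \<delta> / 2))"
  have Xh: "X (1 - \<delta> / 2) > 0" using X d by simp
  have Bd: "Bd \<ge> 1" "E \<le> Bd" "1 / X (1 - \<delta> / 2) \<le> Bd" using E by (auto simp: Bd_def)
  have yx: "y x / x \<le> Bd" if x: "x > 0" for x
  proof (cases "y x \<le> 1 - \<delta> / 2")
    case True
    have "exp (l (y x)) \<le> E" using lb[of "y x"] y_range[OF x] True by (simp add: E_def abs_le_iff)
    then show ?thesis using exp_l[of "y x"] y_range[OF x] X_y[OF x] Bd by simp
  next
    case False
    have "X (1 - \<delta> / 2) \<le> x" using X_mono[of "1 - \<delta> / 2" "y x"] False y_range[OF x] X_y[OF x] d by simp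
    then have "1 / x \<le> 1 / X (1 - \<delta> / 2)" using Xh x by (intro divide_left_mono) auto
    moreover have "y x / x \<le> 1 / x" using y_range[OF x] x by (intro divide_right_mono) auto
    ultimately show ?thesis using Bd by linarith
  qed
  \<comment> \<open>The second summand pays for moments above 1 - \<delta> / 2, which are at
    distance at least \<delta> / 2 from \<alpha>.\<close>
  define D where "D = exp K * K * (1 + K) + (Bd + E + E * K) / (\<delta> / 2)\<^sup>2"
  have D0: "D \<ge> 0" using K E Bd d by (simp add: D_def)
  define C where "C = E * K * (1 + Cp) + D * (1 + 2 * Cp) + Cp"
  have C0: "C \<ge> 0" using K E Bd Cp1 D0 by (simp add: C_def)
  \<comment> \<open>From N0 on, C / N is at most half of 1 / E, so the quotient r stays above 1 / (2
    E).\<close>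
  define N0 where "N0 = nat \<lceil>2 * E * C\<rceil> + 1"
  show ?thesis
  proof (rule that[of "2 * E * C" N0])
    show "2 * E * C \<ge> 0" using E C0 by simp
    fix N k assume N: "N \<ge> N0" and k: "k < N" and a1: "real (k + 1) / N \<le> 1 - \<delta>"
    define \<alpha> where "\<alpha> = real (k + 1) / N"
    have a: "0 < \<alpha>" "\<alpha> \<le> 1 - \<delta>" "\<alpha> \<le> 1 - \<delta> / 2" "\<alpha> < 1"
    proof -
      show "0 < \<alpha>" using k by (simp add: \<alpha>_def)
      show "\<alpha> \<le> 1 - \<delta>" using a1 by (simp add: \<alpha>_def)
      then show "\<alpha> \<le> 1 - \<delta> / 2" "\<alpha> < 1" using d by auto
    qed
    define A where "A = exp (l \<alpha>)"
    have "A \<le> E" "1 / E \<le> A" using lb[OF a(1,3)] by (auto simp: A_def E_def abs_le_iff exp_minus inverse_eq_divide[symmetric] simp flip: exp_minus)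
    have la: "\<bar>l' \<alpha>\<bar> \<le> K" using lb[OF a(1,3)] by blast
    have taylor: "\<bar>y x / x - A - A * l' \<alpha> * (y x - \<alpha>)\<bar> \<le> D * (y x - \<alpha>)\<^sup>2" if x: "x > 0" for x
    proof (cases "y x \<le> 1 - \<delta> / 2")
      case True
      have "\<bar>exp (l (y x)) - exp (l \<alpha>) - exp (l \<alpha>) * l' \<alpha> * (y x - \<alpha>)\<bar> \<le> exp K * K * (1 + K) * (y x - \<alpha>)\<^sup>2"
        by (rule C11_exp[of "{0<..1 - \<delta> / 2}"]) (use lb lL a y_range[OF x] True d in \<open>auto intro!: l_deriv\<close>)
      also have "\<dots> \<le> D * (y x - \<alpha>)\<^sup>2" using Bd E K by (intro mult_right_mono) (auto simp: D_def)
      finally show ?thesis using exp_l[of "y x"] y_range[OF x] X_y[OF x] by (simp add: A_def)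
    next
      case False
      have A1: "\<bar>A * l' \<alpha> * (y x - \<alpha>)\<bar> \<le> E * K * 1"
        unfolding abs_mult using la \<open>A \<le> E\<close> a y_range[OF x] E K
        by (intro mult_mono) (auto simp: A_def)
      have "\<bar>y x / x - A - A * l' \<alpha> * (y x - \<alpha>)\<bar> \<le> Bd + E + E * K"
      proof -
        have "0 \<le> y x / x" "0 \<le> A" using y_range[OF x] x by (auto simp: A_def)
        then show ?thesis using A1 yx[OF x] \<open>A \<le> E\<close> by linarith
      qed
      also have "\<dots> = (Bd + E + E * K) / (\<delta> / 2)\<^sup>2 * (\<delta> / 2)\<^sup>2" using d by simp
      also have "\<dots> \<le> D * (y x - \<alpha>)\<^sup>2"
        using d False a K D0 by (intro mult_mono power_mono) (auto simp: D_def)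
      finally show ?thesis .
    qed
    have N1: "2 * E * C \<le> N" "N > 0"
    proof -
      have "2 * E * C \<le> of_int \<lceil>2 * E * C\<rceil>" by (rule le_of_int_ceiling)
      also have "\<dots> \<le> of_int (int N)" unfolding of_int_le_iff using N by (simp add: N0_def)
      finally show "2 * E * C \<le> N" by simp
      show "N > 0" using k by simp
    qed
    define r where "r = real (k + 1) / N * (Q N k / Q N (k + 1))"
    have "\<bar>r - A\<bar> \<le> (\<bar>A * l' \<alpha>\<bar> * (1 + Cp) + D * (1 + 2 * Cp) + Cp) / N"
      unfolding r_def Q_profile[OF Cp, symmetric]
      by (rule profile.ratio_asymp[OF Cp k yx]) (use taylor in \<open>auto simp: \<alpha>_def\<close>)
    also have "\<dots> \<le> C / N"
    proof -
      have "\<bar>A * l' \<alpha>\<bar> \<le> E * K" unfolding abs_mult using la \<open>A \<le> E\<close> E by (intro mult_mono) (auto simp: A_def)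
      then have "\<bar>A * l' \<alpha>\<bar> * (1 + Cp) \<le> E * K * (1 + Cp)" using Cp1 by (intro mult_right_mono) auto
      then show ?thesis by (intro divide_right_mono) (auto simp: C_def)
    qed
    finally have rA: "\<bar>r - A\<bar> \<le> C / N" .
    have "C / N \<le> 1 / (2 * E)" using N1 E by (simp add: field_simps)
    then have r: "1 / (2 * E) \<le> r" using rA \<open>1 / E \<le> A\<close> by (simp add: abs_le_iff)
    have A2: "1 / (2 * E) \<le> A" using \<open>1 / E \<le> A\<close> E by (smt (verit) divide_left_mono mult_pos_pos)
    have "\<bar>ln r - ln A\<bar> \<le> \<bar>r - A\<bar> / (1 / (2 * E))"
      by (rule abs_ln_diff_le) (use r A2 E in auto)
    also have "\<dots> \<le> (C / N) / (1 / (2 * E))" using rA E by (intro divide_right_mono) auto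
    finally show "\<bar>ln (real (k + 1) / N * (Q N k / Q N (k + 1))) - l (real (k + 1) / N)\<bar> \<le> 2 * E * C / N"
      by (simp add: r_def A_def \<alpha>_def mult_ac)
  qed
qed

end

section \<open>Geodesics\<close>

lemma frechet_of_ck_within:
  assumes S: "thick S" and f: "\<And>n. ck n S f"
  shows "x \<in> S \<Longrightarrow> (f has_derivative frechet_derivative f (at x within S)) (at x within S)"
    "b \<in> Basis \<Longrightarrow> ck n S (\<lambda>x. frechet_derivative f (at x within S) b)"
proof -
  from f[of "Suc n"] obtain D where D: "\<And>x. x \<in> S \<Longrightarrow> (f has_derivative D x) (at x within S)"
    "\<And>b. b \<in> Basis \<Longrightarrow> ck n S (\<lambda>x. D x b)" by auto
  have eq: "frechet_derivative f (at x within S) = D x" if "x \<in> S" for x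
    using thick_frechet[OF S that D(1)[OF that]] .
  show "x \<in> S \<Longrightarrow> (f has_derivative frechet_derivative f (at x within S)) (at x within S)"
    using eq D(1) by simp
  assume b: "b \<in> Basis"
  have "ck n S (\<lambda>x. frechet_derivative f (at x within S) b) \<longleftrightarrow> ck n S (\<lambda>x. D x b)"
    by (rule ck_cong) (simp add: eq)
  then show "ck n S (\<lambda>x. frechet_derivative f (at x within S) b)" using D(2)[OF b] by simp
qed

lemma frechet_of_ck_open:
  assumes S: "open S" and f: "\<And>n. ck n S f"
  shows "x \<in> S \<Longrightarrow> (f has_derivative frechet_derivative f (at x)) (at x)"
    "b \<in> Basis \<Longrightarrow> ck n S (\<lambda>x. frechet_derivative f (at x) b)"
proof -
  note * = frechet_of_ck_within[OF thick_open[OF S] f]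
  have eq: "frechet_derivative f (at x within S) = frechet_derivative f (at x)" if "x \<in> S" for x
    using at_within_open[OF that S] by simp
  show "x \<in> S \<Longrightarrow> (f has_derivative frechet_derivative f (at x)) (at x)"
    using *(1)[of x] at_within_open[of x S] S by simp
  assume b: "b \<in> Basis"
  have "ck n S (\<lambda>x. frechet_derivative f (at x within S) b) \<longleftrightarrow> ck n S (\<lambda>x. frechet_derivative f (at x) b)"
    by (rule ck_cong) (simp add: eq)
  then show "ck n S (\<lambda>x. frechet_derivative f (at x) b)" using *(2)[OF b] by simp
qed

lemma frechet_commute:
  assumes S: "open S" "x \<in> S" and f: "\<And>n. ck n S f" and ab: "a \<in> Basis" "b \<in> Basis"
  shows "frechet_derivative (\<lambda>x. frechet_derivative f (at x) a) (at x) b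
       = frechet_derivative (\<lambda>x. frechet_derivative f (at x) b) (at x) a"
proof (rule symmetric_second_derivative[OF S frechet_of_ck_open(1)[OF S(1) f]])
  have ck: "ck n S (\<lambda>x. frechet_derivative f (at x) a)" "ck n S (\<lambda>x. frechet_derivative f (at x) b)" for n
    using frechet_of_ck_open(2)[OF S(1) f] ab by auto
  show "((\<lambda>x. frechet_derivative f (at x) a) has_derivative frechet_derivative (\<lambda>x. frechet_derivative f (at x) a) (at x)) (at x)"
    "((\<lambda>x. frechet_derivative f (at x) b) has_derivative frechet_derivative (\<lambda>x. frechet_derivative f (at x) b) (at x)) (at x)"
    if "x \<in> S" for x using frechet_of_ck_open(1)[OF S(1)] ck that by blast+
  show "continuous_on S (\<lambda>x. frechet_derivative (\<lambda>x. frechet_derivative f (at x) a) (at x) b)"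
    "continuous_on S (\<lambda>x. frechet_derivative (\<lambda>x. frechet_derivative f (at x) b) (at x) a)"
    using frechet_of_ck_open(2)[OF S(1) ck(1) ab(2)] frechet_of_ck_open(2)[OF S(1) ck(2) ab(1)]
      ck_imp_continuous_on by blast+
qed

lemma frechet_cong_open:
  assumes S: "open S" "x \<in> S" and eq: "\<And>x. x \<in> S \<Longrightarrow> f x = g x"
  shows "frechet_derivative f (at x) = frechet_derivative g (at x)"
proof -
  have "(f has_derivative D) (at x) \<longleftrightarrow> (g has_derivative D) (at x)" for D
    using has_derivative_transform_within_open[OF _ S, of f D UNIV g]
      has_derivative_transform_within_open[OF _ S, of g D UNIV f] eq by auto
  then show ?thesis by (simp add: frechet_derivative_def)
qed

text \<open>A Gronwall argument: W^2 times exp (-2 M s) is nonincreasing forwards from t, W^2 times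
  exp (2 M s) is nondecreasing up to t, and both vanish at t.\<close>

lemma linear_ode_unique:
  fixes W c :: "real \<Rightarrow> real"
  assumes ab: "a \<le> t" "t \<le> b" and W: "\<And>s. s \<in> {a..b} \<Longrightarrow> (W has_real_derivative c s * W s) (at s)"
    and c: "\<And>s. s \<in> {a..b} \<Longrightarrow> \<bar>c s\<bar> \<le> M" and W0: "W t = 0" and s: "s \<in> {a..b}"
  shows "W s = 0"
proof -
  have d: "((\<lambda>s. (W s)\<^sup>2 * exp (k * s)) has_real_derivative (2 * c s + k) * (W s)\<^sup>2 * exp (k * s)) (at s)"
    if "s \<in> {a..b}" for s k
    by (rule derivative_eq_intros W[OF that] refl | simp add: power2_eq_square algebra_simps)+
  show ?thesis
  proof (cases "t \<le> s")
    case True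
    have "(W s)\<^sup>2 * exp (- 2 * M * s) \<le> (W t)\<^sup>2 * exp (- 2 * M * t)"
    proof (rule DERIV_nonpos_imp_nonincreasing[OF True])
      fix r assume r: "t \<le> r" "r \<le> s"
      then have "r \<in> {a..b}" using ab s by auto
      moreover have "(2 * c r + (- 2 * M)) * (W r)\<^sup>2 * exp (- 2 * M * r) \<le> 0"
        using c[OF \<open>r \<in> {a..b}\<close>] by (intro mult_nonpos_nonneg) auto
      ultimately show "\<exists>y. ((\<lambda>s. (W s)\<^sup>2 * exp (- 2 * M * s)) has_real_derivative y) (at r) \<and> y \<le> 0"
        using d[of r "- 2 * M"] by blast
    qed
    then show ?thesis using W0 by (simp add: mult_le_0_iff)
  next
    case False
    have "(W s)\<^sup>2 * exp (2 * M * s) \<le> (W t)\<^sup>2 * exp (2 * M * t)"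
    proof (rule DERIV_nonneg_imp_nondecreasing[of s t])
      fix r assume r: "s \<le> r" "r \<le> t"
      then have "r \<in> {a..b}" using ab s by auto
      moreover have "(2 * c r + 2 * M) * (W r)\<^sup>2 * exp (2 * M * r) \<ge> 0"
        using c[OF \<open>r \<in> {a..b}\<close>] by (intro mult_nonneg_nonneg) auto
      ultimately show "\<exists>y. ((\<lambda>s. (W s)\<^sup>2 * exp (2 * M * s)) has_real_derivative y) (at r) \<and> y \<ge> 0"
        using d[of r "2 * M"] by blast
    qed (use False in simp)
    then show ?thesis using W0 by (simp add: mult_le_0_iff)
  qed
qed

section \<open>Partial derivatives on the strip and Burgers' equation\<close>

abbreviation "Dt f p \<equiv> frechet_derivative f (at p) (1::real, 0::real)"
abbreviation "Dr f p \<equiv> frechet_derivative f (at p) (0::real, 1::real)"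

lemma Basis_real2: "(1, 0) \<in> (Basis :: (real \<times> real) set)" "(0, 1) \<in> (Basis :: (real \<times> real) set)"
  by (auto simp: Basis_prod_def)

definition strip :: "(real \<times> real) set" where "strip = {0..1} \<times> UNIV"
definition istrip :: "(real \<times> real) set" where "istrip = {0<..<1} \<times> UNIV"

lemma istrip: "open istrip" "istrip \<subseteq> strip"
  by (auto simp: istrip_def strip_def intro: open_Times)

lemma thick_plane_strip: "thick strip" unfolding strip_def by (rule thick_strip)

lemma deriv_along:
  fixes F :: "real \<times> real \<Rightarrow> real"
  assumes F: "(F has_derivative F') (at (s, r s))" and r: "(r has_real_derivative r') (at s)"
  shows "((\<lambda>s. F (s, r s)) has_real_derivative F' (1, 0) + r' * F' (0, 1)) (at s)"
proof -
  have "((\<lambda>s. (s, r s)) has_derivative (\<lambda>h. (h, r' * h))) (at s)"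
    using r by (auto intro!: derivative_eq_intros simp: has_field_derivative_def)
  from has_derivative_compose[OF this F]
  have "((\<lambda>s. F (s, r s)) has_derivative (\<lambda>h. F' (h, r' * h))) (at s)" .
  moreover have "F' (h, r' * h) = (F' (1, 0) + r' * F' (0, 1)) * h" for h
  proof -
    interpret linear F' using F has_derivative_linear by blast
    have "F' (h, r' * h) = F' (h *\<^sub>R (1, 0) + (r' * h) *\<^sub>R (0, 1))" by simp
    also have "\<dots> = h * F' (1, 0) + (r' * h) * F' (0, 1)" unfolding add scaleR by simp
    finally show ?thesis by (simp add: algebra_simps)
  qed
  ultimately show ?thesis by (simp add: has_field_derivative_def)
qed

text \<open>u and v are the local potentials in a chart and in the opposite one. \<open>geod\<close>
  is the geodesic equation on the real axis, cleared of denominators: for a rotation invariant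
  \<psi> the squared norm of its z-derivative is a quarter of the square of the radial
  derivative.\<close>

locale geodesic =
  fixes u v :: "real \<times> complex \<Rightarrow> real"
  assumes u_smooth: "ck n ({0..1} \<times> UNIV) u"
    and pot: "t \<in> {0..1} \<Longrightarrow> potential (\<lambda>z. u (t, z)) (\<lambda>z. v (t, z))"
    and geod: "0 < t \<Longrightarrow> t < 1 \<Longrightarrow>
      4 * ddbar (\<lambda>z. u (t, z)) (complex_of_real r) * Dt (Dt (\<lambda>p. u (fst p, complex_of_real (snd p)))) (t, r)
      = (Dr (Dt (\<lambda>p. u (fst p, complex_of_real (snd p)))) (t, r))\<^sup>2"
begin

definition "E p = u (fst p, complex_of_real (snd p))"

lemma ck_E_strip: "ck n strip E"
proof -
  have bl: "bounded_linear (\<lambda>p::real \<times> real. (fst p, complex_of_real (snd p)))"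
    by (intro bounded_linear_Pair bounded_linear_fst bounded_linear_compose[OF bounded_linear_of_real bounded_linear_snd])
  have "ck n strip (\<lambda>p. u (0 + (fst p, complex_of_real (snd p))))"
    by (rule ck_affine[OF bl u_smooth]) (auto simp: strip_def)
  then show ?thesis by (simp add: E_def[abs_def])
qed

lemma ck_E: "ck n istrip E" using ck_E_strip istrip ck_subset by blast

lemma ck_Dt: "(\<And>n. ck n istrip F) \<Longrightarrow> ck n istrip (Dt F)" 
  and ck_Dr: "(\<And>n. ck n istrip F) \<Longrightarrow> ck n istrip (Dr F)"
  using frechet_of_ck_open(2)[OF istrip(1)] Basis_real2 by blast+

lemma has_der: "(\<And>n. ck n istrip F) \<Longrightarrow> p \<in> istrip \<Longrightarrow> (F has_derivative frechet_derivative F (at p)) (at p)"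
  using frechet_of_ck_open(1)[OF istrip(1)] by blast

lemma commute: "(\<And>n. ck n istrip F) \<Longrightarrow> p \<in> istrip \<Longrightarrow> Dt (Dr F) p = Dr (Dt F) p"
  using frechet_commute[OF istrip(1)] Basis_real2 by blast

text \<open>Taken within the closed strip, so that it is continuous up to t = 0 and t = 1, where the
  end metrics live; inside it is \<open>Dr E\<close>.\<close>

definition "E_r p = frechet_derivative E (at p within strip) (0, 1)"

lemma E_r_cont: "continuous_on strip E_r"
  unfolding E_r_def[abs_def]
  using frechet_of_ck_within(2)[OF thick_plane_strip ck_E_strip Basis_real2(2)] ck_imp_continuous_on by blast

lemma E_r: "p \<in> istrip \<Longrightarrow> E_r p = Dr E p"
  using istrip at_within_interior[of p strip] interior_maximal[OF istrip(2) istrip(1)]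
  by (auto simp: E_r_def)

end

text \<open>Slices at several times meet in one statement, so the radial quantities are made
  functions of u and t, independent of any interpretation.\<close>

definition y_at :: "(real \<times> complex \<Rightarrow> real) \<Rightarrow> real \<Rightarrow> real \<Rightarrow> real" where
  "y_at u t = radial.y (\<lambda>z. u (t, z))"

definition g_at :: "(real \<times> complex \<Rightarrow> real) \<Rightarrow> real \<Rightarrow> real \<Rightarrow> real" where
  "g_at u t = radial.g (\<lambda>z. u (t, z))"

definition l_at :: "(real \<times> complex \<Rightarrow> real) \<Rightarrow> real \<Rightarrow> real \<Rightarrow> real" where
  "l_at u t = potential.l (\<lambda>z. u (t, z))"

definition l'_at :: "(real \<times> complex \<Rightarrow> real) \<Rightarrow> real \<Rightarrow> real \<Rightarrow> real" where
  "l'_at u t = potential.l' (\<lambda>z. u (t, z))"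

context geodesic
begin

lemma slice_deriv:
  assumes t: "t \<in> {0..1}"
  shows "radial.e1 (\<lambda>z. u (t, z)) r = E_r (t, r)"
proof -
  interpret potential "\<lambda>z. u (t, z)" "\<lambda>z. v (t, z)" by (rule pot[OF t])
  have p: "(t, r) \<in> strip" using t by (simp add: strip_def)
  have d: "((\<lambda>s. (t, s)) has_derivative (\<lambda>h. (0, h))) (at r)" by (auto intro!: derivative_eq_intros)
  have "(E has_derivative frechet_derivative E (at (t, r) within strip)) (at (t, r) within (\<lambda>s. (t, s)) ` UNIV)"
    by (rule has_derivative_subset[OF frechet_of_ck_within(1)[OF thick_plane_strip ck_E_strip p]])
       (use t in \<open>auto simp: strip_def\<close>)
  from diff_chain_within[OF d this]
  have D: "((\<lambda>s. E (t, s)) has_derivative (\<lambda>h. frechet_derivative E (at (t, r) within strip) (0, h))) (at r)"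
    by (simp add: o_def)
  moreover have "frechet_derivative E (at (t, r) within strip) (0, h) = E_r (t, r) * h" for h
  proof -
    have "linear (frechet_derivative E (at (t, r) within strip))"
      using frechet_of_ck_within(1)[OF thick_plane_strip ck_E_strip p] has_derivative_linear by blast
    from linear_cmul[OF this, of h "(0, 1)"] show ?thesis by (simp add: E_r_def)
  qed
  ultimately have "((\<lambda>s. E (t, s)) has_real_derivative E_r (t, r)) (at r)"
    by (simp add: has_field_derivative_def mult_commute_abs)
  then have "(aff.e has_real_derivative E_r (t, r)) (at r)" by (simp add: aff.e_def[abs_def] E_def)
  then show ?thesis using aff.e(1) DERIV_unique by blast
qed

lemma slice_deriv2:
  assumes t: "0 < t" "t < 1"
  shows "radial.e2 (\<lambda>z. u (t, z)) r = Dr (Dr E) (t, r)"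
proof -
  have t': "t \<in> {0..1}" using t by simp
  interpret potential "\<lambda>z. u (t, z)" "\<lambda>z. v (t, z)" by (rule pot[OF t'])
  have p: "(t, s) \<in> istrip" for s using t by (simp add: istrip_def)
  have "aff.e1 = (\<lambda>s. Dr E (t, s))" using slice_deriv[OF t'] E_r[OF p] by (simp add: fun_eq_iff)
  then have "((\<lambda>s. Dr E (t, s)) has_real_derivative aff.e2 r) (at r)" using aff.e(2)[of r] by simp
  moreover have "((\<lambda>s. Dr E (t, s)) has_derivative (\<lambda>h. frechet_derivative (Dr E) (at (t, r)) (0, h))) (at r)"
    by (rule has_derivative_compose[where f = "\<lambda>s. (t, s)", OF _ has_der[OF ck_Dr[OF ck_E] p]])
       (auto intro!: derivative_eq_intros)
  ultimately have "frechet_derivative (Dr E) (at (t, r)) (0, h) = aff.e2 r * h" for h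
    unfolding has_field_derivative_def using has_derivative_unique by metis
  from this[of 1] show ?thesis by simp
qed

text \<open>With \<open>\<rho> = 2 ln r\<close>, the quotient \<open>V = - u\<^sub>t\<^sub>\<rho> / u\<^sub>\<rho>\<^sub>\<rho>\<close> solves Burgers' equation
  \<open>V\<^sub>t + V V\<^sub>\<rho> = 0\<close> along a geodesic; its characteristics are straight lines in \<open>(t, \<rho>)\<close>,
  which \<open>ray\<close> below parametrises.\<close>

definition "P p = Dr E p + snd p * Dr (Dr E) p"
definition "V p = - 2 * Dr (Dt E) p / P p"

lemma ck_P: "ck n istrip P" unfolding P_def
  by (intro ck_add ck_mult ck_Dr ck_E ck_bounded_linear bounded_linear_snd)

text \<open>P is the r-derivative of \<open>r * Dr E\<close>, that is r times the Laplacian of the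
  slice.\<close>

lemma P_eq: assumes "0 < t" "t < 1" "r > 0" 
  shows "P (t, r) = 4 * r * g_at u t (r\<^sup>2)" "P (t, r) > 0"
    "4 * ddbar (\<lambda>z. u (t, z)) (complex_of_real r) = P (t, r) / r" "y_at u t (r\<^sup>2) = r * Dr E (t, r) / 2"
proof -
  have t': "t \<in> {0..1}" "(t, r) \<in> istrip" using assms by (auto simp: istrip_def)
  interpret potential "\<lambda>z. u (t, z)" "\<lambda>z. v (t, z)" by (rule pot[OF t'(1)])
  have e1: "aff.e1 r = Dr E (t, r)" using slice_deriv[OF t'(1)] E_r[OF t'(2)] by simp
  have "P (t, r) = aff.e1 r + r * aff.e2 r" using e1 slice_deriv2[OF assms(1,2)] by (simp add: P_def)
  then have P: "P (t, r) = 4 * r * aff.G r" using assms by (simp add: aff.G_eq field_simps)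
  then show "P (t, r) = 4 * r * g_at u t (r\<^sup>2)" using assms by (simp add: g_at_def aff.g_def)
  show "P (t, r) > 0" unfolding P using assms aff.G_pos[of r] by simp
  show "4 * ddbar (\<lambda>z. u (t, z)) (complex_of_real r) = P (t, r) / r" using P assms by (simp add: aff.G_def)
  show "y_at u t (r\<^sup>2) = r * Dr E (t, r) / 2" using assms e1 by (simp add: y_at_def aff.y_def)
qed

definition istrip' :: "(real \<times> real) set" where "istrip' = {0<..<1} \<times> {0<..}"

lemma istrip': "open istrip'" "istrip' \<subseteq> istrip" "p \<in> istrip' \<Longrightarrow> snd p > 0" "p \<in> istrip' \<Longrightarrow> P p > 0"
  using P_eq(2) by (auto simp: istrip'_def istrip_def intro!: open_Times)

lemma E_tt: assumes p: "p \<in> istrip'" shows "Dt (Dt E) p = snd p * (Dr (Dt E) p)\<^sup>2 / P p"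
proof -
  obtain t r where tr: "p = (t, r)" "0 < t" "t < 1" "r > 0" using p by (auto simp: istrip'_def)
  have "P (t, r) / r * Dt (Dt E) (t, r) = (Dr (Dt E) (t, r))\<^sup>2"
    using geod[OF tr(2,3), of r] P_eq(3)[OF tr(2-4)] by (simp add: E_def[abs_def])
  then show ?thesis using tr P_eq(2)[OF tr(2-4)] by (simp add: field_simps)
qed

lemma V_deriv: assumes p: "p \<in> istrip'" 
  shows "(V has_derivative (\<lambda>h. (- 2 * frechet_derivative (Dr (Dt E)) (at p) h * P p
     + 2 * Dr (Dt E) p * frechet_derivative P (at p) h) / (P p)\<^sup>2)) (at p)"
proof -
  have p': "p \<in> istrip" using p istrip' by blast
  have "(V has_derivative (\<lambda>h. ((- 2 * frechet_derivative (Dr (Dt E)) (at p) h) * P p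
     - (- 2 * Dr (Dt E) p) * frechet_derivative P (at p) h) / (P p * P p))) (at p)"
    unfolding V_def using istrip'(4)[OF p]
    by (intro has_derivative_divide' has_der[OF ck_P p'] has_derivative_mult_right has_der[OF ck_Dr[OF ck_Dt[OF ck_E]] p']) auto
  then show ?thesis by (simp add: power2_eq_square)
qed

text \<open>Differentiating the geodesic equation in r expresses the derivative of E in t, t, r, and
  commuting partials gives \<open>Dt P\<close>; the rest is algebra. The factor
  \<open>snd p / 2\<close> is the change from \<rho> = 2 ln r to r.\<close>

lemma burgers: assumes p: "p \<in> istrip'" shows "Dt V p + V p * (snd p / 2) * Dr V p = 0"
proof -
  have p': "p \<in> istrip" using p istrip' by blast
  define a where "a = Dr (Dt E) p"
  define b where "b = Dr (Dr (Dt E)) p"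
  define r where "r = snd p"
  define q where "q = P p"
  define c where "c = Dr P p"
  have q: "q > 0" "r > 0" using istrip' p by (auto simp: q_def r_def)
  have V': "frechet_derivative V (at p) = (\<lambda>h. (- 2 * frechet_derivative (Dr (Dt E)) (at p) h * P p
     + 2 * Dr (Dt E) p * frechet_derivative P (at p) h) / (P p)\<^sup>2)"
    using frechet_derivative_at[OF V_deriv[OF p]] by simp
  have Pt: "Dt P p = a + r * b"
  proof -
    have "(P has_derivative (\<lambda>h. frechet_derivative (Dr E) (at p) h +
        (snd p * frechet_derivative (Dr (Dr E)) (at p) h + snd h * Dr (Dr E) p))) (at p)"
      unfolding P_def
      by (intro has_derivative_add has_derivative_mult has_derivative_snd has_derivative_ident
          has_der[OF ck_Dr[OF ck_E] p'] has_der[OF ck_Dr[OF ck_Dr[OF ck_E]] p'])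
    then have "frechet_derivative P (at p) = (\<lambda>h. frechet_derivative (Dr E) (at p) h +
        (snd p * frechet_derivative (Dr (Dr E)) (at p) h + snd h * Dr (Dr E) p))"
      by (rule frechet_derivative_at[symmetric])
    then have "Dt P p = Dt (Dr E) p + r * Dt (Dr (Dr E)) p" by (simp add: r_def)
    also have "Dt (Dr E) p = a" unfolding a_def by (rule commute[OF ck_E p'])
    also have "Dt (Dr (Dr E)) p = Dr (Dt (Dr E)) p" by (rule commute[OF ck_Dr[OF ck_E] p'])
    also have "frechet_derivative (Dt (Dr E)) (at p) = frechet_derivative (Dr (Dt E)) (at p)"
      by (rule frechet_cong_open[OF istrip(1) p']) (rule commute[OF ck_E])
    finally show ?thesis by (simp add: b_def)
  qed
  have Ettr: "Dt (Dr (Dt E)) p = a\<^sup>2 / q + 2 * r * a * b / q - r * a\<^sup>2 * c / q\<^sup>2"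
  proof -
    have "Dt (Dr (Dt E)) p = Dr (Dt (Dt E)) p" by (rule commute[OF ck_Dt[OF ck_E] p'])
    also have "frechet_derivative (Dt (Dt E)) (at p) = frechet_derivative (\<lambda>p. snd p * (Dr (Dt E) p)\<^sup>2 / P p) (at p)"
      by (rule frechet_cong_open[OF istrip'(1) p]) (rule E_tt)
    also have "\<dots> = (\<lambda>h. ((snd p * (2 * Dr (Dt E) p * frechet_derivative (Dr (Dt E)) (at p) h) + snd h * (Dr (Dt E) p)\<^sup>2) * P p
        - snd p * (Dr (Dt E) p)\<^sup>2 * frechet_derivative P (at p) h) / (P p * P p))"
    proof (rule frechet_derivative_at[symmetric])
      have sq: "((\<lambda>p. (Dr (Dt E) p)\<^sup>2) has_derivative (\<lambda>h. 2 * Dr (Dt E) p * frechet_derivative (Dr (Dt E)) (at p) h)) (at p)"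
        using has_derivative_power[OF has_der[OF ck_Dr[OF ck_Dt[OF ck_E]] p'], of 2] by (simp add: mult_ac)
      show "((\<lambda>p. snd p * (Dr (Dt E) p)\<^sup>2 / P p) has_derivative (\<lambda>h. ((snd p * (2 * Dr (Dt E) p * frechet_derivative (Dr (Dt E)) (at p) h) + snd h * (Dr (Dt E) p)\<^sup>2) * P p
        - snd p * (Dr (Dt E) p)\<^sup>2 * frechet_derivative P (at p) h) / (P p * P p))) (at p)"
        using istrip'(4)[OF p]
        by (intro has_derivative_divide' has_der[OF ck_P p'] has_derivative_mult has_derivative_snd has_derivative_ident sq) auto
    qed
    finally have "Dt (Dr (Dt E)) p = ((r * (2 * a * b) + 1 * a\<^sup>2) * q - r * a\<^sup>2 * c) / (q * q)"
      by (simp add: a_def b_def c_def q_def r_def)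
    also have "\<dots> = a\<^sup>2 / q + 2 * r * a * b / q - r * a\<^sup>2 * c / q\<^sup>2"
      using q by (simp add: field_simps power2_eq_square)
    finally show ?thesis .
  qed
  have Vt: "Dt V p = (- 2 * (a\<^sup>2 / q + 2 * r * a * b / q - r * a\<^sup>2 * c / q\<^sup>2) * q + 2 * a * (a + r * b)) / q\<^sup>2"
    unfolding V' using Ettr Pt by (simp add: a_def[symmetric] q_def[symmetric])
  have Vr: "Dr V p = (- 2 * b * q + 2 * a * c) / q\<^sup>2"
    unfolding V' by (simp add: a_def b_def c_def q_def)
  have Veq: "V p = - 2 * a / q" by (simp add: V_def a_def q_def)
  show ?thesis unfolding Vt Vr r_def[symmetric] Veq using q
    by (simp add: field_simps power2_eq_square)
qed

definition "ray t r V0 s = r * exp ((s - t) * V0 / 2)"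

text \<open>Along the ray of initial speed V0 the function V - V0 solves a homogeneous linear
  equation and vanishes at time t, hence everywhere. The derivative of the moment along the ray is
  then a multiple of \<open>Dr (Dt E) + V * P / 2\<close>, which is 0 by the definition of
  V.\<close>

lemma characteristic:
  assumes t: "0 < t" "t < 1" and r: "r > 0"
  shows "\<And>s. 0 < s \<Longrightarrow> s < 1 \<Longrightarrow> V (s, ray t r (V (t, r)) s) = V (t, r)"
    "\<And>s. s \<in> {0..1} \<Longrightarrow> y_at u s ((ray t r (V (t, r)) s)\<^sup>2) = y_at u t (r\<^sup>2)"
proof -
  define V0 where "V0 = V (t, r)"
  define \<gamma> where "\<gamma> = ray t r V0"
  have \<gamma>: "\<gamma> s > 0" "(\<gamma> has_real_derivative \<gamma> s * V0 / 2) (at s)" for s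
    using r by (auto simp: \<gamma>_def ray_def[abs_def] intro!: derivative_eq_intros)
  have \<gamma>_cont: "continuous_on S \<gamma>" for S
    using \<gamma>(2) by (intro continuous_at_imp_continuous_on ballI DERIV_isCont)
  have in': "(s, \<gamma> s) \<in> istrip'" if "0 < s" "s < 1" for s using that \<gamma> by (simp add: istrip'_def)
  \<comment> \<open>The curve moves with speed V0 rather than V, so Burgers' equation leaves a term
    proportional to V - V0.\<close>
  define c where "c s = - (\<gamma> s / 2 * Dr V (s, \<gamma> s))" for s
  have W: "((\<lambda>s. V (s, \<gamma> s) - V0) has_real_derivative c s * (V (s, \<gamma> s) - V0)) (at s)" if "0 < s" "s < 1" for s
  proof -
    note p = in'[OF that]
    have hd: "(V has_derivative frechet_derivative V (at (s, \<gamma> s))) (at (s, \<gamma> s))"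
      using V_deriv[OF p] frechet_derivative_at[OF V_deriv[OF p]] by simp
    have "((\<lambda>s. V (s, \<gamma> s) - V0) has_real_derivative (Dt V (s, \<gamma> s) + \<gamma> s * V0 / 2 * Dr V (s, \<gamma> s)) - 0) (at s)"
      by (intro DERIV_diff deriv_along[OF hd \<gamma>(2)] DERIV_const)
    moreover have "Dt V (s, \<gamma> s) = - (V (s, \<gamma> s) * (\<gamma> s / 2) * Dr V (s, \<gamma> s))"
      using burgers[OF p] by simp
    then have "(Dt V (s, \<gamma> s) + \<gamma> s * V0 / 2 * Dr V (s, \<gamma> s)) - 0 = c s * (V (s, \<gamma> s) - V0)"
      by (simp add: c_def field_simps)
    ultimately show ?thesis by (simp only:)
  qed
  have V_const: "V (s, \<gamma> s) = V0" if s: "0 < s" "s < 1" for s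
  proof -
    \<comment> \<open>Between s and t, away from the ends of the time interval, c is bounded by
      compactness.\<close>
    define a where "a = min s t"
    define b where "b = max s t"
    have ab: "0 < a" "b < 1" "a \<le> t" "t \<le> b" "s \<in> {a..b}" using s t by (auto simp: a_def b_def)
    have "continuous_on istrip' (\<lambda>p. Dr V p)"
    proof -
      have ckc: "continuous_on istrip' F" if "\<And>n. ck n istrip F" for F
        using ck_imp_continuous_on[OF that[of 0]] istrip'(2) continuous_on_subset by blast
      have "continuous_on istrip' (\<lambda>p. (- 2 * Dr (Dr (Dt E)) p * P p + 2 * Dr (Dt E) p * Dr P p) / (P p)\<^sup>2)"
        using istrip'(4) by (intro continuous_intros ckc ck_Dr ck_Dt ck_E ck_P) force
      then show ?thesis
      proof (rule continuous_on_eq)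
        show "(- 2 * Dr (Dr (Dt E)) p * P p + 2 * Dr (Dt E) p * Dr P p) / (P p)\<^sup>2 = Dr V p" if "p \<in> istrip'" for p
          using fun_cong[OF frechet_derivative_at[OF V_deriv[OF that]], of "(0, 1)"] .
      qed
    qed
    then have "continuous_on {a..b} (\<lambda>s. Dr V (s, \<gamma> s))"
      by (rule continuous_on_compose2[of istrip' "\<lambda>p. Dr V p" "{a..b}" "\<lambda>s. (s, \<gamma> s)"])
         (use in' ab in \<open>auto intro!: continuous_intros \<gamma>_cont\<close>)
    then have "continuous_on {a..b} c" unfolding c_def by (auto intro!: continuous_intros \<gamma>_cont)
    then have "bounded (c ` {a..b})" using compact_continuous_image compact_imp_bounded by blast
    then obtain M where "\<forall>s\<in>{a..b}. \<bar>c s\<bar> \<le> M" by (auto simp: bounded_iff)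
    then have M: "\<bar>c s\<bar> \<le> M" if "s \<in> {a..b}" for s using that by blast
    have "V (s, \<gamma> s) - V0 = 0"
    proof (rule linear_ode_unique[OF ab(3,4) _ M _ ab(5)])
      show "((\<lambda>s. V (s, \<gamma> s) - V0) has_real_derivative c s * (V (s, \<gamma> s) - V0)) (at s)" if "s \<in> {a..b}" for s
        using W[of s] that ab by auto
      show "V (t, \<gamma> t) - V0 = 0" by (simp add: V0_def \<gamma>_def ray_def)
    qed
    then show ?thesis by simp
  qed
  then show "\<And>s. 0 < s \<Longrightarrow> s < 1 \<Longrightarrow> V (s, ray t r (V (t, r)) s) = V (t, r)"
    by (simp add: \<gamma>_def V0_def)
  \<comment> \<open>With \<open>E_r\<close> in place of \<open>Dr E\<close>, Y is continuous on the
    closed interval, and constancy of the moment reaches the end metrics.\<close>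
  define Y where "Y s = \<gamma> s * E_r (s, \<gamma> s) / 2" for s
  have Y_eq: "y_at u s ((\<gamma> s)\<^sup>2) = Y s" if "s \<in> {0..1}" for s
  proof -
    interpret potential "\<lambda>z. u (s, z)" "\<lambda>z. v (s, z)" by (rule pot[OF that])
    show ?thesis using \<gamma>(1)[of s] slice_deriv[OF that] by (simp add: y_at_def aff.y_def Y_def)
  qed
  have "(Y has_real_derivative 0) (at s)" if s: "0 < s" "s < 1" for s
  proof -
    note p = in'[OF s]
    have p': "(s, \<gamma> s) \<in> istrip" using p istrip' by blast
    have "((\<lambda>s. \<gamma> s * Dr E (s, \<gamma> s) / 2) has_real_derivative
       (\<gamma> s * (Dt (Dr E) (s, \<gamma> s) + \<gamma> s * V0 / 2 * Dr (Dr E) (s, \<gamma> s)) + \<gamma> s * V0 / 2 * Dr E (s, \<gamma> s)) / 2) (at s)"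
      by (intro DERIV_cdivide DERIV_mult' \<gamma>(2) deriv_along[OF has_der[OF ck_Dr[OF ck_E] p'] \<gamma>(2)])
    moreover have "(\<gamma> s * (Dt (Dr E) (s, \<gamma> s) + \<gamma> s * V0 / 2 * Dr (Dr E) (s, \<gamma> s)) + \<gamma> s * V0 / 2 * Dr E (s, \<gamma> s)) / 2
       = \<gamma> s / 2 * (Dt (Dr E) (s, \<gamma> s) + V0 / 2 * P (s, \<gamma> s))"
      by (simp add: P_def algebra_simps add_divide_distrib)
    moreover have "V0 / 2 * P (s, \<gamma> s) = - Dr (Dt E) (s, \<gamma> s)"
      using V_const[OF s] istrip'(4)[OF p] by (simp add: V_def field_simps)
    then have "\<gamma> s / 2 * (Dt (Dr E) (s, \<gamma> s) + V0 / 2 * P (s, \<gamma> s)) = 0"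
      using commute[OF ck_E p'] by simp
    ultimately have "((\<lambda>s. \<gamma> s * Dr E (s, \<gamma> s) / 2) has_real_derivative 0) (at s)"
      by (simp only:)
    then show ?thesis
    proof (rule has_field_derivative_transform_within_open[where S = "{0<..<1}"])
      fix a :: real assume "a \<in> {0<..<1}"
      then have "(a, \<gamma> a) \<in> istrip" using in'[of a] istrip'(2) by auto
      then show "\<gamma> a * Dr E (a, \<gamma> a) / 2 = Y a" using E_r by (simp add: Y_def)
    qed (use s in auto)
  qed
  moreover have "continuous_on {0..1} Y"
  proof -
    have "continuous_on {0..1} (\<lambda>s. E_r (s, \<gamma> s))"
      by (rule continuous_on_compose2[OF E_r_cont]) (auto intro!: continuous_intros \<gamma>_cont simp: strip_def)
    then show ?thesis unfolding Y_def by (auto intro!: continuous_intros \<gamma>_cont)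
  qed
  ultimately have Yc: "Y s = Y 0" if "s \<in> {0..1}" for s
    using DERIV_isconst2[of 0 1 Y s] that by auto
  show "y_at u s ((ray t r (V (t, r)) s)\<^sup>2) = y_at u t (r\<^sup>2)" if "s \<in> {0..1}" for s
  proof -
    have "\<gamma> t = r" by (simp add: \<gamma>_def ray_def)
    then show ?thesis using Y_eq[OF that] Y_eq[of t] Yc[OF that] Yc[of t] t by (simp add: \<gamma>_def V0_def)
  qed
qed

text \<open>The ray carries the moment y unchanged to time s, so the inverse moment map of time s
  sends y to the square of the radius reached there.\<close>

lemma l_characteristic:
  assumes t: "0 < t" "t < 1" and r: "r > 0" and s: "s \<in> {0..1}"
  defines "y \<equiv> y_at u t (r\<^sup>2)"
  shows "l_at u s y = ln y - ln (r\<^sup>2) - (s - t) * V (t, r)"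
proof -
  interpret potential "\<lambda>z. u (s, z)" "\<lambda>z. v (s, z)" by (rule pot[OF s])
  define x where "x = (ray t r (V (t, r)) s)\<^sup>2"
  have x: "x > 0" using r by (simp add: x_def ray_def)
  have "radial.y (\<lambda>z. u (s, z)) x = y" using characteristic(2)[OF t r s] by (simp add: x_def y_def y_at_def)
  then have "X y = x" using X_y[OF x] by simp
  moreover have "ln x = ln (r\<^sup>2) + (s - t) * V (t, r)"
    using r by (simp add: x_def ray_def ln_mult ln_realpow power_mult_distrib flip: exp_double)
  ultimately show ?thesis by (simp add: l_at_def l_def)
qed

text \<open>\<open>l_characteristic\<close> at s = 0 and s = 1: in the convex combination with
  weights 1 - t and t the terms in V cancel, and the difference of the two identities gives V. The
  second derivatives follow from the definition of V and the geodesic equation.\<close>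

lemma geodesic_facts:
  assumes t: "0 < t" "t < 1" and r: "r > 0"
  defines "x \<equiv> r\<^sup>2" defines "y \<equiv> y_at u t x" defines "g \<equiv> g_at u t x"
  shows "y = x * exp ((1 - t) * l_at u 0 y + t * l_at u 1 y)"
    "Dr (Dt E) (t, r) = 2 * r * g * (l_at u 1 y - l_at u 0 y)"
    "Dt (Dt E) (t, r) = x * g * (l_at u 1 y - l_at u 0 y)\<^sup>2"
    "0 < y" "y < 1" "g > 0"
proof -
  have t': "t \<in> {0..1}" "(t, r) \<in> istrip'" using t r by (auto simp: istrip'_def)
  interpret potential "\<lambda>z. u (t, z)" "\<lambda>z. v (t, z)" by (rule pot[OF t'(1)])
  have x: "x > 0" using r by (simp add: x_def)
  show y: "0 < y" "y < 1" using y_range[OF x] by (auto simp: y_def y_at_def)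
  show g: "g > 0" using aff.g_pos by (simp add: g_def g_at_def)
  have l0: "l_at u 0 y = ln y - ln x + t * V (t, r)"
    using l_characteristic[OF t r, of 0, folded x_def, folded y_def] by simp
  have l1: "l_at u 1 y = ln y - ln x - (1 - t) * V (t, r)"
    using l_characteristic[OF t r, of 1, folded x_def, folded y_def] by simp
  have "(1 - t) * l_at u 0 y + t * l_at u 1 y = ln y - ln x"
    unfolding l0 l1 by (simp add: algebra_simps)
  then show "y = x * exp ((1 - t) * l_at u 0 y + t * l_at u 1 y)"
    using x y by (simp add: exp_diff)
  have V: "V (t, r) = - (l_at u 1 y - l_at u 0 y)" unfolding l0 l1 by (simp add: algebra_simps)
  have P: "P (t, r) = 4 * r * g" using P_eq(1)[OF t r] by (simp add: g_def x_def)
  show 1: "Dr (Dt E) (t, r) = 2 * r * g * (l_at u 1 y - l_at u 0 y)"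
  proof -
    have "- 2 * Dr (Dt E) (t, r) = V (t, r) * P (t, r)" using P_eq(2)[OF t r] by (simp add: V_def)
    moreover have "D = 2 * r * g * L" if "- 2 * D = - L * (4 * r * g)" for D L :: real using that by simp
    ultimately show ?thesis unfolding V P by blast
  qed
  show "Dt (Dt E) (t, r) = x * g * (l_at u 1 y - l_at u 0 y)\<^sup>2"
  proof -
    have "r * (2 * r * g * L)\<^sup>2 / (4 * r * g) = x * g * L\<^sup>2" for L
      using r g by (simp add: x_def power2_eq_square)
    then show ?thesis using E_tt[OF t'(2)] unfolding P 1 by simp
  qed
qed

text \<open>Implicit differentiation in x of the first identity of \<open>geodesic_facts\<close>,
  which holds for all positive x at fixed t.\<close>

lemma g_formula:
  assumes t: "0 < t" "t < 1" and r: "r > 0"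
  defines "x \<equiv> r\<^sup>2" defines "y \<equiv> y_at u t x"
  shows "g_at u t x * (1 - y * ((1 - t) * l'_at u 0 y + t * l'_at u 1 y)) = y / x"
proof -
  have t': "t \<in> {0..1}" using t by auto
  interpret p0: potential "\<lambda>z. u (0, z)" "\<lambda>z. v (0, z)" by (rule pot) simp
  interpret p1: potential "\<lambda>z. u (1, z)" "\<lambda>z. v (1, z)" by (rule pot) simp
  interpret pt: potential "\<lambda>z. u (t, z)" "\<lambda>z. v (t, z)" by (rule pot[OF t'])
  have x: "x > 0" using r by (simp add: x_def)
  define L where "L s = (1 - t) * l_at u 0 s + t * l_at u 1 s" for s
  define L' where "L' = (1 - t) * l'_at u 0 y + t * l'_at u 1 y"
  have id: "pt.y s = s * exp (L (pt.y s))" if "s > 0" for s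
    using geodesic_facts(1)[OF t, of "sqrt s"] that by (simp add: L_def y_at_def)
  have y: "0 < y" "y < 1" "y = pt.y x" using pt.y_range[OF x] by (auto simp: y_def y_at_def)
  have "(L has_real_derivative L') (at y)"
    unfolding L_def L'_def l_at_def l'_at_def
    by (intro DERIV_add DERIV_cmult p0.l_deriv p1.l_deriv y)
  then have "((\<lambda>s. L (pt.y s)) has_real_derivative L' * pt.g x) (at x)"
    unfolding y(3) by (rule DERIV_chain2[OF _ pt.aff.y[OF x]])
  then have "((\<lambda>s. s * exp (L (pt.y s))) has_real_derivative 1 * exp (L (pt.y x)) + exp (L (pt.y x)) * (L' * pt.g x) * x) (at x)"
    by (intro DERIV_mult DERIV_ident DERIV_fun_exp)
  then have "(pt.y has_real_derivative 1 * exp (L (pt.y x)) + exp (L (pt.y x)) * (L' * pt.g x) * x) (at x)"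
    by (rule has_field_derivative_transform_within_open[where S = "{0<..}"]) (use x id in auto)
  from DERIV_unique[OF this pt.aff.y[OF x]]
  have "pt.g x = exp (L (pt.y x)) + (x * exp (L (pt.y x))) * (L' * pt.g x)" by (simp add: algebra_simps)
  also have "x * exp (L (pt.y x)) = y" using id[OF x] y by simp
  also have "exp (L (pt.y x)) = y / x" using id[OF x] y x by (simp add: field_simps)
  finally show ?thesis by (simp add: L'_def g_at_def algebra_simps)
qed

section \<open>The geodesic at the origin\<close>

lemma E_even: "t \<in> {0..1} \<Longrightarrow> E (t, - r) = E (t, r)"
proof -
  assume t: "t \<in> {0..1}"
  interpret potential "\<lambda>z. u (t, z)" "\<lambda>z. v (t, z)" by (rule pot[OF t])
  show ?thesis using aff.e_even[of r] by (simp add: aff.e_def E_def)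
qed

text \<open>At r = 0 evenness kills the mixed derivative, so the geodesic equation leaves a
  vanishing second time derivative, and the potential is affine in t.\<close>

lemma E_at_0: 
  assumes t: "t \<in> {0..1}" shows "u (t, 0) = (1 - t) * u (0, 0) + t * u (1, 0)"
proof -
  have in': "(t, r) \<in> istrip" if "0 < t" "t < 1" for t r using that by (simp add: istrip_def)
  have d: "((\<lambda>s. F (s, r)) has_real_derivative Dt F (t, r)) (at t)"
    if "\<And>n. ck n istrip F" "0 < t" "t < 1" for F t r
    using deriv_along[OF has_der[OF that(1) in'[OF that(2,3)]], of "\<lambda>_. r" 0] by simp
  have dr: "((\<lambda>r. F (t, r)) has_real_derivative Dr F (t, r)) (at r)"
    if "\<And>n. ck n istrip F" "0 < t" "t < 1" for F t r
  proof -
    have "((\<lambda>s. F (t, s)) has_derivative (\<lambda>h. frechet_derivative F (at (t, r)) (0, h))) (at r)"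
      by (rule has_derivative_compose[where f = "\<lambda>s. (t, s)", OF _ has_der[OF that(1) in'[OF that(2,3)]]])
         (auto intro!: derivative_eq_intros)
    moreover have "frechet_derivative F (at (t, r)) (0, h) = Dr F (t, r) * h" for h
      using linear_cmul[OF has_derivative_linear[OF has_der[OF that(1) in'[OF that(2,3)]]], of r h "(0, 1)"] by (simp add: mult.commute)
    then have "(\<lambda>h. frechet_derivative F (at (t, r)) (0, h)) = (*) (Dr F (t, r))" by (intro ext)
    ultimately show ?thesis unfolding has_field_derivative_def by (simp only:)
  qed
  have Et_even: "Dt E (t, - r) = Dt E (t, r)" if "0 < t" "t < 1" for t r
  proof -
    have "((\<lambda>s. E (s, - r)) has_real_derivative Dt E (t, - r)) (at t)" by (rule d[OF ck_E that])
    then have "((\<lambda>s. E (s, r)) has_real_derivative Dt E (t, - r)) (at t)"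
      by (rule has_field_derivative_transform_within_open[where S = "{0<..<1}"]) (use that E_even in auto)
    then show ?thesis using d[OF ck_E that] DERIV_unique by blast
  qed
  have Etr0: "Dr (Dt E) (t, 0) = 0" if "0 < t" "t < 1" for t
  proof -
    have "((\<lambda>r. Dt E (t, - r)) has_real_derivative - Dr (Dt E) (t, 0)) (at 0)"
      using dr[OF ck_Dt[OF ck_E] that, of 0] DERIV_mirror[where f = "\<lambda>r. Dt E (t, r)" and x = 0 and y = "Dr (Dt E) (t, 0)"]
      by simp
    then have "((\<lambda>r. Dt E (t, r)) has_real_derivative - Dr (Dt E) (t, 0)) (at 0)" using Et_even[OF that] by simp
    from DERIV_unique[OF this dr[OF ck_Dt[OF ck_E] that]] show ?thesis by simp
  qed
  have Ett0: "Dt (Dt E) (t, 0) = 0" if "0 < t" "t < 1" for t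
  proof -
    have t': "t \<in> {0..1}" using that by simp
    interpret potential "\<lambda>z. u (t, z)" "\<lambda>z. v (t, z)" by (rule pot[OF t'])
    show ?thesis using geod[OF that, of 0] Etr0[OF that] aff.ddbar_pos[of 0] by (simp add: E_def[abs_def])
  qed
  have c: "Dt E (s, 0) = Dt E (1 / 2, 0)" if "0 < s" "s < 1" for s
  proof (rule has_field_derivative_zero_constant[of "{0<..<1}" "\<lambda>s. Dt E (s, 0)", THEN exE])
    show "((\<lambda>s. Dt E (s, 0)) has_real_derivative 0) (at s within {0<..<1})" if "s \<in> {0<..<1}" for s
      using d[OF ck_Dt[OF ck_E], of s 0] Ett0[of s] that by (auto intro: has_field_derivative_at_within)
    show "Dt E (s, 0) = Dt E (1 / 2, 0)" if "\<forall>x\<in>{0<..<1}. Dt E (x, 0) = c" for c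
      using that \<open>0 < s\<close> \<open>s < 1\<close> by simp
  qed auto
  define k where "k = Dt E (1 / 2, 0)"
  have cont: "continuous_on {0..1} (\<lambda>s. E (s, 0) - k * s)"
  proof -
    have "continuous_on strip E" using ck_E_strip ck_imp_continuous_on by blast
    then have "continuous_on {0..1} (\<lambda>s. E (s, 0))"
      by (rule continuous_on_compose2) (auto intro!: continuous_intros simp: strip_def)
    then show ?thesis by (intro continuous_intros)
  qed
  have "((\<lambda>s. E (s, 0) - k * s) has_real_derivative 0) (at s)" if "0 < s" "s < 1" for s
    using d[OF ck_E that, of 0] c[OF that] by (auto intro!: derivative_eq_intros simp: k_def)
  then have con: "E (s, 0) - k * s = E (0, 0) - k * 0" if "s \<in> {0..1}" for s
    using DERIV_isconst2[of 0 1 "\<lambda>s. E (s, 0) - k * s" s] cont that by auto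
  have "E (t, 0) = E (0, 0) + k * t" "E (1, 0) = E (0, 0) + k" using con[OF t] con[of 1] by auto
  then have "E (t, 0) = (1 - t) * E (0, 0) + t * E (1, 0)" by (simp add: algebra_simps)
  then show ?thesis by (simp add: E_def)
qed

end

section \<open>Geometric interpolation of two sequences of norming constants\<close>

lemma abs_exp_diff_le:
  assumes "a \<le> M" "b \<le> M"
  shows "\<bar>exp a - exp b\<bar> \<le> exp M * \<bar>a - (b::real)\<bar>"
proof -
  have *: "exp a - exp b \<le> exp M * \<bar>a - b\<bar>" if "a \<le> M" for a b
  proof -
    have "exp a - exp b = exp a * (1 - exp (b - a))" by (simp add: exp_diff right_diff_distrib)
    also have "\<dots> \<le> exp a * (a - b)" 
    proof (rule mult_left_mono)
      show "1 - exp (b - a) \<le> a - b" using exp_ge_add_one_self[of "b - a"] by linarith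
    qed simp
    also have "\<dots> \<le> exp a * \<bar>a - b\<bar>" by (intro mult_left_mono) auto
    also have "\<dots> \<le> exp M * \<bar>a - b\<bar>" using that by (intro mult_right_mono) auto
    finally show ?thesis .
  qed
  show ?thesis using *[of a b] *[of b a] assms by (simp add: abs_le_iff abs_minus_commute)
qed

lemma telescope_bound:
  fixes S :: "nat \<Rightarrow> real"
  assumes "a \<le> c" "\<And>j. a \<le> j \<Longrightarrow> j < c \<Longrightarrow> \<bar>S (Suc j) - S j\<bar> \<le> b"
  shows "\<bar>S c - S a\<bar> \<le> real (c - a) * b"
  using assms
proof (induction rule: dec_induct)
  case base
  then show ?case by simp
next
  case (step n)
  have "\<bar>S (Suc n) - S a\<bar> \<le> \<bar>S (Suc n) - S n\<bar> + \<bar>S n - S a\<bar>" by linarith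
  also have "\<dots> \<le> b + real (n - a) * b" using step by (intro add_mono) auto
  also have "\<dots> = real (Suc n - a) * b" using step by (simp add: Suc_diff_le algebra_simps)
  finally show ?case .
qed

text \<open>\<open>q k\<close> plays the role of a norming constant and \<open>l v\<close> that of \<open>ln (y / x)\<close> at the point of
  moment \<open>y = v\<close>. All hypotheses survive geometric interpolation of \<open>q\<close>.\<close>

locale weight =
  fixes N :: nat and \<delta> K :: real and q :: "nat \<Rightarrow> real" and l l' :: "real \<Rightarrow> real"
  assumes \<delta>: "0 < \<delta>" "\<delta> \<le> 1 / 3" and K: "K \<ge> 1" and N: "N \<ge> K" "N * \<delta> \<ge> 1"
    and q_pos: "k \<le> N \<Longrightarrow> q k > 0"
    and log_convex: "k + 2 \<le> N \<Longrightarrow> q (k + 1) ^ 2 \<le> q k * q (k + 2)"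
    and ln_q: "k \<le> N \<Longrightarrow> \<bar>ln (q k)\<bar> \<le> N * K"
    and l_deriv: "0 < v \<Longrightarrow> v \<le> 1 - \<delta> \<Longrightarrow> (l has_real_derivative l' v) (at v)"
    and l_le: "0 < v \<Longrightarrow> v \<le> 1 - \<delta> \<Longrightarrow> \<bar>l v\<bar> \<le> K"
    and l'_le: "0 < v \<Longrightarrow> v \<le> 1 - \<delta> \<Longrightarrow> \<bar>l' v\<bar> \<le> K"
    and l'_lip: "0 < v \<Longrightarrow> v \<le> 1 - \<delta> \<Longrightarrow> 0 < w \<Longrightarrow> w \<le> 1 - \<delta> \<Longrightarrow> \<bar>l' v - l' w\<bar> \<le> K * \<bar>v - w\<bar>"
    and l'_denom: "0 < v \<Longrightarrow> v \<le> 1 - \<delta> \<Longrightarrow> 1 / K \<le> 1 - v * l' v"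
    and ratio: "k < N \<Longrightarrow> real (k + 1) / N \<le> 1 - \<delta> \<Longrightarrow>
      \<bar>ln (real (k + 1) / N * (q k / q (k + 1))) - l (real (k + 1) / N)\<bar> \<le> K / N"

text \<open>The hypotheses bound affine expressions, or their absolute values, in
  \<open>ln q\<close>, l and l'; log-convexity becomes linear after taking logarithms. Convex
  combination therefore keeps the constants.\<close>

lemma weight_interpolate:
  assumes 0: "weight N \<delta> K q0 l0 l0'" and 1: "weight N \<delta> K q1 l1 l1'" and t: "0 \<le> t" "t \<le> 1"
  shows "weight N \<delta> K (\<lambda>k. exp ((1 - t) * ln (q0 k) + t * ln (q1 k)))
     (\<lambda>v. (1 - t) * l0 v + t * l1 v) (\<lambda>v. (1 - t) * l0' v + t * l1' v)"
proof -
  interpret w0: weight N \<delta> K q0 l0 l0' by (rule 0)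
  interpret w1: weight N \<delta> K q1 l1 l1' by (rule 1)
  have conv: "\<bar>(1 - t) * a + t * b\<bar> \<le> M" if "\<bar>a\<bar> \<le> M" "\<bar>b\<bar> \<le> M" for a b M
  proof -
    have "\<bar>(1 - t) * a + t * b\<bar> \<le> (1 - t) * \<bar>a\<bar> + t * \<bar>b\<bar>"
      using t by (metis abs_mult abs_of_nonneg abs_triangle_ineq diff_ge_0_iff_ge)
    also have "\<dots> \<le> (1 - t) * M + t * M" using t that by (intro add_mono mult_left_mono) auto
    finally show ?thesis by (simp add: algebra_simps)
  qed
  have lnq: "ln (q (k + 1)) * 2 \<le> ln (q k) + ln (q (k + 2))" if w: "weight N \<delta> K q l l'" and k: "k + 2 \<le> N" for q l l' k
  proof -
    have p: "q k > 0" "q (k + 1) > 0" "q (k + 2) > 0" using weight.q_pos[OF w] k by auto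
    have "ln (q (k + 1) ^ 2) \<le> ln (q k * q (k + 2))"
      using weight.log_convex[OF w k] p by (subst ln_le_cancel_iff) auto
    then show ?thesis using p by (simp add: ln_realpow ln_mult)
  qed
  show ?thesis
  proof
    show "0 < \<delta>" "\<delta> \<le> 1 / 3" "1 \<le> K" "K \<le> real N" "1 \<le> real N * \<delta>" using w0.\<delta> w0.K w0.N by auto
    show "0 < exp ((1 - t) * ln (q0 k) + t * ln (q1 k))" for k by simp
    show "\<bar>ln (exp ((1 - t) * ln (q0 k) + t * ln (q1 k)))\<bar> \<le> real N * K" if "k \<le> N" for k
      using conv[OF w0.ln_q[OF that] w1.ln_q[OF that]] by simp
    show "(exp ((1 - t) * ln (q0 (k + 1)) + t * ln (q1 (k + 1))))\<^sup>2
         \<le> exp ((1 - t) * ln (q0 k) + t * ln (q1 k)) * exp ((1 - t) * ln (q0 (k + 2)) + t * ln (q1 (k + 2)))"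
      if k: "k + 2 \<le> N" for k
    proof -
      have "(1 - t) * (ln (q0 (k + 1)) * 2) + t * (ln (q1 (k + 1)) * 2)
          \<le> (1 - t) * (ln (q0 k) + ln (q0 (k + 2))) + t * (ln (q1 k) + ln (q1 (k + 2)))"
        using lnq[OF 0 k] lnq[OF 1 k] t by (intro add_mono mult_left_mono) auto
      then have "2 * ((1 - t) * ln (q0 (k + 1)) + t * ln (q1 (k + 1)))
          \<le> ((1 - t) * ln (q0 k) + t * ln (q1 k)) + ((1 - t) * ln (q0 (k + 2)) + t * ln (q1 (k + 2)))"
        by (simp add: algebra_simps)
      then show ?thesis by (simp flip: exp_add exp_double)
    qed
    fix v assume v: "0 < v" "v \<le> 1 - \<delta>"
    show "((\<lambda>v. (1 - t) * l0 v + t * l1 v) has_real_derivative (1 - t) * l0' v + t * l1' v) (at v)"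
      by (intro DERIV_add DERIV_cmult w0.l_deriv w1.l_deriv v)
    show "\<bar>(1 - t) * l0 v + t * l1 v\<bar> \<le> K" "\<bar>(1 - t) * l0' v + t * l1' v\<bar> \<le> K"
      by (intro conv w0.l_le w1.l_le w0.l'_le w1.l'_le v)+
    show "1 / K \<le> 1 - v * ((1 - t) * l0' v + t * l1' v)"
    proof -
      have "1 / K = (1 - t) * (1 / K) + t * (1 / K)" by (simp only: distrib_right[symmetric]) simp
      also have "\<dots> \<le> (1 - t) * (1 - v * l0' v) + t * (1 - v * l1' v)"
        using w0.l'_denom[OF v] w1.l'_denom[OF v] t by (intro add_mono mult_left_mono) auto
      finally show ?thesis by (simp add: algebra_simps)
    qed
    fix w assume w: "0 < w" "w \<le> 1 - \<delta>"
    show "\<bar>((1 - t) * l0' v + t * l1' v) - ((1 - t) * l0' w + t * l1' w)\<bar> \<le> K * \<bar>v - w\<bar>"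
      using conv[OF w0.l'_lip[OF v w] w1.l'_lip[OF v w]] by (simp add: algebra_simps)
  next
    fix k assume k: "k < N" "real (k + 1) / N \<le> 1 - \<delta>"
    have e0: "ln (c * (exp a / exp b)) = ln c + a - b" if "c > 0" for a b c :: real
      using that by (simp add: ln_mult flip: exp_diff)
    have e: "ln (real (k + 1) / N * (exp a / exp b)) = ln (real (k + 1) / N) + a - b" for a b
      by (rule e0) (use k in simp)
    have lr: "ln (real (k + 1) / N * (q k / q (k + 1))) = ln (real (k + 1) / N) + ln (q k) - ln (q (k + 1))"
      if "q k > 0" "q (k + 1) > 0" for q
      using that k e[of "ln (q k)" "ln (q (k + 1))"] by simp
    have p: "q0 k > 0" "q0 (k + 1) > 0" "q1 k > 0" "q1 (k + 1) > 0"
      using w0.q_pos w1.q_pos k by auto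
    show "\<bar>ln (real (k + 1) / N * (exp ((1 - t) * ln (q0 k) + t * ln (q1 k)) / exp ((1 - t) * ln (q0 (k + 1)) + t * ln (q1 (k + 1)))))
        - ((1 - t) * l0 (real (k + 1) / N) + t * l1 (real (k + 1) / N))\<bar> \<le> K / N"
      using conv[OF w0.ratio[OF k] w1.ratio[OF k]] unfolding e lr[OF p(1,2)] lr[OF p(3,4)]
      by (simp add: algebra_simps)
  qed
qed

text \<open>The three margins are staggered: quotients are known up to 1 - \<delta>, the cut-off
  index lies above 1 - 2 \<delta>, and the moment y is below 1 - 3 \<delta>. Every index outside the
  known range is thus at distance at least \<delta> from y.\<close>

locale weight_at = weight +
  fixes x y :: real
  assumes x: "0 < x" "x \<le> K" and y: "0 < y" "y \<le> 1 - 3 * \<delta>" and xy: "y = x * exp (l y)"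
begin

definition "w k = 1 / q k"
definition "A = exp (K + 1)"
definition "H = exp (l y)"
definition "H' = exp (l y) * l' y"
text \<open>Small enough for the three cases of \<open>drift\<close>:
  \<open>exp (- 2 * K - 1)\<close> serves k = 0, \<open>exp (- 2 * K) / K\<close> the slope of
  \<open>Xf\<close> in the middle range, and \<delta> times the latter the tail.\<close>

definition "c = \<delta> * exp (- 2 * K - 1) / K"
definition "M = 3 * A + A * K + 2 * K\<^sup>2 * A + (1 + 6 * K\<^sup>2 * A) + 2 * A * K + 4 * (A * K * (1 + K))
   + (4 * A + A * K) / \<delta>\<^sup>2 + 10 * K + 6 * K / \<delta>\<^sup>2"

lemma A: "A \<ge> 1" using K by (simp add: A_def)

lemma Npos: "N > 0" "1 / N \<le> \<delta>" "K / N \<le> 1" "1 / real N \<le> 1"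
proof -
  show 1: "N > 0" using N K by (cases N) auto
  show "1 / N \<le> \<delta>" "K / N \<le> 1" using N 1 by (auto simp: field_simps)
  then show "1 / real N \<le> 1" using \<delta> by linarith
qed

lemma Mterms: "3 * A \<le> M" "A * K \<le> M" "2 * K\<^sup>2 * A \<le> M" "1 + 6 * K\<^sup>2 * A \<le> M"
  "2 * A * K + 4 * (A * K * (1 + K)) \<le> M" "(4 * A + A * K) / \<delta>\<^sup>2 \<le> M" "10 * K \<le> M" "6 * K / \<delta>\<^sup>2 \<le> M"
proof -
  have "0 \<le> A * K" "0 \<le> 2 * K\<^sup>2 * A" "0 \<le> 6 * K\<^sup>2 * A" "0 \<le> 2 * A * K" "0 \<le> 4 * (A * K * (1 + K))"
    "0 \<le> (4 * A + A * K) / \<delta>\<^sup>2" "0 \<le> 6 * K / \<delta>\<^sup>2" using A K \<delta> by auto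
  then show "3 * A \<le> M" "A * K \<le> M" "2 * K\<^sup>2 * A \<le> M" "1 + 6 * K\<^sup>2 * A \<le> M"
    "2 * A * K + 4 * (A * K * (1 + K)) \<le> M" "(4 * A + A * K) / \<delta>\<^sup>2 \<le> M" "10 * K \<le> M" "6 * K / \<delta>\<^sup>2 \<le> M"
    using A K unfolding M_def by linarith+
qed

text \<open>q is positive only up to N; the value 1 beyond N meets the positivity demanded by
  \<open>bergman_sum\<close>.\<close>

definition "w' k = (if k \<le> N then w k else 1)"

sublocale b: bergman_sum N w' x
  using Npos x q_pos by unfold_locales (auto simp: w'_def w_def)

lemma Hn: "k < N \<Longrightarrow> b.Hn k = real (k + 1) / N * (q k / q (k + 1))"
  by (simp add: b.Hn_def w'_def w_def)

lemma Hn_N: "b.Hn N = 0" by (simp add: b.Hn_def)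

lemma Hn_pos: "k < N \<Longrightarrow> b.Hn k > 0"
  using q_pos[of k] q_pos[of "k + 1"] by (simp add: Hn)

text \<open>\<open>ratio\<close> compares \<open>ln (Hn k)\<close> with l at (k + 1) / N; the
  Lipschitz bound on l then moves the base point to v. A is exp (K + 1) because the error K / N is
  at most 1.\<close>

lemma Hn_approx:
  assumes k: "k < N" "real (k + 1) / N \<le> 1 - \<delta>" and v: "0 < v" "v \<le> 1 - \<delta>" "\<bar>real (k + 1) / N - v\<bar> \<le> e"
  shows "\<bar>b.Hn k - exp (l v)\<bar> \<le> A * (K / N + K * e)" "b.Hn k \<le> A" "exp (- K - 1) \<le> b.Hn k" 
proof -
  have a: "0 < real (k + 1) / N" using k by simp
  have r: "\<bar>ln (b.Hn k) - l (real (k + 1) / N)\<bar> \<le> K / N" using ratio[OF k] by (simp add: Hn k)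
  have lv: "\<bar>l (real (k + 1) / N) - l v\<bar> \<le> K * \<bar>real (k + 1) / N - v\<bar>"
    by (rule abs_diff_le_of_deriv[of "{0<..1 - \<delta>}" l l']) (use l_deriv l'_le a k v in auto)
  also have "\<dots> \<le> K * e" using v K by (intro mult_left_mono) auto
  finally have lv: "\<bar>l (real (k + 1) / N) - l v\<bar> \<le> K * e" .
  have b1: "\<bar>l (real (k + 1) / N)\<bar> \<le> K" "\<bar>l v\<bar> \<le> K" using l_le a k v by auto
  have b2: "ln (b.Hn k) \<le> K + 1" "- K - 1 \<le> ln (b.Hn k)" using r b1 Npos(3) by linarith+
  have e: "exp (ln (b.Hn k)) = b.Hn k" using Hn_pos[OF k(1)] by simp
  have "\<bar>exp (ln (b.Hn k)) - exp (l v)\<bar> \<le> exp (K + 1) * \<bar>ln (b.Hn k) - l v\<bar>"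
    using b1 b2 by (intro abs_exp_diff_le) auto
  also have "\<dots> \<le> exp (K + 1) * (K / N + K * e)" using r lv by (intro mult_left_mono) auto
  finally show "\<bar>b.Hn k - exp (l v)\<bar> \<le> A * (K / N + K * e)" by (simp add: e A_def)
  have "exp (ln (b.Hn k)) \<le> exp (K + 1)" "exp (- K - 1) \<le> exp (ln (b.Hn k))" using b2 by simp_all
  then show "b.Hn k \<le> A" "exp (- K - 1) \<le> b.Hn k" unfolding e A_def by auto
qed

text \<open>The last index for which \<open>ratio\<close> applies; the subtraction of 1 accounts for
  k + 1 in that hypothesis.\<close>

definition "k0 = nat \<lfloor>(1 - \<delta>) * N\<rfloor> - 1"

lemma k0: "k0 < N" "real (k0 + 1) / N \<le> 1 - \<delta>" "1 - 2 * \<delta> \<le> real (k0 + 1) / N"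
proof -
  have "1 \<le> (1 - \<delta>) * N"
  proof -
    have "\<delta> * 1 \<le> (1 - \<delta>) * 1" using \<delta> by simp
    then have "\<delta> * N \<le> (1 - \<delta>) * N" by (intro mult_right_mono) auto
    then show ?thesis using N by (simp add: mult.commute)
  qed
  then have f1: "1 \<le> \<lfloor>(1 - \<delta>) * N\<rfloor>" by (simp add: le_floor_iff)
  then have k01: "real (k0 + 1) = of_int \<lfloor>(1 - \<delta>) * N\<rfloor>" by (simp add: k0_def)
  have le: "real (k0 + 1) \<le> (1 - \<delta>) * N" unfolding k01 by simp
  have ge: "(1 - \<delta>) * N - 1 \<le> real (k0 + 1)" unfolding k01 by linarith
  have 2: "real (k0 + 1) / N \<le> 1 - \<delta>" using le Npos by (simp add: field_simps)
  have "(1 - \<delta>) * N \<le> 1 * real N" using \<delta> by (intro mult_right_mono) auto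
  then have 1: "k0 < N" using le by simp
  have "1 - \<delta> - 1 / N = ((1 - \<delta>) * N - 1) / N" using Npos(1) by (simp add: diff_divide_distrib)
  also have "\<dots> \<le> real (k0 + 1) / N" using ge by (intro divide_right_mono) auto
  finally have 3: "1 - 2 * \<delta> \<le> real (k0 + 1) / N" using Npos by linarith
  show "k0 < N" "real (k0 + 1) / N \<le> 1 - \<delta>" "1 - 2 * \<delta> \<le> real (k0 + 1) / N"
    using 1 2 3 by blast+
qed

lemma k0_le:
  assumes "k < N" "\<not> real (k + 1) / N \<le> 1 - \<delta>"
  shows "k0 \<le> k"
proof -
  have "real (k0 + 1) / N < real (k + 1) / N" using assms k0 by linarith
  then show ?thesis using Npos by (simp add: divide_less_cancel)
qed

lemma quotient_antimono: "j \<le> k \<Longrightarrow> k < N \<Longrightarrow> q k / q (k + 1) \<le> q j / q (j + 1)"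
proof (induction rule: dec_induct)
  case (step n)
  have p: "q n > 0" "q (n + 1) > 0" "q (n + 2) > 0" using q_pos step by auto
  have "q (n + 1) / q (n + 2) \<le> q n / q (n + 1)"
    using log_convex[of n] step p by (simp add: field_simps power2_eq_square)
  then show ?case using step by simp
qed simp

text \<open>Beyond \<open>k0\<close> no asymptotics are assumed. Log-convexity makes q k / q (k + 1)
  nonincreasing, so its value at \<open>k0\<close> bounds all later ones.\<close>

lemma Hn_tail:
  assumes k: "k < N" "\<not> real (k + 1) / N \<le> 1 - \<delta>"
  shows "b.Hn k \<le> real (k + 1) / N * (b.Hn k0 / (real (k0 + 1) / N))"
proof -
  have "q k / q (k + 1) \<le> q k0 / q (k0 + 1)" by (rule quotient_antimono[OF k0_le[OF k] k(1)])
  also have "\<dots> = b.Hn k0 / (real (k0 + 1) / N)" using Npos by (simp add: Hn k0)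
  finally show ?thesis unfolding Hn[OF k(1)] by (intro mult_left_mono) auto
qed

lemma Hn_le: "k \<le> N \<Longrightarrow> b.Hn k \<le> 3 * A"
proof -
  assume k: "k \<le> N"
  consider "k = N" | "k < N" "real (k + 1) / N \<le> 1 - \<delta>" | "k < N" "\<not> real (k + 1) / N \<le> 1 - \<delta>"
    using k by fastforce
  then show ?thesis
  proof cases
    case 1 then show ?thesis using A Hn_N by simp
  next
    case 2
    have "0 < real (k + 1) / N" using 2 by simp
    then show ?thesis using Hn_approx(2)[OF 2, of "real (k + 1) / N" 0] 2 A by simp
  next
    case 3
    have a: "0 < real (k0 + 1) / N" using k0 Npos by simp
    have "b.Hn k \<le> real (k + 1) / N * (b.Hn k0 / (real (k0 + 1) / N))" by (rule Hn_tail[OF 3])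
    also have "\<dots> \<le> 1 * (A / (1 / 3))"
    proof (rule mult_mono)
      have "b.Hn k0 \<le> A" using Hn_approx(2)[OF k0(1,2) a k0(2), of 0] by simp
      moreover have "1 / 3 \<le> real (k0 + 1) / N" using k0(3) \<delta> by linarith
      ultimately show "b.Hn k0 / (real (k0 + 1) / N) \<le> A / (1 / 3)"
        using A by - (rule frac_le, auto)
    qed (use 3 A Hn_pos[OF k0(1)] in auto)
    finally show ?thesis by simp
  qed
qed

lemma y_le: "y \<le> 1 - \<delta>" using y \<delta> by simp

lemma H_bounds: "0 < H" "H \<le> A" "\<bar>H'\<bar> \<le> A * K" "1 / K \<le> 1 - x * H'"
proof -
  have l: "\<bar>l y\<bar> \<le> K" "\<bar>l' y\<bar> \<le> K" using l_le l'_le y y_le by auto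
  show "0 < H" "H \<le> A" using l by (auto simp: H_def A_def)
  then show "\<bar>H'\<bar> \<le> A * K" unfolding H'_def H_def abs_mult using l A by (intro mult_mono) auto
  have "x * H' = y * l' y" using xy by (simp add: H'_def)
  then show "1 / K \<le> 1 - x * H'" using l'_denom y y_le by simp
qed

text \<open>In the known range, \<open>ratio\<close> at v = (k + 1) / N is followed by a Taylor
  expansion at y, the shift from v to k / N costing O(1 / N). Elsewhere k / N is at distance at
  least \<delta> from y, and bounded quantities are absorbed by the square of that distance.\<close>

lemma lin:
  assumes k: "k \<le> N"
  shows "\<bar>b.Hn k - H - H' * (k / N - y)\<bar> \<le> M * (1 / N + (k / N - y)\<^sup>2)"
proof (cases "k < N \<and> real (k + 1) / N \<le> 1 - \<delta>")
  case True
  define v where "v = real (k + 1) / N"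
  have v: "0 < v" "v \<le> 1 - \<delta>" "v = k / N + 1 / N"
  proof -
    show "0 < v" using Npos(1) by (simp add: v_def)
    show "v \<le> 1 - \<delta>" using True by (simp add: v_def)
    show "v = k / N + 1 / N" by (simp add: v_def add_divide_distrib)
  qed
  have 1: "\<bar>b.Hn k - exp (l v)\<bar> \<le> A * (K / N + K * 0)"
  proof -
    have "\<bar>real (k + 1) / N - v\<bar> \<le> 0" by (simp add: v_def)
    then show ?thesis using Hn_approx(1)[OF conjunct1[OF True] conjunct2[OF True] v(1,2)] by blast
  qed
  have 2: "\<bar>exp (l v) - H - H' * (v - y)\<bar> \<le> exp K * K * (1 + K) * (v - y)\<^sup>2"
    unfolding H_def H'_def
  proof (rule C11_exp[of "{0<..1 - \<delta>}" l l' K])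
    show "(l has_real_derivative l' a) (at a)" "\<bar>l a\<bar> \<le> K" "\<bar>l' a\<bar> \<le> K" if "a \<in> {0<..1 - \<delta>}" for a
      using that l_deriv l_le l'_le by simp_all
    show "\<bar>l' a - l' b\<bar> \<le> K * \<bar>a - b\<bar>" if "a \<in> {0<..1 - \<delta>}" "b \<in> {0<..1 - \<delta>}" for a b
      using that l'_lip by simp
  qed (use v y y_le in simp_all)
  have "exp K * K * (1 + K) * (v - y)\<^sup>2 \<le> (A * K * (1 + K)) * (2 * (1 / N + (k / N - y)\<^sup>2))"
  proof (intro mult_mono)
    show "exp K \<le> A" by (simp add: A_def)
    have "v - y = k / N - y + 1 / N" using v(3) by linarith
    then have "(v - y)\<^sup>2 = (k / N - y + 1 / N)\<^sup>2" by (simp only:)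
    also have "\<dots> \<le> 2 * ((k / N - y)\<^sup>2 + (1 / N)\<^sup>2)"
      using sum_squares_bound[of "k / N - y" "1 / N"] by (simp add: power2_sum)
    also have "(1 / real N)\<^sup>2 \<le> 1 / N" using Npos(4) mult_left_mono[of "1 / real N" 1 "1 / real N"] by (simp add: power2_eq_square)
    finally show "(v - y)\<^sup>2 \<le> 2 * (1 / N + (k / N - y)\<^sup>2)" by simp
  qed (use K A in auto)
  with 2 have 2: "\<bar>exp (l v) - H - H' * (v - y)\<bar> \<le> (A * K * (1 + K)) * (2 * (1 / N + (k / N - y)\<^sup>2))"
    by (rule order_trans)
  have 3: "\<bar>H' * (1 / N)\<bar> \<le> (A * K) * (1 / N)" unfolding abs_mult using H_bounds by (intro mult_mono) auto
  have "H' * (v - y) = H' * (k / N - y) + H' * (1 / N)" unfolding v(3) by (simp add: algebra_simps)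
  then have eq: "b.Hn k - H - H' * (k / N - y)
      = (b.Hn k - exp (l v)) + (exp (l v) - H - H' * (v - y)) + H' * (1 / N)" by linarith
  have tri: "\<bar>p + q + r\<bar> \<le> p1 + q1 + r1" if "\<bar>p\<bar> \<le> p1" "\<bar>q\<bar> \<le> q1" "\<bar>r\<bar> \<le> r1" for p q r p1 q1 r1 :: real
    using that by linarith
  have "\<bar>b.Hn k - H - H' * (k / N - y)\<bar>
      \<le> A * (K / N + K * 0) + (A * K * (1 + K)) * (2 * (1 / N + (k / N - y)\<^sup>2)) + (A * K) * (1 / N)"
    unfolding eq by (rule tri[OF 1 2 3])
  also have "\<dots> = (2 * A * K) * (1 / N) + 2 * (A * K * (1 + K)) * (1 / N + (k / N - y)\<^sup>2)"
    by (simp add: algebra_simps)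
  also have "\<dots> \<le> (2 * A * K) * (1 / N + (k / N - y)\<^sup>2) + 4 * (A * K * (1 + K)) * (1 / N + (k / N - y)\<^sup>2)"
    using A K by (intro add_mono mult_left_mono mult_right_mono) auto
  also have "\<dots> = (2 * A * K + 4 * (A * K * (1 + K))) * (1 / N + (k / N - y)\<^sup>2)" by (simp add: distrib_right)
  also have "\<dots> \<le> M * (1 / N + (k / N - y)\<^sup>2)" using Mterms by (intro mult_right_mono) auto
  finally show ?thesis .
next
  case False
  have kN: "1 - 2 * \<delta> \<le> k / N"
  proof (cases "k = N")
    case False
    then have "\<not> real (k + 1) / N \<le> 1 - \<delta>" using \<open>\<not> (k < N \<and> _)\<close> k by auto
    then show ?thesis using Npos by (simp add: add_divide_distrib)
  qed (use Npos \<delta> in simp)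
  moreover have "k / N \<le> 1" using k Npos by simp
  ultimately have d: "\<delta> \<le> k / N - y" "k / N - y \<le> 1" using y by linarith+
  have "\<bar>H' * (k / N - y)\<bar> \<le> A * K * 1" unfolding abs_mult using H_bounds d \<delta> A K by (intro mult_mono) auto
  then have "\<bar>b.Hn k - H - H' * (k / N - y)\<bar> \<le> 4 * A + A * K"
    using Hn_le[OF k] b.Hn_nonneg[of k] H_bounds by linarith
  also have "\<dots> = (4 * A + A * K) / \<delta>\<^sup>2 * \<delta>\<^sup>2" using \<delta> by simp
  also have "\<dots> \<le> M * (1 / N + (k / N - y)\<^sup>2)"
  proof (intro mult_mono)
    have "\<delta>\<^sup>2 \<le> (k / N - y)\<^sup>2" using d \<delta> by (intro power_mono) auto
    then show "\<delta>\<^sup>2 \<le> 1 / N + (k / N - y)\<^sup>2" by (simp add: add_increasing)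
  qed (use Mterms A K in auto)
  finally show ?thesis .
qed

end

context weight_at
begin

text \<open>For l = ln (v / X v) this is X itself: the inverse moment map that belongs to the
  interpolated l. \<open>l'_denom\<close> makes it increasing.\<close>

definition "Xf v = v * exp (- l v)"

lemma Xf_y: "Xf y = x" using xy by (simp add: Xf_def exp_minus field_simps)

lemma Xf_deriv: "0 < v \<Longrightarrow> v \<le> 1 - \<delta> \<Longrightarrow> (Xf has_real_derivative exp (- l v) * (1 - v * l' v)) (at v)"
  unfolding Xf_def[abs_def] by (rule derivative_eq_intros l_deriv refl | simp add: algebra_simps)+

lemma Xf_diff:
  assumes v: "0 < v" "v < v2" "v2 \<le> 1 - \<delta>"
  shows "exp (- K) / K * (v2 - v) \<le> Xf v2 - Xf v"
proof -
  obtain s where s: "v < s" "s < v2" "Xf v2 - Xf v = (v2 - v) * (exp (- l s) * (1 - s * l' s))"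
    using MVT2[of v v2 Xf "\<lambda>s. exp (- l s) * (1 - s * l' s)"] Xf_deriv v by auto
  have "exp (- K) * (1 / K) \<le> exp (- l s) * (1 - s * l' s)"
    using l_le[of s] l'_denom[of s] s v K by (intro mult_mono) auto
  then have "(v2 - v) * (exp (- K) * (1 / K)) \<le> (v2 - v) * (exp (- l s) * (1 - s * l' s))"
    using v by (intro mult_left_mono) auto
  then show ?thesis unfolding s(3) by (simp add: mult.commute)
qed

text \<open>In the middle range v - x exp (l v) equals exp (l v) times \<open>Xf v - Xf y\<close>,
  and \<open>Xf\<close> has slope bounded below. At k = 0 a lower bound for \<open>Hn 0\<close>
  suffices. In the tail \<open>Hn_tail\<close> compares with the cut-off a, where x exp (l a) / a =
  x / Xf a is below 1 by a definite amount because a exceeds y by at least \<delta>.\<close>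

lemma drift:
  assumes k: "k \<le> N"
  shows "c * (k / N - y)\<^sup>2 - M / N * \<bar>k / N - y\<bar> \<le> (k / N - x * b.Hn k) * (k / N - y)"
proof -
  have c_pos: "c > 0" using \<delta> K by (simp add: c_def)
  have M0: "M \<ge> 0" using Mterms A by linarith
  consider "k = 0" | "0 < k" "k < N" "real (k + 1) / N \<le> 1 - \<delta>" | "\<not> (k < N \<and> real (k + 1) / N \<le> 1 - \<delta>)"
    by fastforce
  then show ?thesis
  proof cases
    case 1
    have "real (0 + 1) / N \<le> 1 - \<delta>" "0 < real (0 + 1) / N" using Npos \<delta> by auto
    then have H0: "exp (- K - 1) \<le> b.Hn 0" using Hn_approx(3)[of 0 "real (0 + 1) / N" 0] Npos by simp
    have "exp (- K) \<le> exp (- l y)" using l_le y y_le by (simp add: abs_le_iff)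
    then have "y * exp (- K) \<le> x" using Xf_y y by (simp add: Xf_def flip: Xf_y)
    then have "(y * exp (- K)) * exp (- K - 1) \<le> x * b.Hn 0" using H0 y x by (intro mult_mono) auto
    moreover have "(y * exp (- K)) * exp (- K - 1) = exp (- 2 * K - 1) * y" by (simp flip: exp_add)
    moreover have "c \<le> exp (- 2 * K - 1)"
    proof -
      have "\<delta> / K \<le> 1" using \<delta> K by simp
      then have "exp (- 2 * K - 1) * (\<delta> / K) \<le> exp (- 2 * K - 1) * 1" by (intro mult_left_mono) auto
      then show ?thesis by (simp add: c_def mult.commute)
    qed
    ultimately have "c * y \<le> x * b.Hn 0" using y mult_right_mono[of c "exp (- 2 * K - 1)" y] by linarith
    then have "c * y * y \<le> x * b.Hn 0 * y" using y by (intro mult_right_mono) auto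
    moreover have "0 \<le> M / N * y" using M0 y by simp
    ultimately have "c * y\<^sup>2 - M / N * y \<le> x * b.Hn 0 * y" unfolding power2_eq_square mult.assoc[symmetric] by linarith
    then show ?thesis using y by (simp add: 1)
  next
    case 2
    define v where "v = k / real N"
    have v3: "real (k + 1) / N - v = 1 / N" by (simp add: v_def add_divide_distrib)
    have "0 < v" using 2 Npos by (simp add: v_def)
    moreover have "0 \<le> 1 / real N" by simp
    then have "v \<le> 1 - \<delta>" using 2(3) v3 by linarith
    ultimately have v: "0 < v" "v \<le> 1 - \<delta>" "\<bar>real (k + 1) / N - v\<bar> \<le> 1 / N" using v3 by simp_all
    have "\<bar>b.Hn k - exp (l v)\<bar> \<le> A * (K / N + K * (1 / N))"
      by (rule Hn_approx(1)[OF 2(2,3) v])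
    then have h: "x * \<bar>b.Hn k - exp (l v)\<bar> \<le> K * (A * (K / N + K * (1 / N)))"
      using x K by (intro mult_mono) auto
    also have "\<dots> = 2 * K\<^sup>2 * A / N" by (simp add: power2_eq_square algebra_simps)
    also have "\<dots> \<le> M / N" using Mterms by (intro divide_right_mono) auto
    finally have h: "x * \<bar>b.Hn k - exp (l v)\<bar> \<le> M / N" .
    have main: "c * (v - y)\<^sup>2 \<le> (v - x * exp (l v)) * (v - y)"
    proof -
      have eq: "v - x * exp (l v) = exp (l v) * (Xf v - Xf y)"
        unfolding Xf_y by (simp add: Xf_def algebra_simps flip: exp_add)
      have "exp (- K) / K * (v - y)\<^sup>2 \<le> (Xf v - Xf y) * (v - y)"
      proof (cases v y rule: linorder_cases)
        case less
        have "exp (- K) / K * (y - v) * (y - v) \<le> (Xf y - Xf v) * (y - v)"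
          using Xf_diff[of v y] less v y_le by (intro mult_right_mono) auto
        moreover have "e * (v - y)\<^sup>2 = e * (y - v) * (y - v)" "(a - b) * (v - y) = (b - a) * (y - v)" for e a b
          by (simp_all add: power2_eq_square algebra_simps)
        ultimately show ?thesis by (simp only:)
      next
        case greater
        have "exp (- K) / K * (v - y) * (v - y) \<le> (Xf v - Xf y) * (v - y)"
          using Xf_diff[of y v] greater v y by (intro mult_right_mono) auto
        then show ?thesis by (simp add: power2_eq_square mult.assoc)
      qed simp
      then have "exp (- K) * (exp (- K) / K * (v - y)\<^sup>2) \<le> exp (l v) * ((Xf v - Xf y) * (v - y))"
        using l_le[OF v(1,2)] K by - (rule mult_mono, auto)
      also have "\<dots> = (v - x * exp (l v)) * (v - y)" by (simp add: eq)
      finally have 1: "exp (- K) * (exp (- K) / K * (v - y)\<^sup>2) \<le> (v - x * exp (l v)) * (v - y)" .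
      have "c \<le> exp (- K) * (exp (- K) / K)"
      proof -
        have "\<delta> * exp (- 2 * K - 1) \<le> 1 * exp (- 2 * K)" using \<delta> by (intro mult_mono) auto
        then have "\<delta> * exp (- 2 * K - 1) / K \<le> exp (- 2 * K) / K" using K by (intro divide_right_mono) auto
        then show ?thesis by (simp add: c_def flip: exp_add)
      qed
      then have "c * (v - y)\<^sup>2 \<le> exp (- K) * (exp (- K) / K) * (v - y)\<^sup>2" by (intro mult_right_mono) auto
      then show ?thesis using 1 by (simp add: mult.assoc)
    qed
    have "\<bar>x * (exp (l v) - b.Hn k) * (v - y)\<bar> \<le> M / N * \<bar>v - y\<bar>"
      unfolding abs_mult using h x by (intro mult_right_mono) (auto simp: abs_minus_commute)
    moreover have "(v - x * b.Hn k) * (v - y) = (v - x * exp (l v)) * (v - y) + x * (exp (l v) - b.Hn k) * (v - y)"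
      by (simp add: algebra_simps)
    ultimately show ?thesis using main unfolding v_def[symmetric] by linarith
  next
    case 3
    have d: "\<delta> \<le> k / N - y"
    proof (cases "k = N")
      case False
      then have "\<not> real (k + 1) / N \<le> 1 - \<delta>" using 3 k by auto
      then show ?thesis using Npos y by (simp add: add_divide_distrib)
    qed (use Npos \<delta> y in simp)
    have d1: "k / N - y \<le> k / N" using y by simp
    have "c * (k / N - y) - M / N \<le> k / N - x * b.Hn k"
    proof (cases "k = N")
      case True
      have "c \<le> 1"
      proof -
        have "\<delta> * exp (- 2 * K - 1) \<le> 1 * 1" using \<delta> K by (intro mult_mono) auto
        then show ?thesis using K by (simp add: c_def)
      qed
      then have "c * (k / N - y) \<le> 1 * (k / N)" using d1 d \<delta> c_pos by (intro mult_mono) auto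
      moreover have "M / N \<ge> 0" using M0 by simp
      ultimately show ?thesis using True Hn_N by simp
    next
      case False
      then have k': "k < N" "\<not> real (k + 1) / N \<le> 1 - \<delta>" using 3 k by auto
      define a where "a = real (k0 + 1) / N"
      have a: "0 < a" "a \<le> 1 - \<delta>" "1 - 2 * \<delta> \<le> a" "1 / 3 \<le> a"
      proof -
        show "0 < a" using Npos by (simp add: a_def)
        show "a \<le> 1 - \<delta>" "1 - 2 * \<delta> \<le> a" unfolding a_def by (rule k0)+
        then show "1 / 3 \<le> a" using \<delta> by linarith
      qed
      \<comment> \<open>The relative gap between x = Xf y and Xf a: the slope bound times \<delta>,
        divided by the upper bound exp K of Xf a.\<close>
      define \<kappa> where "\<kappa> = \<delta> * exp (- 2 * K) / K"
      have \<kappa>: "0 < \<kappa>" "c \<le> \<kappa>"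
        using \<delta> K by (auto simp: \<kappa>_def c_def intro!: divide_right_mono mult_left_mono)
      have r: "x * (b.Hn k0 / a) \<le> (1 - \<kappa>) + 3 * K\<^sup>2 * A / N"
      proof -
        have "\<bar>b.Hn k0 - exp (l a)\<bar> \<le> A * (K / N + K * 0)"
          by (rule Hn_approx(1)[OF k0(1,2) a(1,2)]) (simp add: a_def)
        then have "b.Hn k0 \<le> exp (l a) + A * K / N" by (simp add: abs_le_iff)
        then have "x * (b.Hn k0 / a) \<le> x * ((exp (l a) + A * K / N) / a)"
          using x a by (intro mult_left_mono divide_right_mono) auto
        also have "\<dots> = x * (exp (l a) / a) + (x / a) * (A * K / N)" by (simp add: algebra_simps add_divide_distrib)
        also have "(x / a) * (A * K / N) \<le> (K / (1 / 3)) * (A * K / N)"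
          using x a A K by (intro mult_right_mono frac_le) auto
        also have "\<dots> = 3 * K\<^sup>2 * A / N" by (simp add: power2_eq_square)
        also have "x * (exp (l a) / a) \<le> 1 - \<kappa>"
        proof -
          have Xa: "0 < Xf a" "Xf a \<le> exp K"
          proof -
            show "0 < Xf a" using a by (simp add: Xf_def)
            have "a * exp (- l a) \<le> 1 * exp K" using l_le[OF a(1,2)] a \<delta> by (intro mult_mono) (auto simp: abs_le_iff)
            then show "Xf a \<le> exp K" by (simp add: Xf_def)
          qed
          have "exp (- K) / K * \<delta> \<le> exp (- K) / K * (a - y)" using a y K by (intro mult_left_mono) auto
          also have "\<dots> \<le> Xf a - x" using Xf_diff[of y a] a y \<delta> Xf_y by simp
          finally have "exp (- K) / K * \<delta> \<le> Xf a - x" .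
          moreover have "\<kappa> * Xf a \<le> \<kappa> * exp K" using Xa \<kappa> by (intro mult_left_mono) auto
          moreover have "\<kappa> * exp K = exp (- K) / K * \<delta>" by (simp add: \<kappa>_def field_simps flip: exp_add)
          ultimately have "x \<le> (1 - \<kappa>) * Xf a" by (simp add: algebra_simps)
          moreover have "x * (exp (l a) / a) = x / Xf a" using a by (simp add: Xf_def exp_minus field_simps)
          ultimately show ?thesis using Xa by (simp add: pos_divide_le_eq)
        qed
        finally show ?thesis by simp
      qed
      have \<kappa>1: "1 - \<kappa> \<ge> 0 \<and> 1 - \<kappa> \<le> 1"
      proof -
        have "\<delta> * exp (- 2 * K) \<le> 1 * 1" using \<delta> K by (intro mult_mono) auto
        then show ?thesis using K \<kappa> by (simp add: \<kappa>_def)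
      qed
      have b1: "real (k + 1) / N = k / N + 1 / N" by (simp add: add_divide_distrib)
      have b2: "real (k + 1) / N \<le> 1" using k' by simp
      have "x * b.Hn k \<le> x * (real (k + 1) / N * (b.Hn k0 / a))"
        using Hn_tail[OF k'] x by (intro mult_left_mono) (auto simp: a_def)
      also have "\<dots> = real (k + 1) / N * (x * (b.Hn k0 / a))" by simp
      also have "\<dots> \<le> real (k + 1) / N * ((1 - \<kappa>) + 3 * K\<^sup>2 * A / N)" using r by (intro mult_left_mono) auto
      also have "\<dots> = (k / N) * (1 - \<kappa>) + (1 / N) * (1 - \<kappa>) + real (k + 1) / N * (3 * K\<^sup>2 * A / N)"
        unfolding b1 by (simp only: distrib_left distrib_right)
      also have "\<dots> \<le> (k / N) * (1 - \<kappa>) + (1 / N) * 1 + 1 * (3 * K\<^sup>2 * A / N)"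
        using \<kappa>1 b2 A by (intro add_mono mult_left_mono mult_right_mono) auto
      finally have "x * b.Hn k \<le> k / N - \<kappa> * (k / N) + (1 + 3 * K\<^sup>2 * A) / N"
        by (simp add: algebra_simps add_divide_distrib diff_divide_distrib)
      moreover have "(1 + 3 * K\<^sup>2 * A) / N \<le> M / N" 
      proof -
        have "0 \<le> K\<^sup>2 * A" using A by simp
        then have "1 + 3 * K\<^sup>2 * A \<le> M" using Mterms(4) by linarith
        then show ?thesis by (intro divide_right_mono) auto
      qed
      moreover have "c * (k / N - y) \<le> \<kappa> * (k / N)" using \<kappa> d1 d \<delta> c_pos by (intro mult_mono) auto
      ultimately show ?thesis by linarith
    qed
    then have "(c * (k / N - y) - M / N) * (k / N - y) \<le> (k / N - x * b.Hn k) * (k / N - y)"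
      using d \<delta> by (intro mult_right_mono) auto
    moreover have "(c * e - m) * e = c * e\<^sup>2 - m * \<bar>e\<bar>" if "e \<ge> 0" for e m
      using that by (simp add: power2_eq_square algebra_simps)
    ultimately show ?thesis using d \<delta> by simp
  qed
qed

lemma stein: "stein_bounds N w' x y H H' c M K"
proof
  show "0 \<le> y" "y \<le> 1" using y \<delta> by auto
  show "y = x * H" using xy by (simp add: H_def)
  show "0 < c" using \<delta> K by (simp add: c_def)
  show "1 \<le> M" using Mterms A by linarith
  show "x \<le> K" by (rule x)
  show "b.Hn k \<le> M" if "k \<le> N" for k using Hn_le[OF that] Mterms by linarith
  show "\<bar>H\<bar> \<le> M" "\<bar>H'\<bar> \<le> M" using H_bounds Mterms A by auto
  have "c \<le> 1 / K"
  proof -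
    have "\<delta> * exp (- 2 * K - 1) \<le> 1 * 1" using \<delta> K by (intro mult_mono) auto
    then show ?thesis using K by (simp add: c_def divide_right_mono)
  qed
  then show "c \<le> 1 - x * H'" using H_bounds by linarith
  show "c * (b.frac k - y)\<^sup>2 - M / real N * \<bar>b.frac k - y\<bar> \<le> (b.frac k - x * b.Hn k) * (b.frac k - y)" if "k \<le> N" for k
    using drift[OF that] by (simp add: b.frac_def)
  show "\<bar>b.Hn k - H - H' * (b.frac k - y)\<bar> \<le> M * (1 / real N + (b.frac k - y)\<^sup>2)" if "k \<le> N" for k
    using lin[OF that] by (simp add: b.frac_def)
qed

end

text \<open>An increment of \<open>lam\<close> is 1 / N times the difference of two
  \<open>ratio\<close> estimates, in which the logarithm of (j + 1) / N cancels: it is (l1 - l0) / N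
  at (j + 1) / N, up to O(1 / N^2). Telescoping from an index next to N y gives a linear law with
  quadratic error. The base value is immaterial, as only covariances of \<open>lam\<close> are used
  later.\<close>

lemma log_quotient_expansion:
  assumes 0: "weight N \<delta> K q0 l0 l0'" and 1: "weight N \<delta> K q1 l1 l1'"
    and y: "0 < y" "y \<le> 1 - 3 * \<delta>" and k: "k \<le> N" and M: "10 * K \<le> M" "6 * K / \<delta>\<^sup>2 \<le> M"
  defines "lam \<equiv> \<lambda>k. (ln (q0 k) - ln (q1 k)) / real N"
  shows "\<bar>lam k - lam (nat \<lfloor>N * y\<rfloor>) - (l1 y - l0 y) * (k / N - y)\<bar> \<le> M * (1 / N + (k / N - y)\<^sup>2)"
proof -
  interpret w0: weight N \<delta> K q0 l0 l0' by (rule 0)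
  interpret w1: weight N \<delta> K q1 l1 l1' by (rule 1)
  note \<delta> = w0.\<delta> and K = w0.K and N = w0.N
  have Np: "N > 0" "1 / N \<le> \<delta>" using N K by (cases N; auto simp: field_simps)+
  define m where "m = nat \<lfloor>N * y\<rfloor>"
  define l where "l = l1 y - l0 y"
  have y1: "y \<le> 1 - \<delta>" using y \<delta> by simp
  have l: "\<bar>l\<bar> \<le> 2 * K" using w0.l_le[OF y(1) y1] w1.l_le[OF y(1) y1] by (simp add: l_def)
  have m: "real m \<le> N * y" "N * y - 1 \<le> real m"
  proof -
    have "0 \<le> \<lfloor>N * y\<rfloor>" using y by simp
    then have "real m = of_int \<lfloor>N * y\<rfloor>" by (simp add: m_def)
    then show "real m \<le> N * y" "N * y - 1 \<le> real m" by linarith+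
  qed
  have mN: "m / N \<le> y" "y - 1 / N \<le> m / N"
  proof -
    show "m / N \<le> y" using m Np by (auto simp: field_simps)
    have "y - 1 / N = (N * y - 1) / N" using Np by (simp add: diff_divide_distrib)
    then show "y - 1 / N \<le> m / N" using m by (simp add: divide_right_mono)
  qed
  define d where "d = \<bar>k / N - y\<bar>"
  \<comment> \<open>\<open>lam\<close> minus its expected linear part; each increment is O(1 / N)
    times the distance to y plus 1 / N.\<close>
  define S where "S j = lam j - l * (j / N)" for j
  have step: "\<bar>S (Suc j) - S j\<bar> \<le> 1 / N * (2 * K / N + 2 * K * (d + 1 / N))"
    if j: "real (Suc j) / N \<le> 1 - \<delta>" "\<bar>real (Suc j) / N - y\<bar> \<le> d + 1 / N" for j
  proof -
    define v where "v = real (j + 1) / N"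
    have v: "0 < v" "v \<le> 1 - \<delta>" "\<bar>v - y\<bar> \<le> d + 1 / N" using j Np by (auto simp: v_def)
    have jN: "j < N"
    proof -
      have "real (Suc j) / N < 1" using j \<delta> by linarith
      then show ?thesis using Np by simp
    qed
    have p: "q0 j > 0" "q0 (j + 1) > 0" "q1 j > 0" "q1 (j + 1) > 0" using w0.q_pos w1.q_pos jN by auto
    have e: "ln (v * (q j / q (j + 1))) = ln v + ln (q j) - ln (q (j + 1))" if "q j > 0" "q (j + 1) > 0" for q
      using that v by (simp add: ln_mult ln_div)
    have r0: "\<bar>ln v + ln (q0 j) - ln (q0 (j + 1)) - l0 v\<bar> \<le> K / N"
      using w0.ratio[OF jN] v(2) e[OF p(1,2)] unfolding v_def by simp
    have r1: "\<bar>ln v + ln (q1 j) - ln (q1 (j + 1)) - l1 v\<bar> \<le> K / N"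
      using w1.ratio[OF jN] v(2) e[OF p(3,4)] unfolding v_def by simp
    have d0: "\<bar>l0 v - l0 y\<bar> \<le> K * \<bar>v - y\<bar>"
      by (rule abs_diff_le_of_deriv[of "{0<..1 - \<delta>}" l0 l0']) (use w0.l_deriv w0.l'_le v y y1 in auto)
    have d1: "\<bar>l1 v - l1 y\<bar> \<le> K * \<bar>v - y\<bar>"
      by (rule abs_diff_le_of_deriv[of "{0<..1 - \<delta>}" l1 l1']) (use w1.l_deriv w1.l'_le v y y1 in auto)
    have "S (Suc j) - S j = 1 / N * ((ln (q1 j) - ln (q1 (j + 1))) - (ln (q0 j) - ln (q0 (j + 1))) - l)"
      using Np by (simp add: S_def lam_def field_simps)
    then have "\<bar>S (Suc j) - S j\<bar> = 1 / N * \<bar>(ln (q1 j) - ln (q1 (j + 1))) - (ln (q0 j) - ln (q0 (j + 1))) - l\<bar>"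
      by (simp add: abs_mult)
    also have "\<dots> \<le> 1 / N * (2 * K / N + 2 * K * (d + 1 / N))"
    proof (rule mult_left_mono)
      have "\<bar>(ln (q1 j) - ln (q1 (j + 1))) - (ln (q0 j) - ln (q0 (j + 1))) - l\<bar> \<le> 2 * (K / N) + 2 * (K * \<bar>v - y\<bar>)"
      proof -
        have gen: "\<bar>p1 - p0 - (b1 - b0)\<bar> \<le> 2 * a + 2 * e"
          if "\<bar>V + p0 - a0\<bar> \<le> a" "\<bar>V + p1 - a1\<bar> \<le> a" "\<bar>a0 - b0\<bar> \<le> e" "\<bar>a1 - b1\<bar> \<le> e"
          for p0 p1 b0 b1 a0 a1 V a e :: real
          using that unfolding abs_le_iff by (elim conjE, intro conjI; linarith)
        show ?thesis unfolding l_def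
          by (rule gen[OF _ _ d0 d1]) (use r0 r1 in \<open>simp_all add: algebra_simps\<close>)
      qed
      also have "K * \<bar>v - y\<bar> \<le> K * (d + 1 / N)" using v K by (intro mult_left_mono) auto
      finally show "\<bar>(ln (q1 j) - ln (q1 (j + 1))) - (ln (q0 j) - ln (q0 (j + 1))) - l\<bar> \<le> 2 * K / N + 2 * K * (d + 1 / N)"
        by simp
    qed simp
    finally show ?thesis .
  qed
  show ?thesis
  proof (cases "k / N \<le> 1 - \<delta>")
    case True
    have "\<bar>S k - S m\<bar> \<le> N * (d + 1 / N) * (1 / N * (2 * K / N + 2 * K * (d + 1 / N)))" (is "_ \<le> _ * ?b")
    proof -
      have b0: "?b \<ge> 0" using K by (simp add: d_def)
      show ?thesis
      proof (cases "m \<le> k")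
        case True
        have "\<bar>S k - S m\<bar> \<le> real (k - m) * ?b"
        proof (rule telescope_bound[OF True])
          fix j assume j: "m \<le> j" "j < k"
          have a: "real (Suc j) / N \<le> k / N" "m / N + 1 / N \<le> real (Suc j) / N"
            using j by (auto intro!: divide_right_mono simp flip: add_divide_distrib)
          have "0 \<le> 1 / real N" by simp
          then have "\<bar>real (Suc j) / N - y\<bar> \<le> d + 1 / N" using a mN unfolding d_def by linarith
          moreover have "real (Suc j) / N \<le> 1 - \<delta>" using a \<open>k / N \<le> 1 - \<delta>\<close> by linarith
          ultimately show "\<bar>S (Suc j) - S j\<bar> \<le> 1 / N * (2 * K / N + 2 * K * (d + 1 / N))" by (rule step[rotated])
        qed
        moreover have r: "real (k - m) \<le> N * (d + 1 / N)"
        proof -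
          have "real k \<le> N * y + N * d" 
          proof -
            have "k / N \<le> y + d" unfolding d_def by linarith
            then show ?thesis using Np by (simp add: field_simps)
          qed
          then show ?thesis using True m Np by (simp add: algebra_simps)
        qed
        moreover note mult_right_mono[OF r b0]
        ultimately show ?thesis by linarith
      next
        case False
        then have km: "k \<le> m" by simp
        have "\<bar>S m - S k\<bar> \<le> real (m - k) * ?b"
        proof (rule telescope_bound[OF km])
          fix j assume j: "k \<le> j" "j < m"
          have a: "real (Suc j) / N \<le> m / N" "k / N \<le> real (Suc j) / N"
            using j by (auto intro!: divide_right_mono)
          have "0 \<le> 1 / real N" by simp
          then have "\<bar>real (Suc j) / N - y\<bar> \<le> d + 1 / N" using a mN unfolding d_def by linarith
          moreover have "real (Suc j) / N \<le> 1 - \<delta>" using a mN y1 by linarith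
          ultimately show "\<bar>S (Suc j) - S j\<bar> \<le> 1 / N * (2 * K / N + 2 * K * (d + 1 / N))" by (rule step[rotated])
        qed
        moreover have r: "real (m - k) \<le> N * (d + 1 / N)"
        proof -
          have "N * y \<le> real k + N * d" 
          proof -
            have "y \<le> k / N + d" unfolding d_def by linarith
            then show ?thesis using Np by (simp add: field_simps)
          qed
          then show ?thesis using km m Np by (simp add: algebra_simps)
        qed
        moreover note mult_right_mono[OF r b0]
        ultimately show ?thesis by linarith
      qed
    qed
    also have "\<dots> = (d + 1 / N) * (2 * K * (1 / N) + 2 * K * (d + 1 / N))" using Np by simp
    also have "\<dots> \<le> (d + 1 / N) * (2 * K * (d + 1 / N) + 2 * K * (d + 1 / N))"
      using K by (intro mult_left_mono add_mono) (auto simp: d_def)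
    also have "\<dots> = 4 * K * (d + 1 / N)\<^sup>2"
    proof -
      have "z * (2 * K * z + 2 * K * z) = 4 * K * z\<^sup>2" for z by (simp add: power2_eq_square)
      then show ?thesis .
    qed
    also have "\<dots> \<le> 4 * K * (2 * (1 / N + d\<^sup>2))"
    proof (intro mult_left_mono)
      have "(1 / real N)\<^sup>2 \<le> 1 / N" using Np \<delta> mult_left_mono[of "1 / real N" 1 "1 / real N"] by (simp add: power2_eq_square)
      moreover have "(d + 1 / N)\<^sup>2 \<le> 2 * (d\<^sup>2 + (1 / N)\<^sup>2)"
        using sum_squares_bound[of d "1 / N"] by (simp add: power2_sum)
      ultimately show "(d + 1 / N)\<^sup>2 \<le> 2 * (1 / N + d\<^sup>2)" by simp
    qed (use K in auto)
    finally have "\<bar>S k - S m\<bar> \<le> 4 * K * (2 * (1 / N + d\<^sup>2))" .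
    moreover have "4 * K * (2 * z) = 8 * K * z" for z by simp
    ultimately have Skm: "\<bar>S k - S m\<bar> \<le> 8 * K * (1 / N + d\<^sup>2)" by metis
    have "\<bar>l * (y - m / N)\<bar> \<le> 2 * K * (1 / N)" unfolding abs_mult using l mN K by (intro mult_mono) auto
    also have "\<dots> \<le> 2 * K * (1 / N + d\<^sup>2)" using K by (intro mult_left_mono) auto
    finally have "\<bar>l * (y - m / N)\<bar> \<le> 2 * K * (1 / N + d\<^sup>2)" .
    moreover have "lam k - lam m - l * (k / N - y) = (S k - S m) + l * (y - m / N)"
      by (simp add: S_def algebra_simps)
    moreover have "\<bar>p + q\<bar> \<le> 10 * K * z" if "\<bar>p\<bar> \<le> 8 * K * z" "\<bar>q\<bar> \<le> 2 * K * z" for p q z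
      using that by linarith
    ultimately have "\<bar>lam k - lam m - l * (k / N - y)\<bar> \<le> 10 * K * (1 / N + d\<^sup>2)" using Skm by presburger
    also have "\<dots> \<le> M * (1 / N + d\<^sup>2)" using M by (intro mult_right_mono) auto
    finally show ?thesis unfolding m_def l_def d_def by simp
  next
    case False
    have k1: "k / N \<le> 1" using k Np by simp
    have dd: "\<delta> \<le> k / N - y" "k / N - y \<le> 1" using False y k1 \<delta> by linarith+
    have "m \<le> N"
    proof -
      have "real m / N \<le> 1" using mN y1 \<delta> by linarith
      then show ?thesis using Np by simp
    qed
    have lb: "\<bar>lam j\<bar> \<le> 2 * K" if "j \<le> N" for j
    proof -
      have "\<bar>ln (q0 j) - ln (q1 j)\<bar> \<le> N * (2 * K)" using w0.ln_q[OF that] w1.ln_q[OF that] by linarith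
      then show ?thesis using Np by (simp add: lam_def field_simps)
    qed
    have "\<bar>l * (k / N - y)\<bar> \<le> 2 * K * 1" unfolding abs_mult using l dd \<delta> K by (intro mult_mono) auto
    then have "\<bar>lam k - lam m - l * (k / N - y)\<bar> \<le> 6 * K" using lb[OF k] lb[OF \<open>m \<le> N\<close>] by linarith
    also have "\<dots> = 6 * K / \<delta>\<^sup>2 * \<delta>\<^sup>2" using \<delta> by simp
    also have "\<dots> \<le> M * (1 / N + (k / N - y)\<^sup>2)"
    proof (intro mult_mono)
      have "\<delta>\<^sup>2 \<le> (k / N - y)\<^sup>2" using dd \<delta> by (intro power_mono) auto
      then show "\<delta>\<^sup>2 \<le> 1 / N + (k / N - y)\<^sup>2" by (simp add: add_increasing)
    qed (use M K in auto)
    finally show ?thesis unfolding m_def l_def .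
  qed
qed

section \<open>Uniform asymptotics of the Bergman sums\<close>

text \<open>Valid for every K beyond a threshold, so that both end metrics can share one K, as
  \<open>weight_interpolate\<close> demands.\<close>

lemma (in potential) weight_eventually:
  assumes \<delta>: "0 < \<delta>" "\<delta> \<le> 1 / 3"
  obtains K0 where "\<And>K. K \<ge> K0 \<Longrightarrow> \<forall>\<^sub>F N in sequentially. weight N \<delta> K (Q N) l l'"
proof -
  have \<delta>1: "\<delta> < 1" using \<delta> by simp
  obtain K1 where K1: "K1 \<ge> 1" and lb:
    "\<And>v. 0 < v \<Longrightarrow> v \<le> 1 - \<delta> \<Longrightarrow> \<bar>l v\<bar> \<le> K1 \<and> \<bar>l' v\<bar> \<le> K1 \<and> 1 / K1 \<le> 1 - v * l' v"
    and lL: "\<And>v w. 0 < v \<Longrightarrow> v \<le> 1 - \<delta> \<Longrightarrow> 0 < w \<Longrightarrow> w \<le> 1 - \<delta> \<Longrightarrow> \<bar>l' v - l' w\<bar> \<le> K1 * \<bar>v - w\<bar>"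
    using l_bounds[OF \<delta>(1) \<delta>1] by blast
  obtain C1 :: real where C1: "C1 \<ge> 0" "\<And>N j. j \<le> N \<Longrightarrow> N \<ge> 1 \<Longrightarrow> \<bar>ln (Q N j)\<bar> \<le> real N * C1" using ln_Q_bound by blast
  obtain C2 N0 where C2: "C2 \<ge> 0" "\<And>N k. N \<ge> N0 \<Longrightarrow> k < N \<Longrightarrow> real (k + 1) / N \<le> 1 - \<delta> \<Longrightarrow>
    \<bar>ln (real (k + 1) / N * (Q N k / Q N (k + 1))) - l (real (k + 1) / N)\<bar> \<le> C2 / N"
    using ratio_ln_asymp[OF \<delta>(1) \<delta>1] by blast
  show ?thesis
  proof (rule that[of "K1 + C1 + C2"])
    fix K assume K: "K \<ge> K1 + C1 + C2"
    have K': "K1 \<le> K" "C1 \<le> K" "C2 \<le> K" "1 \<le> K" using K K1 C1(1) C2(1) by auto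
    have "\<forall>\<^sub>F N in sequentially. N \<ge> N0 \<and> N \<ge> 1 \<and> real N \<ge> K \<and> real N \<ge> 1 / \<delta>"
      using eventually_ge_at_top[of N0] eventually_ge_at_top[of 1]
        eventually_compose_filterlim[OF eventually_ge_at_top[of K] filterlim_real_sequentially]
        eventually_compose_filterlim[OF eventually_ge_at_top[of "1 / \<delta>"] filterlim_real_sequentially]
      by eventually_elim auto
    then show "\<forall>\<^sub>F N in sequentially. weight N \<delta> K (Q N) l l'"
    proof (rule eventually_mono)
      fix N assume N: "N \<ge> N0 \<and> N \<ge> 1 \<and> real N \<ge> K \<and> real N \<ge> 1 / \<delta>"
      show "weight N \<delta> K (Q N) l l'"
      proof
        show "0 < \<delta>" "\<delta> \<le> 1 / 3" "1 \<le> K" "K \<le> real N" using \<delta> K' N by auto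
        show "1 \<le> real N * \<delta>" using N \<delta> by (simp add: field_simps)
        show "0 < Q N k" if "k \<le> N" for k by (rule Q_pos[OF that])
        show "(Q N (k + 1))\<^sup>2 \<le> Q N k * Q N (k + 2)" if "k + 2 \<le> N" for k by (rule Q_log_convex[OF that])
        show "\<bar>ln (Q N k)\<bar> \<le> real N * K" if "k \<le> N" for k
          using C1(2)[OF that] N mult_left_mono[OF K'(2), of "real N"] by linarith
        show "(l has_real_derivative l' v) (at v)" if "0 < v" "v \<le> 1 - \<delta>" for v
          using l_deriv[of v] that \<delta> by simp
        show "\<bar>l v\<bar> \<le> K" "\<bar>l' v\<bar> \<le> K" if "0 < v" "v \<le> 1 - \<delta>" for v
          using lb[OF that] K' by auto
        show "1 / K \<le> 1 - v * l' v" if "0 < v" "v \<le> 1 - \<delta>" for v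
        proof -
          have "1 / K \<le> 1 / K1" using K' K1 by (intro divide_left_mono) auto
          then show ?thesis using lb[OF that] by linarith
        qed
        show "\<bar>l' v - l' w\<bar> \<le> K * \<bar>v - w\<bar>" if "0 < v" "v \<le> 1 - \<delta>" "0 < w" "w \<le> 1 - \<delta>" for v w
          using lL[OF that] mult_right_mono[OF K'(1), of "\<bar>v - w\<bar>"] by linarith
        show "\<bar>ln (real (k + 1) / real N * (Q N k / Q N (k + 1))) - l (real (k + 1) / real N)\<bar> \<le> K / real N"
          if "k < N" "real (k + 1) / real N \<le> 1 - \<delta>" for k
        proof -
          have "C2 / N \<le> K / N" using K' by (intro divide_right_mono) auto
          then show ?thesis using C2(2)[of N k] that N by force
        qed
      qed
    qed
  qed
qed

definition Q_at :: "(real \<times> complex \<Rightarrow> real) \<Rightarrow> real \<Rightarrow> nat \<Rightarrow> nat \<Rightarrow> real" where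
  "Q_at u s = potential.Q (\<lambda>z. u (s, z))"

context geodesic
begin

text \<open>The moment is continuous on the compact set of t in [0, 1] and 0 \<le> r \<le> R, and
  less than 1 at each of its points.\<close>

lemma y_bound:
  obtains \<delta> where "0 < \<delta>" "\<delta> \<le> 1 / 3"
    "\<And>t r. t \<in> {0..1} \<Longrightarrow> 0 < r \<Longrightarrow> r \<le> R \<Longrightarrow> y_at u t (r\<^sup>2) \<le> 1 - 3 * \<delta>"
proof -
  define B :: "(real \<times> real) set" where "B = {0..1} \<times> {0..max R 0}"
  define Y where "Y p = snd p * E_r p / 2" for p
  have Y: "Y (t, r) = y_at u t (r\<^sup>2)" if "t \<in> {0..1}" "0 < r" for t r
  proof -
    interpret potential "\<lambda>z. u (t, z)" "\<lambda>z. v (t, z)" by (rule pot[OF that(1)])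
    show ?thesis using slice_deriv[OF that(1), of r] that by (simp add: Y_def y_at_def aff.y_def)
  qed
  have "continuous_on strip Y" unfolding Y_def by (auto intro!: continuous_intros E_r_cont)
  then have cont: "continuous_on B Y" by (rule continuous_on_subset) (auto simp: B_def strip_def)
  have "compact B" "B \<noteq> {}" by (auto simp: B_def compact_Times)
  from continuous_attains_sup[OF this cont]
  obtain p where p: "p \<in> B" "\<And>q. q \<in> B \<Longrightarrow> Y q \<le> Y p" by blast
  have "Y p < 1"
  proof (cases "snd p = 0")
    case False
    then have "fst p \<in> {0..1}" "snd p > 0" using p by (auto simp: B_def)
    interpret potential "\<lambda>z. u (fst p, z)" "\<lambda>z. v (fst p, z)" by (rule pot) fact
    show ?thesis using Y[of "fst p" "snd p"] y_range(2)[of "(snd p)\<^sup>2"] \<open>fst p \<in> {0..1}\<close> \<open>snd p > 0\<close>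
      by (simp add: y_at_def)
  qed (simp add: Y_def)
  moreover have "0 \<le> Y p" using p(2)[of "(0, 0)"] by (simp add: B_def Y_def)
  moreover have "y_at u t (r\<^sup>2) \<le> 1 - 3 * ((1 - Y p) / 3)" if "t \<in> {0..1}" "0 < r" "r \<le> R" for t r
  proof -
    have "y_at u t (r\<^sup>2) \<le> Y p" using p(2)[of "(t, r)"] Y[of t r] that by (simp add: B_def)
    then show ?thesis by argo
  qed
  ultimately show ?thesis by (intro that[of "(1 - Y p) / 3"]) simp_all
qed

text \<open>In exponential form the weight is positive and smooth in t for all k, and its
  logarithmic derivative in t is \<open>N * lam N k\<close>.\<close>

definition wt :: "nat \<Rightarrow> real \<Rightarrow> nat \<Rightarrow> real" where
  "wt N t k = exp (- ((1 - t) * ln (Q_at u 0 N k) + t * ln (Q_at u 1 N k)))"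

definition lam :: "nat \<Rightarrow> nat \<Rightarrow> real" where
  "lam N k = (ln (Q_at u 0 N k) - ln (Q_at u 1 N k)) / N"

text \<open>Each (t, r) gives an instance of \<open>weight_at\<close> for the interpolated weights.
  \<delta>, K and hence CF depend on R and the fixed geodesic data but not on (t, r), so the error
  CF / sqrt N is uniform.\<close>

lemma bergman_estimates:
  assumes R: "R > 0" and \<epsilon>: "\<epsilon> > 0"
  shows "\<forall>\<^sub>F N in sequentially. N \<ge> 1 \<and> (\<forall>t r. 0 < t \<longrightarrow> t < 1 \<longrightarrow> 0 < r \<longrightarrow> r \<le> R \<longrightarrow>
    (let x = r\<^sup>2; y = y_at u t x; g = g_at u t x; l = l_at u 1 y - l_at u 0 y in
      \<bar>bergman_sum.mean N (wt N t) x (bergman_sum.frac N) / x - y / x\<bar> \<le> \<epsilon> \<and>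
      \<bar>N * bergman_sum.cov N (wt N t) x (bergman_sum.frac N) (bergman_sum.frac N) / x - g\<bar> \<le> \<epsilon> \<and>
      \<bar>N * bergman_sum.cov N (wt N t) x (lam N) (bergman_sum.frac N) / r - l * r * g\<bar> \<le> \<epsilon> \<and>
      \<bar>N * bergman_sum.cov N (wt N t) x (lam N) (lam N) - l\<^sup>2 * x * g\<bar> \<le> \<epsilon>))"
proof -
  obtain \<delta> where \<delta>: "0 < \<delta>" "\<delta> \<le> 1 / 3"
    and yb: "\<And>t r. t \<in> {0..1} \<Longrightarrow> 0 < r \<Longrightarrow> r \<le> R \<Longrightarrow> y_at u t (r\<^sup>2) \<le> 1 - 3 * \<delta>"
    using y_bound[of R] by blast
  interpret p0: potential "\<lambda>z. u (0, z)" "\<lambda>z. v (0, z)" by (rule pot) simp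
  interpret p1: potential "\<lambda>z. u (1, z)" "\<lambda>z. v (1, z)" by (rule pot) simp
  obtain K0 where K0: "\<And>K. K \<ge> K0 \<Longrightarrow> \<forall>\<^sub>F N in sequentially. weight N \<delta> K (Q_at u 0 N) (l_at u 0) (l'_at u 0)"
    using p0.weight_eventually[OF \<delta>] unfolding Q_at_def l_at_def l'_at_def by blast
  obtain K1 where K1: "\<And>K. K \<ge> K1 \<Longrightarrow> \<forall>\<^sub>F N in sequentially. weight N \<delta> K (Q_at u 1 N) (l_at u 1) (l'_at u 1)"
    using p1.weight_eventually[OF \<delta>] unfolding Q_at_def l_at_def l'_at_def by blast
  \<comment> \<open>R^2 enters because \<open>weight_at\<close> requires x \<le> K.\<close>
  define K where "K = max (max K0 K1) (R\<^sup>2)"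
  define c where "c = weight_at.c \<delta> K"
  define M where "M = weight_at.M \<delta> K"
  define CF where "CF = stein_bounds.CF c M K"
  have "(\<lambda>N. CF * (1 / sqrt (real N))) \<longlonglongrightarrow> CF * 0"
    by (intro tendsto_intros tendsto_divide_0[OF tendsto_const] filterlim_at_top_imp_at_infinity
        filterlim_compose[OF sqrt_at_top] filterlim_real_sequentially)
  then have "(\<lambda>N. CF * (1 / sqrt (real N))) \<longlonglongrightarrow> 0" by simp
  then have e1: "\<forall>\<^sub>F N in sequentially. CF * (1 / sqrt (real N)) < \<epsilon>"
    using \<epsilon> by (rule order_tendstoD)
  have e2: "\<forall>\<^sub>F N in sequentially. weight N \<delta> K (Q_at u 0 N) (l_at u 0) (l'_at u 0)"
    by (rule K0) (simp add: K_def)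
  have e3: "\<forall>\<^sub>F N in sequentially. weight N \<delta> K (Q_at u 1 N) (l_at u 1) (l'_at u 1)"
    by (rule K1) (simp add: K_def)
  show ?thesis
    using e1 e2 e3 eventually_ge_at_top[of 1]
  proof eventually_elim
    fix N :: nat
    assume N: "CF * (1 / sqrt (real N)) < \<epsilon>" and w0: "weight N \<delta> K (Q_at u 0 N) (l_at u 0) (l'_at u 0)"
      and w1: "weight N \<delta> K (Q_at u 1 N) (l_at u 1) (l'_at u 1)" and N1: "1 \<le> N"
    show "N \<ge> 1 \<and> (\<forall>t r. 0 < t \<longrightarrow> t < 1 \<longrightarrow> 0 < r \<longrightarrow> r \<le> R \<longrightarrow>
      (let x = r\<^sup>2; y = y_at u t x; g = g_at u t x; l = l_at u 1 y - l_at u 0 y in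
      \<bar>bergman_sum.mean N (wt N t) x (bergman_sum.frac N) / x - y / x\<bar> \<le> \<epsilon> \<and>
      \<bar>N * bergman_sum.cov N (wt N t) x (bergman_sum.frac N) (bergman_sum.frac N) / x - g\<bar> \<le> \<epsilon> \<and>
      \<bar>N * bergman_sum.cov N (wt N t) x (lam N) (bergman_sum.frac N) / r - l * r * g\<bar> \<le> \<epsilon> \<and>
      \<bar>N * bergman_sum.cov N (wt N t) x (lam N) (lam N) - l\<^sup>2 * x * g\<bar> \<le> \<epsilon>))"
    proof (intro conjI allI impI N1)
      fix t r :: real assume t: "0 < t" "t < 1" and r: "0 < r" "r \<le> R"
      define x where "x = r\<^sup>2"
      define y where "y = y_at u t x"
      define g where "g = g_at u t x"
      define l where "l = l_at u 1 y - l_at u 0 y"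
      define lt where "lt v = (1 - t) * l_at u 0 v + t * l_at u 1 v" for v
      define lt' where "lt' v = (1 - t) * l'_at u 0 v + t * l'_at u 1 v" for v
      define q where "q k = exp ((1 - t) * ln (Q_at u 0 N k) + t * ln (Q_at u 1 N k))" for k
      note gf = geodesic_facts[OF t r(1), folded x_def, folded y_def]
      have x: "0 < x" "x \<le> K"
      proof -
        show "0 < x" using r by (simp add: x_def)
        have "x \<le> R\<^sup>2" unfolding x_def using r by (intro power_mono) auto
        then show "x \<le> K" by (simp add: K_def)
      qed
      interpret w: weight N \<delta> K q lt lt'
        using weight_interpolate[OF w0 w1, of t] t unfolding q_def[abs_def] lt_def[abs_def] lt'_def[abs_def] by simp
      interpret w: weight_at N \<delta> K q lt lt' x y
      proof
        show "y \<le> 1 - 3 * \<delta>" using yb[of t r] t r by (simp add: y_def x_def)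
        show "y = x * exp (lt y)" using gf(1) by (simp add: lt_def)
      qed (use x gf in auto)
      have wt: "w.w' k = wt N t k" if "k \<le> N" for k
        using that by (simp only: w.w'_def w.w_def wt_def q_def exp_minus inverse_eq_divide if_True)
      interpret b: bergman_sum N "wt N t" x using N1 x by unfold_locales (auto simp: wt_def)
      have mean: "w.b.mean f = b.mean f" for f
        unfolding w.b.mean_def b.mean_def w.b.Z_def b.Z_def using wt by (intro arg_cong2[where f = "(/)"] sum.cong) auto
      have cov: "w.b.cov f h = b.cov f h" for f h
        unfolding w.b.cov_def b.cov_def mean by simp
      interpret s: stein_bounds N w.w' x y w.H w.H' c M K
        unfolding c_def M_def by (rule w.stein)
      have "y / x = (x * exp (lt y)) / x" by (subst (1) w.xy) (rule refl)
      then have H: "w.H = y / x" using x by (simp add: w.H_def)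
      \<comment> \<open>The limiting variance of the Stein estimates is identified with the
        curvature coefficient of the geodesic by \<open>g_formula\<close>.\<close>
      have gg: "w.H / (1 - x * w.H') = g"
      proof -
        have "x * w.H' = y * lt' y" using w.xy by (simp add: w.H'_def)
        moreover have "g * (1 - y * lt' y) = y / x"
          using g_formula[OF t r(1), folded x_def, folded y_def] by (simp add: g_def lt'_def)
        moreover have "1 - y * lt' y > 0"
          using w.H_bounds(4) w.K \<open>x * w.H' = y * lt' y\<close> by (smt (verit) divide_pos_pos)
        ultimately show ?thesis unfolding H by (subst nonzero_divide_eq_eq) simp_all
      qed
      have Mb: "10 * K \<le> M" "6 * K / \<delta>\<^sup>2 \<le> M" using w.Mterms(7,8) by (simp_all add: M_def)
      have l_le: "\<bar>l\<bar> \<le> M"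
      proof -
        have y1: "0 < y" "y \<le> 1 - \<delta>" using w.y w.y_le by auto
        have "\<bar>l\<bar> \<le> 2 * K" using weight.l_le[OF w0 y1] weight.l_le[OF w1 y1] by (simp add: l_def)
        then show ?thesis using Mb(1) w.K by linarith
      qed
      have lam: "\<bar>lam N k - lam N (nat \<lfloor>N * y\<rfloor>) - l * (w.b.frac k - y)\<bar> \<le> M * (1 / N + (w.b.frac k - y)\<^sup>2)"
        if "k \<le> N" for k
        using log_quotient_expansion[OF w0 w1 w.y that Mb] unfolding lam_def l_def w.b.frac_def .
      have sqx: "sqrt x = r" using r by (simp add: x_def)
      note sa = s.stein_asymptotics[OF l_le lam, unfolded s.s_def, folded CF_def, unfolded H gg[unfolded H] mean cov sqx]
      show "let x = r\<^sup>2; y = y_at u t x; g = g_at u t x; l = l_at u 1 y - l_at u 0 y in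
      \<bar>bergman_sum.mean N (wt N t) x b.frac / x - y / x\<bar> \<le> \<epsilon> \<and>
      \<bar>N * bergman_sum.cov N (wt N t) x b.frac b.frac / x - g\<bar> \<le> \<epsilon> \<and>
      \<bar>N * bergman_sum.cov N (wt N t) x (lam N) b.frac / r - l * r * g\<bar> \<le> \<epsilon> \<and>
      \<bar>N * bergman_sum.cov N (wt N t) x (lam N) (lam N) - l\<^sup>2 * x * g\<bar> \<le> \<epsilon>"
        unfolding Let_def x_def[symmetric] y_def[symmetric] g_def[symmetric] l_def[symmetric]
        using sa N by (intro conjI) linarith+
    qed
  qed
qed

end

section \<open>Convergence in a chart\<close>

text \<open>The cumulant rule: if b k is the logarithmic derivative of the k-th term, the logarithm
  of the sum has the mean of b as derivative, and a mean varies by the covariance with b.\<close>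

lemma deriv_mean:
  fixes b f :: "nat \<Rightarrow> real" and w :: "real \<Rightarrow> nat \<Rightarrow> real"
  assumes N: "N \<ge> 1" and pos: "\<And>s k. w s k > 0" "\<And>s. x s > 0"
    and d: "\<And>k. k \<le> N \<Longrightarrow> ((\<lambda>s. w s k * x s ^ k) has_real_derivative w a k * x a ^ k * b k) (at a)"
  shows "((\<lambda>s. bergman_sum.mean N (w s) (x s) f) has_real_derivative bergman_sum.cov N (w a) (x a) f b) (at a)"
    "((\<lambda>s. ln (\<Sum>k\<le>N. w s k * x s ^ k)) has_real_derivative bergman_sum.mean N (w a) (x a) b) (at a)"
proof -
  have bs: "bergman_sum N (w s) (x s)" for s using N pos by unfold_locales auto
  interpret bergman_sum N "w a" "x a" by (rule bs)
  have S: "((\<lambda>s. \<Sum>k\<le>N. w s k * x s ^ k * f k) has_real_derivative (\<Sum>k\<le>N. w a k * x a ^ k * b k * f k)) (at a)" for f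
    by (intro DERIV_sum DERIV_cmult_right d) auto
  have Z: "((\<lambda>s. \<Sum>k\<le>N. w s k * x s ^ k) has_real_derivative (\<Sum>k\<le>N. w a k * x a ^ k * b k)) (at a)"
    using S[of "\<lambda>_. 1"] by simp
  have Zp: "(\<Sum>k\<le>N. w a k * x a ^ k) > 0" using Z_pos by (simp add: Z_def)
  have "((\<lambda>s. (\<Sum>k\<le>N. w s k * x s ^ k * f k) / (\<Sum>k\<le>N. w s k * x s ^ k)) has_real_derivative
     ((\<Sum>k\<le>N. w a k * x a ^ k * b k * f k) * (\<Sum>k\<le>N. w a k * x a ^ k)
       - (\<Sum>k\<le>N. w a k * x a ^ k * f k) * (\<Sum>k\<le>N. w a k * x a ^ k * b k))
     / ((\<Sum>k\<le>N. w a k * x a ^ k) * (\<Sum>k\<le>N. w a k * x a ^ k))) (at a)"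
    using Zp by (intro DERIV_divide S Z) auto
  moreover have "((\<Sum>k\<le>N. w a k * x a ^ k * b k * f k) * (\<Sum>k\<le>N. w a k * x a ^ k)
       - (\<Sum>k\<le>N. w a k * x a ^ k * f k) * (\<Sum>k\<le>N. w a k * x a ^ k * b k))
     / ((\<Sum>k\<le>N. w a k * x a ^ k) * (\<Sum>k\<le>N. w a k * x a ^ k)) = cov f b"
    using Zp by (simp add: cov_eq' mean_def Z_def diff_divide_distrib mult_ac)
  ultimately show "((\<lambda>s. bergman_sum.mean N (w s) (x s) f) has_real_derivative cov f b) (at a)"
    by (simp add: bergman_sum.mean_def[OF bs] bergman_sum.Z_def[OF bs])
  have "((\<lambda>s. ln (\<Sum>k\<le>N. w s k * x s ^ k)) has_real_derivative
      1 / (\<Sum>k\<le>N. w a k * x a ^ k) * (\<Sum>k\<le>N. w a k * x a ^ k * b k)) (at a)"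
    by (rule DERIV_chain2[OF DERIV_ln_divide[OF Zp] Z])
  then show "((\<lambda>s. ln (\<Sum>k\<le>N. w s k * x s ^ k)) has_real_derivative mean b) (at a)"
    by (simp add: mean_def Z_def)
qed

lemma frechet_t:
  assumes "(F has_derivative F') (at (t, r))"
  shows "((\<lambda>s. F (s, r)) has_real_derivative F' (1, 0)) (at t)"
    "((\<lambda>s. F (t, s)) has_real_derivative F' (0, 1)) (at r)"
proof -
  show "((\<lambda>s. F (s, r)) has_real_derivative F' (1, 0)) (at t)"
    using deriv_along[where r = "\<lambda>_. r" and r' = 0 and s = t and F = F and F' = F', OF assms] by simp
  have "((\<lambda>s. F (t, s)) has_derivative (\<lambda>h. F' (0, h))) (at r)"
    by (rule has_derivative_compose[where f = "\<lambda>s. (t, s)", OF _ assms]) (auto intro!: derivative_eq_intros)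
  moreover have "F' (0, h) = F' (0, 1) * h" for h
    using linear_cmul[OF has_derivative_linear[OF assms], of h "(0, 1)"] by (simp add: mult.commute)
  then have "(\<lambda>h. F' (0, h)) = (*) (F' (0, 1))" by (intro ext)
  ultimately show "((\<lambda>s. F (t, s)) has_real_derivative F' (0, 1)) (at r)"
    unfolding has_field_derivative_def by (simp only:)
qed

section \<open>Derivatives of the Bergman potential as means and covariances\<close>

context geodesic
begin

definition LN :: "nat \<Rightarrow> real \<times> real \<Rightarrow> real" where
  "LN N p = ln (\<Sum>k\<le>N. wt N (fst p) k * ((snd p)\<^sup>2) ^ k) / N"

text \<open>Both \<open>LN\<close> and E contain minus the logarithm of the metric, so this is the
  difference of Bergman and geodesic potentials, up to the constant ln (2 \<pi>) / N.\<close>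

definition Phi :: "nat \<Rightarrow> real \<times> real \<Rightarrow> real" where
  "Phi N p = LN N p - E p"

lemma sum_pos_LN: "(\<Sum>k\<le>N. wt N t k * (r\<^sup>2) ^ k) > 0"
proof -
  have "(\<Sum>k\<in>{0}. wt N t k * (r\<^sup>2) ^ k) \<le> (\<Sum>k\<le>N. wt N t k * (r\<^sup>2) ^ k)"
    by (intro sum_mono2) (auto simp: wt_def)
  moreover have "wt N t 0 > 0" by (simp add: wt_def)
  ultimately show ?thesis by simp
qed

lemma ck_wt: "ck n S (\<lambda>p::real \<times> 'a::euclidean_space. wt N (fst p) k)"
  unfolding wt_def
  by (intro ck_exp ck_minus ck_add ck_mult ck_diff ck_const ck_bounded_linear bounded_linear_fst)

lemma ck_LN: "ck n S (LN N)"
proof -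
  have "ck n S (\<lambda>p. (1 / N) * ln (\<Sum>k\<le>N. wt N (fst p) k * ((snd p)\<^sup>2) ^ k))"
    using sum_pos_LN
    by (intro ck_cmult ck_ln ck_sum ck_mult ck_wt ck_power ck_bounded_linear bounded_linear_snd) auto
  then show ?thesis by (simp add: LN_def[abs_def])
qed

lemma ck_Phi: "ck n istrip (Phi N)"
  unfolding Phi_def[abs_def] by (intro ck_diff ck_LN ck_E)

text \<open>\<open>deriv_mean\<close> with the logarithmic derivatives of the k-th term: N lam k in
  t and 2 k / r in r.\<close>

lemma LN_derivs:
  assumes N: "N \<ge> 1" and p: "(t, r) \<in> istrip" and r: "r > 0"
  defines "m \<equiv> bergman_sum.mean N (wt N t) (r\<^sup>2)" and "cv \<equiv> bergman_sum.cov N (wt N t) (r\<^sup>2)"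
    and "fr \<equiv> bergman_sum.frac N"
  shows "Dr (LN N) (t, r) = 2 / r * m fr" "Dt (LN N) (t, r) = m (lam N)"
    "Dr (Dr (LN N)) (t, r) = 4 * real N / r\<^sup>2 * cv fr fr - 2 / r\<^sup>2 * m fr"
    "Dr (Dt (LN N)) (t, r) = 2 * real N / r * cv (lam N) fr"
    "Dt (Dt (LN N)) (t, r) = N * cv (lam N) (lam N)"
proof -
  have in': "(s, a) \<in> istrip" if "0 < s" "s < 1" for s a using that by (simp add: istrip_def)
  have t: "0 < t" "t < 1" using p by (auto simp: istrip_def)
  have wp: "wt N s k > 0" for s k by (simp add: wt_def)
  have bs: "bergman_sum N (wt N s) (a\<^sup>2)" if "a > 0" for s a using N that wp by unfold_locales auto
  have mean_eq: "bergman_sum.mean N (wt N s) (a\<^sup>2) (\<lambda>k. c * f k) = c * bergman_sum.mean N (wt N s) (a\<^sup>2) f"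
    if "a > 0" for s a c f using bergman_sum.mean_cmult[OF bs[OF that]] .
  have cov_eq: "bergman_sum.cov N (wt N s) (a\<^sup>2) f (\<lambda>k. c * h k) = c * bergman_sum.cov N (wt N s) (a\<^sup>2) f h"
    if "a > 0" for s a c f h
  proof -
    interpret bergman_sum N "wt N s" "a\<^sup>2" by (rule bs[OF that])
    have "(\<lambda>k. (f k - mean f) * (c * h k - c * mean h)) = (\<lambda>k. c * ((f k - mean f) * (h k - mean h)))"
      by (simp add: fun_eq_iff algebra_simps)
    then have "cov f (\<lambda>k. c * h k) = mean (\<lambda>k. c * ((f k - mean f) * (h k - mean h)))"
      unfolding cov_def mean_cmult[of c h] by (simp only:)
    also have "\<dots> = c * mean (\<lambda>k. (f k - mean f) * (h k - mean h))" by (rule mean_cmult)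
    finally show ?thesis unfolding cov_def[of f h] .
  qed
  have fr: "fr k = real k / N" for k by (simp add: fr_def bergman_sum.frac_def[OF bs[OF r]])
  have fr_eq: "bergman_sum.frac N = fr" by (simp add: fr_def)
  have dt: "((\<lambda>s. wt N s k * (a\<^sup>2) ^ k) has_real_derivative wt N s k * (a\<^sup>2) ^ k * (N * lam N k)) (at s)" for s a k
    using N unfolding wt_def lam_def by (auto intro!: derivative_eq_intros simp: field_simps)
  \<comment> \<open>\<open>deriv_mean\<close> asks for a positive base at every parameter;
    \<open>max a (r / 2)\<close> provides it and equals a near r.\<close>
  have dr: "((\<lambda>a. wt N s k * (max a (r / 2))\<^sup>2 ^ k) has_real_derivative wt N s k * (max a (r / 2))\<^sup>2 ^ k * ((2 * real N / a) * fr k)) (at a)"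
    if "a > r / 2" for s a k
  proof -
    have a: "a > 0" using that r by linarith
    have "((\<lambda>a. wt N s k * (a\<^sup>2) ^ k) has_real_derivative wt N s k * (a\<^sup>2) ^ k * ((2 * real N / a) * fr k)) (at a)"
    proof (cases k)
      case (Suc j)
      have "((\<lambda>a. wt N s k * (a\<^sup>2) ^ k) has_real_derivative wt N s k * (real k * (2 * a) * (a\<^sup>2) ^ j)) (at a)"
      proof -
        have "((\<lambda>a. a\<^sup>2) has_real_derivative 2 * a) (at a)" by (auto intro!: derivative_eq_intros)
        from DERIV_cmult[OF DERIV_power_Suc[OF this, of j], of "wt N s k"]
        show ?thesis unfolding Suc by (simp add: algebra_simps)
      qed
      moreover have "wt N s k * (real k * (2 * a) * (a\<^sup>2) ^ j) = wt N s k * (a\<^sup>2) ^ k * ((2 * real N / a) * fr k)"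
        using a N unfolding Suc by (simp add: fr field_simps power2_eq_square)
      ultimately show ?thesis by simp
    qed (simp add: fr)
    then have "((\<lambda>a. wt N s k * (max a (r / 2))\<^sup>2 ^ k) has_real_derivative wt N s k * (a\<^sup>2) ^ k * ((2 * real N / a) * fr k)) (at a)"
      by (rule has_field_derivative_transform_within_open[where S = "{r / 2<..}"]) (use that in \<open>auto simp: max_def\<close>)
    then show ?thesis using that by (simp add: max_def)
  qed
  have mp: "max a (r / 2) > 0" for a using r by auto
  have LNt: "((\<lambda>s. LN N (s, a)) has_real_derivative bergman_sum.mean N (wt N s) (a\<^sup>2) (lam N)) (at s)"
    if "a > 0" for s a
  proof -
    have "((\<lambda>s. ln (\<Sum>k\<le>N. wt N s k * (a\<^sup>2) ^ k)) has_real_derivative bergman_sum.mean N (wt N s) (a\<^sup>2) (\<lambda>k. N * lam N k)) (at s)"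
      by (rule deriv_mean(2)[where w = "wt N" and x = "\<lambda>_. a\<^sup>2", OF N wp _ dt]) (use that in simp)
    then have "((\<lambda>s. ln (\<Sum>k\<le>N. wt N s k * (a\<^sup>2) ^ k) / N) has_real_derivative N * bergman_sum.mean N (wt N s) (a\<^sup>2) (lam N) / N) (at s)"
      unfolding mean_eq[OF that] by (rule DERIV_cdivide)
    then show ?thesis using N by (simp add: LN_def)
  qed
  have LNr: "((\<lambda>a. LN N (s, a)) has_real_derivative 2 / a * bergman_sum.mean N (wt N s) (a\<^sup>2) fr) (at a)"
    if a: "a > r / 2" for s a
  proof -
    have a0: "a > 0" and mx: "max a (r / 2) = a" using a r by auto
    have "((\<lambda>a. ln (\<Sum>k\<le>N. wt N s k * (max a (r / 2))\<^sup>2 ^ k)) has_real_derivative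
        bergman_sum.mean N (wt N s) ((max a (r / 2))\<^sup>2) (\<lambda>k. (2 * real N / a) * fr k)) (at a)"
      by (rule deriv_mean(2)[where w = "\<lambda>_. wt N s" and x = "\<lambda>a. (max a (r / 2))\<^sup>2", OF N _ _ dr[OF a]])
        (use mp wp in \<open>simp_all add: less_imp_neq[symmetric]\<close>)
    then have "((\<lambda>a. ln (\<Sum>k\<le>N. wt N s k * (max a (r / 2))\<^sup>2 ^ k) / N) has_real_derivative
        (2 * real N / a) * bergman_sum.mean N (wt N s) (a\<^sup>2) fr / N) (at a)"
      unfolding mx mean_eq[OF a0] by (rule DERIV_cdivide)
    then have "((\<lambda>a. LN N (s, a)) has_real_derivative (2 * real N / a) * bergman_sum.mean N (wt N s) (a\<^sup>2) fr / N) (at a)"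
      by (rule has_field_derivative_transform_within_open[where S = "{r / 2<..}"]) (use a in \<open>auto simp: LN_def max_def\<close>)
    then show ?thesis using N by simp
  qed
  have hd: "(F has_derivative frechet_derivative F (at (s, a))) (at (s, a))"
    if "\<And>n. ck n istrip F" "0 < s" "s < 1" for F s a by (rule has_der[OF that(1) in'[OF that(2,3)]])
  have DrL: "Dr (LN N) (s, a) = 2 / a * bergman_sum.mean N (wt N s) (a\<^sup>2) fr" if "0 < s" "s < 1" "a > r / 2" for s a
    using DERIV_unique[OF frechet_t(2)[OF hd[OF ck_LN that(1,2)]] LNr[OF that(3)]] .
  have DtL: "Dt (LN N) (s, a) = bergman_sum.mean N (wt N s) (a\<^sup>2) (lam N)" if "0 < s" "s < 1" "a > 0" for s a
    using DERIV_unique[OF frechet_t(1)[OF hd[OF ck_LN that(1,2)]] LNt[OF that(3)]] .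
  show "Dr (LN N) (t, r) = 2 / r * m fr" "Dt (LN N) (t, r) = m (lam N)"
    using DrL[OF t] DtL[OF t] r by (simp_all add: m_def)
  have mr: "((\<lambda>a. bergman_sum.mean N (wt N t) (a\<^sup>2) f) has_real_derivative 2 * real N / r * cv f fr) (at r)" for f
  proof -
    have mx: "max r (r / 2) = r" using r by simp
    have "((\<lambda>a. bergman_sum.mean N (wt N t) ((max a (r / 2))\<^sup>2) f) has_real_derivative
        bergman_sum.cov N (wt N t) ((max r (r / 2))\<^sup>2) f (\<lambda>k. (2 * real N / r) * fr k)) (at r)"
      by (rule deriv_mean(1)[where w = "\<lambda>_. wt N t" and x = "\<lambda>a. (max a (r / 2))\<^sup>2", OF N _ _ dr])
        (use mp wp r in \<open>simp_all add: less_imp_neq[symmetric]\<close>)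
    then have "((\<lambda>a. bergman_sum.mean N (wt N t) ((max a (r / 2))\<^sup>2) f) has_real_derivative 2 * real N / r * cv f fr) (at r)"
      unfolding mx cov_eq[OF r] cv_def .
    then show ?thesis
      by (rule has_field_derivative_transform_within_open[where S = "{r / 2<..}"]) (use r in \<open>auto simp: max_def\<close>)
  qed
  have mt: "((\<lambda>s. bergman_sum.mean N (wt N s) (r\<^sup>2) f) has_real_derivative N * cv f (lam N)) (at t)" for f
  proof -
    have "((\<lambda>s. bergman_sum.mean N (wt N s) (r\<^sup>2) f) has_real_derivative
        bergman_sum.cov N (wt N t) (r\<^sup>2) f (\<lambda>k. N * lam N k)) (at t)"
      by (rule deriv_mean(1)[where w = "wt N" and x = "\<lambda>_. r\<^sup>2", OF N wp _ dt]) (use r in simp)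
    then show ?thesis unfolding cov_eq[OF r] cv_def .
  qed
  show "Dr (Dr (LN N)) (t, r) = 4 * real N / r\<^sup>2 * cv fr fr - 2 / r\<^sup>2 * m fr"
  proof -
    have "((\<lambda>a. 2 / a * bergman_sum.mean N (wt N t) (a\<^sup>2) fr) has_real_derivative
       2 / r * (2 * real N / r * cv fr fr) + (- 2 / r\<^sup>2) * m fr) (at r)"
      unfolding m_def using r
      by (intro DERIV_mult' mr) (auto intro!: derivative_eq_intros simp: power2_eq_square)
    then have "((\<lambda>a. Dr (LN N) (t, a)) has_real_derivative 2 / r * (2 * real N / r * cv fr fr) + (- 2 / r\<^sup>2) * m fr) (at r)"
      by (rule has_field_derivative_transform_within_open[where S = "{r / 2<..}"]) (use r t DrL in auto)
    from DERIV_unique[OF frechet_t(2)[OF hd[OF ck_Dr[OF ck_LN] t]] this]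
    show ?thesis by (simp add: power2_eq_square)
  qed
  show "Dr (Dt (LN N)) (t, r) = 2 * real N / r * cv (lam N) fr"
  proof -
    have "((\<lambda>a. Dt (LN N) (t, a)) has_real_derivative 2 * real N / r * cv (lam N) fr) (at r)"
      by (rule has_field_derivative_transform_within_open[OF mr, where S = "{0<..}"]) (use r t DtL in auto)
    from DERIV_unique[OF frechet_t(2)[OF hd[OF ck_Dt[OF ck_LN] t]] this] show ?thesis .
  qed
  show "Dt (Dt (LN N)) (t, r) = N * cv (lam N) (lam N)"
  proof -
    have "((\<lambda>s. Dt (LN N) (s, r)) has_real_derivative N * cv (lam N) (lam N)) (at t)"
      by (rule has_field_derivative_transform_within_open[OF mt, where S = "{0<..<1}"]) (use r t DtL in auto)
    from DERIV_unique[OF frechet_t(1)[OF hd[OF ck_Dt[OF ck_LN] t]] this] show ?thesis .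
  qed
qed

lemma D_diff:
  assumes "\<And>n. ck n istrip F" "\<And>n. ck n istrip G" "p \<in> istrip"
  shows "Dt (\<lambda>p. F p - G p) p = Dt F p - Dt G p" "Dr (\<lambda>p. F p - G p) p = Dr F p - Dr G p"
proof -
  have "frechet_derivative (\<lambda>p. F p - G p) (at p) = (\<lambda>v. frechet_derivative F (at p) v - frechet_derivative G (at p) v)"
    by (intro frechet_derivative_at[symmetric] has_derivative_diff has_der assms)
  then show "Dt (\<lambda>p. F p - G p) p = Dt F p - Dt G p" "Dr (\<lambda>p. F p - G p) p = Dr F p - Dr G p" by simp_all
qed

lemma Phi_derivs:
  assumes p: "p \<in> istrip"
  shows "Dt (Phi N) p = Dt (LN N) p - Dt E p" "Dr (Phi N) p = Dr (LN N) p - Dr E p"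
    "Dr (Dr (Phi N)) p = Dr (Dr (LN N)) p - Dr (Dr E) p"
    "Dr (Dt (Phi N)) p = Dr (Dt (LN N)) p - Dr (Dt E) p"
    "Dt (Dt (Phi N)) p = Dt (Dt (LN N)) p - Dt (Dt E) p"
proof -
  have 1: "Dt (Phi N) q = Dt (LN N) q - Dt E q" "Dr (Phi N) q = Dr (LN N) q - Dr E q" if "q \<in> istrip" for q
    unfolding Phi_def[abs_def] using D_diff[OF ck_LN ck_E that] by auto
  show "Dt (Phi N) p = Dt (LN N) p - Dt E p" "Dr (Phi N) p = Dr (LN N) p - Dr E p" using 1[OF p] by auto
  have 2: "frechet_derivative (Dt (Phi N)) (at p) = frechet_derivative (\<lambda>q. Dt (LN N) q - Dt E q) (at p)"
    "frechet_derivative (Dr (Phi N)) (at p) = frechet_derivative (\<lambda>q. Dr (LN N) q - Dr E q) (at p)"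
    by (rule frechet_cong_open[OF istrip(1) p], use 1 in simp)+
  show "Dr (Dr (Phi N)) p = Dr (Dr (LN N)) p - Dr (Dr E) p"
    "Dr (Dt (Phi N)) p = Dr (Dt (LN N)) p - Dr (Dt E) p"
    "Dt (Dt (Phi N)) p = Dt (Dt (LN N)) p - Dt (Dt E) p"
    unfolding 2 using D_diff[OF ck_Dt[OF ck_LN] ck_Dt[OF ck_E] p] D_diff[OF ck_Dr[OF ck_LN] ck_Dr[OF ck_E] p] by auto
qed

text \<open>The derivatives of \<open>Phi\<close> are combinations, with coefficients at most 4, of
  the differences in \<open>bergman_estimates\<close>. The first radial derivative is 2 r times such
  a difference and so gains the factor r.\<close>

lemma Phi_second:
  assumes R: "R > 0" and \<epsilon>: "\<epsilon> > 0"
  shows "\<forall>\<^sub>F N in sequentially. \<forall>t r. 0 < t \<longrightarrow> t < 1 \<longrightarrow> 0 < r \<longrightarrow> r \<le> R \<longrightarrow>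
    \<bar>Dr (Phi N) (t, r)\<bar> \<le> \<epsilon> * r \<and> \<bar>Dr (Dr (Phi N)) (t, r)\<bar> \<le> \<epsilon> \<and>
    \<bar>Dr (Dt (Phi N)) (t, r)\<bar> \<le> \<epsilon> \<and> \<bar>Dt (Dt (Phi N)) (t, r)\<bar> \<le> \<epsilon>"
  using bergman_estimates[OF R, of "\<epsilon> / 6"]
proof (rule eventually_mono)
  show "\<epsilon> / 6 > 0" using \<epsilon> by simp
  fix N :: nat
  assume *: "N \<ge> 1 \<and> (\<forall>t r. 0 < t \<longrightarrow> t < 1 \<longrightarrow> 0 < r \<longrightarrow> r \<le> R \<longrightarrow>
    (let x = r\<^sup>2; y = y_at u t x; g = g_at u t x; l = l_at u 1 y - l_at u 0 y in
      \<bar>bergman_sum.mean N (wt N t) x (bergman_sum.frac N) / x - y / x\<bar> \<le> \<epsilon> / 6 \<and>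
      \<bar>N * bergman_sum.cov N (wt N t) x (bergman_sum.frac N) (bergman_sum.frac N) / x - g\<bar> \<le> \<epsilon> / 6 \<and>
      \<bar>N * bergman_sum.cov N (wt N t) x (lam N) (bergman_sum.frac N) / r - l * r * g\<bar> \<le> \<epsilon> / 6 \<and>
      \<bar>N * bergman_sum.cov N (wt N t) x (lam N) (lam N) - l\<^sup>2 * x * g\<bar> \<le> \<epsilon> / 6))"
  then have N: "N \<ge> 1" by blast
  show "\<forall>t r. 0 < t \<longrightarrow> t < 1 \<longrightarrow> 0 < r \<longrightarrow> r \<le> R \<longrightarrow>
    \<bar>Dr (Phi N) (t, r)\<bar> \<le> \<epsilon> * r \<and> \<bar>Dr (Dr (Phi N)) (t, r)\<bar> \<le> \<epsilon> \<and>
    \<bar>Dr (Dt (Phi N)) (t, r)\<bar> \<le> \<epsilon> \<and> \<bar>Dt (Dt (Phi N)) (t, r)\<bar> \<le> \<epsilon>"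
  proof (intro allI impI)
    fix t r :: real assume t: "0 < t" "t < 1" and r: "0 < r" "r \<le> R"
    have p: "(t, r) \<in> istrip" using t by (simp add: istrip_def)
    define x where "x = r\<^sup>2"
    define y where "y = y_at u t x"
    define g where "g = g_at u t x"
    define l where "l = l_at u 1 y - l_at u 0 y"
    define m where "m = bergman_sum.mean N (wt N t) x (bergman_sum.frac N)"
    define cv where "cv = bergman_sum.cov N (wt N t) x"
    have x: "x > 0" using r by (simp add: x_def)
    have a: "\<bar>m / x - y / x\<bar> \<le> \<epsilon> / 6" "\<bar>N * cv (bergman_sum.frac N) (bergman_sum.frac N) / x - g\<bar> \<le> \<epsilon> / 6"
      "\<bar>N * cv (lam N) (bergman_sum.frac N) / r - l * r * g\<bar> \<le> \<epsilon> / 6"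
      "\<bar>N * cv (lam N) (lam N) - l\<^sup>2 * x * g\<bar> \<le> \<epsilon> / 6"
      using *[THEN conjunct2, rule_format, OF t r]
      unfolding Let_def x_def[symmetric] y_def[symmetric] g_def[symmetric] l_def[symmetric] m_def[symmetric] cv_def[symmetric]
      by blast+
    note L = LN_derivs[OF N p r(1), folded x_def, folded m_def cv_def]
    note P4 = P_eq[OF t r(1), folded x_def, folded y_def g_def]
    note gf = geodesic_facts[OF t r(1), folded x_def, folded y_def, folded g_def l_def]
    have Er: "Dr E (t, r) = 2 / r * y" using P4(4) r by (simp add: field_simps)
    have Err: "Dr (Dr E) (t, r) = 4 * g - 2 / x * y"
      using P4(1) Er r by (simp add: P_def x_def field_simps power2_eq_square)
    have 1: "Dr (Phi N) (t, r) = 2 * r * (m / x - y / x)"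
      unfolding Phi_derivs[OF p] L Er using r by (simp add: x_def power2_eq_square field_simps)
    have "\<bar>Dr (Phi N) (t, r)\<bar> = 2 * r * \<bar>m / x - y / x\<bar>" unfolding 1 abs_mult using r by simp
    also have "\<dots> \<le> 2 * r * (\<epsilon> / 6)" using a r by (intro mult_left_mono) auto
    also have "\<dots> \<le> \<epsilon> * r" using r \<epsilon> by simp
    finally have "\<bar>Dr (Phi N) (t, r)\<bar> \<le> \<epsilon> * r" .
    moreover have 2: "Dr (Dr (Phi N)) (t, r) = 4 * (N * cv (bergman_sum.frac N) (bergman_sum.frac N) / x - g) - 2 * (m / x - y / x)"
      unfolding Phi_derivs[OF p] L Err by (simp add: algebra_simps)
    have "\<bar>4 * A - 2 * B\<bar> \<le> \<epsilon>" if "\<bar>A\<bar> \<le> \<epsilon> / 6" "\<bar>B\<bar> \<le> \<epsilon> / 6" for A B using that by linarith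
    then have "\<bar>Dr (Dr (Phi N)) (t, r)\<bar> \<le> \<epsilon>" unfolding 2 using a by blast
    moreover have 3: "Dr (Dt (Phi N)) (t, r) = 2 * (N * cv (lam N) (bergman_sum.frac N) / r - l * r * g)"
      unfolding Phi_derivs[OF p] L gf by (simp add: algebra_simps)
    have "\<bar>Dr (Dt (Phi N)) (t, r)\<bar> \<le> \<epsilon>" unfolding 3 abs_mult using a(3) \<epsilon> by simp
    moreover have 4: "Dt (Dt (Phi N)) (t, r) = N * cv (lam N) (lam N) - l\<^sup>2 * x * g"
      unfolding Phi_derivs[OF p] L gf by (simp add: mult_ac)
    have "\<bar>Dt (Dt (Phi N)) (t, r)\<bar> \<le> \<epsilon>" unfolding 4 using a(4) \<epsilon> by simp
    ultimately show "\<bar>Dr (Phi N) (t, r)\<bar> \<le> \<epsilon> * r \<and> \<bar>Dr (Dr (Phi N)) (t, r)\<bar> \<le> \<epsilon> \<and>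
      \<bar>Dr (Dt (Phi N)) (t, r)\<bar> \<le> \<epsilon> \<and> \<bar>Dt (Dt (Phi N)) (t, r)\<bar> \<le> \<epsilon>" by blast
  qed
qed

text \<open>At r = 0 only the term k = 0 survives. By \<open>E_at_0\<close>, \<open>Phi\<close> is
  there an affine function of t whose end values tend to 0, and with them its slope.\<close>

lemma Phi_base:
  assumes \<epsilon>: "\<epsilon> > 0"
  shows "\<forall>\<^sub>F N in sequentially. \<forall>t. 0 < t \<longrightarrow> t < 1 \<longrightarrow> \<bar>Phi N (t, 0)\<bar> \<le> \<epsilon> \<and> \<bar>Dt (Phi N) (t, 0)\<bar> \<le> \<epsilon>"
proof -
  interpret p0: potential "\<lambda>z. u (0, z)" "\<lambda>z. v (0, z)" by (rule pot) simp
  interpret p1: potential "\<lambda>z. u (1, z)" "\<lambda>z. v (1, z)" by (rule pot) simp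
  have l: "(\<lambda>N. ln (Q_at u 0 N 0) / N) \<longlonglongrightarrow> - u (0, 0)" "(\<lambda>N. ln (Q_at u 1 N 0) / N) \<longlonglongrightarrow> - u (1, 0)"
    using p0.ln_Q_0_tendsto p1.ln_Q_0_tendsto by (simp_all add: Q_at_def)
  have e: "\<forall>\<^sub>F N in sequentially. \<bar>ln (Q_at u 0 N 0) / N + u (0, 0)\<bar> < \<epsilon> / 2"
    "\<forall>\<^sub>F N in sequentially. \<bar>ln (Q_at u 1 N 0) / N + u (1, 0)\<bar> < \<epsilon> / 2"
    using tendstoD[OF l(1), of "\<epsilon> / 2"] tendstoD[OF l(2), of "\<epsilon> / 2"] \<epsilon> by (simp_all add: dist_real_def)
  show ?thesis using e eventually_ge_at_top[of 1]
  proof eventually_elim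
    fix N :: nat
    define a where "a = ln (Q_at u 0 N 0) / N + u (0, 0)"
    define b where "b = ln (Q_at u 1 N 0) / N + u (1, 0)"
    assume "\<bar>ln (Q_at u 0 N 0) / N + u (0, 0)\<bar> < \<epsilon> / 2" "\<bar>ln (Q_at u 1 N 0) / N + u (1, 0)\<bar> < \<epsilon> / 2" and N: "1 \<le> N"
    then have ab: "\<bar>a\<bar> \<le> \<epsilon> / 2" "\<bar>b\<bar> \<le> \<epsilon> / 2" by (auto simp: a_def b_def)
    have sum0: "(\<Sum>k\<le>N. wt N t k * (0::real) ^ k) = wt N t 0" for t
      by (simp add: sum.atMost_shift power_0_left)
    have Phi: "Phi N (t, 0) = - ((1 - t) * a + t * b)" if "t \<in> {0..1}" for t
    proof -
      have "LN N (t, 0) = ln (wt N t 0) / N" by (simp add: LN_def sum0)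
      also have "\<dots> = - ((1 - t) * (ln (Q_at u 0 N 0) / N) + t * (ln (Q_at u 1 N 0) / N))"
        by (simp add: wt_def add_divide_distrib diff_divide_distrib)
      finally show ?thesis using E_at_0[OF that] by (simp add: Phi_def E_def a_def b_def algebra_simps)
    qed
    show "\<forall>t. 0 < t \<longrightarrow> t < 1 \<longrightarrow> \<bar>Phi N (t, 0)\<bar> \<le> \<epsilon> \<and> \<bar>Dt (Phi N) (t, 0)\<bar> \<le> \<epsilon>"
    proof (intro allI impI conjI)
      fix t :: real assume t: "0 < t" "t < 1"
      have p: "(t, 0) \<in> istrip" using t by (simp add: istrip_def)
      have "\<bar>(1 - t) * a\<bar> \<le> 1 * (\<epsilon> / 2)" "\<bar>t * b\<bar> \<le> 1 * (\<epsilon> / 2)" unfolding abs_mult using ab t by (intro mult_mono; simp)+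
      then show "\<bar>Phi N (t, 0)\<bar> \<le> \<epsilon>" using Phi[of t] t by simp
      have "((\<lambda>t. - ((1 - t) * a + t * b)) has_real_derivative a - b) (at t)"
        by (auto intro!: derivative_eq_intros)
      then have "((\<lambda>t. Phi N (t, 0)) has_real_derivative a - b) (at t)"
        by (rule has_field_derivative_transform_within_open[where S = "{0<..<1}"]) (use t Phi in auto)
      from DERIV_unique[OF frechet_t(1)[OF has_der[OF ck_Phi p]] this]
      show "\<bar>Dt (Phi N) (t, 0)\<bar> \<le> \<epsilon>" using ab by simp
    qed
  qed
qed

text \<open>\<open>Phi\<close> and its time derivative are recovered by radial integration from r =
  0, where \<open>Phi_base\<close> holds.\<close>

lemma Phi_estimates:
  assumes R: "R > 0" and \<epsilon>: "\<epsilon> > 0"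
  shows "\<forall>\<^sub>F N in sequentially. \<forall>t r. 0 < t \<longrightarrow> t < 1 \<longrightarrow> 0 < r \<longrightarrow> r \<le> R \<longrightarrow>
    \<bar>Phi N (t, r)\<bar> \<le> \<epsilon> \<and> \<bar>Dt (Phi N) (t, r)\<bar> \<le> \<epsilon> \<and> \<bar>Dr (Phi N) (t, r)\<bar> \<le> \<epsilon> \<and>
    \<bar>Dr (Phi N) (t, r) / r\<bar> \<le> \<epsilon> \<and> \<bar>Dr (Dr (Phi N)) (t, r)\<bar> \<le> \<epsilon> \<and>
    \<bar>Dr (Dt (Phi N)) (t, r)\<bar> \<le> \<epsilon> \<and> \<bar>Dt (Dt (Phi N)) (t, r)\<bar> \<le> \<epsilon>"
proof -
  \<comment> \<open>Integration over radii up to R multiplies the bound e by R for the time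
    derivative and by R^2 for \<open>Phi\<close>; each must cost at most \<epsilon> / 2.\<close>
  define e where "e = min (\<epsilon> / 2) (min (\<epsilon> / (2 * R)) (\<epsilon> / (2 * R\<^sup>2)))"
  have e: "e > 0" "e \<le> \<epsilon> / 2" "e * R \<le> \<epsilon> / 2" "e * R\<^sup>2 \<le> \<epsilon> / 2"
  proof -
    show "e > 0" "e \<le> \<epsilon> / 2" using R \<epsilon> by (auto simp: e_def)
    have "e \<le> \<epsilon> / (2 * R)" "e \<le> \<epsilon> / (2 * R\<^sup>2)" by (auto simp: e_def)
    then show "e * R \<le> \<epsilon> / 2" "e * R\<^sup>2 \<le> \<epsilon> / 2" using R by (auto simp: field_simps)
  qed
  have "\<epsilon> / 2 > 0" using \<epsilon> by simp
  show ?thesis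
    using Phi_second[OF R e(1)] Phi_base[OF \<open>\<epsilon> / 2 > 0\<close>]
  proof eventually_elim
    fix N
    assume A: "\<forall>t r. 0 < t \<longrightarrow> t < 1 \<longrightarrow> 0 < r \<longrightarrow> r \<le> R \<longrightarrow>
      \<bar>Dr (Phi N) (t, r)\<bar> \<le> e * r \<and> \<bar>Dr (Dr (Phi N)) (t, r)\<bar> \<le> e \<and>
      \<bar>Dr (Dt (Phi N)) (t, r)\<bar> \<le> e \<and> \<bar>Dt (Dt (Phi N)) (t, r)\<bar> \<le> e"
      and B: "\<forall>t. 0 < t \<longrightarrow> t < 1 \<longrightarrow> \<bar>Phi N (t, 0)\<bar> \<le> \<epsilon> / 2 \<and> \<bar>Dt (Phi N) (t, 0)\<bar> \<le> \<epsilon> / 2"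
    show "\<forall>t r. 0 < t \<longrightarrow> t < 1 \<longrightarrow> 0 < r \<longrightarrow> r \<le> R \<longrightarrow>
      \<bar>Phi N (t, r)\<bar> \<le> \<epsilon> \<and> \<bar>Dt (Phi N) (t, r)\<bar> \<le> \<epsilon> \<and> \<bar>Dr (Phi N) (t, r)\<bar> \<le> \<epsilon> \<and>
      \<bar>Dr (Phi N) (t, r) / r\<bar> \<le> \<epsilon> \<and> \<bar>Dr (Dr (Phi N)) (t, r)\<bar> \<le> \<epsilon> \<and>
      \<bar>Dr (Dt (Phi N)) (t, r)\<bar> \<le> \<epsilon> \<and> \<bar>Dt (Dt (Phi N)) (t, r)\<bar> \<le> \<epsilon>"
    proof (intro allI impI)
      fix t r :: real assume t: "0 < t" "t < 1" and r: "0 < r" "r \<le> R"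
      have p: "(t, s) \<in> istrip" for s using t by (simp add: istrip_def)
      have a: "\<bar>Dr (Phi N) (t, s)\<bar> \<le> e * s" "\<bar>Dr (Dt (Phi N)) (t, s)\<bar> \<le> e" if "0 < s" "s \<le> R" for s
        using A t that by auto
      have b: "\<bar>Phi N (t, 0)\<bar> \<le> \<epsilon> / 2" "\<bar>Dt (Phi N) (t, 0)\<bar> \<le> \<epsilon> / 2" using B t by auto
      have eR: "e * s \<le> \<epsilon> / 2" if "0 < s" "s \<le> R" for s
        using e mult_left_mono[of s R e] that by linarith
      obtain s where s: "0 < s" "s < r" "Phi N (t, r) - Phi N (t, 0) = (r - 0) * Dr (Phi N) (t, s)"
        using MVT2[of 0 r "\<lambda>s. Phi N (t, s)" "\<lambda>s. Dr (Phi N) (t, s)"] r frechet_t(2)[OF has_der[OF ck_Phi p]] by blast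
      have "\<bar>Dr (Phi N) (t, s)\<bar> \<le> e * R"
        using a(1)[of s] r s mult_left_mono[of s R e] e by linarith
      then have "\<bar>r * Dr (Phi N) (t, s)\<bar> \<le> R * (e * R)"
        unfolding abs_mult using r e by (intro mult_mono) auto
      then have 1: "\<bar>Phi N (t, r)\<bar> \<le> \<epsilon>" using s(3) b(1) e(4) by (simp add: power2_eq_square mult_ac)
      obtain s where s: "0 < s" "s < r" "Dt (Phi N) (t, r) - Dt (Phi N) (t, 0) = (r - 0) * Dr (Dt (Phi N)) (t, s)"
        using MVT2[of 0 r "\<lambda>s. Dt (Phi N) (t, s)" "\<lambda>s. Dr (Dt (Phi N)) (t, s)"] r
          frechet_t(2)[OF has_der[OF ck_Dt[OF ck_Phi] p]] by blast
      have "\<bar>r * Dr (Dt (Phi N)) (t, s)\<bar> \<le> R * e"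
        unfolding abs_mult using r s a(2)[of s] e by (intro mult_mono) auto
      then have 2: "\<bar>Dt (Phi N) (t, r)\<bar> \<le> \<epsilon>" using s(3) b(2) e(3) by (simp add: mult_ac)
      have 3: "\<bar>Dr (Phi N) (t, r)\<bar> \<le> \<epsilon>" using a(1)[OF r] eR[OF r] \<epsilon> by linarith
      have "\<bar>Dr (Phi N) (t, r) / r\<bar> \<le> e" using a(1)[OF r] r by (simp add: abs_divide pos_divide_le_eq)
      then have 4: "\<bar>Dr (Phi N) (t, r) / r\<bar> \<le> \<epsilon>" using e \<epsilon> by linarith
      have "\<bar>Dr (Dr (Phi N)) (t, r)\<bar> \<le> e" "\<bar>Dr (Dt (Phi N)) (t, r)\<bar> \<le> e" "\<bar>Dt (Dt (Phi N)) (t, r)\<bar> \<le> e"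
        using A t r by auto
      then have "\<bar>Dr (Dr (Phi N)) (t, r)\<bar> \<le> \<epsilon>" "\<bar>Dr (Dt (Phi N)) (t, r)\<bar> \<le> \<epsilon>" "\<bar>Dt (Dt (Phi N)) (t, r)\<bar> \<le> \<epsilon>"
        using e \<epsilon> by linarith+
      with 1 2 3 4 show "\<bar>Phi N (t, r)\<bar> \<le> \<epsilon> \<and> \<bar>Dt (Phi N) (t, r)\<bar> \<le> \<epsilon> \<and> \<bar>Dr (Phi N) (t, r)\<bar> \<le> \<epsilon> \<and>
        \<bar>Dr (Phi N) (t, r) / r\<bar> \<le> \<epsilon> \<and> \<bar>Dr (Dr (Phi N)) (t, r)\<bar> \<le> \<epsilon> \<and>
        \<bar>Dr (Dt (Phi N)) (t, r)\<bar> \<le> \<epsilon> \<and> \<bar>Dt (Dt (Phi N)) (t, r)\<bar> \<le> \<epsilon>" by blast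
    qed
  qed
qed

end

lemma frechet_radial:
  fixes F :: "real \<times> real \<Rightarrow> real"
  assumes F: "(F has_derivative F') (at (t, cmod z))" and z: "z \<noteq> 0"
  shows "((\<lambda>p. F (fst p, cmod (snd p))) has_derivative
    (\<lambda>w. F' (1, 0) * fst w + F' (0, 1) / cmod z * (z \<bullet> snd w))) (at (t, z))"
proof -
  have n: "(cmod has_derivative (\<lambda>v. z \<bullet> v / cmod z)) (at z)"
    using has_derivative_norm[OF z] by (simp add: sgn_div_norm inner_commute divide_inverse mult.commute)
  have "((\<lambda>p. cmod (snd p)) has_derivative (\<lambda>w. z \<bullet> snd w / cmod z)) (at (t, z))"
    by (rule has_derivative_compose[where f = snd and g = cmod]) (use n in \<open>auto intro: has_derivative_snd\<close>)
  then have "((\<lambda>p. (fst p, cmod (snd p))) has_derivative (\<lambda>w. (fst w, z \<bullet> snd w / cmod z))) (at (t, z))"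
    by (intro has_derivative_Pair has_derivative_fst has_derivative_ident)
  then have "((\<lambda>p. F (fst p, cmod (snd p))) has_derivative (\<lambda>w. F' (fst w, z \<bullet> snd w / cmod z))) (at (t, z))"
    by (rule has_derivative_compose) (use F in simp)
  moreover have lin: "F' (a, b) = F' (1, 0) * a + F' (0, 1) * b" for a b
  proof -
    interpret linear F' using F has_derivative_linear by blast
    have "F' (a, b) = F' (a *\<^sub>R (1, 0) + b *\<^sub>R (0, 1))" by simp
    also have "\<dots> = a * F' (1, 0) + b * F' (0, 1)" unfolding add scaleR by simp
    finally show ?thesis by (simp add: mult.commute)
  qed
  have "(\<lambda>w. F' (fst w, z \<bullet> snd w / cmod z)) = (\<lambda>w. F' (1, 0) * fst w + F' (0, 1) / cmod z * (z \<bullet> snd w))"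
  proof
    show "F' (fst w, z \<bullet> snd w / cmod z) = F' (1, 0) * fst w + F' (0, 1) / cmod z * (z \<bullet> snd w)" for w :: "real \<times> complex"
      unfolding lin[of "fst w" "z \<bullet> snd w / cmod z"] by simp
  qed
  ultimately show ?thesis by (simp only:)
qed

lemma abs_inner_Basis_le:
  fixes z :: complex
  assumes "w \<in> Basis"
  shows "\<bar>z \<bullet> snd (w :: real \<times> complex)\<bar> \<le> cmod z" "\<bar>fst w\<bar> \<le> 1" "\<bar>snd w \<bullet> snd w'\<bar> \<le> cmod (snd w')"
    "cmod (snd w) \<le> 1"
proof -
  have n: "cmod (snd w) \<le> 1" "\<bar>fst w\<bar> \<le> 1" using assms by (auto simp: Basis_prod_def Basis_complex_def)
  then show "cmod (snd w) \<le> 1" "\<bar>fst w\<bar> \<le> 1" .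
  have "\<bar>z \<bullet> snd w\<bar> \<le> cmod z * cmod (snd w)" "\<bar>snd w \<bullet> snd w'\<bar> \<le> cmod (snd w) * cmod (snd w')"
    by (rule Cauchy_Schwarz_ineq2)+
  moreover have "cmod z * cmod (snd w) \<le> cmod z * 1" "cmod (snd w) * cmod (snd w') \<le> 1 * cmod (snd w')"
    using n by (intro mult_left_mono mult_right_mono; simp)+
  ultimately show "\<bar>z \<bullet> snd w\<bar> \<le> cmod z" "\<bar>snd w \<bullet> snd w'\<bar> \<le> cmod (snd w')" by linarith+
qed

section \<open>From radial estimates to derivatives in the chart\<close>

context geodesic
begin

definition D :: "nat \<Rightarrow> real \<times> complex \<Rightarrow> real" where
  "D N p = LN N (fst p, cmod (snd p)) - u p"

text \<open>\<open>LN\<close> sees the radius only through its square, a polynomial in the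
  coordinates, so D is smooth across z = 0 where |z| is not.\<close>

lemma ck_D: "ck n ({0..1} \<times> UNIV) (D N)"
proof -
  have sq: "(cmod z)\<^sup>2 = z \<bullet> z" for z by (simp add: power2_norm_eq_inner)
  have i: "ck n S (\<lambda>p::real \<times> complex. snd p \<bullet> snd p)" for n S
  proof -
    have "ck n S (\<lambda>p::real \<times> complex. (snd p \<bullet> 1) * (snd p \<bullet> 1) + (snd p \<bullet> \<i>) * (snd p \<bullet> \<i>))"
      by (intro ck_add ck_mult ck_bounded_linear bounded_linear_compose[OF bounded_linear_inner_left bounded_linear_snd])
    then show ?thesis by (simp add: inner_complex_def)
  qed
  have "ck n ({0..1} \<times> UNIV) (\<lambda>p. (1 / N) * ln (\<Sum>k\<le>N. wt N (fst p) k * (snd p \<bullet> snd p) ^ k) - u p)"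
    using sum_pos_LN[of N _ "cmod _"] unfolding sq
    by (intro ck_diff ck_cmult ck_ln ck_sum ck_mult ck_wt ck_power i u_smooth) auto
  then show ?thesis by (simp add: D_def[abs_def] LN_def sq)
qed

lemma D_Phi: "fst p \<in> {0..1} \<Longrightarrow> D N p = Phi N (fst p, cmod (snd p))"
proof -
  assume t: "fst p \<in> {0..1}"
  interpret potential "\<lambda>z. u (fst p, z)" "\<lambda>z. v (fst p, z)" by (rule pot[OF t])
  show ?thesis using aff.radial[of "snd p"] by (simp add: D_def Phi_def E_def)
qed

text \<open>The open set on which polar coordinates are smooth and derivatives within the strip are
  ordinary ones; its closure is the whole strip.\<close>

definition punctured :: "(real \<times> complex) set" where "punctured = {0<..<1} \<times> (- {0})"

lemma punctured: "open punctured" "p \<in> punctured \<Longrightarrow> at p within {0..1} \<times> UNIV = at p"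
proof -
  show o: "open punctured" unfolding punctured_def by (intro open_Times) auto
  assume p: "p \<in> punctured"
  have "punctured \<subseteq> interior ({0..1} \<times> UNIV)" by (rule interior_maximal[OF _ o]) (auto simp: punctured_def)
  then show "at p within {0..1} \<times> UNIV = at p" using p by (intro at_within_interior) auto
qed

lemma D_first:
  assumes p: "(t, z) \<in> punctured"
  shows "frechet_derivative (D N) (at (t, z) within {0..1} \<times> UNIV) w =
    Dt (Phi N) (t, cmod z) * fst w + Dr (Phi N) (t, cmod z) / cmod z * (z \<bullet> snd w)"
proof -
  have z: "z \<noteq> 0" and i: "(t, cmod z) \<in> istrip" using p by (auto simp: punctured_def istrip_def)
  have "((\<lambda>p. Phi N (fst p, cmod (snd p))) has_derivative
     (\<lambda>w. Dt (Phi N) (t, cmod z) * fst w + Dr (Phi N) (t, cmod z) / cmod z * (z \<bullet> snd w))) (at (t, z))"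
    by (rule frechet_radial[OF has_der[OF ck_Phi i] z])
  then have "(D N has_derivative
     (\<lambda>w. Dt (Phi N) (t, cmod z) * fst w + Dr (Phi N) (t, cmod z) / cmod z * (z \<bullet> snd w))) (at (t, z))"
    by (rule has_derivative_transform_within_open[OF _ punctured(1) p]) (auto simp: D_Phi punctured_def)
  then show ?thesis unfolding punctured(2)[OF p] by (simp flip: frechet_derivative_at)
qed

text \<open>In the space directions this is the Hessian of a radial function: the second radial
  derivative along z, and \<open>Dr Phi / r\<close> on the orthogonal complement.\<close>

lemma D_second:
  assumes p: "(t, z) \<in> punctured"
  shows "frechet_derivative (\<lambda>p. frechet_derivative (D N) (at p within {0..1} \<times> UNIV) w) (at (t, z) within {0..1} \<times> UNIV) w' =
    (Dt (Dt (Phi N)) (t, cmod z) * fst w' + Dr (Dt (Phi N)) (t, cmod z) / cmod z * (z \<bullet> snd w')) * fst w +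
    (Dr (Dt (Phi N)) (t, cmod z) * fst w' + Dr (Dr (Phi N)) (t, cmod z) / cmod z * (z \<bullet> snd w')) / cmod z * (z \<bullet> snd w) +
    Dr (Phi N) (t, cmod z) / cmod z * ((snd w' \<bullet> snd w) - (z \<bullet> snd w') * (z \<bullet> snd w) / (cmod z)\<^sup>2)"
    (is "_ = ?R w'")
proof -
  have z: "z \<noteq> 0" and i: "(t, cmod z) \<in> istrip" using p by (auto simp: punctured_def istrip_def)
  have n: "((\<lambda>p. cmod (snd p)) has_derivative (\<lambda>w. z \<bullet> snd w / cmod z)) (at (t, z))"
  proof (rule has_derivative_compose[where f = snd and g = cmod])
    show "(cmod has_derivative (\<lambda>v. z \<bullet> v / cmod z)) (at (snd (t, z)))"
      using has_derivative_norm[OF z] by (simp add: sgn_div_norm inner_commute divide_inverse mult.commute)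
  qed (auto intro: has_derivative_snd)
  note dt = frechet_radial[OF has_der[OF ck_Dt[OF ck_Phi] i] z] and dr = frechet_radial[OF has_der[OF ck_Dr[OF ck_Phi] i] z]
  have "((\<lambda>p. Dt (Phi N) (fst p, cmod (snd p)) * fst w + Dr (Phi N) (fst p, cmod (snd p)) / cmod (snd p) * (snd p \<bullet> snd w))
     has_derivative ?R) (at (t, z))"
    using z commute[OF ck_Phi i]
    by (auto intro!: derivative_eq_intros dt dr n simp: fun_eq_iff field_simps power2_eq_square)
  then have "((\<lambda>p. frechet_derivative (D N) (at p within {0..1} \<times> UNIV) w) has_derivative ?R) (at (t, z))"
    by (rule has_derivative_transform_within_open[OF _ punctured(1) p]) (metis D_first prod.collapse)
  then show ?thesis unfolding punctured(2)[OF p] by (simp flip: frechet_derivative_at)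
qed

text \<open>A derivative of order at most 2 is a sum of at most six terms, each one of the bounded
  quantities times a factor of absolute value at most 1.\<close>

lemma iter_D_bound:
  assumes vs: "vs \<in> lists Basis" "length vs \<le> 2" and p: "(t, z) \<in> punctured"
    and b: "\<bar>Phi N (t, cmod z)\<bar> \<le> e" "\<bar>Dt (Phi N) (t, cmod z)\<bar> \<le> e" "\<bar>Dr (Phi N) (t, cmod z)\<bar> \<le> e"
      "\<bar>Dr (Phi N) (t, cmod z) / cmod z\<bar> \<le> e" "\<bar>Dr (Dr (Phi N)) (t, cmod z)\<bar> \<le> e"
      "\<bar>Dr (Dt (Phi N)) (t, cmod z)\<bar> \<le> e" "\<bar>Dt (Dt (Phi N)) (t, cmod z)\<bar> \<le> e"
  shows "\<bar>iter_deriv ({0..1} \<times> UNIV) vs (D N) (t, z)\<bar> \<le> 6 * e"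
proof -
  have z: "cmod z > 0" and t: "t \<in> {0..1}" using p by (auto simp: punctured_def)
  have e: "e \<ge> 0" using b(1) by linarith
  have pr: "\<bar>a * c\<bar> \<le> e" if "\<bar>a\<bar> \<le> e" "\<bar>c\<bar> \<le> 1" for a c
    using mult_mono[of "\<bar>a\<bar>" e "\<bar>c\<bar>" 1] that e by (simp add: abs_mult)
  have q: "\<bar>z \<bullet> snd w / cmod z\<bar> \<le> 1" if "w \<in> Basis" for w :: "real \<times> complex"
    using abs_inner_Basis_le(1)[OF that, of z] z by (simp add: abs_divide)
  consider "vs = []" | w where "vs = [w]" | w w' where "vs = [w, w']"
    using vs(2) by (cases vs rule: list.exhaust; cases "tl vs"; cases "tl (tl vs)") auto
  then show ?thesis
  proof cases
    case 1
    then show ?thesis using b(1) e t by (simp add: D_Phi)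
  next
    case (2 w)
    then have w: "w \<in> Basis" using vs by simp
    have eq: "iter_deriv ({0..1} \<times> UNIV) vs (D N) (t, z) =
      Dt (Phi N) (t, cmod z) * fst w + Dr (Phi N) (t, cmod z) * (z \<bullet> snd w / cmod z)"
      unfolding 2 by (simp add: D_first[OF p])
    have "\<bar>Dt (Phi N) (t, cmod z) * fst w\<bar> \<le> e" "\<bar>Dr (Phi N) (t, cmod z) * (z \<bullet> snd w / cmod z)\<bar> \<le> e"
      using pr b q[OF w] abs_inner_Basis_le(2)[OF w] by blast+
    then show ?thesis unfolding eq using e by linarith
  next
    case (3 w w')
    then have w: "w \<in> Basis" "w' \<in> Basis" using vs by auto
    define k where "k = z \<bullet> snd w / cmod z"
    define k' where "k' = z \<bullet> snd w' / cmod z"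
    have kk: "\<bar>k\<bar> \<le> 1" "\<bar>k'\<bar> \<le> 1" "\<bar>fst w\<bar> \<le> 1" "\<bar>fst w'\<bar> \<le> 1" 
      using q w abs_inner_Basis_le(2) by (auto simp: k_def k'_def)
    have one: "\<bar>a * c\<bar> \<le> 1" if "\<bar>a\<bar> \<le> 1" "\<bar>c\<bar> \<le> 1" for a c :: real
      using mult_mono[of "\<bar>a\<bar>" 1 "\<bar>c\<bar>" 1] that by (simp add: abs_mult)
    have ww: "\<bar>snd w' \<bullet> snd w\<bar> \<le> 1"
      using abs_inner_Basis_le(3)[OF w(2), of w] abs_inner_Basis_le(4)[OF w(1)] by linarith
    have eq: "iter_deriv ({0..1} \<times> UNIV) vs (D N) (t, z) =
      Dt (Dt (Phi N)) (t, cmod z) * (fst w' * fst w) + Dr (Dt (Phi N)) (t, cmod z) * (k' * fst w) +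
      Dr (Dt (Phi N)) (t, cmod z) * (fst w' * k) + Dr (Dr (Phi N)) (t, cmod z) * (k' * k) +
      (Dr (Phi N) (t, cmod z) / cmod z * (snd w' \<bullet> snd w) - Dr (Phi N) (t, cmod z) / cmod z * (k' * k))"
      unfolding 3 iter_deriv.simps D_second[OF p] using z by (simp add: k_def k'_def algebra_simps add_divide_distrib power2_eq_square)
    have 6: "\<bar>a1 + a2 + a3 + a4 + (a5 - a6)\<bar> \<le> 6 * e" if "\<bar>a1\<bar> \<le> e" "\<bar>a2\<bar> \<le> e" "\<bar>a3\<bar> \<le> e" "\<bar>a4\<bar> \<le> e" "\<bar>a5\<bar> \<le> e" "\<bar>a6\<bar> \<le> e"
      for a1 a2 a3 a4 a5 a6 using that by linarith
    show ?thesis unfolding eq by (intro 6 pr b one kk ww)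
  qed
qed

lemma iter_D_cont: "vs \<in> lists Basis \<Longrightarrow> length vs \<le> 2 \<Longrightarrow> continuous_on ({0..1} \<times> UNIV) (iter_deriv ({0..1} \<times> UNIV) vs (D N))"
  using ck_D[of 2 N] unfolding Ck_on_iff_ck[OF thick_strip, symmetric] Ck_on_def by blast

text \<open>The bound 6 e / 12 holds for 0 < t < 1 and z nonzero; continuity of the derivatives
  carries the closed bound e / 2 to t = 0, t = 1 and z = 0.\<close>

theorem D_converges:
  assumes vs: "vs \<in> lists Basis" "length vs \<le> 2" and K: "compact K"
  shows "uniform_limit ({0..1} \<times> K) (\<lambda>N. iter_deriv ({0..1} \<times> UNIV) vs (D N)) (\<lambda>_. 0) sequentially"
proof (rule uniform_limitI)
  fix e :: real assume e: "e > 0"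
  obtain R where R: "R > 0" "\<And>z. z \<in> K \<Longrightarrow> cmod z < R"
    using K[THEN compact_imp_bounded, unfolded bounded_pos_less] by auto
  have "e / 12 > 0" using e by simp
  from Phi_estimates[OF R(1) this]
  show "\<forall>\<^sub>F N in sequentially. \<forall>p\<in>{0..1} \<times> K. dist (iter_deriv ({0..1} \<times> UNIV) vs (D N) p) 0 < e"
  proof eventually_elim
    fix N
    assume A: "\<forall>t r. 0 < t \<longrightarrow> t < 1 \<longrightarrow> 0 < r \<longrightarrow> r \<le> R \<longrightarrow>
      \<bar>Phi N (t, r)\<bar> \<le> e / 12 \<and> \<bar>Dt (Phi N) (t, r)\<bar> \<le> e / 12 \<and> \<bar>Dr (Phi N) (t, r)\<bar> \<le> e / 12 \<and>
      \<bar>Dr (Phi N) (t, r) / r\<bar> \<le> e / 12 \<and> \<bar>Dr (Dr (Phi N)) (t, r)\<bar> \<le> e / 12 \<and>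
      \<bar>Dr (Dt (Phi N)) (t, r)\<bar> \<le> e / 12 \<and> \<bar>Dt (Dt (Phi N)) (t, r)\<bar> \<le> e / 12"
    define S where "S = {0<..<1::real} \<times> (ball (0::complex) R - {0})"
    have cl: "closure S = {0..1} \<times> cball 0 R"
    proof -
      have "closure (ball (0::complex) R - {0}) = cball 0 R"
      proof -
        have "0 islimpt ball (0::complex) R" using R by (intro interior_limit_point) auto
        then have "0 islimpt (ball (0::complex) R - {0})" unfolding islimpt_def by blast
        then have "0 \<in> closure (ball (0::complex) R - {0})" by (simp add: closure_def)
        then have "ball 0 R \<subseteq> closure (ball (0::complex) R - {0})" using closure_subset[of "ball (0::complex) R - {0}"] by blast
        then have "closure (ball 0 R) \<subseteq> closure (ball (0::complex) R - {0})" by (simp add: closure_minimal)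
        moreover have "closure (ball (0::complex) R - {0}) \<subseteq> closure (ball 0 R)" by (intro closure_mono) auto
        ultimately show ?thesis using R by auto
      qed
      then show ?thesis by (simp add: S_def closure_Times)
    qed
    have *: "iter_deriv ({0..1} \<times> UNIV) vs (D N) p \<in> {- (e / 2)..e / 2}" if "p \<in> closure S" for p
    proof -
      have "iter_deriv ({0..1} \<times> UNIV) vs (D N) ` closure S \<subseteq> {- (e / 2)..e / 2}"
      proof (rule image_closure_subset)
        show "continuous_on (closure S) (iter_deriv ({0..1} \<times> UNIV) vs (D N))"
          by (rule continuous_on_subset[OF iter_D_cont[OF vs]]) (auto simp: cl)
        have bd: "\<bar>iter_deriv ({0..1} \<times> UNIV) vs (D N) q\<bar> \<le> e / 2" if q: "q \<in> S" for q
        proof -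
          obtain t z where tq: "q = (t, z)" by (cases q)
          then have tz: "q = (t, z)" "0 < t" "t < 1" "cmod z < R" "z \<noteq> 0" using q by (auto simp: S_def)
          have "\<bar>iter_deriv ({0..1} \<times> UNIV) vs (D N) (t, z)\<bar> \<le> 6 * (e / 12)"
            using A[rule_format, of t "cmod z"] tz by (intro iter_D_bound[OF vs]) (auto simp: punctured_def)
          then show ?thesis using tz by simp
        qed
        then have "iter_deriv ({0..1} \<times> UNIV) vs (D N) q \<in> {- (e / 2)..e / 2}" if "q \<in> S" for q
          using bd[OF that] by (simp only: atLeastAtMost_iff) linarith
        then show "iter_deriv ({0..1} \<times> UNIV) vs (D N) ` S \<subseteq> {- (e / 2)..e / 2}" by blast
      qed simp
      then show ?thesis using that by blast
    qed
    show "\<forall>p\<in>{0..1} \<times> K. dist (iter_deriv ({0..1} \<times> UNIV) vs (D N) p) 0 < e"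
    proof (intro ballI)
      fix p :: "real \<times> complex" assume "p \<in> {0..1} \<times> K"
      then have "p \<in> {0..1} \<times> cball 0 R" using R(2) by (auto simp: less_imp_le)
      then have "iter_deriv ({0..1} \<times> UNIV) vs (D N) p \<in> {- (e / 2)..e / 2}" using * cl by blast
      then have "\<bar>iter_deriv ({0..1} \<times> UNIV) vs (D N) p\<bar> \<le> e / 2" by (simp only: atLeastAtMost_iff) linarith
      then show "dist (iter_deriv ({0..1} \<times> UNIV) vs (D N) p) 0 < e" using e by (simp add: dist_real_def)
    qed
  qed
qed

end

section \<open>Norming constants as radial integrals\<close>

context potential
begin

lemma swap_charts: "potential fi f"
proof
  fix z :: complex assume z: "z \<noteq> 0"
  have "f (1 / z) = 2 * ln (cmod (1 / z)) + fi (1 / (1 / z))" using z by (intro glue) simp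
  then show "fi z = 2 * ln (cmod z) + f (1 / z)" using z by (simp add: norm_divide ln_div)
qed

text \<open>The substitution of 1 / x for x: the transition term ln x in U produces x^(-N), and g dx
  is invariant up to orientation.\<close>

lemma Q_swap:
  assumes k: "k \<le> N"
  shows "Q N (N - k) = potential.Q fi N k"
proof -
  interpret s: potential fi f by (rule swap_charts)
  define F where "F x = x ^ k * exp (- real N * inf.U x) * inf.g x" for x
  define S :: "real set" where "S = {0<..}"
  have int: "set_integrable lborel S (\<lambda>x. x ^ j * exp (- real N * U x) * g x)" if "j \<le> N" for j
  proof -
    obtain C where C: "profile U y g g' (f 0) C" by (rule profile_exists)
    have "set_integrable lborel {0<..} (\<lambda>x. profile.W U g N j x * 1)"
      by (rule profile.I_integrable[OF C that]) (rule profile.bcont_const[OF C])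
    then show ?thesis by (simp add: profile.W_def[OF C] S_def)
  qed
  have eq: "\<bar>- 1 / x\<^sup>2\<bar> * F (1 / x) = x ^ (N - k) * exp (- real N * U x) * g x" if "x \<in> S" for x
  proof -
    have x: "x > 0" using that by (simp add: S_def)
    have "- real N * U x = - real N * inf.U (1 / x) + - (real N * ln x)"
      by (simp add: U_inf[OF x] algebra_simps)
    moreover have "exp (real N * ln x) = x ^ N" using x by (simp add: exp_of_nat_mult)
    ultimately have "exp (- real N * U x) = exp (- real N * inf.U (1 / x)) / x ^ N"
      by (simp only: exp_add exp_minus divide_inverse)
    moreover have "x ^ N = x ^ k * x ^ (N - k)" using k by (simp flip: power_add)
    ultimately show ?thesis using x by (simp add: F_def g_inf power_one_over)
  qed
  have img: "(\<lambda>x. 1 / x) ` S = S"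
    by (auto simp: S_def image_iff intro!: bexI[of _ "1 / _"])
  have int': "(\<lambda>x. x ^ (N - k) * exp (- real N * U x) * g x) absolutely_integrable_on S"
    by (rule nonnegative_absolutely_integrable_1[OF set_borel_integral_eq_integral(1)[OF int]])
      (use aff.g_pos in \<open>auto simp: S_def less_imp_le\<close>)
  have Q: "Q N (N - k) = integral S (\<lambda>x. x ^ (N - k) * exp (- real N * U x) * g x)"
    using set_borel_integral_eq_integral(2)[OF int, of "N - k"] by (simp add: Q_def S_def)
  have "(\<lambda>x. \<bar>- 1 / x\<^sup>2\<bar> * F (1 / x)) absolutely_integrable_on S \<and> integral S (\<lambda>x. \<bar>- 1 / x\<^sup>2\<bar> * F (1 / x)) = Q N (N - k)"
  proof
    show "(\<lambda>x. \<bar>- 1 / x\<^sup>2\<bar> * F (1 / x)) absolutely_integrable_on S"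
      by (rule iffD2[OF set_integrable_cong, OF _ _ _ int']) (simp_all only: eq)
    show "integral S (\<lambda>x. \<bar>- 1 / x\<^sup>2\<bar> * F (1 / x)) = Q N (N - k)"
      unfolding Q by (rule integral_cong) (rule eq)
  qed
  moreover have "(\<lambda>x. \<bar>- 1 / x\<^sup>2\<bar> * F (1 / x)) absolutely_integrable_on S \<and> integral S (\<lambda>x. \<bar>- 1 / x\<^sup>2\<bar> * F (1 / x)) = b
      \<longleftrightarrow> F absolutely_integrable_on (\<lambda>x. 1 / x) ` S \<and> integral ((\<lambda>x. 1 / x) ` S) F = b" for b
  proof (rule has_absolute_integral_change_of_variables_1'[where S = S and f = F and b = b and g = "\<lambda>x. 1 / x" and g' = "\<lambda>x. - 1 / x\<^sup>2"])
    show "((\<lambda>x. 1 / x) has_real_derivative - 1 / x\<^sup>2) (at x within S)" if "x \<in> S" for x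
      by (rule has_field_derivative_at_within[OF D_inverse]) (use that in \<open>simp add: S_def\<close>)
  qed (simp_all add: S_def inj_on_def)
  ultimately have "integral S F = Q N (N - k)" unfolding img by blast
  moreover have "integral S F = s.Q N k"
  proof -
    obtain C where C: "profile inf.U inf.y inf.g inf.g' (fi 0) C" by (rule s.profile_exists)
    have "set_integrable lborel {0<..} (\<lambda>x. profile.W inf.U inf.g N k x * 1)"
      by (rule profile.I_integrable[OF C k]) (rule profile.bcont_const[OF C])
    then have "set_integrable lborel {0<..} F" by (simp add: profile.W_def[OF C] F_def[abs_def])
    from set_borel_integral_eq_integral(2)[OF this] show ?thesis by (simp add: s.Q_def S_def F_def[abs_def])
  qed
  ultimately show ?thesis by simp
qed

end

text \<open>The disc |z|^2 \<le> a has area \<pi> a, and the half-lines below a generate the Borel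
  sets.\<close>

lemma distr_cmod_square: "distr lborel borel (\<lambda>z. (cmod z)\<^sup>2) = density lborel (\<lambda>x. ennreal (pi * indicator {0<..} x))"
    (is "?M = ?N")
proof (rule measure_eqI_generator_eq[where E = "range atMost" and \<Omega> = UNIV and A = "\<lambda>i. {..real i}"])
  show "Int_stable (range atMost :: real set set)" by (auto simp: Int_stable_def)
  show "sets ?M = sigma_sets UNIV (range atMost)" "sets ?N = sigma_sets UNIV (range atMost)"
    using arg_cong[OF borel_eq_atMost[where 'a = real], of sets] by (simp_all add: sets_measure_of)
  have M: "emeasure ?M {..a} = ennreal (pi * max 0 a)" for a
  proof -
    have "emeasure ?M {..a} = emeasure lborel {z. (cmod z)\<^sup>2 \<le> a}"
      by (subst emeasure_distr) (auto intro!: arg_cong[where f = "emeasure lborel"])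
    also have "\<dots> = ennreal (pi * max 0 a)"
    proof (cases "a \<ge> 0")
      case True
      then have "{z. (cmod z)\<^sup>2 \<le> a} = cball 0 (sqrt a)"
        by (auto simp: real_le_rsqrt dist_norm intro: sqrt_ge_absD)
      then show ?thesis using True emeasure_cball[of "sqrt a" "0::complex"] by (simp add: unit_ball_vol_2)
    next
      case False
      then have "{z. (cmod z)\<^sup>2 \<le> a} = {}" by (auto simp: not_le intro: order_less_le_trans)
      then show ?thesis using False by simp
    qed
    finally show ?thesis .
  qed
  have N: "emeasure ?N {..a} = ennreal (pi * max 0 a)" for a
  proof -
    have "emeasure ?N {..a} = (\<integral>\<^sup>+x. ennreal pi * indicator {0<..a} x \<partial>lborel)"
      by (subst emeasure_density) (auto intro!: nn_integral_cong split: split_indicator)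
    also have "\<dots> = ennreal pi * emeasure lborel {0<..a}" by (rule nn_integral_cmult_indicator) simp
    also have "\<dots> = ennreal (pi * max 0 a)"
      by (cases "a \<ge> 0") (auto simp: ennreal_mult')
    finally show ?thesis .
  qed
  show "emeasure ?M X = emeasure ?N X" if "X \<in> range atMost" for X using that M N by auto
  show "emeasure ?M {..real i} \<noteq> \<infinity>" for i by (simp add: M)
  show "(\<Union>i. {..real i}) = UNIV" by (auto intro: real_arch_simple)
qed auto

lemma integral_cmod_square:
  fixes F :: "real \<Rightarrow> real"
  assumes [measurable]: "F \<in> borel_measurable borel"
  shows "(LINT z|lborel. F ((cmod z)\<^sup>2)) = pi * (LBINT x:{0<..}. F x)"
proof -
  have "(LINT z|lborel. F ((cmod z)\<^sup>2)) = (LINT x|distr lborel borel (\<lambda>z. (cmod z)\<^sup>2). F x)"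
    by (subst integral_distr) auto
  also have "\<dots> = (LINT x|lborel. (pi * indicator {0<..} x) *\<^sub>R F x)"
    unfolding distr_cmod_square by (intro integral_density) auto
  also have "\<dots> = (LINT x|lborel. pi * (indicator {0<..} x *\<^sub>R F x))" by (simp add: mult_ac)
  finally show ?thesis by (simp add: set_lebesgue_integral_def)
qed

section \<open>Charts of the projective line\<close>

lemma abs_cp1_scale:
  assumes "v \<noteq> 0" "c \<noteq> 0"
  shows "abs_cp1 (c * fst v, c * snd v) = abs_cp1 v"
proof -
  have "(c * fst v, c * snd v) \<noteq> 0" using assms by (auto simp: zero_prod_def prod_eq_iff)
  then have "collinear_nonzero v (c * fst v, c * snd v)"
    using assms unfolding collinear_nonzero_def by blast
  from iffD2[OF Quotient3_rel[OF Quotient3_cp1] this] show ?thesis by simp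
qed

lemma hermitian_metric_pos: "hermitian_metric h \<Longrightarrow> v \<noteq> 0 \<Longrightarrow> h v > 0"
  and hermitian_metric_scale:
    "hermitian_metric h \<Longrightarrow> v \<noteq> 0 \<Longrightarrow> c \<noteq> 0 \<Longrightarrow> h (c * fst v, c * snd v) = h v / (cmod c)\<^sup>2"
  unfolding hermitian_metric_def by blast+

lemma lift_nonzero: "\<sigma> \<in> chart_lifts \<Longrightarrow> \<sigma> z \<noteq> 0"
  by (auto simp: chart_lifts_def affine_lift_def infinity_lift_def zero_prod_def)

lemma lift_glue:
  assumes "{\<sigma>, \<tau>} = chart_lifts" "z \<noteq> 0"
  shows "\<sigma> z = (z * fst (\<tau> (1 / z)), z * snd (\<tau> (1 / z)))"
  using assms unfolding chart_lifts_def doubleton_eq_iff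
  by (elim disjE conjE) (simp_all add: affine_lift_def infinity_lift_def)

text \<open>Rotating a chart coordinate rotates the lifted vector up to a unit scalar; in the chart
  at infinity the angle changes sign.\<close>

lemma lift_rotate:
  assumes "\<sigma> \<in> chart_lifts"
  obtains c \<theta>' where "cmod c = 1"
    "\<sigma> (cis \<theta> * z) = (c * fst (rotate_vec \<theta>' (\<sigma> z)), c * snd (rotate_vec \<theta>' (\<sigma> z)))"
proof -
  consider "\<sigma> = affine_lift" | "\<sigma> = infinity_lift" using assms by (auto simp: chart_lifts_def)
  then show ?thesis
  proof cases
    case 1
    show ?thesis by (rule that[of 1 \<theta>]) (simp_all add: 1 affine_lift_def rotate_vec_def)
  next
    case 2
    show ?thesis by (rule that[of "cis \<theta>" "- \<theta>"]) (simp_all add: 2 infinity_lift_def rotate_vec_def cis_mult)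
  qed
qed

lemma rotate_vec_nonzero: "v \<noteq> 0 \<Longrightarrow> rotate_vec \<theta> v \<noteq> 0"
  by (auto simp: rotate_vec_def zero_prod_def prod_eq_iff)

lemma S1_invariant_lift:
  assumes "S1_invariant f" "\<sigma> \<in> chart_lifts"
  shows "f (abs_cp1 (\<sigma> z)) = f (abs_cp1 (\<sigma> (complex_of_real (cmod z))))"
proof -
  have *: "f (abs_cp1 (\<sigma> (cis \<theta> * w))) = f (abs_cp1 (\<sigma> w))" for \<theta> w
  proof -
    obtain c \<theta>' where c: "cmod c = 1"
      "\<sigma> (cis \<theta> * w) = (c * fst (rotate_vec \<theta>' (\<sigma> w)), c * snd (rotate_vec \<theta>' (\<sigma> w)))"
      by (rule lift_rotate[OF assms(2)])
    have "c \<noteq> 0" using c(1) by auto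
    then have "abs_cp1 (\<sigma> (cis \<theta> * w)) = abs_cp1 (rotate_vec \<theta>' (\<sigma> w))"
      unfolding c(2) by (intro abs_cp1_scale rotate_vec_nonzero lift_nonzero assms)
    moreover have "f (abs_cp1 (rotate_vec \<theta>' v)) = f (abs_cp1 v)" if "v \<noteq> 0" for v
      using assms(1) that unfolding S1_invariant_def by blast
    ultimately show ?thesis using lift_nonzero[OF assms(2)] by simp
  qed
  have "z = cis (Arg z) * complex_of_real (cmod z)" using rcis_cmod_Arg[of z] by (simp add: rcis_def mult.commute)
  then show ?thesis using *[of "Arg z" "complex_of_real (cmod z)"] by simp
qed

lemma S1_invariant_metric_lift:
  assumes "S1_invariant_metric h" "hermitian_metric h" "\<sigma> \<in> chart_lifts"
  shows "h (\<sigma> z) = h (\<sigma> (complex_of_real (cmod z)))"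
proof -
  have *: "h (\<sigma> (cis \<theta> * w)) = h (\<sigma> w)" for \<theta> w
  proof -
    obtain c \<theta>' where c: "cmod c = 1"
      "\<sigma> (cis \<theta> * w) = (c * fst (rotate_vec \<theta>' (\<sigma> w)), c * snd (rotate_vec \<theta>' (\<sigma> w)))"
      by (rule lift_rotate[OF assms(3)])
    have "c \<noteq> 0" using c(1) by auto
    then have "h (\<sigma> (cis \<theta> * w)) = h (rotate_vec \<theta>' (\<sigma> w))"
      unfolding c(2) using c(1)
      by (simp add: hermitian_metric_scale[OF assms(2)] rotate_vec_nonzero lift_nonzero[OF assms(3)])
    moreover have "h (rotate_vec \<theta>' v) = h v" if "v \<noteq> 0" for v
      using assms(1) that unfolding S1_invariant_metric_def by blast
    ultimately show ?thesis using lift_nonzero[OF assms(3)] by simp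
  qed
  have "z = cis (Arg z) * complex_of_real (cmod z)" using rcis_cmod_Arg[of z] by (simp add: rcis_def mult.commute)
  then show ?thesis using *[of "Arg z" "complex_of_real (cmod z)"] by simp
qed

lemma ddbar_diff:
  assumes f: "\<And>n. ck n UNIV f" and g: "\<And>n. ck n UNIV g"
  shows "ddbar (\<lambda>z. f z - g z) \<zeta> = ddbar f \<zeta> - ddbar g \<zeta>"
proof -
  have d: "frechet_derivative (\<lambda>z. F z - H z) (at z) v = frechet_derivative F (at z) v - frechet_derivative H (at z) v"
    if F: "\<And>n. ck n UNIV F" and H: "\<And>n. ck n UNIV H" for F H :: "complex \<Rightarrow> real" and z v
    using frechet_derivative_at[OF has_derivative_diff[OF frechet_of_ck(1)[OF F] frechet_of_ck(1)[OF H]]]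
    by (metis (no_types, lifting))
  have "ck n UNIV (\<lambda>z. f z - g z)" for n by (intro ck_diff f g)
  moreover have "lap (\<lambda>z. f z - g z) \<zeta> = lap f \<zeta> - lap g \<zeta>"
    unfolding lap_def d[OF f g]
    using d[OF frechet_of_ck(2)[OF f one_i_Basis(1)] frechet_of_ck(2)[OF g one_i_Basis(1)]]
      d[OF frechet_of_ck(2)[OF f one_i_Basis(2)] frechet_of_ck(2)[OF g one_i_Basis(2)]] by simp
  ultimately show ?thesis using f g by (simp add: ddbar_eq_lap diff_divide_distrib)
qed

lemma ddbar_minus:
  assumes f: "\<And>n. ck n UNIV f"
  shows "ddbar (\<lambda>z. - f z) \<zeta> = - ddbar f \<zeta>"
proof -
  have 0: "ddbar (\<lambda>_. 0) \<zeta> = 0" using ddbar_diff[OF f f, of \<zeta>] by simp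
  show ?thesis using ddbar_diff[OF ck_const[of _ UNIV 0] f, of \<zeta>] unfolding 0 by simp
qed

lemma line_deriv:
  assumes F: "(F has_derivative F') (at (t, z))"
  shows "((\<lambda>s. F (s, z)) has_real_derivative F' (1, 0)) (at t)"
proof -
  have "((\<lambda>s. F (s, z)) has_derivative (\<lambda>h. F' (h, 0))) (at t)"
    by (rule has_derivative_compose[where f = "\<lambda>s. (s, z)", OF _ F]) (auto intro!: derivative_eq_intros)
  moreover have "F' (h, 0) = F' (1, 0) * h" for h
    using linear_cmul[OF has_derivative_linear[OF F], of h "(1, 0)"] by (simp add: mult.commute)
  then have "(\<lambda>h. F' (h, 0)) = (*) (F' (1, 0))" by (intro ext)
  ultimately show ?thesis unfolding has_field_derivative_def by (simp only:)
qed

locale ma_data =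
  fixes h :: metric and \<phi>0 \<phi>1 :: "cp1 \<Rightarrow> real" and \<phi> :: "real \<Rightarrow> cp1 \<Rightarrow> real"
  assumes h: "hermitian_metric h" "smooth_metric h" "S1_invariant_metric h"
    and twist: "hermitian_metric (twist \<phi>0 h)" "hermitian_metric (twist \<phi>1 h)"
    and geo: "MA_geodesic h \<phi>0 \<phi>1 \<phi>"
begin

definition "a \<sigma> z = ln (h (\<sigma> z))"
text \<open>The local potential of the form in \<open>omega_pot\<close>. Unlike \<phi> it depends on
  the chart, changing by 2 ln |z|.\<close>

definition "u \<sigma> p = path_in_chart \<phi> \<sigma> p - a \<sigma> (snd p)"

lemma u_eq: "u \<sigma> (t, z) = in_chart (\<phi> t) \<sigma> z - a \<sigma> z"
  by (simp add: u_def path_in_chart_def)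

lemma h_pos: "\<sigma> \<in> chart_lifts \<Longrightarrow> h (\<sigma> z) > 0"
  by (rule hermitian_metric_pos[OF h(1) lift_nonzero])

lemma ck_a: assumes "\<sigma> \<in> chart_lifts" shows "ck n UNIV (a \<sigma>)"
proof -
  have "ck n UNIV (h \<circ> \<sigma>)"
    using h(2) assms smooth_on_iff_ck[OF thick_open[OF open_UNIV], of "h \<circ> \<sigma>"] by (auto simp: smooth_metric_def)
  then show ?thesis unfolding a_def[abs_def] using h_pos[OF assms] by (intro ck_ln) (auto simp: o_def)
qed

lemma ck_path: assumes "\<sigma> \<in> chart_lifts" shows "ck n ({0..1} \<times> UNIV) (path_in_chart \<phi> \<sigma>)"
  using geo assms smooth_on_iff_ck[OF thick_strip, of "path_in_chart \<phi> \<sigma>"]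
  by (auto simp: MA_geodesic_def smooth_path_def)

lemma ck_u: assumes "\<sigma> \<in> chart_lifts" shows "ck n ({0..1} \<times> UNIV) (u \<sigma>)"
proof -
  have "ck n ({0..1} \<times> UNIV) (\<lambda>p::real \<times> complex. a \<sigma> (0 + snd p))"
    by (rule ck_affine[OF bounded_linear_snd ck_a[OF assms]]) auto
  then show ?thesis unfolding u_def[abs_def] by (intro ck_diff ck_path assms) simp
qed

lemma ck_slice:
  fixes F :: "real \<times> complex \<Rightarrow> real"
  assumes "ck n ({0..1} \<times> UNIV) F" "t \<in> {0..1}"
  shows "ck n UNIV (\<lambda>z. F (t, z))"
proof -
  have "bounded_linear (\<lambda>z::complex. (0::real, z))"
    by (intro bounded_linear_Pair bounded_linear_zero bounded_linear_ident)
  from ck_affine[OF this assms(1), of UNIV "(t, 0)"] assms(2) show ?thesis by simp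
qed

lemma ddbar_u:
  assumes \<sigma>: "\<sigma> \<in> chart_lifts" and t: "t \<in> {0..1}"
  shows "ddbar (\<lambda>z. u \<sigma> (t, z)) \<zeta> = omega_pot h (\<phi> t) \<sigma> \<zeta>"
proof -
  have p: "ck n UNIV (in_chart (\<phi> t) \<sigma>)" for n
    using ck_slice[OF ck_path[OF \<sigma>] t, of n] by (simp add: path_in_chart_def)
  show ?thesis unfolding u_eq ddbar_diff[OF p ck_a[OF \<sigma>]]
    by (simp add: omega_pot_def ric_def a_def[abs_def])
qed

lemma u_radial:
  assumes \<sigma>: "\<sigma> \<in> chart_lifts" and t: "t \<in> {0..1}"
  shows "u \<sigma> (t, z) = u \<sigma> (t, complex_of_real (cmod z))"
proof -
  have "S1_invariant (\<phi> t)" using geo t by (simp add: MA_geodesic_def)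
  from S1_invariant_lift[OF this \<sigma>, of z] S1_invariant_metric_lift[OF h(3,1) \<sigma>, of z]
  show ?thesis unfolding u_eq a_def in_chart_def by simp
qed

lemma potential_u:
  assumes \<sigma>\<tau>: "{\<sigma>, \<tau>} = chart_lifts" and t: "t \<in> {0..1}"
  shows "potential (\<lambda>z. u \<sigma> (t, z)) (\<lambda>z. u \<tau> (t, z))"
proof -
  have r: "radial (\<lambda>z. u \<rho> (t, z))" if \<rho>: "\<rho> \<in> chart_lifts" for \<rho>
  proof (rule radial.intro)
    show "ck n UNIV (\<lambda>z. u \<rho> (t, z))" for n by (rule ck_slice[OF ck_u[OF \<rho>] t])
    show "u \<rho> (t, z) = u \<rho> (t, complex_of_real (cmod z))" for z by (rule u_radial[OF \<rho> t])
    show "ddbar (\<lambda>z. u \<rho> (t, z)) z > 0" for z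
      unfolding ddbar_u[OF \<rho> t] using geo t \<rho> by (simp add: MA_geodesic_def)
  qed
  have c: "\<sigma> \<in> chart_lifts" "\<tau> \<in> chart_lifts" using \<sigma>\<tau> by auto
  show ?thesis
  proof (intro potential.intro potential_axioms.intro r c)
    fix z :: complex assume z: "z \<noteq> 0"
    have nz: "\<tau> (1 / z) \<noteq> 0" by (rule lift_nonzero[OF c(2)])
    have 1: "abs_cp1 (\<sigma> z) = abs_cp1 (\<tau> (1 / z))"
      unfolding lift_glue[OF \<sigma>\<tau> z] by (rule abs_cp1_scale[OF nz z])
    have "h (\<sigma> z) = h (\<tau> (1 / z)) / (cmod z)\<^sup>2"
      unfolding lift_glue[OF \<sigma>\<tau> z] by (rule hermitian_metric_scale[OF h(1) nz z])
    then have "ln (h (\<sigma> z)) = ln (h (\<tau> (1 / z))) - 2 * ln (cmod z)"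
      using z h_pos[OF c(2), of "1 / z"] by (simp add: ln_div ln_realpow less_imp_neq[symmetric])
    then show "u \<sigma> (t, z) = 2 * ln (cmod z) + u \<tau> (t, 1 / z)"
      unfolding u_eq a_def in_chart_def 1 by simp
  qed
qed

definition "Ut \<sigma> p = frechet_derivative (u \<sigma>) (at p) (1, 0)"

lemma interior_strip: "open ({0<..<1::real} \<times> (UNIV :: complex set))" 
  by (intro open_Times) auto

lemma ck_u_open: "\<sigma> \<in> chart_lifts \<Longrightarrow> ck n ({0<..<1} \<times> UNIV) (u \<sigma>)"
  by (rule ck_subset[OF ck_u]) auto

lemma ck_Ut: "\<sigma> \<in> chart_lifts \<Longrightarrow> ck n ({0<..<1} \<times> UNIV) (Ut \<sigma>)"
  unfolding Ut_def[abs_def] by (rule frechet_of_ck_open(2)[OF interior_strip ck_u_open]) (auto simp: Basis_prod_def)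

lemma has_derivative_u:
  assumes "\<sigma> \<in> chart_lifts" "0 < t" "t < 1"
  shows "(u \<sigma> has_derivative frechet_derivative (u \<sigma>) (at (t, z))) (at (t, z))"
    "(Ut \<sigma> has_derivative frechet_derivative (Ut \<sigma>) (at (t, z))) (at (t, z))"
  using frechet_of_ck_open(1)[OF interior_strip ck_u_open, of \<sigma> "(t, z)"]
    frechet_of_ck_open(1)[OF interior_strip ck_Ut, of \<sigma> "(t, z)"] assms by auto

lemma time_deriv_eq:
  assumes \<sigma>: "\<sigma> \<in> chart_lifts" and t: "0 < t" "t < 1"
  shows "time_deriv \<phi> t (abs_cp1 (\<sigma> z)) = Ut \<sigma> (t, z)"
    "time_deriv (time_deriv \<phi>) t (abs_cp1 (\<sigma> z)) = frechet_derivative (Ut \<sigma>) (at (t, z)) (1, 0)"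
proof -
  have at: "at s within {0..1} = at s" if "0 < s" "s < 1" for s :: real
    using that by (intro at_within_interior) auto
  have 1: "time_deriv \<phi> s (abs_cp1 (\<sigma> z)) = Ut \<sigma> (s, z)" if s: "0 < s" "s < 1" for s
  proof -
    have "((\<lambda>s. u \<sigma> (s, z) + a \<sigma> z) has_real_derivative Ut \<sigma> (s, z) + 0) (at s)"
      unfolding Ut_def by (intro DERIV_add DERIV_const line_deriv has_derivative_u[OF \<sigma> s])
    then have "((\<lambda>s. \<phi> s (abs_cp1 (\<sigma> z))) has_vector_derivative Ut \<sigma> (s, z)) (at s)"
      by (simp add: u_eq in_chart_def has_real_derivative_iff_has_vector_derivative)
    then show ?thesis unfolding time_deriv_def at[OF s] by (rule vector_derivative_at)
  qed
  show "time_deriv \<phi> t (abs_cp1 (\<sigma> z)) = Ut \<sigma> (t, z)" by (rule 1[OF t])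
  have "((\<lambda>s. Ut \<sigma> (s, z)) has_real_derivative frechet_derivative (Ut \<sigma>) (at (t, z)) (1, 0)) (at t)"
    by (rule line_deriv[OF has_derivative_u(2)[OF \<sigma> t]])
  then have "((\<lambda>s. time_deriv \<phi> s (abs_cp1 (\<sigma> z))) has_real_derivative frechet_derivative (Ut \<sigma>) (at (t, z)) (1, 0)) (at t)"
    by (rule has_field_derivative_transform_within_open[where S = "{0<..<1}"]) (use t 1 in auto)
  then show "time_deriv (time_deriv \<phi>) t (abs_cp1 (\<sigma> z)) = frechet_derivative (Ut \<sigma>) (at (t, z)) (1, 0)"
    unfolding time_deriv_def[of "time_deriv \<phi>"] at[OF t] has_real_derivative_iff_has_vector_derivative
    by (rule vector_derivative_at)
qed

lemma Ut_radial:
  assumes \<sigma>: "\<sigma> \<in> chart_lifts" and t: "0 < t" "t < 1" and eq: "cmod x = cmod y"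
  shows "Ut \<sigma> (t, x) = Ut \<sigma> (t, y)"
proof -
  have "((\<lambda>s. u \<sigma> (s, x)) has_real_derivative Ut \<sigma> (t, x)) (at t)"
    unfolding Ut_def by (intro line_deriv has_derivative_u[OF \<sigma> t])
  then have "((\<lambda>s. u \<sigma> (s, y)) has_real_derivative Ut \<sigma> (t, x)) (at t)"
  proof (rule has_field_derivative_transform_within_open[where S = "{0<..<1}"])
    show "u \<sigma> (s, x) = u \<sigma> (s, y)" if "s \<in> {0<..<1}" for s
      using u_radial[OF \<sigma>, of s x] u_radial[OF \<sigma>, of s y] that eq by simp
  qed (use t in auto)
  moreover have "((\<lambda>s. u \<sigma> (s, y)) has_real_derivative Ut \<sigma> (t, y)) (at t)"
    unfolding Ut_def by (intro line_deriv has_derivative_u[OF \<sigma> t])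
  ultimately show ?thesis by (rule DERIV_unique)
qed

lemma compose_of_real:
  assumes "(F has_derivative F') (at (t, complex_of_real r))"
  shows "((\<lambda>p. F (fst p, complex_of_real (snd p))) has_derivative (\<lambda>w. F' (fst w, complex_of_real (snd w)))) (at (t, r))"
proof (rule has_derivative_compose[where f = "\<lambda>p. (fst p, complex_of_real (snd p))"])
  show "((\<lambda>p. (fst p, complex_of_real (snd p))) has_derivative (\<lambda>w. (fst w, complex_of_real (snd w)))) (at (t, r))"
    by (auto intro!: derivative_eq_intros)
qed (use assms in simp)

text \<open>At a real point a rotation invariant function has vanishing derivative in the direction
  \<i>, so the squared modulus of its z-derivative is a quarter of the squared radial derivative;
  this is the factor 4.\<close>

lemma geodesic_equation:
  assumes \<sigma>: "\<sigma> \<in> chart_lifts" and t: "0 < t" "t < 1"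
  shows "4 * ddbar (\<lambda>z. u \<sigma> (t, z)) (complex_of_real r) * Dt (Dt (\<lambda>p. u \<sigma> (fst p, complex_of_real (snd p)))) (t, r)
      = (Dr (Dt (\<lambda>p. u \<sigma> (fst p, complex_of_real (snd p)))) (t, r))\<^sup>2"
proof -
  define T where "T = frechet_derivative (Ut \<sigma>) (at (t, complex_of_real r))"
  have T: "(Ut \<sigma> has_derivative T) (at (t, complex_of_real r))" unfolding T_def by (rule has_derivative_u(2)[OF \<sigma> t])
  interpret T: linear T using T by (rule has_derivative_linear)
  have 0: "Dt (\<lambda>p. u \<sigma> (fst p, complex_of_real (snd p))) (s, b) = Ut \<sigma> (s, complex_of_real b)" if s: "0 < s" "s < 1" for s b
    unfolding frechet_derivative_at[OF compose_of_real[OF has_derivative_u(1)[OF \<sigma> s]], symmetric]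
    by (simp add: Ut_def)
  have 1: "Dt (\<lambda>p. u \<sigma> (fst p, complex_of_real (snd p))) p = Ut \<sigma> (fst p, complex_of_real (snd p))" if "p \<in> istrip" for p
    using 0[of "fst p" "snd p"] that by (auto simp: istrip_def)
  have tr: "(t, r) \<in> istrip" using t by (simp add: istrip_def)
  have 2: "frechet_derivative (Dt (\<lambda>p. u \<sigma> (fst p, complex_of_real (snd p)))) (at (t, r)) = (\<lambda>w. T (fst w, complex_of_real (snd w)))"
  proof -
    have "frechet_derivative (Dt (\<lambda>p. u \<sigma> (fst p, complex_of_real (snd p)))) (at (t, r))
      = frechet_derivative (\<lambda>p. Ut \<sigma> (fst p, complex_of_real (snd p))) (at (t, r))"
      by (rule frechet_cong_open[OF istrip(1) tr]) (rule 1)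
    also have "\<dots> = (\<lambda>w. T (fst w, complex_of_real (snd w)))"
      by (rule frechet_derivative_at[OF compose_of_real[OF T], symmetric])
    finally show ?thesis .
  qed
  define \<psi> where "\<psi> z = Ut \<sigma> (t, z)" for z
  have \<psi>: "(\<psi> has_derivative (\<lambda>v. T (0, v))) (at (complex_of_real r))"
    unfolding \<psi>_def by (rule has_derivative_compose[where f = "\<lambda>z. (t, z)", OF _ T]) (auto intro!: derivative_eq_intros)
  \<comment> \<open>Points conjugate to each other have equal modulus, so \<psi> is even along the
    imaginary direction.\<close>
  have Ti: "T (0, \<i>) = 0"
  proof -
    have "((\<lambda>s. complex_of_real r + s *\<^sub>R \<i>) has_derivative (\<lambda>s. s *\<^sub>R \<i>)) (at 0)"
      by (auto intro!: derivative_eq_intros)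
    from has_derivative_compose[OF this, of \<psi> "\<lambda>v. T (0, v)"] \<psi>
    have "((\<lambda>s. \<psi> (complex_of_real r + s *\<^sub>R \<i>)) has_derivative (\<lambda>s. T (0, s *\<^sub>R \<i>))) (at 0)" by simp
    moreover have "T (0, s *\<^sub>R \<i>) = T (0, \<i>) * s" for s using T.scaleR[of s "(0, \<i>)"] by simp
    then have "(\<lambda>s. T (0, s *\<^sub>R \<i>)) = (*) (T (0, \<i>))" by (intro ext)
    ultimately have d: "((\<lambda>s. \<psi> (complex_of_real r + s *\<^sub>R \<i>)) has_real_derivative T (0, \<i>)) (at 0)"
      unfolding has_field_derivative_def by (simp only:)
    then have "((\<lambda>s. \<psi> (complex_of_real r + (- s) *\<^sub>R \<i>)) has_real_derivative - T (0, \<i>)) (at 0)"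
      using DERIV_mirror[where f = "\<lambda>s. \<psi> (complex_of_real r + s *\<^sub>R \<i>)" and x = 0] by simp
    moreover have "\<psi> (complex_of_real r + (- s) *\<^sub>R \<i>) = \<psi> (complex_of_real r + s *\<^sub>R \<i>)" for s
      unfolding \<psi>_def by (rule Ut_radial[OF \<sigma> t]) (simp add: cmod_def)
    ultimately have "((\<lambda>s. \<psi> (complex_of_real r + s *\<^sub>R \<i>)) has_real_derivative - T (0, \<i>)) (at 0)" by simp
    from DERIV_unique[OF d this] show ?thesis by simp
  qed
  have chart: "in_chart (time_deriv \<phi> t) \<sigma> = \<psi>"
    by (simp add: fun_eq_iff in_chart_def \<psi>_def time_deriv_eq(1)[OF \<sigma> t])
  have "wirtinger_z (\<lambda>x. complex_of_real (in_chart (time_deriv \<phi> t) \<sigma> x)) (complex_of_real r) = complex_of_real (T (0, 1) / 2)"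
    unfolding wirtinger_z_def chart frechet_complex_of_real[OF \<psi>] by (simp add: Ti)
  then have w: "(cmod (wirtinger_z (\<lambda>x. complex_of_real (in_chart (time_deriv \<phi> t) \<sigma> x)) (complex_of_real r)))\<^sup>2 = (T (0, 1))\<^sup>2 / 4"
    by (simp only: norm_of_real) (simp add: power_divide)
  have t': "t \<in> {0..1}" using t by auto
  have "T (1, 0) = in_chart (time_deriv (time_deriv \<phi>) t) \<sigma> (complex_of_real r)"
    by (simp add: in_chart_def time_deriv_eq(2)[OF \<sigma> t] T_def)
  also have "\<dots> = grad_norm2 h (\<phi> t) (time_deriv \<phi> t) \<sigma> (complex_of_real r)"
    using geo t' \<sigma> by (simp add: MA_geodesic_def)
  also have "\<dots> = (T (0, 1))\<^sup>2 / 4 / ddbar (\<lambda>z. u \<sigma> (t, z)) (complex_of_real r)"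
    unfolding grad_norm2_def w ddbar_u[OF \<sigma> t'] ..
  finally have "T (1, 0) = (T (0, 1))\<^sup>2 / 4 / ddbar (\<lambda>z. u \<sigma> (t, z)) (complex_of_real r)" .
  moreover have "ddbar (\<lambda>z. u \<sigma> (t, z)) (complex_of_real r) > 0"
    unfolding ddbar_u[OF \<sigma> t'] using geo t' \<sigma> by (simp add: MA_geodesic_def)
  ultimately have "4 * ddbar (\<lambda>z. u \<sigma> (t, z)) (complex_of_real r) * T (1, 0) = (T (0, 1))\<^sup>2" by simp
  then show ?thesis unfolding 2 by simp
qed

lemma geodesic_u:
  assumes \<sigma>\<tau>: "{\<sigma>, \<tau>} = chart_lifts"
  shows "geodesic (u \<sigma>) (u \<tau>)"
proof (rule geodesic.intro)
  have c: "\<sigma> \<in> chart_lifts" using \<sigma>\<tau> by auto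
  show "ck n ({0..1} \<times> UNIV) (u \<sigma>)" for n by (rule ck_u[OF c])
  show "potential (\<lambda>z. u \<sigma> (t, z)) (\<lambda>z. u \<tau> (t, z))" if "t \<in> {0..1}" for t by (rule potential_u[OF \<sigma>\<tau> that])
qed (rule geodesic_equation, use \<sigma>\<tau> in auto)

end

section \<open>Bergman potentials in a chart\<close>

context ma_data
begin

lemma chart_pair: "{affine_lift, infinity_lift} = chart_lifts" "{infinity_lift, affine_lift} = chart_lifts"
  by (auto simp: chart_lifts_def)

lemma twist_lift: "\<sigma> \<in> chart_lifts \<Longrightarrow> twist (\<phi> t) h (\<sigma> z) = exp (- u \<sigma> (t, z))"
  using h_pos by (simp add: twist_def u_eq a_def in_chart_def exp_diff exp_minus divide_inverse mult.commute)

text \<open>The factor 2 comes from \<i> dz \<and> dzbar = 2 dx \<and> dy, the factor \<pi> from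
  passing to |z|^2.\<close>

lemma norming_const_eq:
  assumes t: "t \<in> {0..1}" and tw: "hermitian_metric (twist (\<phi> t) h)" and k: "k \<le> N"
  shows "norming_const (twist (\<phi> t) h) N k = 2 * pi * Q_at (u affine_lift) t N k"
proof -
  have \<sigma>: "affine_lift \<in> chart_lifts" by (simp add: chart_lifts_def)
  interpret potential "\<lambda>z. u affine_lift (t, z)" "\<lambda>z. u infinity_lift (t, z)"
    by (rule potential_u[OF chart_pair(1) t])
  define F where "F x = x ^ k * exp (- real N * U x) * g x" for x
  have "continuous_on UNIV aff.e" using aff.ck_e ck_imp_continuous_on by blast
  then have "continuous_on UNIV U"
    unfolding aff.U_def by (rule continuous_on_compose2) (auto intro: continuous_intros)
  then have "continuous_on UNIV F" unfolding F_def by (intro continuous_intros g_cont)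
  then have meas: "F \<in> borel_measurable borel" by (rule borel_measurable_continuous_onI)
  have F: "in_chart (section_norm2 (twist (\<phi> t) h) N (monomial_section N k)) affine_lift z *
      (2 * ric (twist (\<phi> t) h) affine_lift z) = 2 * F ((cmod z)\<^sup>2)" for z
  proof -
    have 1: "section_norm2 (twist (\<phi> t) h) N (monomial_section N k) (abs_cp1 (affine_lift z)) =
        ((cmod z)\<^sup>2) ^ k * exp (- u affine_lift (t, z)) ^ N"
      by (subst section_norm2_abs[OF tw lift_nonzero[OF \<sigma>] monomial_section_homogeneous[OF k]])
        (simp add: monomial_section_def twist_lift[OF \<sigma>] norm_power power_mult power_mult_distrib
          flip: power_mult power_even_eq, simp add: affine_lift_def norm_power mult.commute flip: power_mult)
    have 2: "ric (twist (\<phi> t) h) affine_lift z = ddbar (\<lambda>z. u affine_lift (t, z)) z"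
      unfolding ric_def twist_lift[OF \<sigma>] ln_exp ddbar_minus[OF aff.smooth] by simp
    have 3: "ddbar (\<lambda>z. u affine_lift (t, z)) z = g ((cmod z)\<^sup>2)"
    proof (cases "z = 0")
      case True
      then show ?thesis by (simp add: aff.g_def aff.G_def)
    next
      case False
      then show ?thesis by (simp add: aff.g_def aff.ddbar_radial)
    qed
    have "u affine_lift (t, z) = U ((cmod z)\<^sup>2)" using aff.f_eq[of z] by (simp add: aff.U_def)
    then have "exp (- u affine_lift (t, z)) ^ N = exp (- real N * U ((cmod z)\<^sup>2))"
      by (simp flip: exp_of_nat_mult)
    then show ?thesis unfolding in_chart_def 1 2 3 F_def by simp
  qed
  show ?thesis
    unfolding norming_const_def integral_ric_def F
    using integral_cmod_square[OF meas] by (simp add: Q_at_def Q_def F_def[abs_def])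
qed

text \<open>In the coordinate w = 1 / z the section of index k is the monomial w^(N - k).\<close>

definition chart_index :: "(complex \<Rightarrow> complex \<times> complex) \<Rightarrow> nat \<Rightarrow> nat \<Rightarrow> nat" where
  "chart_index \<sigma> N k = (if \<sigma> = affine_lift then k else N - k)"

lemma affine_neq_infinity: "infinity_lift \<noteq> affine_lift"
proof
  assume "infinity_lift = affine_lift"
  then have "infinity_lift 0 = affine_lift 0" by simp
  then show False by (simp add: infinity_lift_def affine_lift_def)
qed

lemma norming_const_chart:
  assumes \<sigma>: "\<sigma> \<in> chart_lifts" and t: "t \<in> {0..1}" and tw: "hermitian_metric (twist (\<phi> t) h)" and k: "k \<le> N"
  shows "norming_const (twist (\<phi> t) h) N k = 2 * pi * Q_at (u \<sigma>) t N (chart_index \<sigma> N k)"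
proof (cases "\<sigma> = affine_lift")
  case True
  then show ?thesis using norming_const_eq[OF t tw k] by (simp add: chart_index_def)
next
  case False
  then have "\<sigma> = infinity_lift" using \<sigma> by (simp add: chart_lifts_def)
  then show ?thesis
    using norming_const_eq[OF t tw k] potential.Q_swap[OF potential_u[OF chart_pair(2) t] k]
    by (simp add: chart_index_def affine_neq_infinity Q_at_def)
qed

lemma section_norm2_chart:
  assumes \<sigma>: "\<sigma> \<in> chart_lifts" and k: "k \<le> N"
  shows "section_norm2 h N (monomial_section N k) (abs_cp1 (\<sigma> z)) = ((cmod z)\<^sup>2) ^ chart_index \<sigma> N k * h (\<sigma> z) ^ N"
proof -
  have "section_norm2 h N (monomial_section N k) (abs_cp1 (\<sigma> z)) = (cmod (monomial_section N k (\<sigma> z)))\<^sup>2 * h (\<sigma> z) ^ N"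
    by (rule section_norm2_abs[OF h(1) lift_nonzero[OF \<sigma>] monomial_section_homogeneous[OF k]])
  moreover have "cmod (monomial_section N k (\<sigma> z)) = cmod z ^ chart_index \<sigma> N k"
    using \<sigma> affine_neq_infinity
    by (auto simp: chart_lifts_def chart_index_def monomial_section_def affine_lift_def[of z] infinity_lift_def[of z] norm_power)
  ultimately show ?thesis by (simp add: mult.commute flip: power_mult)
qed

text \<open>Each norming constant carries 2 \<pi>, and the exponents 1 - t and t add up to 1, so 2
  \<pi> leaves the sum as one constant. The factor h^N becomes the logarithm of h, which is already
  part of u.\<close>

lemma bergman_chart:
  assumes \<sigma>\<tau>: "{\<sigma>, \<tau>} = chart_lifts" and N: "N \<ge> 1"
  shows "path_in_chart (bergman_potential h (twist \<phi>0 h) (twist \<phi>1 h) N) \<sigma> p - path_in_chart \<phi> \<sigma> p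
    = geodesic.D (u \<sigma>) N p - ln (2 * pi) / N"
proof -
  obtain t z where p: "p = (t, z)" by (cases p)
  have \<sigma>: "\<sigma> \<in> chart_lifts" using \<sigma>\<tau> by auto
  interpret geodesic "u \<sigma>" "u \<tau>" by (rule geodesic_u[OF \<sigma>\<tau>])
  have \<phi>: "\<phi>0 = \<phi> 0" "\<phi>1 = \<phi> 1" using geo by (simp_all add: MA_geodesic_def)
  have Qpos: "Q_at (u \<sigma>) s N k > 0" if "s \<in> {0..1}" "k \<le> N" for s k
    unfolding Q_at_def by (rule potential.Q_pos[OF potential_u[OF \<sigma>\<tau> that(1)] that(2)])
  have j: "chart_index \<sigma> N k \<le> N" if "k \<le> N" for k using that by (simp add: chart_index_def)
  have den: "norming_const (twist \<phi>0 h) N k powr (1 - t) * norming_const (twist \<phi>1 h) N k powr t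
      = 2 * pi / wt N t (chart_index \<sigma> N k)" if k: "k \<le> N" for k
  proof -
    define i where "i = chart_index \<sigma> N k"
    have q: "Q_at (u \<sigma>) 0 N i > 0" "Q_at (u \<sigma>) 1 N i > 0" using Qpos j[OF k] by (auto simp: i_def)
    have n: "norming_const (twist \<phi>0 h) N k = 2 * pi * Q_at (u \<sigma>) 0 N i" "norming_const (twist \<phi>1 h) N k = 2 * pi * Q_at (u \<sigma>) 1 N i"
      using norming_const_chart[OF \<sigma> _ _ k, of 0] norming_const_chart[OF \<sigma> _ _ k, of 1] twist
      by (simp_all add: \<phi> i_def)
    have "norming_const (twist \<phi>0 h) N k powr (1 - t) * norming_const (twist \<phi>1 h) N k powr t
      = exp ((1 - t) * (ln (2 * pi) + ln (Q_at (u \<sigma>) 0 N i)) + t * (ln (2 * pi) + ln (Q_at (u \<sigma>) 1 N i)))"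
      unfolding n using q by (simp add: powr_def ln_mult exp_add)
    also have "(1 - t) * (ln (2 * pi) + ln (Q_at (u \<sigma>) 0 N i)) + t * (ln (2 * pi) + ln (Q_at (u \<sigma>) 1 N i))
      = ln (2 * pi) - (- ((1 - t) * ln (Q_at (u \<sigma>) 0 N i) + t * ln (Q_at (u \<sigma>) 1 N i)))"
      by (simp add: algebra_simps)
    also have "exp \<dots> = 2 * pi / wt N t i" unfolding exp_diff wt_def by simp
    finally show ?thesis by (simp only: i_def)
  qed
  define c where "c = h (\<sigma> z) ^ N / (2 * pi)"
  define Z where "Z = (\<Sum>k\<le>N. wt N t k * ((cmod z)\<^sup>2) ^ k)"
  have pos: "c > 0" "Z > 0" using h_pos[OF \<sigma>] sum_pos_LN by (simp_all add: c_def Z_def)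
  have "(\<Sum>k = 0..N. section_norm2 h N (monomial_section N k) (abs_cp1 (\<sigma> z)) /
      (norming_const (twist \<phi>0 h) N k powr (1 - t) * norming_const (twist \<phi>1 h) N k powr t))
    = (\<Sum>k\<le>N. c * (wt N t (chart_index \<sigma> N k) * ((cmod z)\<^sup>2) ^ chart_index \<sigma> N k))"
    unfolding atLeast0AtMost by (intro sum.cong) (simp_all add: den section_norm2_chart[OF \<sigma>] c_def)
  also have "\<dots> = (\<Sum>k\<le>N. c * (wt N t k * ((cmod z)\<^sup>2) ^ k))"
  proof (cases "\<sigma> = affine_lift")
    case False
    show ?thesis
      \<comment> \<open>In the chart at infinity the index is reflected, which permutes the
        summands.\<close>
      by (rule sum.reindex_bij_witness[where i = "\<lambda>k. N - k" and j = "\<lambda>k. N - k"]) (use False in \<open>auto simp: chart_index_def\<close>)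
  qed (simp add: chart_index_def)
  also have "\<dots> = c * Z" by (simp add: Z_def sum_distrib_left)
  finally have S: "(\<Sum>k = 0..N. section_norm2 h N (monomial_section N k) (abs_cp1 (\<sigma> z)) /
      (norming_const (twist \<phi>0 h) N k powr (1 - t) * norming_const (twist \<phi>1 h) N k powr t)) = c * Z" .
  have "ln (c * Z) = ln c + ln Z" using pos by (intro ln_mult_pos)
  also have "ln c = N * a \<sigma> z - ln (2 * pi)" using h_pos[OF \<sigma>, of z] by (simp add: c_def ln_div ln_realpow a_def)
  finally have "1 / N * ln (c * Z) = a \<sigma> z - ln (2 * pi) / N + ln Z / N" using N by (simp add: field_simps)
  then show ?thesis
    unfolding p path_in_chart_def in_chart_def bergman_potential_def fst_conv snd_conv S
    by (simp add: D_def LN_def Z_def u_eq in_chart_def)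
qed

end

text \<open>Applied to the constant ln (2 \<pi>) / N left by \<open>bergman_chart\<close>, which
  only the undifferentiated difference can see.\<close>

lemma iter_deriv_diff_const:
  "iter_deriv S vs (\<lambda>x. f x - c) x = (if vs = [] then iter_deriv S vs f x - c else iter_deriv S vs f x)"
proof (cases vs)
  case (Cons v ws)
  have "((\<lambda>x. f x - c) has_derivative F') F \<longleftrightarrow> (f has_derivative F') F" for F F'
    using has_derivative_diff[OF _ has_derivative_const, of f F' F c]
      has_derivative_add[OF _ has_derivative_const, of "\<lambda>x. f x - c" F' F c] by auto
  then have "frechet_derivative (\<lambda>x. f x - c) F = frechet_derivative f F" for F
    by (simp add: frechet_derivative_def)
  then show ?thesis by (simp add: Cons)
qed simp

theorem theorem1p2:
  fixes h :: metric
    and \<phi>0 \<phi>1 :: "cp1 \<Rightarrow> real"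
    and \<phi> :: "real \<Rightarrow> cp1 \<Rightarrow> real"
  assumes "hermitian_metric h" "smooth_metric h" "S1_invariant_metric h" "positive_curvature h"
    and "hermitian_metric (twist \<phi>0 h)" "smooth_metric (twist \<phi>0 h)"
      "S1_invariant_metric (twist \<phi>0 h)" "positive_curvature (twist \<phi>0 h)"
    and "hermitian_metric (twist \<phi>1 h)" "smooth_metric (twist \<phi>1 h)"
      "S1_invariant_metric (twist \<phi>1 h)" "positive_curvature (twist \<phi>1 h)"
    and "MA_geodesic h \<phi>0 \<phi>1 \<phi>"
  shows "C2_converges (bergman_potential h (twist \<phi>0 h) (twist \<phi>1 h)) \<phi>"
proof -
  interpret ma_data h \<phi>0 \<phi>1 \<phi> by unfold_locales (fact assms)+
  define S where "S = {0..1::real} \<times> (UNIV :: complex set)"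
  define B where "B N = bergman_potential h (twist \<phi>0 h) (twist \<phi>1 h) N" for N
  have "(\<forall>\<^sub>F N in sequentially. Ck_on 2 S (\<lambda>p. path_in_chart (B N) \<sigma> p - path_in_chart \<phi> \<sigma> p)) \<and>
    (\<forall>vs \<in> lists Basis. length vs \<le> 2 \<longrightarrow> (\<forall>K. compact K \<longrightarrow>
      uniform_limit ({0..1} \<times> K) (\<lambda>N. iter_deriv S vs (\<lambda>p. path_in_chart (B N) \<sigma> p - path_in_chart \<phi> \<sigma> p)) (\<lambda>_. 0) sequentially))"
    if "\<sigma> \<in> chart_lifts" for \<sigma>
  proof -
    have "\<sigma> = affine_lift \<or> \<sigma> = infinity_lift" using that by (simp add: chart_lifts_def)
    then obtain \<tau> where \<sigma>\<tau>: "{\<sigma>, \<tau>} = chart_lifts" using chart_pair by blast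
    interpret geodesic "u \<sigma>" "u \<tau>" by (rule geodesic_u[OF \<sigma>\<tau>])
    have eq: "(\<lambda>p. path_in_chart (B N) \<sigma> p - path_in_chart \<phi> \<sigma> p) = (\<lambda>p. D N p - ln (2 * pi) / N)" if "N \<ge> 1" for N
      unfolding B_def by (rule ext, rule bergman_chart[OF \<sigma>\<tau> that])
    have "Ck_on 2 S (\<lambda>p. path_in_chart (B N) \<sigma> p - path_in_chart \<phi> \<sigma> p)" if "N \<ge> 1" for N
      unfolding eq[OF that] S_def Ck_on_iff_ck[OF thick_strip] by (intro ck_diff ck_D ck_const)
    then have 1: "\<forall>\<^sub>F N in sequentially. Ck_on 2 S (\<lambda>p. path_in_chart (B N) \<sigma> p - path_in_chart \<phi> \<sigma> p)"
      using eventually_ge_at_top[of 1] by (rule eventually_mono[rotated])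
    have 2: "uniform_limit ({0..1} \<times> K) (\<lambda>N. iter_deriv S vs (\<lambda>p. path_in_chart (B N) \<sigma> p - path_in_chart \<phi> \<sigma> p)) (\<lambda>_. 0) sequentially"
      if vs: "vs \<in> lists Basis" "length vs \<le> 2" and K: "compact K" for vs K
    proof -
      define c where "c N = (if vs = [] then ln (2 * pi) / real N else 0)" for N
      have "c \<longlonglongrightarrow> 0"
        unfolding c_def[abs_def] by (cases "vs = []") (simp_all add: lim_const_over_n)
      then have "uniform_limit ({0..1} \<times> K) (\<lambda>N _. c N) (\<lambda>_. 0) sequentially"
        by (auto simp: uniform_limit_iff tendsto_iff)
      from uniform_limit_minus[OF D_converges[OF vs K] this]
      have lim: "uniform_limit ({0..1} \<times> K) (\<lambda>N p. iter_deriv S vs (D N) p - c N) (\<lambda>_. 0) sequentially"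
        by (simp add: S_def)
      have "\<forall>\<^sub>F N in sequentially. \<forall>p\<in>{0..1} \<times> K.
          iter_deriv S vs (D N) p - c N = iter_deriv S vs (\<lambda>p. path_in_chart (B N) \<sigma> p - path_in_chart \<phi> \<sigma> p) p"
        using eventually_ge_at_top[of 1]
        by (rule eventually_mono) (simp add: eq iter_deriv_diff_const c_def)
      from iffD1[OF uniform_limit_cong[OF this refl] lim] show ?thesis .
    qed
    show ?thesis using 1 2 by blast
  qed
  then show ?thesis unfolding C2_converges_def Let_def S_def B_def by blast
qed

end
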